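(* Let $d\ge 2$, let $\widehat X$ be a non-degenerate stationary Poisson hyperplane process in $\mathbb{R}^d$ whose spherical directional distribution $\varphi$ is subspace-free, and let $X$ be the tessellation of $\mathbb{R}^d$ induced by $\widehat X$. Let $k\in\{1,\dots,d\}$, and let $\Sigma$ be a translation invariant size functional for $\mathcal P_k$. Then the typical $k$-face $Z^{(k)}$ of $X$ (with respect to the incenter as center function) satisfies $$\lim_{a\to0}\mathbb{P}\left(\mathfrak{s}_c(Z^{(k)})\in S\mid\Sigma(Z^{(k)})<a\right)=\frac{\xi_{k,\varphi,\Sigma}(S)}{\xi_{k,\varphi,\Sigma}(\mathcal P_{k,c})}$$ for every $S\in\mathcal B(\mathcal P_{k,c})$, where the measure $\xi_{k,\varphi,\Sigma}$ on $\mathcal B(\mathcal P_{k,c})$ is defined by $$\xi_{k,\varphi,\Sigma}:=\int_{\mathsf P_k}\mathbf 1\{\mathfrak{s}_c(T_k(\mathbf u))\in\cdot\}\,\frac{D_k(\mathbf u)}{\Sigma(T_k(\mathbf u))}\,\varphi^{d+1}(\mathrm d\mathbf u).$$ In particular, $$\lim_{a\to0}\mathbb{P}\left(f_{k-1}(Z^{(k)})=k+1\mid\Sigma(Z^{(k)})<a\right)=1.$$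
   Context: Notation. $\mathbb{R}^d$ ($d\ge2$) has origin $o$, scalar product $\langle\cdot,\cdot\rangle$, norm $\|\cdot\|$; $S^{d-1}$ is the unit sphere and $\lambda_d$ is Lebesgue measure. $\mathcal H$ is the space of hyperplanes in $\mathbb{R}^d$ with its usual topology. Write $H(u,\tau)=\{x:\langle x,u\rangle=\tau\}$ and $H^-(u,\tau)=\{x:\langle x,u\rangle\le\tau\}$ for $u\in S^{d-1}$, $\tau\in\mathbb{R}$. $\mathcal K$ is the space of convex bodies (nonempty compact convex subsets of $\mathbb{R}^d$) with the Hausdorff metric, $\mathcal B(T)$ is the Borel $\sigma$-algebra of a topological space $T$, and $\mathcal P_k\subset\mathcal K$ is the set of $k$-dimensional polytopes. $f_r(P)$ is the number of $r$-dimensional faces of a polytope $P$. Hyperplane process. $\widehat X$ is a stationary Poisson hyperplane process on a probability space with probability $\mathbb P$ and expectation $\mathbb E$. Its intensity measure $\widehat\Theta=\mathbb{E}\widehat X$ satisfies $$\int_{\mathcal H}f\,\mathrm d\widehat\Theta=\widehat\gamma\int_{S^{d-1}}\int_{-\infty}^\infty f(H(u,\tau))\,\mathrm d\tau\,\varphi(\mathrm du)$$ for all nonnegative measurable $f$, with intensity $\widehat\gamma\in(0,\infty)$ and an even Borel probability measure $\varphi$ on $S^{d-1}$, the spherical directional distribution. Non-degenerate means that $\varphi$ is not concentrated on a great subsphere. A measure on $S^{d-1}$ is subspace-free if it is zero on each great subsphere (intersection of $S^{d-1}$ with a $(d-1)$-dimensional linear subspace). The hitting functional is $\Phi(K)=\int_{S^{d-1}}h(K,u)\,\varphi(\mathrm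 du)$ for $K\in\mathcal K$, where $h(K,u)=\max\{\langle x,u\rangle:x\in K\}$. Typical $k$-face. $\widehat X$ induces a tessellation $X$ of $\mathbb{R}^d$ into convex polytopes (cells); $X^{(k)}$ is the stationary particle process of the $k$-dimensional faces of the cells (each face counted once). $\mathcal P_k'\subset\mathcal P_k$ is the set of $k$-dimensional polytopes with a unique inball (largest inscribed $k$-dimensional ball), and for $P\in\mathcal P_k'$ the incenter $c(P)$ is the center of this ball. If $\varphi$ is subspace-free, almost surely all $k$-faces of $X$ are in $\mathcal P_k'$. The intensity $\gamma^{(k)}\in(0,\infty)$ of $X^{(k)}$ and the probability distribution $\mathbb{Q}^{(k)}$ are determined by $$\gamma^{(k)}\mathbb{Q}^{(k)}(A)=\mathbb{E}\sum_{K\in X^{(k)}}\mathbf 1_A(K-c(K))\,\mathbf 1_B(c(K)),$$ for Borel sets $A\subset\mathcal P_k$ and any $B\in\mathcal B(\mathbb{R}^d)$ with $\lambda_d(B)=1$. The typical $k$-face $Z^{(k)}$ is a random polytope with distribution $\mathbb{Q}^{(k)}$. Size and shape. A size functional for $\mathcal P_k$ is a real function on $\mathcal K$ that is increasing under set inclusion, homogeneous of degree one, continuous with respect to the Hausdorff metric, and positive on $k$-dimensional sets. The shape of $P\in\mathcal P_k'$ is $\mathfrak s_c(P)=\frac{1}{\Phi(P)}(P-c(P))$, and the shape space is $\mathcal P_{k,c}=\mathfrak s_c(\mathcal P_k')=\{P\in\mathcal P_k':c(P)=o,\ \Phi(P)=1\}$. Quantities depending on $\mathbf u$. A $(d+1)$-tuple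 $\mathbf u=(u_1,\dots,u_{d+1})$ of unit vectors is in general position if any $d$ of them are linearly independent. For such $\mathbf u$ let $L_{\mathbf u}=(\mathrm{lin}\{u_{k+2},\dots,u_{d+1}\})^\perp$, a $k$-dimensional linear subspace ($L_{\mathbf u}=\mathbb{R}^d$ if $k=d$), and let $v_j=u_j|L_{\mathbf u}$ be the orthogonal projection of $u_j$ to $L_{\mathbf u}$, $j=1,\dots,k+1$ ($v_j=u_j$ if $k=d$). $\mathsf P_k\subset(S^{d-1})^{d+1}$ is the set of all $\mathbf u$ in general position such that $v_1,\dots,v_{k+1}$ positively span $L_{\mathbf u}$ (i.e. every vector of $L_{\mathbf u}$ is a nonnegative linear combination of them). $D_k(\mathbf u)$ is the absolute value of the determinant of the $(d+1)\times(d+1)$ matrix whose $j$-th row is $(\langle u_j,e_1\rangle,\dots,\langle u_j,e_d\rangle,\|u_j|L_{\mathbf u}\|)$ for $j=1,\dots,k+1$ and $(\langle u_j,e_1\rangle,\dots,\langle u_j,e_d\rangle,0)$ for $j=k+2,\dots,d+1$, where $(e_1,\dots,e_d)$ is an orthonormal basis of $\mathbb{R}^d$. $T_k(\mathbf u)=L_{\mathbf u}\cap\bigcap_{i=1}^{k+1}H^-(u_i,\|u_i|L_{\mathbf u}\|)$, a $k$-simplex in $L_{\mathbf u}$ with incenter $o$ and inradius $1$. *)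

theory Defs
  imports "HOL-Probability.Probability" "Jordan_Normal_Form.Determinant"
begin

text \<open>
  The ambient space is a type \<open>'a::euclidean_space\<close>, of dimension \<open>DIM('a)\<close>.
  The inner product is written with the constant \<open>inner\<close> because its infix symbol is
  also used for vectors in \<open>Jordan_Normal_Form\<close>.
\<close>

section \<open>Topologies and Borel \<open>\<sigma>\<close>-algebras\<close>

definition borel_of :: "'b topology \<Rightarrow> 'b measure" where
  "borel_of T = sigma (topspace T) {U. openin T U}"

definition hyperplane :: "'a::euclidean_space \<Rightarrow> real \<Rightarrow> 'a set" where
  "hyperplane u \<tau> = {x. inner x u = \<tau>}"

definition lower_halfspace :: "'a::euclidean_space \<Rightarrow> real \<Rightarrow> 'a set" where
  "lower_halfspace u \<tau> = {x. inner x u \<le> \<tau>}"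

definition hyperplanes :: "'a::euclidean_space set set" where
  "hyperplanes = {hyperplane u \<tau> | u \<tau>. u \<in> sphere 0 1}"

text \<open>The usual topology on the space of hyperplanes is the quotient topology
  under the parametrization by unit normal vector and signed distance.\<close>

definition hyperplane_topology :: "'a::euclidean_space set topology" where
  "hyperplane_topology = topology (\<lambda>U. U \<subseteq> hyperplanes \<and>
     openin (top_of_set (sphere 0 1 \<times> UNIV))
       {p \<in> sphere 0 1 \<times> UNIV. hyperplane (fst p) (snd p) \<in> U})"

lemma openin_hyperplane_topology:
  fixes U :: "'a::euclidean_space set set"
  shows "openin hyperplane_topology U \<longleftrightarrow> U \<subseteq> hyperplanes \<and>
     openin (top_of_set (sphere 0 1 \<times> UNIV))
       {p \<in> sphere 0 1 \<times> UNIV. hyperplane (fst p) (snd p) \<in> U}"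
proof -
  let ?P = "\<lambda>U :: 'a set set. {p \<in> sphere 0 1 \<times> UNIV. hyperplane (fst p) (snd p) \<in> U}"
  let ?L = "\<lambda>U :: 'a set set. U \<subseteq> hyperplanes \<and> openin (top_of_set (sphere 0 1 \<times> UNIV)) (?P U)"
  have "istopology ?L"
    unfolding istopology_def
  proof (intro conjI allI impI)
    fix S T assume S: "?L S" and T: "?L T"
    show "S \<inter> T \<subseteq> hyperplanes" using S by blast
    have "?P (S \<inter> T) = ?P S \<inter> ?P T" by blast
    then show "openin (top_of_set (sphere 0 1 \<times> UNIV)) (?P (S \<inter> T))"
      using S T by (simp only: openin_Int)
  next
    fix \<K> assume K: "\<forall>K\<in>\<K>. ?L K"
    show "\<Union>\<K> \<subseteq> hyperplanes" using K by blast
    have "?P (\<Union>\<K>) = \<Union>(?P ` \<K>)" by blast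
    moreover have "openin (top_of_set (sphere 0 1 \<times> UNIV)) (\<Union>(?P ` \<K>))"
      using K by (intro openin_Union) blast
    ultimately show "openin (top_of_set (sphere 0 1 \<times> UNIV)) (?P (\<Union>\<K>))"
      by (rule ssubst)
  qed
  then show ?thesis
    unfolding hyperplane_topology_def by (simp only: topology_inverse')
qed

lemma topspace_hyperplane_topology:
  "topspace hyperplane_topology = (hyperplanes :: 'a::euclidean_space set set)"
proof -
  have "{p \<in> sphere (0::'a) 1 \<times> UNIV. hyperplane (fst p) (snd p) \<in> hyperplanes} = sphere 0 1 \<times> UNIV"
    by (auto simp: hyperplanes_def)
  then have "openin hyperplane_topology (hyperplanes :: 'a set set)"
    using openin_topspace[of "top_of_set (sphere (0::'a) 1 \<times> (UNIV::real set))"]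
    by (simp add: openin_hyperplane_topology)
  then show ?thesis
    using openin_hyperplane_topology[of "topspace hyperplane_topology"] openin_subset by blast
qed

lemma quotient_map_hyperplane:
  "quotient_map (top_of_set (sphere (0::'a::euclidean_space) 1 \<times> UNIV)) hyperplane_topology
     (\<lambda>(u, \<tau>). hyperplane u \<tau>)"
proof -
  have "(\<lambda>(u, \<tau>). hyperplane u \<tau>) ` (sphere (0::'a) 1 \<times> UNIV) = hyperplanes"
    by (auto simp: hyperplanes_def)
  then show ?thesis
    by (auto simp: quotient_map_def topspace_hyperplane_topology openin_hyperplane_topology
        case_prod_unfold)
qed

definition convex_bodies :: "'a::euclidean_space set set" where
  "convex_bodies = {K. K \<noteq> {} \<and> compact K \<and> convex K}"

text \<open>The Hausdorff distance is only used between convex bodies; the value \<open>0\<close> elsewhere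
  serves the totality conditions of the locale \<open>Metric_space\<close>.\<close>

definition hausdorff_dist :: "'a::euclidean_space set \<Rightarrow> 'a set \<Rightarrow> real" where
  "hausdorff_dist K L = (if K \<in> convex_bodies \<and> L \<in> convex_bodies
     then max (SUP x\<in>K. infdist x L) (SUP y\<in>L. infdist y K) else 0)"

definition convex_body_topology :: "'a::euclidean_space set topology" where
  "convex_body_topology = Metric_space.mtopology convex_bodies hausdorff_dist"

lemma hausdorff_dist_le_iff:
  fixes K L :: "'a::euclidean_space set"
  assumes K: "K \<in> convex_bodies" and L: "L \<in> convex_bodies"
  shows "hausdorff_dist K L \<le> e \<longleftrightarrow> (\<forall>x\<in>K. infdist x L \<le> e) \<and> (\<forall>y\<in>L. infdist y K \<le> e)"
proof -
  have bdd: "bdd_above ((\<lambda>x. infdist x B) ` A)" if "compact A" for A B :: "'a set"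
    by (intro bounded_imp_bdd_above compact_imp_bounded compact_continuous_image that
        continuous_intros)
  have "(SUP x\<in>A. infdist x B) \<le> e \<longleftrightarrow> (\<forall>x\<in>A. infdist x B \<le> e)"
    if "compact A" "A \<noteq> {}" for A B :: "'a set"
    using that bdd by (intro cSUP_le_iff) auto
  then show ?thesis
    using K L by (auto simp: hausdorff_dist_def convex_bodies_def)
qed

lemma Metric_space_hausdorff_dist:
  "Metric_space (convex_bodies :: 'a::euclidean_space set set) hausdorff_dist"
proof
  fix K L :: "'a set"
  show "hausdorff_dist K L = hausdorff_dist L K"
    by (simp add: hausdorff_dist_def max.commute conj_commute)
  show nonneg: "0 \<le> hausdorff_dist K L"
  proof (cases "K \<in> convex_bodies \<and> L \<in> convex_bodies")
    case True
    then obtain x where "x \<in> K" by (auto simp: convex_bodies_def)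
    then have "infdist x L \<le> hausdorff_dist K L"
      using True hausdorff_dist_le_iff by blast
    then show ?thesis by (meson infdist_nonneg order_trans)
  qed (simp only: hausdorff_dist_def if_False order_refl)
next
  fix K L :: "'a set" assume K: "K \<in> convex_bodies" and L: "L \<in> convex_bodies"
  have "0 \<le> hausdorff_dist K L"
  proof -
    obtain x where "x \<in> K" using K by (auto simp: convex_bodies_def)
    then have "infdist x L \<le> hausdorff_dist K L"
      using K L hausdorff_dist_le_iff by blast
    then show ?thesis by (meson infdist_nonneg order_trans)
  qed
  then have "hausdorff_dist K L = 0 \<longleftrightarrow> (\<forall>x\<in>K. infdist x L \<le> 0) \<and> (\<forall>y\<in>L. infdist y K \<le> 0)"
    using hausdorff_dist_le_iff[OF K L, of 0] by linarith
  also have "\<dots> \<longleftrightarrow> (\<forall>x\<in>K. x \<in> L) \<and> (\<forall>y\<in>L. y \<in> K)"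
  proof -
    have "infdist x A \<le> 0 \<longleftrightarrow> x \<in> A" if "A \<in> convex_bodies" for x and A :: "'a set"
      using that in_closed_iff_infdist_zero[of A x] infdist_nonneg[of x A]
      by (auto simp: convex_bodies_def compact_imp_closed)
    then show ?thesis using K L by blast
  qed
  finally show "hausdorff_dist K L = 0 \<longleftrightarrow> K = L" by blast
next
  fix K L N :: "'a set"
  assume K: "K \<in> convex_bodies" and L: "L \<in> convex_bodies" and N: "N \<in> convex_bodies"
  have *: "infdist x C \<le> hausdorff_dist A B + hausdorff_dist B C"
    if A: "A \<in> convex_bodies" and B: "B \<in> convex_bodies" and C: "C \<in> convex_bodies" and x: "x \<in> A"
    for A B C :: "'a set" and x
  proof -
    have "closed B" "B \<noteq> {}" using B by (auto simp: convex_bodies_def compact_imp_closed)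
    then obtain y where y: "y \<in> B" "infdist x B = dist x y"
      using infdist_attains_inf by metis
    have "infdist x B \<le> hausdorff_dist A B" using hausdorff_dist_le_iff[OF A B] x by blast
    moreover have "infdist y C \<le> hausdorff_dist B C" using hausdorff_dist_le_iff[OF B C] y by blast
    moreover have "infdist x C \<le> infdist y C + dist x y" by (rule infdist_triangle)
    ultimately show ?thesis using y by linarith
  qed
  have comm: "hausdorff_dist A B = hausdorff_dist B A" for A B :: "'a set"
    by (simp add: hausdorff_dist_def max.commute conj_commute)
  show "hausdorff_dist K N \<le> hausdorff_dist K L + hausdorff_dist L N"
    unfolding hausdorff_dist_le_iff[OF K N]
    using *[OF K L N] *[OF N L K] comm[of N L] comm[of L K] by (metis add.commute)
qed

section \<open>Point processes of hyperplanes\<close>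

abbreviation count_on :: "'b set \<Rightarrow> 'b set \<Rightarrow> ennreal" where
  "count_on \<eta> A \<equiv> emeasure (count_space UNIV) (\<eta> \<inter> A)"

text \<open>Simple point processes are identified with random locally finite sets of hyperplanes.
  This is no restriction here: the intensity measures below are diffuse, so that the Poisson
  process is almost surely simple.\<close>

definition configurations :: "'a::euclidean_space set set set" where
  "configurations = {\<eta>. \<eta> \<subseteq> hyperplanes \<and> (\<forall>C. compact C \<longrightarrow> finite {H \<in> \<eta>. H \<inter> C \<noteq> {}})}"

definition configuration_space :: "'a::euclidean_space set set measure" where
  "configuration_space = sigma configurations
     {{\<eta> \<in> configurations. count_on \<eta> A \<in> R} | A R.
        A \<in> sets (borel_of hyperplane_topology) \<and> R \<in> sets borel}"

definition intensity_measure ::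
    "'w measure \<Rightarrow> ('w \<Rightarrow> 'a::euclidean_space set set) \<Rightarrow> 'a set measure" where
  "intensity_measure M X = measure_of hyperplanes (sets (borel_of hyperplane_topology))
     (\<lambda>A. \<integral>\<^sup>+\<omega>. count_on (X \<omega>) A \<partial>M)"

definition poisson_hyperplane_process ::
    "'w measure \<Rightarrow> ('w \<Rightarrow> 'a::euclidean_space set set) \<Rightarrow> bool" where
  "poisson_hyperplane_process M X \<longleftrightarrow>
     prob_space M \<and> X \<in> measurable M configuration_space \<and>
     (\<forall>A \<in> sets (borel_of hyperplane_topology). emeasure (intensity_measure M X) A < \<infinity> \<longrightarrow>
        (\<forall>n. measure M {\<omega> \<in> space M. count_on (X \<omega>) A = of_nat n} =
          exp (- measure (intensity_measure M X) A) * measure (intensity_measure M X) A ^ n / fact n)) \<and>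
     (\<forall>\<A>. finite \<A> \<and> \<A> \<subseteq> sets (borel_of hyperplane_topology) \<and> disjoint \<A> \<longrightarrow>
        prob_space.indep_vars M (\<lambda>_. borel) (\<lambda>A \<omega>. count_on (X \<omega>) A) \<A>)"

definition stationary ::
    "'w measure \<Rightarrow> ('w \<Rightarrow> 'a::euclidean_space set set) \<Rightarrow> bool" where
  "stationary M X \<longleftrightarrow> (\<forall>t. distr M configuration_space (\<lambda>\<omega>. (\<lambda>H. (+) t ` H) ` X \<omega>) =
     distr M configuration_space X)"

definition even_measure :: "'a::euclidean_space measure \<Rightarrow> bool" where
  "even_measure \<phi> \<longleftrightarrow> (\<forall>A \<in> sets \<phi>. emeasure \<phi> (uminus ` A) = emeasure \<phi> A)"

text \<open>\<open>\<gamma>\<close> is the intensity and \<open>\<phi>\<close> the spherical directional distribution of the process.\<close>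

definition has_intensity_and_direction :: "'w measure \<Rightarrow> ('w \<Rightarrow> 'a::euclidean_space set set) \<Rightarrow>
    real \<Rightarrow> 'a measure \<Rightarrow> bool" where
  "has_intensity_and_direction M X \<gamma> \<phi> \<longleftrightarrow>
     0 < \<gamma> \<and> prob_space \<phi> \<and> sets \<phi> = sets (restrict_space borel (sphere 0 1)) \<and> even_measure \<phi> \<and>
     (\<forall>f \<in> borel_measurable (borel_of hyperplane_topology).
        (\<integral>\<^sup>+H. f H \<partial>intensity_measure M X) =
        ennreal \<gamma> * (\<integral>\<^sup>+u. (\<integral>\<^sup>+\<tau>. f (hyperplane u \<tau>) \<partial>lborel) \<partial>\<phi>))"

definition nondegenerate :: "'a::euclidean_space measure \<Rightarrow> bool" where
  "nondegenerate \<phi> \<longleftrightarrow> (\<forall>L. subspace L \<and> dim L = DIM('a) - 1 \<longrightarrow> \<not> (AE u in \<phi>. u \<in> sphere 0 1 \<inter> L))"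

definition subspace_free :: "'a::euclidean_space measure \<Rightarrow> bool" where
  "subspace_free \<phi> \<longleftrightarrow> (\<forall>L. subspace L \<and> dim L = DIM('a) - 1 \<longrightarrow> emeasure \<phi> (sphere 0 1 \<inter> L) = 0)"

definition support_function :: "'a::euclidean_space set \<Rightarrow> 'a \<Rightarrow> real" where
  "support_function K u = (SUP x\<in>K. inner x u)"

definition hitting_functional :: "'a::euclidean_space measure \<Rightarrow> 'a set \<Rightarrow> real" where
  "hitting_functional \<phi> K = (\<integral>u. support_function K u \<partial>\<phi>)"

section \<open>Polytopes and the faces of the tessellation\<close>

definition polytopes_dim :: "nat \<Rightarrow> 'a::euclidean_space set set" where
  "polytopes_dim k = {P. polytope P \<and> aff_dim P = int k}"

definition num_faces :: "nat \<Rightarrow> 'a::euclidean_space set \<Rightarrow> nat" where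
  "num_faces r P = card {F. F face_of P \<and> aff_dim F = int r}"

definition cells :: "'a::euclidean_space set set \<Rightarrow> 'a set set" where
  "cells \<eta> = closure ` components (UNIV - \<Union>\<eta>)"

definition tessellation_faces :: "nat \<Rightarrow> 'a::euclidean_space set set \<Rightarrow> 'a set set" where
  "tessellation_faces k \<eta> = {F. \<exists>C\<in>cells \<eta>. F face_of C \<and> aff_dim F = int k}"

text \<open>\<open>cball z r \<inter> affine hull P\<close> is the ball of the dimension of \<open>P\<close> with center \<open>z\<close>
  and radius \<open>r\<close> in the affine hull of \<open>P\<close>.\<close>

definition inscribed_ball :: "'a::euclidean_space set \<Rightarrow> 'a \<Rightarrow> real \<Rightarrow> bool" where
  "inscribed_ball P z r \<longleftrightarrow> z \<in> P \<and> 0 < r \<and> cball z r \<inter> affine hull P \<subseteq> P"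

definition inball :: "'a::euclidean_space set \<Rightarrow> 'a \<Rightarrow> real \<Rightarrow> bool" where
  "inball P z r \<longleftrightarrow> inscribed_ball P z r \<and> (\<forall>y s. inscribed_ball P y s \<longrightarrow> s \<le> r)"

definition unique_inball_polytopes :: "nat \<Rightarrow> 'a::euclidean_space set set" where
  "unique_inball_polytopes k = {P \<in> polytopes_dim k. \<exists>!(z, r). inball P z r}"

definition incenter :: "'a::euclidean_space set \<Rightarrow> 'a" where
  "incenter P = (THE z. \<exists>r. inball P z r)"

definition centered :: "'a::euclidean_space set \<Rightarrow> 'a set" where
  "centered P = (\<lambda>x. x - incenter P) ` P"

definition polytope_space :: "nat \<Rightarrow> 'a::euclidean_space set measure" where
  "polytope_space k = restrict_space (borel_of convex_body_topology) (polytopes_dim k)"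

text \<open>The incenter is only meaningful on \<open>unique_inball_polytopes k\<close>, which under the
  assumptions of the theorem almost surely contains all \<open>k\<close>-faces of the tessellation; the sum
  over the faces is therefore taken over this set.\<close>

definition typical_face_distribution :: "nat \<Rightarrow> 'w measure \<Rightarrow>
    ('w \<Rightarrow> 'a::euclidean_space set set) \<Rightarrow> real \<Rightarrow> 'a set measure \<Rightarrow> bool" where
  "typical_face_distribution k M X \<gamma>\<^sub>k Q \<longleftrightarrow>
     0 < \<gamma>\<^sub>k \<and> prob_space Q \<and> sets Q = sets (polytope_space k) \<and>
     (\<forall>A \<in> sets (polytope_space k). \<forall>B \<in> sets borel. emeasure lborel B = 1 \<longrightarrow>
        ennreal \<gamma>\<^sub>k * emeasure Q A =
        (\<integral>\<^sup>+\<omega>. (\<integral>\<^sup>+K. indicator A (centered K) * indicator B (incenter K)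
            \<partial>count_space (tessellation_faces k (X \<omega>) \<inter> unique_inball_polytopes k)) \<partial>M))"

definition typical_face :: "nat \<Rightarrow> 'w measure \<Rightarrow> ('w \<Rightarrow> 'a::euclidean_space set set) \<Rightarrow>
    'v measure \<Rightarrow> ('v \<Rightarrow> 'a set) \<Rightarrow> bool" where
  "typical_face k M X N Z \<longleftrightarrow> prob_space N \<and> Z \<in> measurable N (polytope_space k) \<and>
     (\<exists>\<gamma>\<^sub>k. typical_face_distribution k M X \<gamma>\<^sub>k (distr N (polytope_space k) Z))"

section \<open>Size and shape\<close>

definition size_functional :: "nat \<Rightarrow> ('a::euclidean_space set \<Rightarrow> real) \<Rightarrow> bool" where
  "size_functional k \<Sigma> \<longleftrightarrow>
     (\<forall>K\<in>convex_bodies. \<forall>L\<in>convex_bodies. K \<subseteq> L \<longrightarrow> \<Sigma> K \<le> \<Sigma> L) \<and>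
     (\<forall>K\<in>convex_bodies. \<forall>c\<ge>0. \<Sigma> ((\<lambda>x. c *\<^sub>R x) ` K) = c * \<Sigma> K) \<and>
     continuous_map convex_body_topology euclideanreal \<Sigma> \<and>
     (\<forall>K\<in>convex_bodies. aff_dim K = int k \<longrightarrow> 0 < \<Sigma> K)"

definition translation_invariant :: "('a::euclidean_space set \<Rightarrow> real) \<Rightarrow> bool" where
  "translation_invariant \<Sigma> \<longleftrightarrow> (\<forall>K\<in>convex_bodies. \<forall>t. \<Sigma> ((+) t ` K) = \<Sigma> K)"

definition shape :: "'a::euclidean_space measure \<Rightarrow> 'a set \<Rightarrow> 'a set" where
  "shape \<phi> P = (\<lambda>x. (1 / hitting_functional \<phi> P) *\<^sub>R x) ` centered P"

definition shape_set :: "'a::euclidean_space measure \<Rightarrow> nat \<Rightarrow> 'a set set" where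
  "shape_set \<phi> k = shape \<phi> ` unique_inball_polytopes k"

definition shape_space :: "'a::euclidean_space measure \<Rightarrow> nat \<Rightarrow> 'a set measure" where
  "shape_space \<phi> k = restrict_space (borel_of convex_body_topology) (shape_set \<phi> k)"

section \<open>The limit measure\<close>

text \<open>Tuples \<open>u\<close> of \<open>DIM('a) + 1\<close> unit vectors are functions on \<open>{1..DIM('a) + 1}\<close>.\<close>

definition general_position :: "(nat \<Rightarrow> 'a::euclidean_space) \<Rightarrow> bool" where
  "general_position u \<longleftrightarrow> (\<forall>J. J \<subseteq> {1..DIM('a) + 1} \<and> card J = DIM('a) \<longrightarrow>
     inj_on u J \<and> independent (u ` J))"

definition Lsub :: "nat \<Rightarrow> (nat \<Rightarrow> 'a::euclidean_space) \<Rightarrow> 'a set" where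
  "Lsub k u = orthogonal_comp (span (u ` {k + 2..DIM('a) + 1}))"

definition orth_proj :: "'a::euclidean_space set \<Rightarrow> 'a \<Rightarrow> 'a" where
  "orth_proj L x = (THE y. y \<in> L \<and> x - y \<in> orthogonal_comp L)"

definition tuples :: "nat \<Rightarrow> (nat \<Rightarrow> 'a::euclidean_space) set" where
  "tuples k = {u \<in> {1..DIM('a) + 1} \<rightarrow>\<^sub>E sphere 0 1. general_position u \<and>
     (\<forall>x \<in> Lsub k u. \<exists>c. (\<forall>j\<in>{1..k + 1}. 0 \<le> c j) \<and>
        x = (\<Sum>j = 1..k + 1. c j *\<^sub>R orth_proj (Lsub k u) (u j)))}"

text \<open>The choice of the enumerated orthonormal basis does not affect the absolute value of the
  determinant below.\<close>

definition basis_enum :: "nat \<Rightarrow> 'a::euclidean_space" where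
  "basis_enum = (SOME e. bij_betw e {..<DIM('a)} Basis)"

text \<open>Matrices of \<open>Jordan_Normal_Form\<close> are indexed from \<open>0\<close>, so that row \<open>i\<close>
  belongs to the vector \<open>u (i + 1)\<close>.\<close>

definition Dk :: "nat \<Rightarrow> (nat \<Rightarrow> 'a::euclidean_space) \<Rightarrow> real" where
  "Dk k u = \<bar>Determinant.det (Matrix.mat (DIM('a) + 1) (DIM('a) + 1) (\<lambda>(i, j).
     if j < DIM('a) then inner (u (i + 1)) (basis_enum j)
     else if i + 1 \<le> k + 1 then norm (orth_proj (Lsub k u) (u (i + 1)))
     else 0))\<bar>"

definition Tk :: "nat \<Rightarrow> (nat \<Rightarrow> 'a::euclidean_space) \<Rightarrow> 'a set" where
  "Tk k u = Lsub k u \<inter>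
     (\<Inter>i\<in>{1..k + 1}. lower_halfspace (u i) (norm (orth_proj (Lsub k u) (u i))))"

definition xi :: "nat \<Rightarrow> 'a::euclidean_space measure \<Rightarrow> ('a set \<Rightarrow> real) \<Rightarrow> 'a set measure" where
  "xi k \<phi> \<Sigma> = measure_of (shape_set \<phi> k) (sets (shape_space \<phi> k))
     (\<lambda>S. \<integral>\<^sup>+u\<in>tuples k. indicator S (shape \<phi> (Tk k u)) * ennreal (Dk k u / \<Sigma> (Tk k u))
        \<partial>(PiM {1..DIM('a) + 1} (\<lambda>_. \<phi>)))"

end

theory Submission
  imports Defs
begin

text \<open>
  A \<open>k\<close>-face with a unique inball lies in \<open>d - k\<close> hyperplanes of the process, and the inball touches
  \<open>k + 1\<close> further ones. These \<open>d + 1\<close> hyperplanes, with unit normals \<open>u\<close>, determine the incenter \<open>z\<close>,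
  the inradius \<open>r\<close> and the simplex \<open>z + r T\<^sub>k(u)\<close>, which contains the face and is equal to it unless
  another hyperplane hits the simplex. For fixed \<open>u\<close> the distances of the hyperplanes depend linearly
  on \<open>(z, r)\<close>, with Jacobian \<open>D\<^sub>k(u)\<close>. Hence the mean number of such tuples with \<open>z\<close> in the unit cube and
  \<open>\<Sigma>(z + r T\<^sub>k(u)) < a\<close> is a constant times \<open>a \<integral> D\<^sub>k / \<Sigma>(T\<^sub>k)\<close>, by the homogeneity of \<open>\<Sigma>\<close>.

  The other faces are negligible: \<open>\<Sigma>\<close> is at least a constant times the inradius, so only tuples with
  \<open>r = O(a)\<close> matter. An additional hyperplane that hits a simplex of bounded circumradius contributes
  a second factor \<open>a\<close> to the next factorial moment, and the simplices of large circumradius carry little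
  of the finite mass \<open>\<integral> D\<^sub>k\<close>. The conditional probabilities therefore converge to the quotients of the
  leading terms.
\<close>

section \<open>Linear algebra\<close>

text \<open>One asymptotic formula serves both limits. It is proved for every Borel class of convex
  bodies that, on polytopes with a unique inball, is invariant under translation and positive
  scaling; a shape event and the class of simplices are two such classes. The number of oriented
  tuples that describe one simplex face and the intensity of the typical face are constant factors,
  so they cancel in the quotient.

  The obstacle is that \<open>Tk k u\<close> has inradius 1 but a circumradius that is unbounded in
  \<open>u\<close>. The effect of an additional hyperplane is bounded through the circumradius, so
  the error is not quadratic in a outright: it is at most a times a small number plus a^2 times a
  constant that depends on a cutoff \<open>R\<close>. The cutoff is therefore fixed before a tends
  to 0.

  Unit normals are determined by hyperplanes only up to sign. All integrals live on the double cover
  by pairs (normal, distance), where the intensity becomes a product measure and the change of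
  variables is linear.\<close>

notation scaleR (infixr "*R" 75)

notation iff (infixr "<->" 25)

syntax "_NN" :: "pttrn => ennreal => 'a measure => ennreal" ("(2NN ((2 _./ _)/ \<partial>_))" [60,61] 110)
translations "NN x. f \<partial>M" => "CONST nn_integral M (%x. f)"

text \<open>\<open>II('a)\<close> is the index set of the hyperplanes that bound a simplex face.\<close>

syntax "_II" :: "type => nat set" ("(1II/(1'(_')))")
translations "II('a)" => "{1..DIM('a) + 1}"

no_notation Matrix.scalar_prod (infix "\<bullet>" 70)
no_notation Matrix.vec_index (infixl "$" 100)
hide_const (open) Matrix.orthogonal
hide_fact (open) Matrix.orthogonal_def

text \<open>Independence of a family instead of a set: a repeated vector destroys it, although the
  set of values may stay independent.\<close>

definition indep_fam :: "('i => 'b::euclidean_space) => 'i set => bool" where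
 "indep_fam w I <-> inj_on w I & independent (w ` I)"

lemma indep_fam_iff_span: "indep_fam w I <-> (ALL i:I. w i ~: span (w ` (I - {i})))"
proof
 assume L: "indep_fam w I"
 show "ALL i:I. w i ~: span (w ` (I - {i}))"
 proof
  fix i assume i: "i : I"
  have "w ` (I - {i}) = w ` I - {w i}"
   using L i by(auto simp:indep_fam_def inj_on_def)
  thus "w i ~: span (w ` (I - {i}))"
   using L i by(auto simp:indep_fam_def dependent_def)
 qed
next
 assume R: "ALL i:I. w i ~: span (w ` (I - {i}))"
 have inj: "inj_on w I"
 proof(rule inj_onI, rule ccontr)
  fix i j assume "i : I" "j : I" "w i = w j" "i ~= j"
  hence "w i : w ` (I - {i})" by auto
  hence "w i : span (w ` (I - {i}))" by(rule span_base)
  thus False using R \<open>i \<in> I\<close> by simp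
 qed
 moreover have "independent (w ` I)"
  unfolding dependent_def
 proof clarsimp
  fix i assume i: "i : I" and s: "w i : span (w ` I - {w i})"
  have "w ` (I - {i}) = w ` I - {w i}"
   using inj i by(auto simp:inj_on_def)
  thus False using R i s by auto
 qed
 ultimately show "indep_fam w I" by(simp add:indep_fam_def)
qed

lemma indep_fam_subset: "indep_fam w I ==> J <= I ==> indep_fam w J"
 unfolding indep_fam_def by(meson image_mono inj_on_subset independent_mono)

lemma indep_fam_cong: "(!!i. i : I ==> w i = w' i) ==> indep_fam w I = indep_fam w' I"
 unfolding indep_fam_def by(metis image_cong inj_on_cong)

lemma indep_fam_iff_sum:
 assumes "finite I"
 shows "indep_fam w I <-> (ALL a. (\<Sum>i\<in>I. a i *R w i) = 0 --> (ALL i:I. a i = 0))"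
proof
 assume L: "indep_fam w I"
 show "ALL a. (\<Sum>i\<in>I. a i *R w i) = 0 --> (ALL i:I. a i = 0)"
 proof(intro allI impI ballI, rule ccontr)
  fix a i assume s: "(\<Sum>i\<in>I. a i *R w i) = 0" and i: "i : I" "a i ~= 0"
  have "a i *R w i = - (\<Sum>j\<in>I - {i}. a j *R w j)"
   using s i assms by(simp add:sum.remove[of I i] eq_neg_iff_add_eq_0)
  moreover have "(\<Sum>j\<in>I - {i}. a j *R w j) : span (w ` (I - {i}))"
   by(intro span_sum span_scale span_base) auto
  ultimately have "a i *R w i : span (w ` (I - {i}))" by(simp add:span_neg)
  hence "w i : span (w ` (I - {i}))"
   using i(2) span_scale[of "a i *R w i" _ "1 / a i"] by simp
  thus False using L i by(simp add:indep_fam_iff_span)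
 qed
next
 assume R: "ALL a. (\<Sum>i\<in>I. a i *R w i) = 0 --> (ALL i:I. a i = 0)"
 have inj: "inj_on w I"
 proof(rule inj_onI, rule ccontr)
  fix i j assume ij: "i : I" "j : I" "w i = w j" "i ~= j"
  let ?a = "%l. if l = i then 1 else if l = j then - 1 else (0::real)"
  have "(\<Sum>l\<in>I. ?a l *R w l) = (\<Sum>l\<in>{i,j}. ?a l *R w l)"
   using ij assms by(intro sum.mono_neutral_right) auto
  also have "... = 0" using ij by simp
  finally show False using R ij(1) by(auto dest!: spec[of _ ?a])
 qed
 have "independent (w ` I)"
  unfolding independent_explicit_module
 proof(intro allI impI)
  fix t u v assume t: "finite t" "t <= w ` I" "(\<Sum>v\<in>t. u v *R v) = 0" "v : t"
  let ?a = "%l. if w l : t then u (w l) else (0::real)"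
  have "(\<Sum>l\<in>I. ?a l *R w l) = (\<Sum>x\<in>w ` I. (if x : t then u x else 0) *R x)"
   by(simp add:sum.reindex[OF inj])
  also have "... = (\<Sum>v\<in>t. u v *R v)"
   using assms t(2) by(intro sum.mono_neutral_cong_right) auto
  finally have "(\<Sum>l\<in>I. ?a l *R w l) = 0" using t(3) by simp
  hence "ALL i:I. ?a i = 0" by(rule R[THEN spec, THEN mp])
  thus "u v = 0" using t(2,4) by fastforce
 qed
 thus "indep_fam w I" using inj by(simp add:indep_fam_def)
qed

lemma indep_fam_nonzero: "indep_fam w I ==> i : I ==> w i ~= 0"
 using span_zero by(metis indep_fam_iff_span)

lemma indep_fam_card: "indep_fam w I ==> finite I ==> card (w ` I) = card I"
 by(simp add:indep_fam_def card_image)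

lemma indep_fam_dim_span: "indep_fam w I ==> finite I ==> dim (span (w ` I)) = card I"
 by(metis dim_span dim_eq_card_independent indep_fam_card indep_fam_def)

lemma indep_fam_span_UNIV:
 fixes w :: "'i => 'b::euclidean_space"
 shows "indep_fam w I ==> finite I ==> card I = DIM('b) ==> span (w ` I) = UNIV"
 by(metis dim_eq_full dim_span indep_fam_dim_span span_span)

lemma indep_famD:
 assumes "indep_fam w I" "finite I" "(\<Sum>i\<in>I. a i *R w i) = 0" "i : I"
 shows "a i = 0"
 using assms by(auto simp:indep_fam_iff_sum)

section \<open>Gram-Schmidt residuals and orthogonal projections\<close>

text \<open>The component of \<open>x\<close> orthogonal to the span of the list, by Gram-Schmidt.
  If \<open>y\<close> depends on \<open>ys\<close>, its residual is 0 and division by zero drops the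
  term. The explicit formula is what makes projections, dual vectors and the test for independence
  measurable in the vectors.\<close>

primrec resid :: "'b::euclidean_space list => 'b => 'b" where
 "resid [] x = x"
| "resid (y # ys) x = resid ys x - (inner (resid ys x) (resid ys y) / inner (resid ys y) (resid ys y)) *R resid ys y"

text \<open>Orthogonality to \<open>y\<close> reduces to orthogonality to its residual, because
  \<open>y\<close> differs from the residual by an element of the span of \<open>ys\<close>, where
  the induction hypothesis applies.\<close>

lemma resid_props: "x - resid ys x : span (set ys) & (ALL y:span (set ys). orthogonal (resid ys x) y)"
proof(induction ys arbitrary: x)
 case Nil
 thus ?case by(auto simp:orthogonal_def)
next
 case (Cons y ys)
 let ?w = "resid ys y" and ?x = "resid ys x"
 let ?c = "inner ?x ?w / inner ?w ?w"
 have sub: "span (set ys) <= span (set (y # ys))" by(rule span_mono) auto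
 have w: "?w : span (set (y # ys))"
 proof -
  have "y - (y - ?w) : span (set (y # ys))"
   by(rule span_diff) (use Cons.IH[of y] sub in \<open>auto intro: span_base\<close>)
  thus ?thesis by simp
 qed
 have 1: "x - resid (y # ys) x : span (set (y # ys))"
 proof -
  have "x - resid (y # ys) x = (x - ?x) + ?c *R ?w" by simp
  also have "... : span (set (y # ys))"
   by(intro span_add span_scale w) (use Cons.IH[of x] sub in auto)
  finally show ?thesis .
 qed
 have orth: "orthogonal (resid (y # ys) x) z" if "z : set (y # ys)" for z
 proof -
  have o: "inner (resid (y # ys) x) ?w = 0"
   by(cases "?w = 0") (auto simp:inner_diff_left)
  have o2: "inner (resid (y # ys) x) v = 0" if "v : span (set ys)" for v
   using that Cons.IH[of x] Cons.IH[of y] by(simp add:inner_diff_left orthogonal_def)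
  show ?thesis
  proof(cases "z : set ys")
   case True
   thus ?thesis using o2 by(simp add:orthogonal_def span_base)
  next
   case False
   hence "z = y" using that by auto
   moreover have "inner (resid (y # ys) x) (y - ?w) = 0" by(rule o2) (use Cons.IH[of y] in auto)
   ultimately show ?thesis using o by(simp add:orthogonal_def inner_diff_right)
  qed
 qed
 have "ALL z:span (set (y # ys)). orthogonal (resid (y # ys) x) z"
  using orth orthogonal_to_span by blast
 thus ?case using 1 by blast
qed

lemma resid_eq_0_iff: "resid ys x = 0 <-> x : span (set ys)"
proof
 assume "resid ys x = 0"
 thus "x : span (set ys)" using resid_props[of x ys] by simp
next
 assume "x : span (set ys)"
 hence "x - (x - resid ys x) : span (set ys)" using resid_props[of x ys] span_diff by blast
 hence "orthogonal (resid ys x) (resid ys x)" using resid_props[of x ys] by simp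
 thus "resid ys x = 0" by(simp add:orthogonal_def)
qed

lemma measurable_resid[measurable (raw)]:
 assumes "x : borel_measurable N"
  and "!!i. i : set is ==> f i : borel_measurable N"
 shows "(%w. resid (map (%i. f i w) is) (x w)) : borel_measurable N"
 using assms
proof(induction "is" arbitrary: x)
 case (Cons i "is")
 have [measurable]: "(%w. resid (map (%i. f i w) is) (x w)) : borel_measurable N"
  "(%w. resid (map (%i. f i w) is) (f i w)) : borel_measurable N"
  by(auto intro!:Cons)
 show ?case by simp
qed simp

lemma orth_proj_eqI:
 assumes "subspace L" "y : L" "x - y : orthogonal_comp L"
 shows "orth_proj L x = y"
 unfolding orth_proj_def
proof(rule the_equality)
 show "y : L & x - y : orthogonal_comp L" using assms by simp
next
 fix z assume z: "z : L & x - z : orthogonal_comp L"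
 have "z - y : L" using z assms by(simp add:subspace_diff)
 hence "inner (z - y) (x - y) = 0" "inner (z - y) (x - z) = 0"
  using z assms(3) by(auto simp:orthogonal_comp_def orthogonal_def)
 hence "inner (z - y) ((x - y) - (x - z)) = 0" by(simp add:inner_diff_right del:diff_diff_eq2)
 hence "inner (z - y) (z - y) = 0" by simp
 thus "z = y" by simp
qed

lemma orth_proj_span_comp: "orth_proj (orthogonal_comp (span (set ys))) x = resid ys x"
proof(rule orth_proj_eqI)
 show "subspace (orthogonal_comp (span (set ys)))" by(rule subspace_orthogonal_comp)
 show "resid ys x : orthogonal_comp (span (set ys))"
  using resid_props[of x ys] by(auto simp:orthogonal_comp_def orthogonal_commute)
 show "x - resid ys x : orthogonal_comp (orthogonal_comp (span (set ys)))"
  using resid_props[of x ys] by(simp add:orthogonal_comp_self)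
qed

text \<open>Every subspace is the complement of the span of a finite list, so a residual supplies
  the point that the description operator in \<open>orth_proj\<close> asks for.\<close>

lemma orth_proj_props:
 fixes L :: "'b::euclidean_space set"
 assumes "subspace L"
 shows "orth_proj L x : L" "x - orth_proj L x : orthogonal_comp L"
proof -
 obtain B where B: "finite B" "span B = orthogonal_comp L"
  by(rule basis_subspace_exists[OF subspace_orthogonal_comp])
 then obtain ys where ys: "set ys = B" using finite_list by blast
 have L: "L = orthogonal_comp (span (set ys))" using B ys orthogonal_comp_self[OF assms] by simp
 have "orth_proj L x = resid ys x" unfolding L by(rule orth_proj_span_comp)
 moreover have "resid ys x : L"
  using resid_props[of x ys] by(subst L) (auto simp:orthogonal_comp_def orthogonal_commute)
 moreover have "x - resid ys x : orthogonal_comp L"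
  using resid_props[of x ys] unfolding B(2)[symmetric] ys by simp
 ultimately show "orth_proj L x : L" "x - orth_proj L x : orthogonal_comp L" by auto
qed

lemma inner_orth_proj:
 assumes "subspace L" "y : L"
 shows "inner y (orth_proj L x) = inner y x"
 using orth_proj_props(2)[OF assms(1), of x] assms(2)
 by(auto simp:orthogonal_comp_def orthogonal_def inner_diff_right)

lemma norm_orth_proj_le:
 assumes "subspace L"
 shows "norm (orth_proj L x) <= norm x"
proof -
 let ?y = "orth_proj L x"
 have "norm ?y ^ 2 = inner ?y x"
  using inner_orth_proj[OF assms orth_proj_props(1)[OF assms]] by(simp add:power2_norm_eq_inner)
 also have "... <= norm ?y * norm x" by(rule norm_cauchy_schwarz)
 finally show ?thesis by(cases "?y = 0") (auto simp:power2_eq_square)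
qed

lemma orth_proj_sum:
 assumes "subspace L"
 shows "orth_proj L (\<Sum>i\<in>I. a i *R x i) = (\<Sum>i\<in>I. a i *R orth_proj L (x i))"
proof(rule orth_proj_eqI[OF assms])
 show "(\<Sum>i\<in>I. a i *R orth_proj L (x i)) : L"
  by(intro subspace_sum subspace_scale assms orth_proj_props)
 have "(\<Sum>i\<in>I. a i *R x i) - (\<Sum>i\<in>I. a i *R orth_proj L (x i)) = (\<Sum>i\<in>I. a i *R (x i - orth_proj L (x i)))"
  by(simp add:sum_subtractf scaleR_diff_right)
 also have "... : orthogonal_comp L"
  by(intro subspace_sum subspace_scale subspace_orthogonal_comp orth_proj_props assms)
 finally show "(\<Sum>i\<in>I. a i *R x i) - (\<Sum>i\<in>I. a i *R orth_proj L (x i)) : orthogonal_comp L" .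
qed

lemma orth_proj_eq_0_iff:
 assumes "subspace L"
 shows "orth_proj L x = 0 <-> x : orthogonal_comp L"
 by(metis assms diff_zero orth_proj_eqI orth_proj_props(2) subspace_0)

section \<open>Dual bases\<close>

text \<open>The residual \<open>r\<close> of \<open>w i\<close> against the other vectors has the
  same product with \<open>w i\<close> as with itself; dividing by this number gives the dual vector
  within the span of the family. The order on the indices serves to turn the index set into a
  list.\<close>

definition dual_vec :: "('i::linorder => 'b::euclidean_space) => 'i set => 'i => 'b" where
 "dual_vec w I i = (let r = resid (map w (sorted_list_of_set (I - {i}))) (w i) in (1 / inner r r) *R r)"

lemma inner_dual_vec:
 assumes "finite I" "indep_fam w I" "i : I" "j : I"
 shows "inner (dual_vec w I i) (w j) = (if i = j then 1 else 0)"
proof -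
 let ?ys = "map w (sorted_list_of_set (I - {i}))"
 let ?r = "resid ?ys (w i)"
 have s: "set ?ys = w ` (I - {i})" using assms(1) by simp
 have p: "w i - ?r : span (set ?ys)" "!!y. y : span (set ?ys) ==> inner ?r y = 0"
  using resid_props[of "w i" ?ys] unfolding orthogonal_def by blast+
 have r: "?r ~= 0" using assms(2,3) unfolding resid_eq_0_iff s indep_fam_iff_span by blast
 show ?thesis
 proof(cases "i = j")
  case True
  have "inner ?r (w i) = inner ?r ?r + inner ?r (w i - ?r)" by(simp add:inner_diff_right)
  also have "... = inner ?r ?r" using p by simp
  finally show ?thesis using True r by(simp add:dual_vec_def Let_def)
 next
  case False
  hence "w j : span (set ?ys)" unfolding s using assms(4) by(intro span_base) auto
  hence "inner ?r (w j) = 0" by(rule p(2))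
  thus ?thesis using False by(simp add:dual_vec_def Let_def del:map_map)
 qed
qed

lemma measurable_dual_vec[measurable (raw)]:
 assumes "finite I" "i : I"
  and "!!i. i : I ==> f i : borel_measurable N"
 shows "(%w. dual_vec (%i. f i w) I i) : borel_measurable N"
proof -
 have [measurable]: "(%w. resid (map (%i. f i w) (sorted_list_of_set (I - {i}))) (f i w)) : borel_measurable N"
  using assms by(intro measurable_resid) auto
 show ?thesis unfolding dual_vec_def Let_def by measurable
qed

lemma measurable_indep_fam:
 fixes I :: "'i::linorder set"
 assumes "finite I" "!!i. i : I ==> f i : borel_measurable N"
 shows "{w : space N. indep_fam (%i. f i w) I} : sets N"
proof -
 have [measurable]: "(%w. resid (map (%i. f i w) (sorted_list_of_set (I - {i}))) (f i w)) : borel_measurable N" if "i : I" for i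
  using assms that by(intro measurable_resid) auto
 have "{w : space N. indep_fam (%i. f i w) I} =
  {w : space N. ALL i:I. resid (map (%i. f i w) (sorted_list_of_set (I - {i}))) (f i w) ~= 0}"
  using assms(1) by(auto simp:indep_fam_iff_span resid_eq_0_iff)
 also have "... : sets N" using assms(1) by measurable
 finally show ?thesis .
qed

lemma eq_of_inner_indep:
 fixes w :: "'i => 'b::euclidean_space"
 assumes "span (w ` I) = UNIV" "!!i. i : I ==> inner x (w i) = inner y (w i)"
 shows "x = y"
proof -
 have "orthogonal (x - y) z" if "z : span (w ` I)" for z
  using that by(rule orthogonal_to_span)
   (auto simp:orthogonal_def assms inner_diff_left)
 hence "orthogonal (x - y) (x - y)" using assms(1) by simp
 thus ?thesis by(simp add:orthogonal_def)
qed

section \<open>Hyperplane processes\<close>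

locale directional =
 fixes \<phi> :: "'a::euclidean_space measure"
 assumes prob_space_phi: "prob_space \<phi>"
  and sets_phi: "sets \<phi> = sets (restrict_space borel (sphere 0 1))"
  and even_phi: "even_measure \<phi>"
begin

sublocale \<phi>: prob_space \<phi> by(rule prob_space_phi)

lemma space_phi: "space \<phi> = sphere 0 1"
 using sets_eq_imp_space_eq[OF sets_phi] by(simp add:space_restrict_space)

lemma measurable_phi_borel [measurable]: "(%x. x) : measurable \<phi> borel"
proof -
 have "(%x. x) : measurable (restrict_space borel (sphere (0::'a) 1)) borel"
  by(intro measurable_restrict_space1) simp
 thus ?thesis using measurable_cong_sets[OF sets_phi refl] by blast
qed

lemma measurable_uminus_phi: "uminus : measurable \<phi> \<phi>"
proof -
 have "uminus : measurable (restrict_space borel (sphere (0::'a) 1)) (restrict_space borel (sphere (0::'a) 1))"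
  by(intro measurable_restrict_space3) auto
 thus ?thesis using measurable_cong_sets[OF sets_phi sets_phi] by blast
qed

lemma distr_uminus_phi: "distr \<phi> \<phi> uminus = \<phi>"
proof(rule measure_eqI)
 fix A assume "A : sets (distr \<phi> \<phi> uminus)"
 hence A: "A : sets \<phi>" by simp
 have "emeasure (distr \<phi> \<phi> uminus) A = emeasure \<phi> (uminus -` A Int space \<phi>)"
  using A measurable_uminus_phi by(simp add:emeasure_distr)
 also have "uminus -` A Int space \<phi> = uminus ` A"
 proof -
  have "A <= sphere 0 1" using sets.sets_into_space[OF A] space_phi by simp
  hence "!!x. x : A ==> norm x = 1" by(auto simp:dist_norm)
  thus ?thesis by(force simp:space_phi image_iff intro:bexI[of _ "- _"])
 qed
 also have "emeasure \<phi> (uminus ` A) = emeasure \<phi> A"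
  using even_phi A by(auto simp:even_measure_def)
 finally show "emeasure (distr \<phi> \<phi> uminus) A = emeasure \<phi> A" .
qed simp

lemma phi_uminus:
 assumes "f : borel_measurable \<phi>"
 shows "(NN u. f (- u) \<partial>\<phi>) = (NN u. f u \<partial>\<phi>)"
proof -
 have "(NN u. f u \<partial>\<phi>) = (NN u. f u \<partial>distr \<phi> \<phi> uminus)" by(simp add:distr_uminus_phi)
 also have "... = (NN u. f (- u) \<partial>\<phi>)"
  using assms measurable_uminus_phi by(intro nn_integral_distr) auto
 finally show ?thesis by simp
qed

end

section \<open>The double cover of the space of hyperplanes\<close>

text \<open>Let \<open>w\<close> be the part of \<open>v\<close> orthogonal to \<open>u\<close>.
  Both \<open>s *R u\<close> and \<open>s *R u + w\<close> lie on the hyperplane, so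
  \<open>w\<close> is orthogonal to \<open>v\<close> as well and vanishes; \<open>v\<close> is then
  a multiple of \<open>u\<close>, and both are unit vectors.\<close>

lemma hyperplane_eq_iff:
 fixes u v :: "'a::euclidean_space"
 assumes "norm u = 1" "norm v = 1"
 shows "hyperplane u s = hyperplane v t <-> (v = u & t = s) | (v = - u & t = - s)"
proof
 assume eq: "hyperplane u s = hyperplane v t"
 have uu: "inner u u = 1" "inner v v = 1" using assms by(auto simp:norm_eq_1)
 have mem: "!!x. inner x u = s <-> inner x v = t" using eq by(auto simp:hyperplane_def)
 define w where "w = v - inner v u *R u"
 have 1: "inner (s *R u) v = t" using mem[of "s *R u"] uu by simp
 have wu: "inner w u = 0" using uu by(simp add:w_def inner_diff_left)
 have "inner (s *R u + w) v = t" using mem[of "s *R u + w"] uu wu by(simp add:inner_add_left)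
 hence "inner w v = 0" using 1 by(simp add:inner_add_left)
 hence "inner w w = 0" using wu by(subst (2) w_def) (simp add:inner_diff_right)
 hence v: "v = inner v u *R u" by(simp add:w_def)
 hence "norm v = \<bar>inner v u\<bar> * norm u" by(metis norm_scaleR)
 hence "inner v u = 1 | inner v u = - 1" using assms by auto
 thus "(v = u & t = s) | (v = - u & t = - s)"
  using v 1 uu by auto
next
 assume "(v = u & t = s) | (v = - u & t = - s)"
 thus "hyperplane u s = hyperplane v t" by(auto simp:hyperplane_def)
qed

definition hyp :: "'a::euclidean_space \<times> real => 'a set" where
 "hyp p = hyperplane (fst p) (snd p)"

definition params :: "('a::euclidean_space \<times> real) set" where
 "params = sphere 0 1 \<times> UNIV"

lemma hyp_eq_iff: "p : params ==> p' : params ==> hyp p = hyp p' <-> p' = p | p' = - p"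
 using hyperplane_eq_iff[of "fst p" "fst p'" "snd p" "snd p'"]
 by(auto simp:hyp_def params_def prod_eq_iff)

lemma uminus_params_iff [simp]: "- p : params <-> p : params"
 by(auto simp:params_def mem_Times_iff)

lemma params_neq_uminus: "p : params ==> p ~= - p"
proof
 assume "p : params" "p = - p"
 hence "fst p = - fst p" "norm (fst p) = 1" by(auto simp:params_def prod_eq_iff)
 hence "2 *R fst p = 0" by(simp add:scaleR_2 eq_neg_iff_add_eq_0)
 thus False using \<open>norm (fst p) = 1\<close> by simp
qed

lemma hyp_uminus [simp]: "hyp (- p) = hyp p"
 by(auto simp:hyp_def hyperplane_def)

lemma hyp_in_hyperplanes: "p : params ==> hyp p : hyperplanes"
 by(auto simp:hyp_def hyperplanes_def params_def)

lemma hyperplanesE: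
 assumes "H : hyperplanes"
 obtains p where "p : params" "H = hyp p"
 using assms by(auto simp:hyp_def hyperplanes_def params_def)

lemma space_borel_of: "space (borel_of T) = topspace T"
 by(simp add:borel_of_def space_measure_of_conv)

lemma sets_borel_of: "sets (borel_of T) = sigma_sets (topspace T) {U. openin T U}"
 unfolding borel_of_def by(rule sets_measure_of) (auto dest:openin_subset)

lemma openin_sets_borel_of: "openin T U ==> U : sets (borel_of T)"
 by(simp add:sets_borel_of)

lemma closed_params: "closed (params :: ('a::euclidean_space \<times> real) set)"
 unfolding params_def by(intro closed_Times) auto

text \<open>On each open half of the double cover the map \<open>hyp\<close> is injective and open.
  Injectivity carries complements to relative complements, so the induction over Borel sets works on
  a half; finitely many halves cover everything.\<close>

lemma hyp_image_measurable:
 fixes B :: "('a::euclidean_space \<times> real) set"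
 assumes B: "B : sets borel" "B <= params"
 shows "hyp ` B : sets (borel_of hyperplane_topology)"
proof -
 define W :: "'a => ('a \<times> real) set" where "W e = {p : params. 0 < inner (fst p) e}" for e
 have inj: "inj_on hyp (W e)" for e
  by(rule inj_onI) (auto simp:W_def hyp_eq_iff)
 have op: "openin hyperplane_topology (hyp ` (V Int W e))" if "open V" for V :: "('a \<times> real) set" and e
  unfolding openin_hyperplane_topology
 proof
  show "hyp ` (V Int W e) <= hyperplanes" by(auto simp:W_def hyp_in_hyperplanes)
  let ?V = "V Int {p. 0 < inner (fst p) e}"
  have oV: "open ?V" by(intro open_Int that open_Collect_less continuous_intros)
  \<comment> \<open>Each hyperplane has exactly two parameters, so the preimage of the image
    consists of the set and its antipodal copy.\<close>
  have eq: "{p : sphere 0 1 \<times> UNIV. hyperplane (fst p) (snd p) : hyp ` (V Int W e)} =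
   (?V Un uminus ` ?V) Int params"
  proof(rule equalityI; rule subsetI)
   fix p assume "p : {p : sphere 0 1 \<times> UNIV. hyperplane (fst p) (snd p) : hyp ` (V Int W e)}"
   hence p: "p : params" "hyp p : hyp ` (V Int W e)" by(auto simp:params_def hyp_def)
   then obtain p' where p': "p' : V" "p' : W e" "hyp p = hyp p'" by auto
   hence "p = p' | p = - p'"
    using hyp_eq_iff[of p p'] p(1) by(auto simp:W_def)
   thus "p : (?V Un uminus ` ?V) Int params" using p' p(1) by(auto simp:W_def)
  next
   fix p assume p: "p : (?V Un uminus ` ?V) Int params"
   hence "hyp p : hyp ` (V Int W e)"
   proof(cases "p : ?V")
    case True thus ?thesis using p by(auto simp:W_def)
   next
    case False
    then obtain p' where p': "p' : ?V" "p = - p'" using p by auto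
    hence "p' : params" using p by auto
    hence "hyp p' : hyp ` (V Int W e)" using p' by(auto simp:W_def)
    thus ?thesis using p' by simp
   qed
   thus "p : {p : sphere 0 1 \<times> UNIV. hyperplane (fst p) (snd p) : hyp ` (V Int W e)}"
    using p by(auto simp:params_def hyp_def)
  qed
  have "open (?V Un uminus ` ?V)" using oV by(intro open_Un open_negations)
  thus "openin (top_of_set (sphere 0 1 \<times> UNIV))
    {p : sphere 0 1 \<times> UNIV. hyperplane (fst p) (snd p) : hyp ` (V Int W e)}"
   unfolding eq by(subst Int_commute, subst params_def) (rule openin_open_Int)
 qed
 have D: "hyp ` (B Int W e) : sets (borel_of hyperplane_topology)" for e
 proof -
  have "B : sigma_sets UNIV {S. open S}" using B(1) by(simp add:borel_def)
  thus ?thesis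
  proof(induction rule: sigma_sets.induct)
   case (Basic a)
   thus ?case by(auto intro!:openin_sets_borel_of op)
  next
   case Empty
   thus ?case by simp
  next
   case (Compl a)
   have "hyp ` ((UNIV - a) Int W e) = hyp ` (UNIV Int W e) - hyp ` (a Int W e)"
   proof -
    have "(UNIV - a) Int W e = UNIV Int W e - a Int W e" by blast
    thus ?thesis using inj_on_image_set_diff[OF inj[of e], of "UNIV Int W e" "a Int W e"] by auto
   qed
   also have "... : sets (borel_of hyperplane_topology)"
    by(rule sets.Diff[OF openin_sets_borel_of[OF op[OF open_UNIV]] Compl.IH])
   finally show ?case .
  next
   case (Union a)
   have "hyp ` (\<Union> (range a) Int W e) = (\<Union>i. hyp ` (a i Int W e))" by auto
   thus ?case using Union by auto
  qed
 qed
 \<comment> \<open>A unit vector has a nonzero coordinate, hence a positive product with some signed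
   basis vector.\<close>
 have "B = (\<Union>e\<in>Basis Un uminus ` Basis. B Int W e)"
 proof -
  have "EX e:Basis Un uminus ` Basis. p : W e" if "p : B" for p
  proof(rule ccontr)
   assume neg: "~ ?thesis"
   have "p : params" using that B by auto
   hence "inner (fst p) e <= 0" "inner (fst p) (- e) <= 0" if "e : Basis" for e
    using neg that unfolding W_def by(blast intro:leI)+
   hence "inner (fst p) e = 0" if "e : Basis" for e
    using that by(fastforce intro:antisym)
   hence "ALL e:Basis. inner (fst p) e = 0" by blast
   hence "fst p = 0" by(rule euclidean_all_zero_iff[THEN iffD1])
   thus False using \<open>p \<in> params\<close> by(auto simp:params_def)
  qed
  thus ?thesis by blast
 qed
 hence "hyp ` B = (\<Union>e\<in>Basis Un uminus ` Basis. hyp ` (B Int W e))"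
  by(metis image_UN)
 also have "... : sets (borel_of hyperplane_topology)"
  using D by(intro sets.finite_UN) auto
 finally show ?thesis .
qed

definition num_points :: "'b set => ennreal" where "num_points A = emeasure (count_space UNIV) A"

lemma num_points_finite: "finite A ==> num_points A = of_nat (card A)"
 by(simp add:num_points_def)

lemma num_points_UN_disjoint: "disjoint_family A ==> num_points (\<Union>i. A i) = (\<Sum>i. num_points (A i))"
 unfolding num_points_def by(rule suminf_emeasure[symmetric]) auto

section \<open>The intensity measure and its lift to the double cover\<close>

locale hyperplane_process =
 fixes M :: "'w measure" and X :: "'w => 'a::euclidean_space set set" and \<gamma> :: real and \<phi> :: "'a measure"
 assumes poisson: "poisson_hyperplane_process M X"
  and direction: "has_intensity_and_direction M X \<gamma> \<phi>"
begin

lemma prob_space_M: "prob_space M" using poisson by(simp add:poisson_hyperplane_process_def)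
sublocale M: prob_space M by(rule prob_space_M)
sublocale directional \<phi>
 by(rule directional.intro) (use direction in \<open>auto simp: has_intensity_and_direction_def\<close>)

lemma gamma_pos: "0 < \<gamma>" using direction by(simp add:has_intensity_and_direction_def)

lemma configuration:
 assumes "w : space M"
 shows "X w : configurations"
proof -
 have "X : measurable M configuration_space"
  using poisson by(simp add:poisson_hyperplane_process_def)
 moreover have "space (configuration_space :: 'a set set measure) = configurations"
  by(simp add:configuration_space_def space_measure_of_conv)
 ultimately show ?thesis using measurable_space[of X M configuration_space w] assms by simp
qed

lemma measurable_count_on:
 assumes "A : sets (borel_of hyperplane_topology)"
 shows "(%w. num_points (X w Int A)) : borel_measurable M"
proof(rule measurableI)
 fix R :: "ennreal set" assume R: "R : sets borel"
 have X: "X : measurable M configuration_space"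
  using poisson by(simp add:poisson_hyperplane_process_def)
 have "{\<eta> : configurations. count_on \<eta> A : R} : sets configuration_space"
  unfolding configuration_space_def using assms R
  by(subst sets_measure_of) (auto intro!:sigma_sets.Basic)
 from measurable_sets[OF X this] show "(%w. num_points (X w Int A)) -` R Int space M : sets M"
  by(rule back_subst[of "%S. S : sets M"]) (auto simp:configuration num_points_def)
qed simp

text \<open>The intensity is declared through \<open>measure_of\<close>, so its values are available
  only once the mean count is shown to be countably additive.\<close>

lemma emeasure_intensity:
 assumes "A : sets (borel_of hyperplane_topology)"
 shows "emeasure (intensity_measure M X) A = (NN w. num_points (X w Int A) \<partial>M)"
 unfolding intensity_measure_def num_points_def[symmetric]
proof(rule emeasure_measure_of_sigma)
 have sp: "space (borel_of hyperplane_topology) = (hyperplanes :: 'a set set)"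
  by(simp add:space_borel_of topspace_hyperplane_topology)
 show "sigma_algebra hyperplanes (sets (borel_of (hyperplane_topology :: 'a set topology)))"
  unfolding sp[symmetric] by(rule sets.sigma_algebra_axioms)
 show "positive (sets (borel_of hyperplane_topology)) (%A. NN w. num_points (X w Int A) \<partial>M)"
  by(simp add:positive_def num_points_def)
 show "countably_additive (sets (borel_of hyperplane_topology)) (%A. NN w. num_points (X w Int A) \<partial>M)"
 proof(rule countably_additiveI)
  fix A :: "nat => 'a set set"
  assume A: "range A <= sets (borel_of hyperplane_topology)" "disjoint_family A"
  have "(\<Sum>i. NN w. num_points (X w Int A i) \<partial>M) = (NN w. (\<Sum>i. num_points (X w Int A i)) \<partial>M)"
   using A(1) by(intro nn_integral_suminf[symmetric] measurable_count_on) auto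
  also have "... = (NN w. num_points (X w Int \<Union>(range A)) \<partial>M)"
  proof(rule nn_integral_cong)
   fix w
   have "disjoint_family (%i. X w Int A i)" using A(2) by(auto simp:disjoint_family_on_def)
   from num_points_UN_disjoint[OF this]
   show "(\<Sum>i. num_points (X w Int A i)) = num_points (X w Int \<Union>(range A))" by simp
  qed
  finally show "(\<Sum>i. NN w. num_points (X w Int A i) \<partial>M) = (NN w. num_points (X w Int \<Union>(range A)) \<partial>M)" .
 qed
qed (use assms in auto)

text \<open>On sets where \<open>hyp\<close> is injective this product measure corresponds to the
  intensity measure, up to the factor \<open>2 * \<gamma>\<close>.\<close>

definition E :: "('a \<times> real) measure" where "E = \<phi> \<Otimes>\<^sub>M lborel"

lemma space_E: "space E = params"
 by(simp add:E_def space_pair_measure space_phi params_def)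

lemma measurable_E_borel [measurable]: "(%x. x) : measurable E borel"
 unfolding E_def borel_prod[symmetric]
proof(rule measurable_pair)
 show "fst \<circ> (%x. x) : measurable (\<phi> \<Otimes>\<^sub>M lborel) borel"
  using measurable_compose[OF measurable_fst measurable_phi_borel] by(simp add:comp_def)
 show "snd \<circ> (%x. x) : measurable (\<phi> \<Otimes>\<^sub>M lborel) borel" by(simp add:comp_def)
qed

lemma sets_E: "A : sets E <-> A : sets borel & A <= params"
proof
 assume A: "A : sets E"
 have 1: "(%x. x) : measurable (restrict_space borel params) E"
  unfolding E_def
 proof(rule measurable_pair)
  have "fst : measurable (restrict_space borel params) (restrict_space borel (sphere (0::'a) 1))"
   by(intro measurable_restrict_space3) (auto simp:params_def borel_prod[symmetric])
  thus "fst \<circ> (%x. x) : measurable (restrict_space borel params) \<phi>"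
   using measurable_cong_sets[OF refl sets_phi] by(auto simp:comp_def)
  have "snd : measurable (restrict_space borel (params :: ('a \<times> real) set)) borel"
   by(intro measurable_restrict_space1) (auto simp:borel_prod[symmetric])
  thus "snd \<circ> (%x. x) : measurable (restrict_space borel (params :: ('a \<times> real) set)) lborel"
   by(auto simp:comp_def)
 qed
 have "A Int params : sets (restrict_space borel params)"
  using measurable_sets[OF 1 A] by(simp add:space_restrict_space)
 moreover have "A <= params" using sets.sets_into_space[OF A] space_E by simp
 ultimately show "A : sets borel & A <= params"
  using borel_closed[OF closed_params] by(subst (asm) sets_restrict_space_iff) (auto simp:Int_absorb2)
next
 assume A: "A : sets borel & A <= params"
 have "(%x. x) : measurable E borel" by measurable
 from measurable_sets[OF this, of A] A show "A : sets E" by(simp add:space_E Int_absorb2)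
qed

sublocale E: sigma_finite_measure E
 unfolding E_def
 by(intro sigma_finite_pair_measure \<phi>.sigma_finite_measure_axioms sigma_finite_lborel)

text \<open>The parametrised integral meets a hyperplane of the image twice, at its parameter in
  \<open>B\<close> and at the antipode. Evenness of \<phi> and reflection of the line make the two
  contributions equal, hence the factor 2.\<close>

lemma intensity_hyp_image:
 assumes B: "B : sets E" and inj: "inj_on hyp B"
 shows "emeasure (intensity_measure M X) (hyp ` B) = ennreal (2 * \<gamma>) * emeasure E B"
proof -
 have B': "B : sets borel" "B <= params" using B by(auto simp:sets_E)
 have H: "hyp ` B : sets (borel_of hyperplane_topology)" by(rule hyp_image_measurable[OF B'])
 have sI: "sets (intensity_measure M X) = sets (borel_of hyperplane_topology)"
  unfolding intensity_measure_def
  using sets.sets_measure_of_eq[of "borel_of hyperplane_topology"]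
  by(simp add:space_borel_of topspace_hyperplane_topology)
 have "emeasure (intensity_measure M X) (hyp ` B) = (NN H. indicator (hyp ` B) H \<partial>intensity_measure M X)"
  using H sI by simp
 also have "... = ennreal \<gamma> * (NN u. (NN \<tau>. indicator (hyp ` B) (hyperplane u \<tau>) \<partial>lborel) \<partial>\<phi>)"
  using direction H by(simp add:has_intensity_and_direction_def)
 also have "(NN u. (NN \<tau>. indicator (hyp ` B) (hyperplane u \<tau>) \<partial>lborel) \<partial>\<phi>) =
  (NN u. (NN \<tau>. indicator B (u, \<tau>) + indicator B (- u, - \<tau>) \<partial>lborel) \<partial>\<phi>)"
 proof(intro nn_integral_cong)
  fix u \<tau> assume "u : space \<phi>"
  hence p: "(u, \<tau>) : params" by(simp add:space_phi params_def)
  have "hyp (u, \<tau>) : hyp ` B <-> (u, \<tau>) : B | - (u, \<tau>) : B"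
  proof
   assume "hyp (u, \<tau>) : hyp ` B"
   then obtain p' where p': "p' : B" "hyp (u, \<tau>) = hyp p'" by blast
   hence "p' = (u, \<tau>) | p' = - (u, \<tau>)" using B'(2) hyp_eq_iff[OF p, of p'] by blast
   thus "(u, \<tau>) : B | - (u, \<tau>) : B" using p' by blast
  next
   assume "(u, \<tau>) : B | - (u, \<tau>) : B"
   thus "hyp (u, \<tau>) : hyp ` B"
   proof
    assume "- (u, \<tau>) : B"
    hence "hyp (- (u, \<tau>)) : hyp ` B" by(rule imageI)
    thus ?thesis by(simp only:hyp_uminus)
   qed simp
  qed
  moreover have "~ ((u, \<tau>) : B & - (u, \<tau>) : B)"
  proof
   assume "(u, \<tau>) : B & - (u, \<tau>) : B"
   hence "(u, \<tau>) = - (u, \<tau>)" by(intro inj_onD[OF inj]) (auto simp del:uminus_Pair)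
   thus False using params_neq_uminus[OF p] by blast
  qed
  ultimately show "indicator (hyp ` B) (hyperplane u \<tau>) = (indicator B (u, \<tau>) + indicator B (- u, - \<tau>) :: ennreal)"
   by(auto simp:hyp_def indicator_def)
 qed
 also have "... = (NN u. (NN \<tau>. indicator B (u, \<tau>) \<partial>lborel) + (NN \<tau>. indicator B (- u, \<tau>) \<partial>lborel) \<partial>\<phi>)"
 proof(intro nn_integral_cong)
  fix u
  have [measurable]: "Measurable.pred borel (%\<tau>. (v, \<tau>) : B)" for v
   using B'(1) by measurable
  have "(NN \<tau>. indicator B (u, \<tau>) + indicator B (- u, - \<tau>) \<partial>lborel) =
   (NN \<tau>. indicator B (u, \<tau>) \<partial>lborel) + (NN \<tau>. indicator B (- u, - \<tau>) \<partial>lborel)"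
   by(intro nn_integral_add) (auto simp:indicator_def)
  also have "(NN \<tau>. indicator B (- u, - \<tau>) \<partial>lborel) = (NN \<tau>. indicator B (- u, \<tau>) \<partial>lborel)"
   using nn_integral_real_affine[of "%\<tau>. indicator B (- u, \<tau>)" "-1" 0] by(simp add:indicator_def)
  finally show "(NN \<tau>. indicator B (u, \<tau>) + indicator B (- u, - \<tau>) \<partial>lborel) =
   (NN \<tau>. indicator B (u, \<tau>) \<partial>lborel) + (NN \<tau>. indicator B (- u, \<tau>) \<partial>lborel)" .
 qed
 also have "... = 2 * (NN u. (NN \<tau>. indicator B (u, \<tau>) \<partial>lborel) \<partial>\<phi>)"
 proof -
  have m: "(%u. NN \<tau>. indicator B (u, \<tau>) \<partial>lborel) : borel_measurable \<phi>"
   using B unfolding E_def by(intro lborel.borel_measurable_nn_integral) simp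
  have m': "(%u. NN \<tau>. indicator B (- u, \<tau>) \<partial>lborel) : borel_measurable \<phi>"
   by(rule measurable_compose[OF measurable_uminus_phi m])
  show ?thesis using phi_uminus[OF m] m m' by(simp add:nn_integral_add mult_2)
 qed
 also have "(NN u. (NN \<tau>. indicator B (u, \<tau>) \<partial>lborel) \<partial>\<phi>) = emeasure E B"
  using B unfolding E_def
  by(subst lborel.nn_integral_fst) auto
 finally show ?thesis
  using gamma_pos by(simp add:ennreal_mult mult.assoc mult.commute mult.left_commute)
qed

end

section \<open>Counting tuples of distinct hyperplanes\<close>

lemma num_points_PiE:
 assumes "finite I" "!!i. i : I ==> finite (S i)"
 shows "num_points (PiE I S) = (\<Prod>i\<in>I. num_points (S i))"
 using assms by(simp add:num_points_finite finite_PiE card_PiE)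

lemma num_points_image: "inj_on f A ==> finite A ==> num_points (f ` A) = num_points A"
 by(simp add:num_points_finite card_image)

lemma num_points_mono: "A <= B ==> num_points A <= num_points B"
 unfolding num_points_def by(rule emeasure_mono) auto

text \<open>Each hyperplane may enter with either of its two parameters, so n distinct hyperplanes
  in a given order give \<open>2 ^ n\<close> tuples; the intensity factor
  \<open>2 * \<gamma>\<close> per entry accounts for this.\<close>

definition tup :: "'i set => 'a::euclidean_space set set => ('i => 'a \<times> real) set" where
 "tup I \<eta> = {p : I \<rightarrow>\<^sub>E params. (ALL i:I. hyp (p i) : \<eta>) & inj_on (%i. hyp (p i)) I}"

context hyperplane_process
begin

definition lift :: "'w => ('a \<times> real) set" where "lift w = {x : params. hyp x : X w}"

text \<open>The foot point of a hyperplane with bounded parameter lies in a fixed ball, so local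
  finiteness applies; each hyperplane has at most two parameters.\<close>

lemma finite_lift_bounded:
 assumes "w : space M" "bounded A"
 shows "finite (lift w Int A)"
proof -
 obtain R where R: "!!x. x : A ==> norm x <= R" using assms(2) by(auto simp:bounded_iff)
 define Hs where "Hs = {H : X w. H Int cball 0 R ~= {}}"
 have "finite Hs" using configuration[OF assms(1)] by(auto simp:configurations_def Hs_def)
 have h: "hyp x : Hs" if "x : lift w Int A" for x
 proof -
  have x: "x : params" "hyp x : X w" "norm x <= R" using that R by(auto simp:lift_def)
  have "\<bar>snd x\<bar> <= norm x" using norm_snd_le[of "snd x" "fst x"] by simp
  moreover have "inner (fst x) (fst x) = 1" using x(1) by(auto simp:params_def norm_eq_1)
  ultimately have "snd x *R fst x : hyp x Int cball 0 R"
   using x by(auto simp:hyp_def hyperplane_def params_def)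
  thus ?thesis using x(2) by(auto simp:Hs_def)
 qed
 have "finite {x : lift w Int A. hyp x = H}" for H
 proof(cases "EX y. y : lift w Int A & hyp y = H")
  case True
  then obtain y where y: "y : lift w" "hyp y = H" by blast
  have "{x : lift w Int A. hyp x = H} <= {y, - y}"
  proof
   fix x assume "x : {x : lift w Int A. hyp x = H}"
   hence "hyp y = hyp x" "x : params" "y : params" using y by(auto simp:lift_def)
   thus "x : {y, - y}" using hyp_eq_iff by blast
  qed
  thus ?thesis by(rule finite_subset) simp
 next
  case False
  hence "{x : lift w Int A. hyp x = H} = {}" by blast
  thus ?thesis by(simp only:finite.emptyI)
 qed
 hence "finite (\<Union>H\<in>Hs. {x : lift w Int A. hyp x = H})" using \<open>finite Hs\<close> by blast
 thus ?thesis by(rule finite_subset[rotated]) (use h in blast)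
qed

lemma emeasure_E_bounded:
 assumes "A : sets E" "bounded A"
 shows "emeasure E A < \<infinity>"
proof -
 obtain R where R: "!!x. x : A ==> norm x <= R" using assms(2) by(auto simp:bounded_iff)
 have "A <= space \<phi> \<times> {-R..R}"
 proof
  fix x assume x: "x : A"
  have "x : params" using x assms(1) by(auto simp:sets_E)
  moreover have "\<bar>snd x\<bar> <= R" using norm_snd_le[of "snd x" "fst x"] R[OF x] by simp
  ultimately show "x : space \<phi> \<times> {-R..R}" by(auto simp:params_def space_phi mem_Times_iff)
 qed
 hence "emeasure E A <= emeasure E (space \<phi> \<times> {-R..R})"
  by(rule emeasure_mono) (simp add:E_def)
 also have "... = emeasure \<phi> (space \<phi>) * emeasure lborel {-R..R}"
  unfolding E_def by(intro lborel.emeasure_pair_measure_Times) auto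
 also have "... < \<infinity>" by(simp add:\<phi>.emeasure_space_1 ennreal_mult_less_top emeasure_lborel_Icc_eq)
 finally show ?thesis .
qed

abbreviation "EI I \<equiv> PiM I (%_. E)"

definition cnt :: "'i set => 'w => ('i => 'a \<times> real) set => ennreal" where
 "cnt I w B = num_points (tup I (X w) Int B)"

text \<open>Disjoint images of the sides exclude tuples with a repeated hyperplane and turn the
  number of tuples in the product into a product of independent counts. Boundedness keeps these
  counts and their means finite.\<close>

definition good_sides :: "'i set => ('i => ('a \<times> real) set) => bool" where
 "good_sides I V <-> (ALL i:I. V i : sets E & bounded (V i) & inj_on hyp (V i)) &
   (ALL i:I. ALL j:I. i ~= j --> hyp ` V i Int hyp ` V j = {})"

lemma good_sides_Int:
 assumes "good_sides I V" "!!i. i : I ==> A i : sets E"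
 shows "good_sides I (%i. A i Int V i)"
 using assms unfolding good_sides_def
 by(auto intro:bounded_Int inj_on_subset) blast

lemma cnt_rectangle:
 assumes "finite I" "good_sides I V" "w : space M"
 shows "cnt I w (PiE I V) = (\<Prod>i\<in>I. num_points (X w Int hyp ` V i))"
  and "cnt I w (PiE I V) < \<infinity>"
proof -
 have fin: "finite (lift w Int V i)" if "i : I" for i
  using assms that by(intro finite_lift_bounded) (auto simp:good_sides_def)
 have par: "V i <= params" if "i : I" for i
  using assms(2) that by(auto simp:good_sides_def sets_E)
 have "tup I (X w) Int PiE I V = PiE I (%i. lift w Int V i)"
 proof(rule equalityI; rule subsetI)
  fix p assume "p : tup I (X w) Int PiE I V"
  thus "p : PiE I (%i. lift w Int V i)"
   by(auto simp:tup_def lift_def PiE_iff)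
 next
  fix p assume p: "p : PiE I (%i. lift w Int V i)"
  hence pi: "p i : lift w" "p i : V i" if "i : I" for i using that by(auto simp:PiE_iff)
  have "inj_on (%i. hyp (p i)) I"
  proof(rule inj_onI, rule ccontr)
   fix i j assume ij: "i : I" "j : I" "hyp (p i) = hyp (p j)" "i ~= j"
   hence "hyp (p i) : hyp ` V i Int hyp ` V j" using pi by auto
   thus False using assms(2) ij unfolding good_sides_def by blast
  qed
  thus "p : tup I (X w) Int PiE I V" using p pi by(auto simp:tup_def lift_def PiE_iff)
 qed
 hence "cnt I w (PiE I V) = (\<Prod>i\<in>I. num_points (lift w Int V i))"
  using fin assms(1) by(simp add:cnt_def num_points_PiE)
 also have "... = (\<Prod>i\<in>I. num_points (X w Int hyp ` V i))"
 proof(rule prod.cong[OF refl])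
  fix i assume i: "i : I"
  have "X w Int hyp ` V i = hyp ` (lift w Int V i)" using par[OF i] by(auto simp:lift_def)
  moreover have "inj_on hyp (lift w Int V i)"
   using assms(2) i by(auto simp:good_sides_def intro:inj_on_subset)
  ultimately show "num_points (lift w Int V i) = num_points (X w Int hyp ` V i)"
   using fin[OF i] by(simp add:num_points_image)
 qed
 finally show "cnt I w (PiE I V) = (\<Prod>i\<in>I. num_points (X w Int hyp ` V i))" .
 have "(\<Prod>i\<in>I. num_points (lift w Int V i)) = of_nat (\<Prod>i\<in>I. card (lift w Int V i))"
  using fin by(simp add:num_points_finite)
 hence "(\<Prod>i\<in>I. num_points (lift w Int V i)) < \<infinity>"
  by(simp only:infinity_ennreal_def of_nat_less_top)
 thus "cnt I w (PiE I V) < \<infinity>"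
  using \<open>cnt I w (PiE I V) = (\<Prod>i\<in>I. num_points (lift w \<inter> V i))\<close> by simp
qed

lemma sets_hyp_image: "V : sets E ==> hyp ` V : sets (borel_of hyperplane_topology)"
 by(intro hyp_image_measurable) (auto simp:sets_E)

sublocale EI: product_sigma_finite "%_. E" ..

lemma cnt_rectangle_integral:
 assumes "finite I" "good_sides I V"
 shows "(%w. cnt I w (PiE I V)) : borel_measurable M"
  and "(NN w. cnt I w (PiE I V) \<partial>M) = ennreal (2 * \<gamma>) ^ card I * emeasure (EI I) (PiE I V)"
proof -
 have V: "V i : sets E" "inj_on hyp (V i)" if "i : I" for i
  using assms(2) that by(auto simp:good_sides_def)
 have m: "(%w. num_points (X w Int hyp ` V i)) : borel_measurable M" if "i : I" for i
  using V[OF that] by(intro measurable_count_on sets_hyp_image)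
 have "(%w. \<Prod>i\<in>I. num_points (X w Int hyp ` V i)) : borel_measurable M"
  using m by(intro borel_measurable_prod_ennreal) auto
 thus "(%w. cnt I w (PiE I V)) : borel_measurable M"
  by(subst measurable_cong[OF cnt_rectangle(1)[OF assms]]) auto
 have int: "(NN w. num_points (X w Int hyp ` V i) \<partial>M) = ennreal (2 * \<gamma>) * emeasure E (V i)" if "i : I" for i
  using intensity_hyp_image[OF V[OF that]] emeasure_intensity[OF sets_hyp_image[OF V(1)[OF that]]] by simp
 have "(NN w. cnt I w (PiE I V) \<partial>M) = (NN w. (\<Prod>i\<in>I. num_points (X w Int hyp ` V i)) \<partial>M)"
  by(intro nn_integral_cong cnt_rectangle(1) assms)
 also have "... = (\<Prod>i\<in>I. (NN w. num_points (X w Int hyp ` V i) \<partial>M))"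
 \<comment> \<open>Independence is available for a set of Borel sets, not for a family: several
   empty sides would collapse to one element of that set, so they are treated first.\<close>
 proof(cases "EX i:I. V i = {}")
  case True
  then obtain i where i: "i : I" "V i = {}" by blast
  hence 0: "(\<Prod>i\<in>I. num_points (X w Int hyp ` V i)) = 0" for w
   using assms(1) by(intro prod_zero) (auto simp:num_points_def intro!:bexI[of _ i])
  have 1: "(\<Prod>i\<in>I. (NN w. num_points (X w Int hyp ` V i) \<partial>M)) = 0"
   using assms(1) i by(intro prod_zero) (auto simp:num_points_def intro!:bexI[of _ i])
  show ?thesis unfolding 0 1 by simp
 next
  case False
  define \<A> where "\<A> = (%i. hyp ` V i) ` I"
  have disj: "hyp ` V i Int hyp ` V j = {}" if "i : I" "j : I" "i ~= j" for i j
   using assms(2) that unfolding good_sides_def by blast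
  have inj: "inj_on (%i. hyp ` V i) I"
  proof(rule inj_onI, rule ccontr)
   fix i j assume ij: "i : I" "j : I" "hyp ` V i = hyp ` V j" "i ~= j"
   hence "hyp ` V i = {}" using disj[of i j] by simp
   thus False using False ij by simp
  qed
  have d: "disjoint \<A>"
   unfolding \<A>_def disjoint_def using disj by blast
  have s: "\<A> <= sets (borel_of hyperplane_topology)" unfolding \<A>_def using V(1) sets_hyp_image by blast
  have f: "finite \<A>" unfolding \<A>_def using assms(1) by simp
  have "M.indep_vars (%_. borel) (%A w. num_points (X w Int A)) \<A>"
   using poisson d s f unfolding poisson_hyperplane_process_def num_points_def by blast
  hence "(NN w. (\<Prod>A\<in>\<A>. num_points (X w Int A)) \<partial>M) = (\<Prod>A\<in>\<A>. NN w. num_points (X w Int A) \<partial>M)"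
   by(intro M.indep_vars_nn_integral f) auto
  thus ?thesis unfolding \<A>_def by(simp add:prod.reindex[OF inj])
 qed
 also have "... = (\<Prod>i\<in>I. ennreal (2 * \<gamma>) * emeasure E (V i))"
  by(intro prod.cong refl int)
 also have "... = ennreal (2 * \<gamma>) ^ card I * emeasure (EI I) (PiE I V)"
  using V(1) by(simp add:prod.distrib EI.emeasure_PiM[OF assms(1)])
 finally show "(NN w. cnt I w (PiE I V) \<partial>M) = ennreal (2 * \<gamma>) ^ card I * emeasure (EI I) (PiE I V)" .
qed

definition intensity_set :: "'i set => ('i => 'a \<times> real) set => bool" where
 "intensity_set I B <-> (%w. cnt I w B) : borel_measurable M &
   (NN w. cnt I w B \<partial>M) = ennreal (2 * \<gamma>) ^ card I * emeasure (EI I) B"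

lemma cnt_Diff:
 assumes "A <= B" "cnt I w A < \<infinity>"
 shows "cnt I w (B - A) = cnt I w B - cnt I w A"
proof -
 have eq: "tup I (X w) Int (B - A) = (tup I (X w) Int B) - (tup I (X w) Int A)" by blast
 show ?thesis
  unfolding cnt_def eq num_points_def
  by(rule emeasure_Diff) (use assms in \<open>auto simp: cnt_def num_points_def\<close>)
qed

lemma cnt_mono: "A <= B ==> cnt I w A <= cnt I w B"
 unfolding cnt_def by(rule num_points_mono) auto

lemma cnt_UN_disjoint:
 assumes "disjoint_family A"
 shows "cnt I w (\<Union>i. A i) = (\<Sum>i. cnt I w (A i))"
proof -
 have "disjoint_family (%i. tup I (X w) Int A i)" using assms by(auto simp:disjoint_family_on_def)
 from num_points_UN_disjoint[OF this] show ?thesis by(simp add:cnt_def)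
qed

lemma intensity_set_UN_disjoint:
 assumes "disjoint_family A" "!!i::nat. intensity_set I (A i)" "!!i. A i : sets (EI I)"
 shows "intensity_set I (\<Union>i. A i)"
proof -
 have [measurable]: "(%w. cnt I w (A i)) : borel_measurable M" for i
  using assms(2) by(simp add:intensity_set_def)
 have "(NN w. cnt I w (\<Union>i. A i) \<partial>M) = (\<Sum>i. NN w. cnt I w (A i) \<partial>M)"
  by(simp add:cnt_UN_disjoint[OF assms(1)] nn_integral_suminf)
 also have "... = (\<Sum>i. ennreal (2 * \<gamma>) ^ card I * emeasure (EI I) (A i))"
  using assms(2) by(simp add:intensity_set_def)
 also have "... = ennreal (2 * \<gamma>) ^ card I * emeasure (EI I) (\<Union>i. A i)"
  using assms by(simp add:suminf_emeasure image_subset_iff)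
 finally show ?thesis by(simp add:intensity_set_def cnt_UN_disjoint[OF assms(1)])
qed

text \<open>A Dynkin argument. Complements require the subtraction of counts and of means, which is
  legitimate inside a rectangle because both are finite there.\<close>

lemma intensity_set_rectangle_Int:
 assumes I: "finite I" and V: "good_sides I V" and B: "B : sets (EI I)"
 shows "intensity_set I (B Int PiE I V)"
proof -
 let ?R = "PiE I V"
 have R: "?R : sets (EI I)" using V I by(intro sets_PiM_I_finite) (auto simp:good_sides_def)
 have fin: "emeasure (EI I) ?R < \<infinity>"
  using V I emeasure_E_bounded
  by(subst EI.emeasure_PiM) (auto simp:good_sides_def less_top[symmetric] ennreal_prod_eq_top)
 have finc: "cnt I w (A Int ?R) < \<infinity>" if "w : space M" for w A
  using cnt_mono[of "A Int ?R" ?R I w] cnt_rectangle(2)[OF I V that] by(meson Int_lower2 order.strict_trans1)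
 have iR: "intensity_set I ?R"
  unfolding intensity_set_def using cnt_rectangle_integral[OF I V] by blast
 have "B : sigma_sets (\<Pi>\<^sub>E i\<in>I. space E) (prod_algebra I (%_. E))" using B by(simp add:sets_PiM)
 with Int_stable_prod_algebra prod_algebra_sets_into_space show ?thesis
 proof(induction rule: sigma_sets_induct_disjoint)
  case (basic A)
  then obtain W where W: "A = PiE I W" "W : I \<rightarrow> sets E"
   unfolding prod_algebra_eq_finite[OF I] by blast
  have "A Int ?R = PiE I (%i. W i Int V i)" unfolding W by(rule PiE_Int)
  moreover have "good_sides I (%i. W i Int V i)" by(rule good_sides_Int[OF V]) (use W(2) in auto)
  ultimately show ?case unfolding intensity_set_def using cnt_rectangle_integral[OF I] by auto
 next
  case empty
  thus ?case by(simp add:intensity_set_def cnt_def num_points_def)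
 next
  case (compl A)
  have A: "A : sets (EI I)" using compl(1) by(simp add:sets_PiM)
  have RA: "((\<Pi>\<^sub>E i\<in>I. space E) - A) Int ?R = ?R - A Int ?R"
   using sets.sets_into_space[OF R] by(auto simp:space_PiM)
  have c: "cnt I w (?R - A Int ?R) = cnt I w ?R - cnt I w (A Int ?R)" if "w : space M" for w
   using finc[OF that] by(intro cnt_Diff) auto
  have [measurable]: "(%w. cnt I w ?R) : borel_measurable M" "(%w. cnt I w (A Int ?R)) : borel_measurable M"
   using iR compl(2) by(simp_all add:intensity_set_def)
  have fi: "(NN w. cnt I w (A Int ?R) \<partial>M) < \<infinity>"
  proof -
   have "emeasure (EI I) (A Int ?R) <= emeasure (EI I) ?R" by(intro emeasure_mono R) auto
   hence "emeasure (EI I) (A Int ?R) < \<infinity>" using fin by order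
   hence "ennreal (2 * \<gamma>) ^ card I * emeasure (EI I) (A Int ?R) < \<infinity>"
    by(simp add:ennreal_mult_less_top power_less_top_ennreal)
   thus ?thesis using compl(2) by(simp add:intensity_set_def)
  qed
  have "(NN w. cnt I w (?R - A Int ?R) \<partial>M) = (NN w. cnt I w ?R - cnt I w (A Int ?R) \<partial>M)"
   by(intro nn_integral_cong c)
  also have "... = (NN w. cnt I w ?R \<partial>M) - (NN w. cnt I w (A Int ?R) \<partial>M)"
   using fi by(intro nn_integral_diff) (auto intro!:AE_I2 cnt_mono)
  also have "... = ennreal (2 * \<gamma>) ^ card I * emeasure (EI I) ?R - ennreal (2 * \<gamma>) ^ card I * emeasure (EI I) (A Int ?R)"
   using iR compl(2) by(simp add:intensity_set_def)
  also have "... = ennreal (2 * \<gamma>) ^ card I * emeasure (EI I) (?R - A Int ?R)"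
  proof -
   have "ennreal (2 * \<gamma>) ^ card I ~= \<top>" by(simp add:power_eq_top_ennreal)
   moreover have "emeasure (EI I) (A Int ?R) <= emeasure (EI I) ?R" by(intro emeasure_mono R) auto
   moreover have "emeasure (EI I) (?R - A Int ?R) = emeasure (EI I) ?R - emeasure (EI I) (A Int ?R)"
    using A R fin calculation(2) by(intro emeasure_Diff) (auto simp:top_unique)
   ultimately show ?thesis by(simp add:ennreal_right_diff_distrib)
  qed
  finally have 1: "(NN w. cnt I w (?R - A Int ?R) \<partial>M) = ennreal (2 * \<gamma>) ^ card I * emeasure (EI I) (?R - A Int ?R)" .
  have 2: "(%w. cnt I w (?R - A Int ?R)) : borel_measurable M"
   by(subst measurable_cong[OF c]) auto
  show ?case unfolding intensity_set_def RA using 1 2 by blast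
 next
  case (union A)
  have "intensity_set I (\<Union>i. A i Int ?R)"
  proof(rule intensity_set_UN_disjoint)
   show "disjoint_family (%i. A i Int ?R)" using union(1) by(auto simp:disjoint_family_on_def)
   show "A i Int ?R : sets (EI I)" for i
   proof(rule sets.Int[OF _ R])
    show "A i : sets (EI I)" using union(2) by(auto simp:sets_PiM)
   qed
  qed (use union in auto)
  thus ?case by simp
 qed
qed

definition distinct_hyps :: "'i set => ('i => 'a \<times> real) set" where
 "distinct_hyps I = {p : I \<rightarrow>\<^sub>E params. inj_on (%i. hyp (p i)) I}"

text \<open>Around a tuple of distinct hyperplanes, take balls so small that no ball meets another
  one or any antipode of a ball. Centres from a countable dense set and radii
  \<open>1 / real (Suc m)\<close> leave only countably many products.\<close>

lemma good_sides_cover: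
 assumes I: "finite I"
 obtains R :: "nat => ('i => 'a \<times> real) set"
 where "!!n. R n = {} | (EX V. good_sides I V & R n = PiE I V)" "distinct_hyps I = (\<Union>n. R n)"
proof -
 obtain D :: "('a \<times> real) set" where D: "countable D" "!!S. open S ==> S ~= {} ==> EX x:D. x : S"
  using countable_dense_setE by blast
 define side where "side m c = (%i. ball (c i) (1 / real (Suc m)) Int params)" for m and c :: "'i => 'a \<times> real"
 define \<G> where "\<G> = insert {} {PiE I (side m c) | m c. c : PiE I (%_. D) & good_sides I (side m c)}"
 have "countable \<G>"
 proof -
  have "countable (PiE I (%_. D))" using I D(1) by(rule countable_PiE)
  hence "countable ((%(m::nat, c). PiE I (side m c)) ` (UNIV \<times> PiE I (%_. D)))" by blast
  moreover have "\<G> <= insert {} ((%(m, c). PiE I (side m c)) ` (UNIV \<times> PiE I (%_. D)))"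
   unfolding \<G>_def by auto
  ultimately show ?thesis by(meson countable_insert countable_subset)
 qed
 hence R: "range (from_nat_into \<G>) = \<G>" by(intro range_from_nat_into) (auto simp:\<G>_def)
 show ?thesis
 proof
  show "from_nat_into \<G> n = {} | (EX V. good_sides I V & from_nat_into \<G> n = PiE I V)" for n
  proof -
   have "from_nat_into \<G> n : \<G>" using R by blast
   thus ?thesis unfolding \<G>_def by blast
  qed
  show "distinct_hyps I = (\<Union>n. from_nat_into \<G> n)"
   unfolding R
  proof(rule equalityI; rule subsetI)
   fix p assume p: "p : distinct_hyps I"
   hence par: "p i : params" if "i : I" for i using that by(auto simp:distinct_hyps_def PiE_iff)
   \<comment> \<open>The second family includes the pairs with \<open>i = j\<close>: the distance
     from \<open>p i\<close> to \<open>- p i\<close> is what makes \<open>hyp\<close> injective on a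
     single side.\<close>
   define Q where "Q = (%(i, j). dist (p i) (p j)) ` {(i, j) : I \<times> I. i ~= j} Un (%(i, j). dist (p i) (- p j)) ` (I \<times> I)"
   have fQ: "finite Q" using I by(auto simp:Q_def intro:finite_subset[of _ "I \<times> I"])
   have pos: "0 < q" if "q : Q" for q
   proof -
    have "p i ~= p j" if "i : I" "j : I" "i ~= j" for i j
     using p that by(auto simp:distinct_hyps_def inj_on_def)
    moreover have "p i ~= - p j" if "i : I" "j : I" for i j
    proof
     assume eq: "p i = - p j"
     hence "hyp (p i) = hyp (p j)" by simp
     hence "i = j" using p that by(auto simp:distinct_hyps_def inj_on_def)
     thus False using eq params_neq_uminus[OF par[OF that(1)]] by simp
    qed
    ultimately show ?thesis using that by(auto simp:Q_def)
   qed
   obtain \<epsilon> where e: "0 < \<epsilon>" "!!q. q : Q ==> \<epsilon> <= q"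
   proof(rule that[of "Min (insert 1 Q)"])
    show "0 < Min (insert 1 Q)" using fQ pos by(subst Min_gr_iff) auto
    show "Min (insert 1 Q) <= q" if "q : Q" for q using fQ that by(intro Min_le) auto
   qed
   \<comment> \<open>Points of a side and \<open>p i\<close> are each within a quarter of \<epsilon>
     from the centre, hence within a half of each other. If two sides met, up to sign, two
     parameters at distance at least \<epsilon> would be closer than \<epsilon>.\<close>
   obtain m where m: "1 / real (Suc m) < \<epsilon> / 4" using nat_approx_posE[of "\<epsilon> / 4"] e(1) by auto
   have "EX x:D. x : ball (p i) (1 / real (Suc m))" for i by(rule D(2)) auto
   then obtain c0 where c0: "!!i. c0 i : D" "!!i. c0 i : ball (p i) (1 / real (Suc m))" by metis
   define c where "c = restrict c0 I"
   have c: "c : PiE I (%_. D)" "!!i. i : I ==> p i : side m c i"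
    using c0 par by(auto simp:c_def side_def dist_commute)
   have near: "dist y (p i) < \<epsilon> / 2" if "i : I" "y : side m c i" for i y
    using that c0(2)[of i] m dist_triangle[of y "p i" "c0 i"] by(auto simp:side_def c_def dist_commute)
   have nearm: "dist (- y) (- p i) < \<epsilon> / 2" if "i : I" "y : side m c i" for i y
    using near[OF that] by(simp add:dist_minus)
   have "good_sides I (side m c)"
    unfolding good_sides_def
   proof(intro conjI ballI impI)
    fix i assume i: "i : I"
    show "side m c i : sets E" by(auto simp:sets_E side_def borel_closed[OF closed_params])
    show "bounded (side m c i)" unfolding side_def by(intro bounded_Int) auto
    show "inj_on hyp (side m c i)"
    proof(rule inj_onI, rule ccontr)
     fix y z assume yz: "y : side m c i" "z : side m c i" "hyp y = hyp z" "y ~= z"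
     have "y : params" "z : params" using yz by(auto simp:side_def)
     hence "z = - y" using yz hyp_eq_iff by blast
     hence "dist (p i) (- p i) < \<epsilon>"
      using near[OF i yz(2)] nearm[OF i yz(1)] dist_triangle[of "p i" "- p i" z] by(simp add:dist_commute)
     moreover have "dist (p i) (- p i) : Q" using i by(auto simp:Q_def)
     ultimately show False using e(2) by fastforce
    qed
   next
    fix i j assume ij: "i : I" "j : I" "i ~= j"
    show "hyp ` side m c i Int hyp ` side m c j = {}"
    proof(rule ccontr)
     assume "hyp ` side m c i Int hyp ` side m c j ~= {}"
     then obtain y z where yz: "y : side m c i" "z : side m c j" "hyp y = hyp z" by(auto; blast)
     have "y : params" "z : params" using yz by(auto simp:side_def)
     then consider "z = y" | "z = - y" using yz hyp_eq_iff by blast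
     thus False
     proof cases
      case 1
      hence "dist (p i) (p j) < \<epsilon>"
       using near[OF ij(1) yz(1)] near[OF ij(2) yz(2)] dist_triangle[of "p i" "p j" z] by(simp add:dist_commute)
      moreover have "dist (p i) (p j) : Q" using ij by(auto simp:Q_def)
      ultimately show False using e(2) by fastforce
     next
      case 2
      hence "dist (- p i) (p j) < \<epsilon>"
       using nearm[OF ij(1) yz(1)] near[OF ij(2) yz(2)] dist_triangle[of "- p i" "p j" z] by(simp add:dist_commute)
      moreover have "dist (p j) (- p i) : Q" using ij by(auto simp:Q_def)
      ultimately show False using e(2) by(fastforce simp:dist_commute)
     qed
    qed
   qed
   hence "PiE I (side m c) : \<G>" unfolding \<G>_def using c(1) by blast
   moreover have "p : PiE I (side m c)" using c(2) p by(auto simp:distinct_hyps_def PiE_iff)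
   ultimately show "p : \<Union>\<G>" by blast
  next
   fix p assume "p : \<Union>\<G>"
   then obtain V where V: "good_sides I V" "p : PiE I V" unfolding \<G>_def by blast
   have "V i <= params" if "i : I" for i using V(1) that by(auto simp:good_sides_def sets_E)
   hence "p : I \<rightarrow>\<^sub>E params" using V(2) by(auto simp:PiE_iff)
   moreover have "inj_on (%i. hyp (p i)) I"
   proof(rule inj_onI, rule ccontr)
    fix i j assume ij: "i : I" "j : I" "hyp (p i) = hyp (p j)" "i ~= j"
    hence "hyp (p i) : hyp ` V i Int hyp ` V j" using V(2) by(auto simp:PiE_iff)
    thus False using V(1) ij unfolding good_sides_def by blast
   qed
   ultimately show "p : distinct_hyps I" by(simp add:distinct_hyps_def)
  qed
 qed
qed

text \<open>\<open>disjointed\<close> cuts the countable cover into disjoint pieces, each inside one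
  rectangle, and countable additivity puts them together.\<close>

lemma intensity_set_distinct:
 assumes I: "finite I" and B: "B : sets (EI I)"
 shows "intensity_set I (B Int distinct_hyps I)" "distinct_hyps I : sets (EI I)"
proof -
 obtain R :: "nat => _" where R: "!!n. R n = {} | (EX V. good_sides I V & R n = PiE I V)" "distinct_hyps I = (\<Union>n. R n)"
  by(rule good_sides_cover[OF I]) blast
 have Rs: "R n : sets (EI I)" for n
  using R(1)[of n] I by(auto simp:good_sides_def intro!:sets_PiM_I_finite)
 show D: "distinct_hyps I : sets (EI I)" unfolding R(2) using Rs by blast
 have i: "intensity_set I (C Int R n)" if "C : sets (EI I)" for C n
  using R(1)[of n] intensity_set_rectangle_Int[OF I _ that]
  by(auto simp:intensity_set_def cnt_def num_points_def)
 have d: "disjointed R n : sets (EI I)" for n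
  using sets.range_disjointed_sets[of R "EI I"] Rs by blast
 have "intensity_set I (\<Union>n. B Int disjointed R n)"
 proof(rule intensity_set_UN_disjoint)
  show "disjoint_family (%i. B Int disjointed R i)"
   using disjoint_family_disjointed[of R] by(auto simp:disjoint_family_on_def)
  show "B Int disjointed R n : sets (EI I)" for n using B d by blast
  show "intensity_set I (B Int disjointed R n)" for n
  proof -
   have "B Int disjointed R n = (B Int disjointed R n) Int R n" using disjointed_subset[of R n] by blast
   thus ?thesis using i[of "B Int disjointed R n" n] B d by simp
  qed
 qed
 moreover have "(\<Union>n. B Int disjointed R n) = B Int distinct_hyps I"
  unfolding R(2) UN_disjointed_eq[of R, symmetric] by blast
 ultimately show "intensity_set I (B Int distinct_hyps I)" by simp
qed

definition tuple_sum :: "'i set => 'w => (('i => 'a \<times> real) => ennreal) => ennreal" where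
 "tuple_sum I w f = (NN p. f p * indicator (tup I (X w)) p \<partial>count_space UNIV)"

lemma tup_subset: "tup I \<eta> <= distinct_hyps I"
 by(auto simp:tup_def distinct_hyps_def)

text \<open>The Campbell formula for the factorial moment measures of a Poisson process: the mean
  sum over tuples of distinct points is the integral against the product of the intensities.
  Indicators are settled by the sets above; the rest is induction over measurable functions.\<close>

theorem factorial_moment:
 fixes I :: "'i set"
 assumes I: "finite I" and f: "f : borel_measurable (EI I)"
 shows "(%w. tuple_sum I w f) : borel_measurable M &
  (NN w. tuple_sum I w f \<partial>M) =
   ennreal (2 * \<gamma>) ^ card I * (NN p. f p * indicator (distinct_hyps I) p \<partial>EI I)"
 using f
proof(induction rule: borel_measurable_induct)
 case (cong f g)
 have "tuple_sum I w f = tuple_sum I w g" for w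
  unfolding tuple_sum_def
 proof(rule nn_integral_cong)
  fix p
  show "f p * indicator (tup I (X w)) p = g p * indicator (tup I (X w)) p"
   using cong(3)[of p] tup_subset[of I "X w"]
   by(cases "p : tup I (X w)") (auto simp:space_PiM space_E distinct_hyps_def)
 qed
 moreover have "(NN p. f p * indicator (distinct_hyps I) p \<partial>EI I) = (NN p. g p * indicator (distinct_hyps I) p \<partial>EI I)"
  using cong(3) by(intro nn_integral_cong) simp
 ultimately show ?case using cong(4) by simp
next
 case (set A)
 have eq: "tuple_sum I w (indicator A) = cnt I w (A Int distinct_hyps I)" for w
 proof -
  have "tuple_sum I w (indicator A) = (NN p. indicator (tup I (X w) Int (A Int distinct_hyps I)) p \<partial>count_space UNIV)"
   unfolding tuple_sum_def using tup_subset[of I "X w"]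
   by(intro nn_integral_cong) (auto simp:indicator_def)
  thus ?thesis by(simp add:cnt_def num_points_def)
 qed
 have "(NN p. indicator A p * indicator (distinct_hyps I) p \<partial>EI I) = emeasure (EI I) (A Int distinct_hyps I)"
 proof -
  have "(NN p. indicator A p * indicator (distinct_hyps I) p \<partial>EI I) = (NN p. indicator (A Int distinct_hyps I) p \<partial>EI I)"
   by(intro nn_integral_cong) (simp add:indicator_inter_arith)
  also have "... = emeasure (EI I) (A Int distinct_hyps I)"
   by(intro nn_integral_indicator sets.Int set intensity_set_distinct(2)[OF I set])
  finally show ?thesis .
 qed
 thus ?case using intensity_set_distinct(1)[OF I set] unfolding eq intensity_set_def by simp
next
 case (mult u c)
 have eq: "tuple_sum I w (%x. c * u x) = c * tuple_sum I w u" for w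
  unfolding tuple_sum_def by(subst nn_integral_cmult[symmetric]) (auto simp:mult.assoc)
 have "(NN p. c * u p * indicator (distinct_hyps I) p \<partial>EI I) = c * (NN p. u p * indicator (distinct_hyps I) p \<partial>EI I)"
  using mult(2) intensity_set_distinct(2)[OF I sets.empty_sets]
  by(subst nn_integral_cmult[symmetric]) (auto simp:mult.assoc)
 thus ?case using mult(4) unfolding eq
  by(auto simp:nn_integral_cmult mult.left_commute)
next
 case (add u v)
 have eq: "tuple_sum I w (%x. v x + u x) = tuple_sum I w v + tuple_sum I w u" for w
  unfolding tuple_sum_def by(subst nn_integral_add[symmetric]) (auto simp:distrib_right)
 have "(NN p. (v p + u p) * indicator (distinct_hyps I) p \<partial>EI I) =
  (NN p. v p * indicator (distinct_hyps I) p \<partial>EI I) + (NN p. u p * indicator (distinct_hyps I) p \<partial>EI I)"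
  using add intensity_set_distinct(2)[OF I sets.empty_sets]
  by(subst nn_integral_add[symmetric]) (auto simp:distrib_right)
 thus ?case using add unfolding eq
  by(auto simp:nn_integral_add distrib_left)
next
 case (seq U)
 have inc: "incseq (%i p. U i p * indicator S p)" for S :: "('i => 'a \<times> real) set"
  using seq(3) by(auto simp:incseq_def le_fun_def intro!:mult_right_mono)
 have incU: "incseq U" using seq(3) .
 have eq: "tuple_sum I w (%x. SUP i. U i x) = (SUP i. tuple_sum I w (U i))" for w
  unfolding tuple_sum_def
  by(subst nn_integral_monotone_convergence_SUP[symmetric]) (auto simp:inc SUP_mult_right_ennreal)
 have "(NN p. (SUP i. U i p) * indicator (distinct_hyps I) p \<partial>EI I) =
  (SUP i. NN p. U i p * indicator (distinct_hyps I) p \<partial>EI I)"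
  using seq(1) intensity_set_distinct(2)[OF I sets.empty_sets]
  by(subst nn_integral_monotone_convergence_SUP[symmetric]) (auto simp:inc SUP_mult_right_ennreal)
 moreover have "(NN w. (SUP i. tuple_sum I w (U i)) \<partial>M) = (SUP i. NN w. tuple_sum I w (U i) \<partial>M)"
 proof(rule nn_integral_monotone_convergence_SUP)
  show "incseq (%i w. tuple_sum I w (U i))"
   using incU unfolding tuple_sum_def
   by(auto simp:incseq_def le_fun_def intro!:nn_integral_mono mult_right_mono)
  show "!!i. (%w. tuple_sum I w (U i)) : borel_measurable M" using seq by simp
 qed
 moreover have "(%w. tuple_sum I w (U i)) : borel_measurable M"
  "(NN w. tuple_sum I w (U i) \<partial>M) = ennreal (2 * \<gamma>) ^ card I * (NN p. U i p * indicator (distinct_hyps I) p \<partial>EI I)" for i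
  using seq by simp_all
 ultimately show ?case unfolding SUP_apply eq
  by(simp add:SUP_mult_left_ennreal)
qed

text \<open>Regrouping pairs of families into families of pairs preserves the product measure, as it
  does so on rectangles. It puts all normals outside and all distances inside, ready for the change
  of variables with fixed normals.\<close>

lemma nn_integral_EI:
 assumes I: "finite I" and f: "f : borel_measurable (EI I)"
 shows "(NN p. f p \<partial>EI I) =
  (NN u. (NN \<tau>. f (\<lambda>i\<in>I. (u i, \<tau> i)) \<partial>PiM I (%_. lborel)) \<partial>PiM I (%_. \<phi>))"
proof -
 interpret P: product_prob_space "%_. \<phi>" ..
 interpret L: product_sigma_finite "%_. lborel :: real measure" ..
 let ?P = "PiM I (%_. \<phi>)" and ?L = "PiM I (%_. lborel :: real measure)"
 let ?z = "%(u, \<tau>). \<lambda>i\<in>I. (u i, \<tau> i)"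
 interpret sL: sigma_finite_measure ?L by(rule L.sigma_finite[OF I])
 have z: "?z : measurable (?P \<Otimes>\<^sub>M ?L) (EI I)"
  unfolding case_prod_beta
  by(intro measurable_restrict) (unfold E_def, measurable)
 have "distr (?P \<Otimes>\<^sub>M ?L) (EI I) ?z = EI I"
 proof(rule EI.PiM_eqI[OF I])
  fix A assume A: "!!i. i : I ==> A i : sets E"
  have secm: "(%u. emeasure lborel (Pair u -` A i)) : borel_measurable \<phi>" if "i : I" for i
   using A[OF that] unfolding E_def by(rule lborel.measurable_emeasure_Pair)
  have sec: "Pair u -` A i : sets borel" if "i : I" for u i
   using sets_Pair1[of "A i" \<phi> "lborel :: real measure" u] A[OF that] by(simp add:E_def)
  have "PiE I A : sets (EI I)" using A I by(intro sets_PiM_I_finite) auto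
  hence "emeasure (distr (?P \<Otimes>\<^sub>M ?L) (EI I) ?z) (PiE I A) =
   (NN p. indicator (PiE I A) p \<partial>distr (?P \<Otimes>\<^sub>M ?L) (EI I) ?z)"
   by(intro nn_integral_indicator[symmetric]) simp
  also have "... = (NN x. indicator (PiE I A) (?z x) \<partial>(?P \<Otimes>\<^sub>M ?L))"
   using \<open>PiE I A \<in> sets (EI I)\<close> by(intro nn_integral_distr z) simp
  also have "... = (NN u. (NN \<tau>. indicator (PiE I A) (\<lambda>i\<in>I. (u i, \<tau> i)) \<partial>?L) \<partial>?P)"
   using z \<open>PiE I A \<in> sets (EI I)\<close>
   by(subst sL.nn_integral_fst[symmetric]) auto
  also have "... = (NN u. (\<Prod>i\<in>I. emeasure lborel (Pair (u i) -` A i)) \<partial>?P)"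
  proof(intro nn_integral_cong)
   fix u
   have "(NN \<tau>. indicator (PiE I A) (\<lambda>i\<in>I. (u i, \<tau> i)) \<partial>?L) = (NN \<tau>. indicator (PiE I (%i. Pair (u i) -` A i)) \<tau> \<partial>?L)"
    by(intro nn_integral_cong) (auto simp:indicator_def space_PiM PiE_iff)
   also have "... = emeasure ?L (PiE I (%i. Pair (u i) -` A i))"
    using sec I by(intro nn_integral_indicator sets_PiM_I_finite) auto
   also have "... = (\<Prod>i\<in>I. emeasure lborel (Pair (u i) -` A i))"
    using sec I by(intro L.emeasure_PiM) auto
   finally show "(NN \<tau>. indicator (PiE I A) (\<lambda>i\<in>I. (u i, \<tau> i)) \<partial>?L) = (\<Prod>i\<in>I. emeasure lborel (Pair (u i) -` A i))" .
  qed
  also have "... = (\<Prod>i\<in>I. NN u. emeasure lborel (Pair u -` A i) \<partial>\<phi>)"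
   using secm by(intro P.product_nn_integral_prod I) auto
  also have "... = (\<Prod>i\<in>I. emeasure E (A i))"
   using A unfolding E_def by(intro prod.cong refl lborel.emeasure_pair_measure_alt[symmetric]) auto
  finally show "emeasure (distr (?P \<Otimes>\<^sub>M ?L) (EI I) ?z) (PiE I A) = (\<Prod>i\<in>I. emeasure E (A i))" .
 qed simp
 hence "(NN p. f p \<partial>EI I) = (NN p. f p \<partial>distr (?P \<Otimes>\<^sub>M ?L) (EI I) ?z)" by simp
 also have "... = (NN x. f (?z x) \<partial>(?P \<Otimes>\<^sub>M ?L))" using f z by(intro nn_integral_distr) simp_all
 also have "... = (NN u. (NN \<tau>. f (\<lambda>i\<in>I. (u i, \<tau> i)) \<partial>?L) \<partial>?P)"
  using measurable_compose[OF z f] by(subst sL.nn_integral_fst[symmetric]) auto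
 finally show ?thesis .
qed

end

section \<open>Change of variables\<close>

text \<open>An index type with one element more than the dimension. The volume formula for linear
  images lives on \<open>real ^ 'n\<close> with a finite well-ordered \<open>'n\<close>, whereas
  \<open>Dk\<close> is the determinant of a matrix indexed by numbers.\<close>

typedef (overloaded) ('a::euclidean_space) idx = "{..<DIM('a)+1}"
 morphisms idx_nat nat_idx
 by auto

lemma bij_idx_nat: "bij_betw (idx_nat :: 'a::euclidean_space idx => nat) UNIV {..<DIM('a)+1}"
 unfolding bij_betw_def
proof
 show "inj (idx_nat :: 'a idx => nat)" by(simp add:inj_on_def idx_nat_inject)
 show "range (idx_nat :: 'a idx => nat) = {..<DIM('a)+1}"
  by(rule type_definition.Rep_range[OF type_definition_idx])
qed

lemma idx_nat_less: "idx_nat (i :: 'a::euclidean_space idx) < DIM('a) + 1"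
 using idx_nat[of i] by simp

instance idx :: (euclidean_space) finite
proof
 show "finite (UNIV :: 'a idx set)" using bij_betw_finite[OF bij_idx_nat] by simp
qed

instantiation idx :: (euclidean_space) wellorder
begin

definition less_eq_idx :: "'a idx => 'a idx => bool" where "i <= j <-> idx_nat i <= idx_nat j"
definition less_idx :: "'a idx => 'a idx => bool" where "i < j <-> idx_nat i < idx_nat j"

instance
proof
 fix P :: "'a idx => bool" and i :: "'a idx" assume "!!i. (!!j. j < i ==> P j) ==> P i"
 thus "P i" by(rule measure_induct_rule[where f = idx_nat]) (simp add:less_idx_def)
qed (auto simp:less_eq_idx_def less_idx_def idx_nat_inject)

end

text \<open>Both determinants are Leibniz sums, and a bijection of the index sets transports
  permutations without changing their sign.\<close>

lemma det_eq_det_vec: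
 fixes A :: "nat => nat => real"
 shows "Determinant.det (Matrix.mat (DIM('a::euclidean_space) + 1) (DIM('a) + 1) (%(i, j). A i j)) =
  Determinants.det (\<chi> i j. A (idx_nat (i :: 'a idx)) (idx_nat j))"
proof -
 let ?n = "DIM('a) + 1"
 let ?f = "idx_nat :: 'a idx => nat"
 have f: "bij_betw ?f UNIV {0..<?n}" using bij_idx_nat by(simp add:atLeast0LessThan)
 have inj: "inj ?f" using f by(simp add:bij_betw_def)
 \<comment> \<open>The form in which \<open>bij_betw_permutations\<close> delivers the transported
   permutation; it is identified with \<open>map_permutation\<close>, whose sign is known.\<close>
 let ?c = "%\<pi> x. if x : {0..<?n} then ?f (\<pi> (inv_into UNIV ?f x)) else x"
 have c: "?c \<pi> = map_permutation UNIV ?f \<pi>" for \<pi>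
  using f by(auto simp:map_permutation_def restrict_id_def bij_betw_def fun_eq_iff)
 have "Determinant.det (Matrix.mat ?n ?n (%(i, j). A i j)) =
  (\<Sum>p | p permutes {0..<?n}. of_int (sign p) * (\<Prod>i = 0..<?n. A i (p i)))"
  by(subst Determinant.det_def') (auto intro!:sum.cong prod.cong simp:permutes_in_image)
 also have "... = (\<Sum>p | p permutes (UNIV :: 'a idx set). of_int (sign (?c p)) * (\<Prod>i = 0..<?n. A i (?c p i)))"
  by(rule sum.reindex_bij_betw[OF bij_betw_permutations[OF f], symmetric])
 also have "... = (\<Sum>p | p permutes (UNIV :: 'a idx set). of_int (sign p) * (\<Prod>i\<in>UNIV. A (?f i) (?f (p i))))"
 proof(rule sum.cong[OF refl])
  fix p assume "p : {p. p permutes (UNIV :: 'a idx set)}"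
  hence p: "p permutes (UNIV :: 'a idx set)" by simp
  have "sign (?c p) = sign p" unfolding c by(rule sign_map_permutation[OF inj p]) simp
  moreover have "(\<Prod>i = 0..<?n. A i (?c p i)) = (\<Prod>i\<in>UNIV. A (?f i) (?c p (?f i)))"
   by(rule prod.reindex_bij_betw[OF f, symmetric])
  moreover have "(\<Prod>i\<in>UNIV. A (?f i) (?c p (?f i))) = (\<Prod>i\<in>UNIV. A (?f i) (?f (p i)))"
   using inj idx_nat_less[where 'a = 'a] by(intro prod.cong refl) (auto simp:inv_f_f)
  ultimately show "of_int (sign (?c p)) * (\<Prod>i = 0..<?n. A i (?c p i)) = of_int (sign p) * (\<Prod>i\<in>UNIV. A (?f i) (?f (p i)))"
   by simp
 qed
 finally show ?thesis by(simp add:Determinants.det_def)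
qed

lemma prod_Basis_cart:
 fixes x :: "real ^ 'n"
 shows "(\<Prod>b\<in>Basis. inner x b) = (\<Prod>i\<in>UNIV. x $ i)"
proof -
 have B: "Basis = (%i. axis i (1::real)) ` (UNIV :: 'n set)" by(auto simp:Basis_vec_def)
 have "inj (%i :: 'n. axis i (1::real))" by(auto simp:inj_on_def axis_eq_axis)
 thus ?thesis unfolding B by(simp add:prod.reindex inner_axis)
qed

lemma borel_measurable_vec_lambda:
 fixes f :: "'n::finite => 'b => real"
 assumes "!!i. f i : borel_measurable N"
 shows "(%x. \<chi> i. f i x) : borel_measurable N"
proof(subst borel_measurable_euclidean_space, intro ballI)
 fix b :: "real ^ 'n" assume "b : Basis"
 then obtain i where "b = axis i 1" by(auto simp:Basis_vec_def)
 thus "(%x. inner (\<chi> i. f i x) b) : borel_measurable N" using assms[of i] by(simp add:inner_axis)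
qed

lemma lborel_cart_eqI:
 fixes \<mu> :: "(real ^ 'n) measure"
 assumes s: "sets \<mu> = sets borel"
  and e: "!!l u :: real ^ 'n. (!!i. l $ i <= u $ i) ==>
   emeasure \<mu> (box l u) = ennreal (\<Prod>i\<in>UNIV. u $ i - l $ i)"
 shows "\<mu> = lborel"
proof(rule lborel_eqI[symmetric])
 fix l u :: "real ^ 'n" assume "!!b. b : Basis ==> inner l b <= inner u b"
 hence "l $ i <= u $ i" for i
  using axis_in_Basis_iff[of i "1::real"] by(metis Basis_real_def inner_axis inner_real_def mult.right_neutral singletonI)
 thus "emeasure \<mu> (box l u) = ennreal (prod ((\<bullet>) (u - l)) Basis)"
  using e prod_Basis_cart[of "u - l"] by simp
qed (rule s)

lemma mem_box_vec: "x : box (l :: real ^ 'n) u <-> (ALL i. l $ i < x $ i & x $ i < u $ i)"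
 by(auto simp:mem_box Basis_vec_def inner_axis)

text \<open>Boxes pull back to boxes with the same side lengths.\<close>

lemma distr_lborel_basis:
 fixes \<beta> :: "'n::finite => 'b::euclidean_space"
 assumes \<beta>: "bij_betw \<beta> UNIV Basis"
 shows "distr lborel borel (%x. \<chi> i. inner x (\<beta> i)) = (lborel :: (real ^ 'n) measure)"
proof(rule lborel_cart_eqI)
 have m: "(%x. \<chi> i. inner x (\<beta> i)) : borel_measurable (lborel :: 'b measure)"
  by(intro borel_measurable_vec_lambda) simp
 have inj: "inj \<beta>" and B: "\<beta> ` UNIV = Basis" using \<beta> by(auto simp:bij_betw_def)
 fix l u :: "real ^ 'n" assume le: "!!i. l $ i <= u $ i"
 let ?s = "%v :: real ^ 'n. \<Sum>j\<in>UNIV. (v $ j) *R \<beta> j"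
 have s: "inner (?s v) (\<beta> i) = v $ i" for v i
 proof -
  have "inner (?s v) (\<beta> i) = (\<Sum>j\<in>UNIV. v $ j * inner (\<beta> j) (\<beta> i))" by(simp add:inner_sum_left)
  also have "... = (\<Sum>j\<in>UNIV. if j = i then v $ j else 0)"
  proof(rule sum.cong[OF refl])
   fix j
   have "\<beta> i : Basis" "\<beta> j : Basis" using B by auto
   thus "v $ j * inner (\<beta> j) (\<beta> i) = (if j = i then v $ j else 0)" using inj by(simp add:inner_Basis inj_eq)
  qed
  finally show ?thesis by(simp add:sum.delta)
 qed
 have "(%x. \<chi> i. inner x (\<beta> i)) -` box l u Int space lborel = box (?s l) (?s u)"
  using s by(auto simp:mem_box_vec mem_box B[symmetric])
 hence "emeasure (distr lborel borel (%x. \<chi> i. inner x (\<beta> i))) (box l u) = emeasure lborel (box (?s l) (?s u))"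
  using m by(subst emeasure_distr) auto
 also have "... = ennreal (\<Prod>b\<in>Basis. inner (?s u - ?s l) b)"
  using le s by(subst emeasure_lborel_box) (auto simp:B[symmetric])
 also have "(\<Prod>b\<in>Basis. inner (?s u - ?s l) b) = (\<Prod>i\<in>UNIV. inner (?s u - ?s l) (\<beta> i))"
  by(simp only:B[symmetric] prod.reindex[OF inj] comp_def)
 also have "... = (\<Prod>i\<in>UNIV. u $ i - l $ i)" using s by(simp add:inner_diff_left)
 finally show "emeasure (distr lborel borel (%x. \<chi> i. inner x (\<beta> i))) (box l u) = ennreal (\<Prod>i\<in>UNIV. u $ i - l $ i)" .
qed simp

lemma distr_PiM_lborel:
 fixes h :: "'n::finite => nat"
 assumes h: "bij_betw h UNIV I"
 shows "distr (PiM I (%_. lborel)) borel (%\<tau>. \<chi> i. \<tau> (h i)) = (lborel :: (real ^ 'n) measure)"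
proof(rule lborel_cart_eqI)
 interpret L: product_sigma_finite "%_. lborel :: real measure" ..
 have I: "finite I" using bij_betw_finite[OF h] by simp
 have hI: "h i : I" for i using h by(auto simp:bij_betw_def)
 have m: "(%\<tau>. \<chi> i. \<tau> (h i)) : borel_measurable (PiM I (%_. lborel :: real measure))"
 proof(rule borel_measurable_vec_lambda)
  fix i show "(%\<tau>. \<tau> (h i)) : borel_measurable (PiM I (%_. lborel :: real measure))"
   using measurable_component_singleton[OF hI, where M = "%_. lborel :: real measure"] by simp
 qed
 fix l u :: "real ^ 'n" assume le: "!!i. l $ i <= u $ i"
 let ?g = "inv_into UNIV h"
 have g: "?g (h i) = i" for i using h by(simp add:bij_betw_def inv_f_f)
 have "(%\<tau>. \<chi> i. \<tau> (h i)) -` box l u Int space (PiM I (%_. lborel :: real measure)) =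
  PiE I (%j. {l $ ?g j<..<u $ ?g j})"
 proof -
  have "(ALL i. l $ i < \<tau> (h i) & \<tau> (h i) < u $ i) <-> (ALL j:I. l $ ?g j < \<tau> j & \<tau> j < u $ ?g j)" for \<tau>
   using h g by(auto simp:bij_betw_def)
  thus ?thesis by(auto simp:mem_box_vec space_PiM PiE_iff)
 qed
 hence "emeasure (distr (PiM I (%_. lborel)) borel (%\<tau>. \<chi> i. \<tau> (h i))) (box l u) =
  emeasure (PiM I (%_. lborel)) (PiE I (%j. {l $ ?g j<..<u $ ?g j}))"
  using m by(subst emeasure_distr) auto
 also have "... = (\<Prod>j\<in>I. emeasure lborel {l $ ?g j<..<u $ ?g j})"
  using I by(intro L.emeasure_PiM) auto
 also have "... = (\<Prod>j\<in>I. ennreal (u $ ?g j - l $ ?g j))" using le by simp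
 also have "... = (\<Prod>i\<in>UNIV. ennreal (u $ i - l $ i))"
  by(subst prod.reindex_bij_betw[OF h, symmetric]) (simp add:g)
 also have "... = ennreal (\<Prod>i\<in>UNIV. u $ i - l $ i)" using le by(intro prod_ennreal) simp
 finally show "emeasure (distr (PiM I (%_. lborel)) borel (%\<tau>. \<chi> i. \<tau> (h i))) (box l u) = ennreal (\<Prod>i\<in>UNIV. u $ i - l $ i)" .
qed simp

text \<open>By uniqueness on boxes it suffices that the preimage of a box, scaled by the
  determinant, has the volume of the box. This is the volume formula for linear images applied to
  the preimage.\<close>

lemma nn_integral_lborel_matrix:
 fixes A :: "((real, 'n::{finite, wellorder}) Finite_Cartesian_Product.vec, 'n) Finite_Cartesian_Product.vec"
 assumes A: "invertible A" and g: "g : borel_measurable borel"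
 shows "(NN y. g y \<partial>lborel) = ennreal \<bar>Determinants.det A\<bar> * (NN x. g (A *v x) \<partial>lborel)"
proof -
 have lin: "linear ((*v) A)" by simp
 have m: "(*v) A : borel_measurable (lborel :: (real, 'n) Finite_Cartesian_Product.vec measure)"
  using linear_continuous_on[OF linear_conv_bounded_linear[THEN iffD1, OF lin], of UNIV]
  by(simp add:borel_measurable_continuous_onI)
 have bij: "bij ((*v) A)" using A by(simp add:invertible_eq_bij)
 have "scale_measure (ennreal \<bar>Determinants.det A\<bar>) (distr lborel borel ((*v) A)) = lborel"
 proof(rule lborel_cart_eqI)
  fix l u :: "(real, 'n) Finite_Cartesian_Product.vec" assume le: "!!i. l $ i <= u $ i"
  let ?S = "(*v) A -` box l u"
  have im: "(*v) A ` ?S = box l u" using bij by(simp add:bij_is_surj surj_image_vimage_eq)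
  obtain B where B: "B ** A = Finite_Cartesian_Product.mat 1" "A ** B = Finite_Cartesian_Product.mat 1"
   using A unfolding invertible_def by blast
  \<comment> \<open>Written as an image under the inverse matrix, the preimage inherits Lebesgue
    measurability and finite volume from the box.\<close>
  have S_eq: "?S = (*v) B ` box l u"
  proof(rule equalityI; rule subsetI)
   fix x assume "x : ?S"
   hence "A *v x : box l u" by simp
   moreover have "x = B *v (A *v x)" using B by(simp add:matrix_vector_mul_assoc)
   ultimately show "x : (*v) B ` box l u" by(rule rev_image_eqI)
  qed (use B in \<open>auto simp: matrix_vector_mul_assoc\<close>)
  have Sm: "?S : lmeasurable" unfolding S_eq by(rule measurable_linear_image) auto
  have Sb: "?S : sets borel" using measurable_sets[OF m, of "box l u"] by simp
  have "measure lebesgue (box l u) = \<bar>Determinants.det A\<bar> * measure lebesgue ?S"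
   using measure_linear_image[OF lin Sm] unfolding im by simp
  hence meas: "measure lborel (box l u) = \<bar>Determinants.det A\<bar> * measure lborel ?S"
   using Sb by(simp add:measure_completion)
  have fin: "emeasure lborel ?S < \<infinity>" using Sm Sb by(simp add:fmeasurable_def emeasure_completion)
  have "emeasure (scale_measure (ennreal \<bar>Determinants.det A\<bar>) (distr lborel borel ((*v) A))) (box l u) =
   ennreal \<bar>Determinants.det A\<bar> * emeasure lborel ?S"
   using m by(simp add:emeasure_distr)
  also have "emeasure lborel ?S = ennreal (measure lborel ?S)" using fin by(simp add:emeasure_eq_ennreal_measure less_top[symmetric])
  also have "ennreal \<bar>Determinants.det A\<bar> * ennreal (measure lborel ?S) = ennreal (measure lborel (box l u))"
   unfolding meas by(simp add:ennreal_mult)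
  also have "... = emeasure lborel (box l u)"
   using emeasure_lborel_box_finite[of l u] by(simp add:emeasure_eq_ennreal_measure less_top[symmetric])
  also have "... = ennreal (\<Prod>b\<in>Basis. inner (u - l) b)"
   using le by(subst emeasure_lborel_box) (auto simp:Basis_vec_def inner_axis)
  finally show "emeasure (scale_measure (ennreal \<bar>Determinants.det A\<bar>) (distr lborel borel ((*v) A))) (box l u) =
   ennreal (\<Prod>i\<in>UNIV. u $ i - l $ i)" using prod_Basis_cart[of "u - l"] by simp
 qed simp
 hence "(NN y. g y \<partial>lborel) = (NN y. g y \<partial>scale_measure (ennreal \<bar>Determinants.det A\<bar>) (distr lborel borel ((*v) A)))" by simp
 also have "... = ennreal \<bar>Determinants.det A\<bar> * (NN x. g (A *v x) \<partial>lborel)"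
  using g m by(subst nn_integral_scale_measure) (auto simp:nn_integral_distr)
 finally show ?thesis .
qed

lemma basis_enum_bij: "bij_betw (basis_enum :: nat => 'a::euclidean_space) {..<DIM('a)} Basis"
proof -
 have "card {..<DIM('a)} = card (Basis :: 'a set)" by simp
 hence "EX e. bij_betw e {..<DIM('a)} (Basis :: 'a set)"
  by(intro finite_same_card_bij) auto
 thus ?thesis unfolding basis_enum_def by(rule someI_ex)
qed

text \<open>\<open>Dk\<close> with a free last column: the determinant with rows (u i, \<rho>
  i).\<close>

definition Dmat :: "(nat => 'a::euclidean_space) => (nat => real) => real" where
 "Dmat u \<rho> = \<bar>Determinant.det (Matrix.mat (DIM('a) + 1) (DIM('a) + 1) (%(i, j).
   if j < DIM('a) then inner (u (i + 1)) (basis_enum j) else \<rho> (i + 1)))\<bar>"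

text \<open>The distances depend on (z, r) through the matrix with rows (u i, \<rho> i), invertible
  because the rows are independent. The computation passes through \<open>real ^ 'a idx\<close>:
  \<open>U\<close> turns its vectors into families of distances, \<open>T\<close> gives the
  coordinates of (z, r), and the matrix acts in between.\<close>

theorem nn_integral_linear_change:
 fixes u :: "nat => 'a::euclidean_space" and \<rho> :: "nat => real"
 assumes ind: "indep_fam (%i. (u i, \<rho> i)) II('a)"
  and g: "g : borel_measurable (PiM II('a) (%_. lborel))"
 shows "Dmat u \<rho> > 0"
  and "(NN \<tau>. g \<tau> \<partial>PiM II('a) (%_. lborel)) =
   ennreal (Dmat u \<rho>) * (NN z. (NN r. g (\<lambda>i\<in>II('a). inner z (u i) + r * \<rho> i) \<partial>lborel) \<partial>lborel)"
proof -
 let ?I = "II('a)"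
 let ?f = "idx_nat :: 'a idx => nat"
 define h where "h i = ?f i + 1" for i
 have h: "bij_betw h UNIV ?I"
 proof -
  have "bij_betw Suc {..<DIM('a)+1} ?I"
   using bij_betw_imageI[of Suc "{..<DIM('a)+1}" ?I] image_Suc_lessThan[of "DIM('a) + 1"] by auto
  from bij_betw_trans[OF bij_idx_nat this] show ?thesis by(simp add:comp_def h_def[abs_def])
 qed
 \<comment> \<open>Enumerates the basis of the product space in the order of the matrix columns; the
   direction of the radius comes last.\<close>
 define \<beta> where "\<beta> i = (if ?f i < DIM('a) then (basis_enum (?f i) :: 'a, 0) else (0, 1::real))" for i
 have be: "basis_enum j : (Basis :: 'a set)" if "j < DIM('a)" for j
  using basis_enum_bij[where 'a = 'a] that by(auto simp:bij_betw_def)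
 have inj_be: "basis_enum i = (basis_enum j :: 'a) <-> i = j" if "i < DIM('a)" "j < DIM('a)" for i j
  using basis_enum_bij[where 'a = 'a] that by(auto simp:bij_betw_def inj_on_def)
 have \<beta>: "bij_betw \<beta> UNIV Basis"
 proof -
  have inj: "inj \<beta>"
  proof(rule injI)
   fix i j assume e: "\<beta> i = \<beta> j"
   have "?f i = ?f j"
    using e idx_nat_less[of i] idx_nat_less[of j] inj_be[of "?f i" "?f j"]
    by(auto simp:\<beta>_def split:if_splits)
   thus "i = j" by(simp add:idx_nat_inject)
  qed
  have "range \<beta> <= Basis" using be by(auto simp:\<beta>_def Basis_prod_def)
  moreover have "card (range \<beta>) = card (Basis :: ('a \<times> real) set)"
   using card_image[OF inj] bij_betw_same_card[OF bij_idx_nat[where 'a = 'a]] by simp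
  ultimately have "range \<beta> = Basis" by(intro card_subset_eq) auto
  thus ?thesis using inj by(simp add:bij_betw_def)
 qed
 define A :: "real ^ 'a idx ^ 'a idx" where
  "A = (\<chi> i j. (%i j. if j < DIM('a) then inner (u (i + 1)) (basis_enum j) else \<rho> (i + 1)) (?f i) (?f j))"
 have D: "Dmat u \<rho> = \<bar>Determinants.det A\<bar>"
  unfolding Dmat_def A_def by(subst det_eq_det_vec[where 'a = 'a]) simp
 define T where "T x = (\<chi> i. inner x (\<beta> i))" for x :: "'a \<times> real"
 have AT: "(A *v T x) $ i = inner x (u (h i), \<rho> (h i))" for x i
 proof -
  have A\<beta>: "A $ i $ j = inner (u (h i), \<rho> (h i)) (\<beta> j)" for j by(simp add:A_def \<beta>_def h_def)
  have "(A *v T x) $ i = (\<Sum>j\<in>UNIV. inner (u (h i), \<rho> (h i)) (\<beta> j) * inner x (\<beta> j))"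
   by(simp add:matrix_vector_mult_def A\<beta> T_def)
  also have "... = (\<Sum>b\<in>Basis. inner (u (h i), \<rho> (h i)) b * inner x b)"
   by(rule sum.reindex_bij_betw[OF \<beta>])
  also have "... = inner x (u (h i), \<rho> (h i))" by(subst (2) inner_commute) (rule euclidean_inner[symmetric])
  finally show ?thesis .
 qed
 have sp: "span ((%i. (u i, \<rho> i)) ` ?I) = UNIV" using ind by(intro indep_fam_span_UNIV) auto
 have "invertible A"
  unfolding invertible_left_inverse matrix_left_invertible_ker
 proof(intro allI impI)
  fix y assume y: "A *v y = 0"
  define x where "x = (\<Sum>j\<in>UNIV. (y $ j) *R \<beta> j)"
  have \<beta>\<beta>: "inner (\<beta> j) (\<beta> i) = (if j = i then 1 else 0)" for i j
  proof -
   have "\<beta> i : Basis" "\<beta> j : Basis" "inj \<beta>" using \<beta> by(auto simp:bij_betw_def)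
   thus ?thesis by(simp add:inner_Basis inj_eq)
  qed
  have "inner x (\<beta> i) = (\<Sum>j\<in>UNIV. if j = i then y $ j else 0)" for i
   unfolding x_def inner_sum_left inner_scaleR_left \<beta>\<beta> by(intro sum.cong) auto
  hence Tx: "T x = y" by(simp add:T_def Finite_Cartesian_Product.vec_eq_iff sum.delta)
  have "x = 0"
  proof(rule eq_of_inner_indep[OF sp])
   fix m assume "m : ?I"
   then obtain i where "m = h i" using h unfolding bij_betw_def by blast
   thus "inner x (u m, \<rho> m) = inner 0 (u m, \<rho> m)" using AT[of x i] y Tx by simp
  qed
  thus "y = 0" unfolding Tx[symmetric] by(simp add:T_def Finite_Cartesian_Product.vec_eq_iff)
 qed
 thus "Dmat u \<rho> > 0" unfolding D using invertible_det_nz[of A] by simp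
 define U where "U x = (\<lambda>m\<in>?I. x $ (inv_into UNIV h m))" for x :: "real ^ 'a idx"
 have hinv: "inv_into UNIV h (h i) = i" "m : ?I ==> h (inv_into UNIV h m) = m" for i m
  using h by(auto simp:bij_betw_def inv_f_f f_inv_into_f)
 have Um: "U : measurable borel (PiM ?I (%_. lborel))"
  unfolding U_def by(intro measurable_restrict) simp
 have gU: "(%x. g (U x)) : borel_measurable borel" by(rule measurable_compose[OF Um g])
 let ?W = "%\<tau>. \<chi> i. \<tau> (h i)"
 have Wm: "?W : borel_measurable (PiM ?I (%_. lborel :: real measure))"
 proof(rule borel_measurable_vec_lambda)
  fix i
  have "h i : ?I" using h by(auto simp:bij_betw_def)
  from measurable_component_singleton[OF this, of "%_. lborel :: real measure"]
  show "(%\<tau>. \<tau> (h i)) : borel_measurable (PiM ?I (%_. lborel :: real measure))" by simp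
 qed
 have "(NN \<tau>. g \<tau> \<partial>PiM ?I (%_. lborel)) = (NN \<tau>. g (U (?W \<tau>)) \<partial>PiM ?I (%_. lborel))"
 proof(intro nn_integral_cong arg_cong[where f = g])
  fix \<tau> assume "\<tau> : space (PiM ?I (%_. lborel :: real measure))"
  hence e: "\<tau> : extensional ?I" by(auto simp:space_PiM PiE_def)
  show "\<tau> = U (?W \<tau>)"
  proof
   fix m show "\<tau> m = U (?W \<tau>) m"
   proof(cases "m : ?I")
    case True
    have U1: "U (?W \<tau>) m = \<tau> (h (inv_into UNIV h m))"
     unfolding U_def restrict_def if_P[OF True] vec_lambda_beta by(rule refl)
    have h2: "\<tau> (h (inv_into UNIV h m)) = \<tau> m" by(rule arg_cong[OF hinv(2)[OF True]])
    show ?thesis by(rule trans[OF h2[symmetric] U1[symmetric]])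
   next
    case False
    have U2: "U (?W \<tau>) m = undefined" unfolding U_def restrict_def by(rule if_not_P[OF False])
    show ?thesis by(rule trans[OF extensional_arb[OF e False] U2[symmetric]])
   qed
  qed
 qed
 also have "... = (NN x. g (U x) \<partial>distr (PiM ?I (%_. lborel)) borel ?W)"
  using gU Wm by(intro nn_integral_distr[symmetric]) simp_all
 also have "... = (NN x. g (U x) \<partial>lborel)" by(simp only:distr_PiM_lborel[OF h])
 also have "... = ennreal (Dmat u \<rho>) * (NN x. g (U (A *v x)) \<partial>lborel)"
  unfolding D by(rule nn_integral_lborel_matrix[OF \<open>invertible A\<close> gU])
 also have "(NN x. g (U (A *v x)) \<partial>lborel) = (NN x. g (U (A *v x)) \<partial>distr lborel borel T)"
  using distr_lborel_basis[OF \<beta>] by(simp only:T_def[abs_def])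
 also have "... = (NN x. g (U (A *v T x)) \<partial>lborel)"
 proof(rule nn_integral_distr)
  show "T : measurable lborel borel"
   unfolding T_def by(intro borel_measurable_vec_lambda) simp
  have "(*v) A : borel_measurable borel"
   by(intro borel_measurable_continuous_onI linear_continuous_on linear_conv_bounded_linear[THEN iffD1]) simp
  from measurable_compose[OF this gU] show "(%x. g (U (A *v x))) : borel_measurable (distr lborel borel T)" by simp
 qed
 also have "... = (NN x. g (\<lambda>i\<in>?I. inner (fst x) (u i) + snd x * \<rho> i) \<partial>lborel)"
 proof(intro nn_integral_cong arg_cong[where f = g] ext)
  fix x :: "'a \<times> real" and m
  show "U (A *v T x) m = (\<lambda>i\<in>?I. inner (fst x) (u i) + snd x * \<rho> i) m"
  proof(cases "m : ?I")
   case True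
   have "U (A *v T x) m = (A *v T x) $ inv_into UNIV h m"
    unfolding U_def restrict_def by(rule if_P[OF True])
   also have "... = inner x (u (h (inv_into UNIV h m)), \<rho> (h (inv_into UNIV h m)))" by(rule AT)
   also have "... = inner (fst x) (u m) + snd x * \<rho> m"
    unfolding hinv(2)[OF True] inner_prod_def by simp
   also have "... = (\<lambda>i\<in>?I. inner (fst x) (u i) + snd x * \<rho> i) m"
    unfolding restrict_def by(rule if_P[OF True, symmetric])
   finally show ?thesis .
  next
   case False
   show ?thesis unfolding U_def restrict_def if_not_P[OF False] by(rule refl)
  qed
 qed
 also have "... = (NN z. (NN r. g (\<lambda>i\<in>?I. inner z (u i) + r * \<rho> i) \<partial>lborel) \<partial>lborel)"
 proof -
  have "(%x :: 'a \<times> real. \<lambda>i\<in>?I. inner (fst x) (u i) + snd x * \<rho> i) : measurable (lborel \<Otimes>\<^sub>M lborel) (PiM ?I (%_. lborel))"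
   by(intro measurable_restrict) simp
  from measurable_compose[OF this g] show ?thesis
   unfolding lborel_prod[symmetric] by(subst lborel.nn_integral_fst[symmetric]) simp_all
 qed
 finally show "(NN \<tau>. g \<tau> \<partial>PiM ?I (%_. lborel)) =
   ennreal (Dmat u \<rho>) * (NN z. (NN r. g (\<lambda>i\<in>?I. inner z (u i) + r * \<rho> i) \<partial>lborel) \<partial>lborel)" .
qed

section \<open>Simplices tangent to the unit ball\<close>

declare sum.cl_ivl_Suc [simp del]

section \<open>Projections of an independent family\<close>

lemma mem_orthogonal_comp_span:
 "x : orthogonal_comp (span S) <-> (ALL y:S. inner x y = 0)"
proof
 assume "x : orthogonal_comp (span S)"
 thus "ALL y:S. inner x y = 0"
  by(auto simp:orthogonal_comp_def orthogonal_def inner_commute span_base)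
next
 assume R: "ALL y:S. inner x y = 0"
 have "orthogonal x y" if "y : span S" for y
  using that by(rule orthogonal_to_span) (use R in \<open>auto simp: orthogonal_def\<close>)
 thus "x : orthogonal_comp (span S)"
  by(auto simp:orthogonal_comp_def orthogonal_commute)
qed

lemma dim_orthogonal_comp:
 fixes W :: "'b::euclidean_space set"
 assumes "subspace W"
 shows "dim (orthogonal_comp W) + dim W = DIM('b)"
proof -
 have "dim {y : UNIV. ALL x:W. orthogonal x y} + dim W = dim (UNIV :: 'b set)"
  using assms by(intro dim_subspace_orthogonal_to_vectors) auto
 thus ?thesis by(simp add:orthogonal_comp_def)
qed

lemma indep_fam_span_sum:
 assumes "indep_fam w I" "finite I" "x : span (w ` I)"
 obtains b where "x = (\<Sum>i\<in>I. b i *R w i)"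
proof -
 have "x : range (%b. \<Sum>y\<in>w ` I. b y *R y)" using assms span_finite[of "w ` I"] by auto
 then obtain b where "x = (\<Sum>y\<in>w ` I. b y *R y)" by blast
 also have "... = (\<Sum>i\<in>I. b (w i) *R w i)"
  using assms(1) by(subst sum.reindex) (auto simp:indep_fam_def)
 finally show ?thesis by(rule that)
qed

lemma indep_fam_sum_in_span:
 assumes ind: "indep_fam w (J Un N)" and fin: "finite J" "finite N" and dj: "J Int N = {}"
  and s: "(\<Sum>i\<in>J. a i *R w i) : span (w ` N)" and i: "i : J"
 shows "a i = 0"
proof -
 have "indep_fam w N" using ind by(rule indep_fam_subset) auto
 then obtain b where b: "(\<Sum>i\<in>J. a i *R w i) = (\<Sum>i\<in>N. b i *R w i)"
  by(rule indep_fam_span_sum[OF _ fin(2) s])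
 let ?c = "%i. if i : J then a i else - b i"
 have "(\<Sum>i\<in>J Un N. ?c i *R w i) = (\<Sum>i\<in>J. ?c i *R w i) + (\<Sum>i\<in>N. ?c i *R w i)"
  using fin dj by(intro sum.union_disjoint)
 also have "(\<Sum>i\<in>N. ?c i *R w i) = (\<Sum>i\<in>N. - (b i *R w i))"
  using dj by(intro sum.cong) auto
 also have "(\<Sum>i\<in>J. ?c i *R w i) = (\<Sum>i\<in>J. a i *R w i)" by(intro sum.cong) auto
 finally have "(\<Sum>i\<in>J Un N. ?c i *R w i) = 0" using b by(simp add:sum_negf)
 from indep_famD[OF ind _ this, of i] show "a i = 0" using fin i by auto
qed

text \<open>A combination of projections is the projection of the combination. If it vanishes, the
  combination lies in the span of the vectors with index in \<open>N\<close>, and independence of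
  the whole family applies.\<close>

lemma indep_fam_orth_proj:
 assumes ind: "indep_fam w (J Un N)" and fin: "finite J" "finite N" and dj: "J Int N = {}"
 shows "indep_fam (%i. orth_proj (orthogonal_comp (span (w ` N))) (w i)) J"
 unfolding indep_fam_iff_sum[OF fin(1)]
proof(intro allI impI ballI)
 let ?L = "orthogonal_comp (span (w ` N))"
 have L: "subspace ?L" by(rule subspace_orthogonal_comp)
 fix a i assume s: "(\<Sum>i\<in>J. a i *R orth_proj ?L (w i)) = 0" and i: "i : J"
 have "orth_proj ?L (\<Sum>i\<in>J. a i *R w i) = 0" using s by(simp add:orth_proj_sum[OF L])
 hence "(\<Sum>i\<in>J. a i *R w i) : orthogonal_comp ?L"
  using orth_proj_eq_0_iff[OF L] by blast
 hence "(\<Sum>i\<in>J. a i *R w i) : span (w ` N)" by(simp add:orthogonal_comp_self)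
 thus "a i = 0" using i by(rule indep_fam_sum_in_span[OF ind fin dj])
qed

section \<open>The simplex, its vertices and its inball\<close>

definition Tk_at :: "nat => (nat => 'a::euclidean_space) => 'a => real => 'a set" where
 "Tk_at k u z r = (%x. z + r *R x) ` Tk k u"

text \<open>The vertex opposite to facet \<open>j\<close>. The normals other than \<open>u j\<close>
  form a basis; the vertex has prescribed products with them, namely the norm of the projection for
  the facets and 0 for the normals orthogonal to \<open>Lsub k u\<close>. The dual basis solves this
  by an explicit, hence measurable, formula.\<close>

definition Tk_vertex :: "nat => (nat => 'a::euclidean_space) => nat => 'a" where
 "Tk_vertex k u j = (\<Sum>i\<in>{1..k+1} - {j}. norm (orth_proj (Lsub k u) (u i)) *R
   dual_vec u (II('a) - {j}) i)"

lemma subspace_Lsub: "subspace (Lsub k u)"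
 unfolding Lsub_def by(rule subspace_orthogonal_comp)

lemma mem_Lsub:
 fixes u :: "nat => 'a::euclidean_space"
 shows "x : Lsub k u <-> (ALL i:{k+2..DIM('a)+1}. inner x (u i) = 0)"
 unfolding Lsub_def mem_orthogonal_comp_span by auto

lemma general_position_indep_fam:
 fixes u :: "nat => 'a::euclidean_space"
 assumes "general_position u" "J <= II('a)" "card J <= DIM('a)"
 shows "indep_fam u J"
proof -
 obtain J' where J': "J <= J'" "J' <= II('a)" "card J' = DIM('a)"
  using exists_subset_between[of J "DIM('a)" "II('a)"] assms by auto
 hence "indep_fam u J'" using assms(1) by(auto simp:general_position_def indep_fam_def)
 thus ?thesis using J'(1) by(rule indep_fam_subset)
qed

locale gp_data =
 fixes k :: nat and u :: "nat => 'a::euclidean_space"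
 assumes k: "k : {1..DIM('a)}" and gp: "general_position u"
begin

abbreviation "I1 \<equiv> {1..k+1}"
abbreviation "L \<equiv> Lsub k u"
abbreviation "v i \<equiv> orth_proj (Lsub k u) (u i)"

lemma v_in_L: "v i : L" by(rule orth_proj_props(1)[OF subspace_Lsub])

lemma inner_v: "x : L ==> inner x (v i) = inner x (u i)"
 by(rule inner_orth_proj[OF subspace_Lsub])

lemma card_I2: "card {k+2..DIM('a)+1} = DIM('a) - k" using k by simp

lemma dim_L: "dim L = k"
proof -
 have "dim (span (u ` {k+2..DIM('a)+1})) = DIM('a) - k"
  using general_position_indep_fam[OF gp, of "{k+2..DIM('a)+1}"] k by(subst indep_fam_dim_span) auto
 moreover have "dim L + dim (span (u ` {k+2..DIM('a)+1})) = DIM('a)"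
  unfolding Lsub_def by(rule dim_orthogonal_comp) simp
 ultimately show ?thesis using k by(auto simp del:dim_span)
qed

text \<open>At most \<open>k\<close> of the first normals together with the
  \<open>DIM('a) - k\<close> normals that define \<open>L\<close> are at most \<open>DIM('a)\<close>
  vectors, so general position makes them independent.\<close>

lemma v_indep:
 assumes J: "J <= I1" "card J <= k"
 shows "indep_fam v J"
proof -
 have fJ: "finite J" using J(1) finite_subset by blast
 have "card (J Un {k+2..DIM('a)+1}) <= DIM('a)"
  using card_Un_le[of J "{k+2..DIM('a)+1}"] card_I2 J(2) k by auto
 hence "indep_fam u (J Un {k+2..DIM('a)+1})"
  using J(1) k by(intro general_position_indep_fam[OF gp]) auto
 thus ?thesis
  unfolding Lsub_def using J(1) fJ by(intro indep_fam_orth_proj) auto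
qed

lemma v_nonzero: "i : I1 ==> v i ~= 0"
 using v_indep[of "{i}"] k indep_fam_nonzero[of v "{i}" i] by auto

end

locale face_data = gp_data +
 assumes u: "u : tuples k"
begin

lemma norm_u: "i : II('a) ==> norm (u i) = 1"
 using u by(auto simp:tuples_def PiE_iff)

lemma pos_comb:
 assumes "x : L"
 obtains c where "!!j. j : I1 ==> 0 <= c j" "x = (\<Sum>j\<in>I1. c j *R v j)"
 using u assms that unfolding tuples_def by blast

text \<open>Write the negative of the sum of the \<open>v j\<close> as a nonnegative combination and
  add the sum back: every coefficient is then at least 1.\<close>

lemma pos_dependency:
 obtains c where "!!j. j : I1 ==> 0 < c j" "(\<Sum>j\<in>I1. c j *R v j) = 0"
proof -
 have "- (\<Sum>j\<in>I1. v j) : L" by(intro subspace_neg subspace_sum subspace_Lsub v_in_L)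
 then obtain b where b: "!!j. j : I1 ==> 0 <= b j" "- (\<Sum>j\<in>I1. v j) = (\<Sum>j\<in>I1. b j *R v j)"
  by(rule pos_comb) blast
 show ?thesis
 proof
  show "0 < 1 + b j" if "j : I1" for j using b(1)[OF that] by simp
  have "(\<Sum>j\<in>I1. (1 + b j) *R v j) = (\<Sum>j\<in>I1. v j) + (\<Sum>j\<in>I1. b j *R v j)"
   by(simp add:scaleR_add_left sum.distrib)
  thus "(\<Sum>j\<in>I1. (1 + b j) *R v j) = 0" using b(2)[symmetric] by simp
 qed
qed

text \<open>Expand one factor of \<open>inner x x\<close> as a nonnegative combination of the
  \<open>v j\<close>.\<close>

lemma inner_v_nonpos_imp_0:
 assumes "x : L" "!!i. i : I1 ==> inner x (v i) <= 0"
 shows "x = 0"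
proof -
 obtain c where c: "!!j. j : I1 ==> 0 <= c j" "x = (\<Sum>j\<in>I1. c j *R v j)" by(rule pos_comb[OF assms(1)]) blast
 have "inner x x = (\<Sum>j\<in>I1. c j * inner x (v j))" by(subst (2) c(2)) (simp add:inner_sum_right)
 also have "... <= 0" by(intro sum_nonpos mult_nonneg_nonpos c(1) assms(2))
 finally have "inner x x = 0" using inner_ge_zero[of x] by linarith
 thus ?thesis by simp
qed

text \<open>Subtracting the multiple of \<open>c\<close> that removes the first coefficient leaves a
  dependency between \<open>k\<close> of the vectors, which are independent.\<close>

lemma dependency_unique:
 assumes c: "!!j. j : I1 ==> 0 < c j" "(\<Sum>j\<in>I1. c j *R v j) = 0"
  and a: "(\<Sum>j\<in>I1. a j *R v j) = 0"
 shows "EX l. ALL j:I1. a j = l * c j"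
proof -
 define l where "l = a 1 / c 1"
 have c1: "0 < c 1" by(rule c(1)) simp
 have "(\<Sum>j\<in>I1. (a j - l * c j) *R v j) = (\<Sum>j\<in>I1. a j *R v j) - l *R (\<Sum>j\<in>I1. c j *R v j)"
  by(simp add:scaleR_diff_left sum_subtractf scaleR_sum_right)
 also have "... = 0" using a c(2) by simp
 finally have "(\<Sum>j\<in>I1. (a j - l * c j) *R v j) = 0" .
 moreover have "(\<Sum>j\<in>I1. (a j - l * c j) *R v j) = (\<Sum>j\<in>I1 - {1}. (a j - l * c j) *R v j)"
  using c1 by(intro sum.mono_neutral_right) (auto simp:l_def)
 ultimately have z: "(\<Sum>j\<in>I1 - {1}. (a j - l * c j) *R v j) = 0" by simp
 have ind: "indep_fam v (I1 - {1})" by(rule v_indep) auto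
 have "a j - l * c j = 0" if "j : I1" for j
 proof(cases "j = 1")
  case True thus ?thesis using c1 by(simp add:l_def)
 next
  case False thus ?thesis using indep_famD[OF ind _ z] that by simp
 qed
 thus ?thesis by(intro exI[of _ l]) auto
qed

lemma mem_Tk: "x : Tk k u <-> x : L & (ALL i:I1. inner x (v i) <= norm (v i))"
 unfolding Tk_def lower_halfspace_def using inner_v by auto

lemma Tk_subset_L: "Tk k u <= L" by(auto simp:Tk_def)

lemma Tk_vertex_props:
 assumes j: "j : I1"
 shows "Tk_vertex k u j : L" "!!i. i : I1 ==> i ~= j ==> inner (Tk_vertex k u j) (v i) = norm (v i)"
proof -
 let ?J = "II('a) - {j}"
 have ind: "indep_fam u ?J" using j k by(intro general_position_indep_fam[OF gp]) auto
 have in_u: "inner (Tk_vertex k u j) (u i) = (if i : I1 then norm (v i) else 0)" if "i : ?J" for i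
 proof -
  have "inner (Tk_vertex k u j) (u i) = (\<Sum>l\<in>I1 - {j}. norm (v l) * inner (dual_vec u ?J l) (u i))"
   by(simp add:Tk_vertex_def inner_sum_left)
  also have "... = (\<Sum>l\<in>I1 - {j}. if l = i then norm (v l) else 0)"
  proof(rule sum.cong[OF refl])
   fix l assume "l : I1 - {j}"
   hence "l : ?J" using k by auto
   thus "norm (v l) * inner (dual_vec u ?J l) (u i) = (if l = i then norm (v l) else 0)"
    using inner_dual_vec[OF _ ind _ that, of l] by simp
  qed
  also have "... = (if i : I1 then norm (v i) else 0)" using that by(simp add:sum.delta)
  finally show ?thesis .
 qed
 show L: "Tk_vertex k u j : L" unfolding mem_Lsub using in_u j by auto
 show "inner (Tk_vertex k u j) (v i) = norm (v i)" if "i : I1" "i ~= j" for i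
  using in_u[of i] that k by(simp add:inner_v[OF L])
qed

text \<open>The positive dependency provides barycentric coordinates: the weight of a vertex is
  proportional to the slack of the opposite facet inequality.\<close>

lemma Tk_eq_convex_hull: "Tk k u = convex hull (Tk_vertex k u ` I1)"
proof -
 obtain c where c: "!!j. j : I1 ==> 0 < c j" "(\<Sum>j\<in>I1. c j *R v j) = 0" by(rule pos_dependency) blast
 define s where "s = (\<Sum>j\<in>I1. c j * norm (v j))"
 have s: "0 < s" unfolding s_def using c(1) v_nonzero by(intro sum_pos) auto
 have z: "(\<Sum>i\<in>I1. c i * inner x (v i)) = 0" for x
 proof -
  have "(\<Sum>i\<in>I1. c i * inner x (v i)) = inner x (\<Sum>j\<in>I1. c j *R v j)" by(simp add:inner_sum_right)
  thus ?thesis using c(2) by simp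
 qed
 \<comment> \<open>The weighted sum of all products vanishes, so the products with the other facet
   normals determine the remaining one.\<close>
 have own: "inner (Tk_vertex k u j) (v j) = norm (v j) - s / c j" if j: "j : I1" for j
 proof -
  let ?p = "Tk_vertex k u j"
  have "0 = c j * inner ?p (v j) + (\<Sum>i\<in>I1 - {j}. c i * inner ?p (v i))"
   using z[of ?p] sum.remove[of I1 j "%i. c i * inner ?p (v i)"] j by simp
  also have "(\<Sum>i\<in>I1 - {j}. c i * inner ?p (v i)) = (\<Sum>i\<in>I1 - {j}. c i * norm (v i))"
   using Tk_vertex_props(2)[OF j] by(intro sum.cong) auto
  also have "... = s - c j * norm (v j)"
   unfolding s_def using sum.remove[of I1 j "%i. c i * norm (v i)"] j by simp
  finally show ?thesis using c(1)[OF j] by(simp add:field_simps)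
 qed
 show ?thesis
 proof(rule equalityI)
  have "Tk_vertex k u ` I1 <= Tk k u"
  proof(rule image_subsetI)
   fix j assume j: "j : I1"
   have "inner (Tk_vertex k u j) (v i) <= norm (v i)" if "i : I1" for i
    using Tk_vertex_props(2)[OF j that] own[OF j] c(1)[OF j] s
    by(cases "i = j") auto
   thus "Tk_vertex k u j : Tk k u" unfolding mem_Tk using Tk_vertex_props(1)[OF j] by blast
  qed
  moreover have "convex (Tk k u)"
  proof -
   have "Tk k u = L Int (\<Inter>i\<in>I1. {x. inner (v i) x <= norm (v i)})"
    by(auto simp:mem_Tk inner_commute)
   thus ?thesis
    using subspace_imp_convex[OF subspace_Lsub, of k u] convex_halfspace_le
    by(auto intro!:convex_Int convex_INT)
  qed
  ultimately show "convex hull (Tk_vertex k u ` I1) <= Tk k u" by(rule hull_minimal)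
 next
  show "Tk k u <= convex hull (Tk_vertex k u ` I1)"
  proof
   fix x assume x: "x : Tk k u"
   \<comment> \<open>The factor \<open>c j / s\<close> makes the weights add up to 1, because the
     dependency annihilates the terms that contain \<open>x\<close>.\<close>
   define t where "t j = (norm (v j) - inner x (v j)) * c j / s" for j
   have t0: "0 <= t j" if "j : I1" for j
    using x c(1)[OF that] s that unfolding t_def mem_Tk by(intro divide_nonneg_pos mult_nonneg_nonneg) auto
   have "(\<Sum>j\<in>I1. t j) = (\<Sum>j\<in>I1. c j * norm (v j) - c j * inner x (v j)) / s"
    unfolding t_def by(simp add:sum_divide_distrib[symmetric] algebra_simps)
   also have "... = 1" using z[of x] s by(simp only:sum_subtractf s_def[symmetric]) simp
   finally have t1: "(\<Sum>j\<in>I1. t j) = 1" .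
   let ?y = "\<Sum>j\<in>I1. t j *R Tk_vertex k u j"
   have yL: "?y : L" by(intro subspace_sum subspace_scale subspace_Lsub Tk_vertex_props(1))
   have yi: "inner ?y (v i) = inner x (v i)" if i: "i : I1" for i
   proof -
    have "inner ?y (v i) = (\<Sum>j\<in>I1. t j * inner (Tk_vertex k u j) (v i))" by(simp add:inner_sum_left)
    also have "... = (\<Sum>j\<in>I1. t j * norm (v i) - (if j = i then t j * (s / c j) else 0))"
    proof(rule sum.cong[OF refl])
     fix j assume j: "j : I1"
     show "t j * inner (Tk_vertex k u j) (v i) = t j * norm (v i) - (if j = i then t j * (s / c j) else 0)"
      using Tk_vertex_props(2)[OF j i] own[OF j] by(cases "i = j") (simp_all add:right_diff_distrib)
    qed
    also have "... = norm (v i) - t i * (s / c i)"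
     using i t1 by(simp add:sum_subtractf sum.delta sum_distrib_right[symmetric])
    also have "... = inner x (v i)" using c(1)[OF i] s by(simp add:t_def)
    finally show ?thesis .
   qed
   \<comment> \<open>The difference lies in \<open>L\<close> and has product 0 with every
     \<open>v i\<close>, so positive spanning forces it to be 0.\<close>
   have "?y - x = 0"
    using yL x yi by(intro inner_v_nonpos_imp_0) (auto simp:mem_Tk inner_diff_left intro:subspace_diff[OF subspace_Lsub])
   hence "x = ?y" by simp
   moreover have "?y : convex hull (Tk_vertex k u ` I1)"
    using t0 t1 by(intro convex_sum) (auto simp:convex_convex_hull hull_inc)
   ultimately show "x : convex hull (Tk_vertex k u ` I1)" by simp
  qed
 qed
qed

abbreviation "simp z r \<equiv> Tk_at k u z r"

lemma mem_simp:
 assumes r: "0 < r"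
 shows "x : simp z r <-> x - z : L & (ALL i:I1. inner (x - z) (v i) <= r * norm (v i))"
proof -
 have "x : simp z r <-> (1 / r) *R (x - z) : Tk k u"
 proof
  assume "x : simp z r"
  thus "(1 / r) *R (x - z) : Tk k u" using r by(auto simp:Tk_at_def)
 next
  assume t: "(1 / r) *R (x - z) : Tk k u"
  have "x = z + r *R ((1 / r) *R (x - z))" using r by simp
  thus "x : simp z r" unfolding Tk_at_def using t by blast
 qed
 also have "... <-> x - z : L & (ALL i:I1. inner (x - z) (v i) <= r * norm (v i))"
 proof -
  have "(1 / r) *R (x - z) : L <-> x - z : L"
   using subspace_scale[OF subspace_Lsub, of "(1/r) *R (x - z)" k u r]
    subspace_scale[OF subspace_Lsub, of "x - z" k u "1/r"] r by auto
  moreover have "inner ((1 / r) *R (x - z)) (v i) <= norm (v i) <-> inner (x - z) (v i) <= r * norm (v i)" for i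
   using r by(simp only:inner_scaleR_left) (simp add:pos_divide_le_eq mult.commute)
  ultimately show ?thesis unfolding mem_Tk by blast
 qed
 finally show ?thesis .
qed

lemma mem_simp_u:
 assumes r: "0 < r"
 shows "x : simp z r <-> x - z : L & (ALL i:I1. inner x (u i) <= inner z (u i) + r * norm (v i))"
proof -
 have "inner (x - z) (v i) <= r * norm (v i) <-> inner x (u i) <= inner z (u i) + r * norm (v i)"
  if "x - z : L" for i
  using inner_v[OF that, of i] unfolding inner_diff_left by linarith
 thus ?thesis unfolding mem_simp[OF r] by blast
qed

lemma simp_eq_convex_hull: "simp z r = convex hull ((%j. z + r *R Tk_vertex k u j) ` I1)"
proof -
 have "simp z r = (%x. z + x) ` ((%x. r *R x) ` Tk k u)" by(auto simp:Tk_at_def image_image)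
 also have "... = convex hull ((%x. z + x) ` ((%x. r *R x) ` Tk_vertex k u ` I1))"
  unfolding Tk_eq_convex_hull by(simp add:convex_hull_scaling convex_hull_translation)
 finally show ?thesis by(simp add:image_image)
qed

lemma simp_subset: "simp z r <= (%x. z + x) ` L"
 using Tk_subset_L subspace_scale[OF subspace_Lsub] by(fastforce simp:Tk_at_def)

lemma ball_subset_simp:
 assumes "0 < r" "x - z : L" "dist x z <= r"
 shows "x : simp z r"
proof -
 have "inner (x - z) (v i) <= r * norm (v i)" for i
  using norm_cauchy_schwarz[of "x - z" "v i"] mult_right_mono[of "norm (x - z)" r "norm (v i)"] assms(3)
  by(simp add:dist_norm)
 thus ?thesis using assms(1,2) by(simp add:mem_simp)
qed

lemma affine_hull_simp:
 assumes r: "0 < r"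
 shows "affine hull (simp z r) = (%x. z + x) ` L"
proof(rule equalityI)
 have "affine ((%x. z + x) ` L)"
  using subspace_imp_affine[OF subspace_Lsub] by(metis affine_translation)
 thus "affine hull (simp z r) <= (%x. z + x) ` L" using simp_subset by(simp add:hull_minimal)
next
 show "(%x. z + x) ` L <= affine hull (simp z r)"
 proof clarify
  fix y assume y: "y : L"
  have zin: "z : simp z r" by(rule ball_subset_simp[OF r]) (use r in \<open>auto simp: subspace_0[OF subspace_Lsub]\<close>)
  show "z + y : affine hull (simp z r)"
  proof(cases "y = 0")
   case True thus ?thesis using zin by(simp add:hull_inc)
  next
   case False
   \<comment> \<open>A point of the simplex on the ray from \<open>z\<close> towards
     \<open>z + y\<close>; the line through \<open>z\<close> and \<open>q\<close> contains
     \<open>z + y\<close>.\<close>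
   define q where "q = z + (r / norm y) *R y"
   have "q : simp z r"
    by(rule ball_subset_simp[OF r]) (use r y False in \<open>auto simp: q_def dist_norm subspace_scale[OF subspace_Lsub]\<close>)
   hence "(1 - norm y / r) *R z + (norm y / r) *R q : affine hull (simp z r)"
    using zin by(intro mem_affine[OF affine_affine_hull]) (auto simp:hull_inc)
   moreover have "(1 - norm y / r) *R z + (norm y / r) *R q = z + y"
    using r False by(simp add:q_def algebra_simps)
   ultimately show ?thesis by simp
  qed
 qed
qed

lemma aff_dim_simp:
 assumes "0 < r"
 shows "aff_dim (simp z r) = int k"
proof -
 have "aff_dim (simp z r) = aff_dim (affine hull (simp z r))" by(rule aff_dim_affine_hull[symmetric])
 also have "... = int k"
  unfolding affine_hull_simp[OF assms] aff_dim_translation_eq aff_dim_subspace[OF subspace_Lsub] dim_L ..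
 finally show ?thesis .
qed

lemma simp_in_polytopes_dim: "0 < r ==> simp z r : polytopes_dim k"
 unfolding polytopes_dim_def polytope_def using aff_dim_simp simp_eq_convex_hull by blast

text \<open>The point of the ball farthest in direction \<open>v i\<close> has to respect facet
  \<open>i\<close>, which costs \<open>s * norm (v i)\<close>. Weighting these inequalities with a
  positive dependency cancels the centre and leaves \<open>s <= r\<close>; for equality all products
  of \<open>y - z\<close> with the \<open>v i\<close> are nonpositive.\<close>

lemma inscribed_ball_simp:
 assumes r: "0 < r" and b: "inscribed_ball (simp z r) y s"
 shows "s <= r" "s = r ==> y = z"
proof -
 obtain c where c: "!!j. j : I1 ==> 0 < c j" "(\<Sum>j\<in>I1. c j *R v j) = 0" by(rule pos_dependency) blast
 have s: "0 < s" and y: "y : simp z r" and sub: "cball y s Int affine hull (simp z r) <= simp z r"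
  using b by(auto simp:inscribed_ball_def)
 have yL: "y - z : L" using y r by(simp add:mem_simp)
 have ineq: "inner (y - z) (v i) + s * norm (v i) <= r * norm (v i)" if i: "i : I1" for i
 proof -
  let ?x = "y + (s / norm (v i)) *R v i"
  have nv: "norm (v i) > 0" using v_nonzero[OF i] by simp
  have xz: "?x - z = (y - z) + (s / norm (v i)) *R v i" by simp
  have "?x - z : L" unfolding xz by(intro subspace_add subspace_scale subspace_Lsub yL v_in_L)
  hence "?x : affine hull (simp z r)" unfolding affine_hull_simp[OF r] by(metis add.commute diff_add_cancel imageI)
  moreover have "?x : cball y s" using s nv by(simp add:dist_norm)
  ultimately have "?x : simp z r" using sub by blast
  hence "inner (?x - z) (v i) <= r * norm (v i)" using i by(simp add:mem_simp[OF r])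
  moreover have "inner (?x - z) (v i) = inner (y - z) (v i) + s * norm (v i)"
  proof -
   have "inner (v i) (v i) = norm (v i) * norm (v i)" by(simp add:dot_square_norm power2_eq_square)
   thus ?thesis unfolding xz using nv by(simp add:inner_add_left)
  qed
  ultimately show ?thesis by simp
 qed
 have "(\<Sum>i\<in>I1. c i * inner (y - z) (v i)) = inner (y - z) (\<Sum>j\<in>I1. c j *R v j)" by(simp add:inner_sum_right)
 hence z0: "(\<Sum>i\<in>I1. c i * inner (y - z) (v i)) = 0" using c(2) by simp
 have p: "0 < (\<Sum>i\<in>I1. c i * norm (v i))" using c(1) v_nonzero by(intro sum_pos) auto
 have "(\<Sum>i\<in>I1. c i * (inner (y - z) (v i) + s * norm (v i))) <= (\<Sum>i\<in>I1. c i * (r * norm (v i)))"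
  using ineq c(1) by(intro sum_mono mult_left_mono) (auto simp:less_imp_le)
 moreover have "(\<Sum>i\<in>I1. c i * (inner (y - z) (v i) + s * norm (v i))) = s * (\<Sum>i\<in>I1. c i * norm (v i))"
  using z0 by(simp add:distrib_left sum.distrib sum_distrib_left mult.left_commute)
 moreover have "(\<Sum>i\<in>I1. c i * (r * norm (v i))) = r * (\<Sum>i\<in>I1. c i * norm (v i))"
  by(simp add:sum_distrib_left mult.left_commute)
 ultimately show "s <= r" using p by simp
 assume "s = r"
 hence "y - z = 0" using ineq by(intro inner_v_nonpos_imp_0[OF yL]) fastforce
 thus "y = z" by simp
qed

lemma inball_simp:
 assumes r: "0 < r"
 shows "inball (simp z r) y s <-> y = z & s = r"
proof -
 have "inscribed_ball (simp z r) z r"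
  unfolding inscribed_ball_def affine_hull_simp[OF r]
  using r ball_subset_simp[OF r] by(auto simp:dist_commute subspace_0[OF subspace_Lsub])
 thus ?thesis
  using inscribed_ball_simp[OF r] unfolding inball_def by(metis order_antisym)
qed

lemma incenter_simp: "0 < r ==> incenter (simp z r) = z"
 by(simp add:incenter_def inball_simp)

lemma simp_unique_inball: "0 < r ==> simp z r : unique_inball_polytopes k"
 unfolding unique_inball_polytopes_def using simp_in_polytopes_dim
 by(auto simp:inball_simp intro!:ex1I[of _ "(z, r)"])

lemma Tk_eq_simp: "Tk k u = simp 0 1" by(simp add:Tk_at_def)

end

lemma face_dataI:
 fixes u :: "nat => 'a::euclidean_space"
 shows "k : {1..DIM('a)} ==> u : tuples k ==> face_data k u"
 by(auto simp:face_data_def gp_data_def face_data_axioms_def tuples_def)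

section \<open>Faces of the tessellation\<close>

lemma indep_fam_reindex:
 assumes "bij_betw h A B"
 shows "indep_fam (%i. w (h i)) A <-> indep_fam w B"
proof -
 have "inj_on h A" "h ` A = B" using assms by(auto simp:bij_betw_def)
 hence "inj_on (%i. w (h i)) A <-> inj_on w B"
  using inj_on_imageI2[of w h A] comp_inj_on_iff[of h A w] by(auto simp:comp_def)
 moreover have "(%i. w (h i)) ` A = w ` B" using \<open>h ` A = B\<close> by auto
 ultimately show ?thesis by(simp add:indep_fam_def)
qed

text \<open>Phrased through tuples over an interval, so that it holds almost surely by one moment
  computation for each length.\<close>

definition generic :: "'a::euclidean_space set set => bool" where
 "generic \<eta> <-> (ALL n<=DIM('a). ALL p:tup {1..n} \<eta>. indep_fam (%i. fst (p i)) {1..n})"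

lemma genericD:
 fixes \<eta> :: "'a::euclidean_space set set"
 assumes "generic \<eta>" "finite J" "card J <= DIM('a)"
  and "!!i. i : J ==> p i : params & hyp (p i) : \<eta>" "inj_on (%i. hyp (p i)) J"
 shows "indep_fam (%i. fst (p i)) J"
proof -
 obtain h where h: "bij_betw h {1..card J} J" using ex_bij_betw_nat_finite_1[OF assms(2)] by blast
 hence hJ: "!!i. i : {1..card J} ==> h i : J" by(auto simp:bij_betw_def)
 have inj: "inj_on (%i. hyp (p (h i))) {1..card J}"
  using comp_inj_on[of h "{1..card J}" "%i. hyp (p i)"] h assms(5) by(auto simp:bij_betw_def comp_def)
 have "inj_on (%i. hyp (restrict (%i. p (h i)) {1..card J} i)) {1..card J}"
  using inj by(subst inj_on_cong[where g = "%i. hyp (p (h i))"]) auto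
 hence "restrict (%i. p (h i)) {1..card J} : tup {1..card J} \<eta>"
  unfolding tup_def using assms(4) hJ by simp
 hence "indep_fam (%i. fst (restrict (%i. p (h i)) {1..card J} i)) {1..card J}"
  using assms(1,3) unfolding generic_def by blast
 hence "indep_fam (%i. fst (p (h i))) {1..card J}"
  by(subst (asm) indep_fam_cong[where w' = "%i. fst (p (h i))"]) auto
 thus ?thesis using indep_fam_reindex[OF h, of "%i. fst (p i)"] by simp
qed

lemma mem_hyp: "x : hyp p <-> inner x (fst p) = snd p"
 by(simp add:hyp_def hyperplane_def)

lemma closed_hyp: "closed (hyp p)"
proof -
 have "hyp p = {x. inner (fst p) x = snd p}" by(auto simp:mem_hyp inner_commute)
 thus ?thesis by(simp add:closed_hyperplane)
qed

lemma same_side_le: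
 assumes "connected T" "x : T" "y : T" "inner x (fst p) < snd p" "hyp p Int T = {}"
 shows "inner y (fst p) < snd p"
proof(rule ccontr)
 assume "~ inner y (fst p) < snd p"
 then obtain w where "w : T" "inner (fst p) w = snd p"
  using connected_ivt_hyperplane[OF assms(1-3), of "fst p" "snd p"] assms(4)
  by(auto simp:inner_commute)
 thus False using assms(5) by(auto simp:mem_hyp inner_commute)
qed

section \<open>Cells and faces as intersections of half-spaces\<close>

lemma configurations_finite_hits:
 "\<eta> : configurations ==> compact T ==> finite {H : \<eta>. H Int T ~= {}}"
 by(auto simp:configurations_def)

lemma configurations_subset: "\<eta> : configurations ==> H : \<eta> ==> H : hyperplanes"
 by(auto simp:configurations_def)

lemma configurations_rep:
 assumes "\<eta> : configurations" "H : \<eta>"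
 obtains p where "p : params" "H = hyp p" "inner z (fst p) <= snd p"
proof -
 obtain p where p: "p : params" "H = hyp p" using assms by(blast elim: hyperplanesE dest:configurations_subset)
 show ?thesis
 proof(cases "inner z (fst p) <= snd p")
  case True thus ?thesis using p that by blast
 next
  case False thus ?thesis using p that[of "- p"] by auto
 qed
qed

text \<open>Only finitely many hyperplanes meet the unit ball around \<open>z\<close>, and each of
  them that misses \<open>z\<close> stays off a smaller ball.\<close>

lemma configurations_local:
 fixes \<eta> :: "'a::euclidean_space set set"
 assumes "\<eta> : configurations"
 obtains \<delta> where "0 < \<delta>" "!!H. H : \<eta> ==> z ~: H ==> H Int cball z \<delta> = {}"
proof -
 define F where "F = {H : \<eta>. H Int cball z 1 ~= {}} - {H. z : H}"
 have fin: "finite F" unfolding F_def using configurations_finite_hits[OF assms compact_cball[of z 1]] by blast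
 have "ALL H:F. EX d>0. H Int cball z d = {}"
 proof
  fix H assume H: "H : F"
  hence "H : \<eta>" "z ~: H" by(auto simp:F_def)
  then obtain p where "H = hyp p" using configurations_rep[OF assms] by blast
  hence "closed H" using closed_hyp by blast
  hence "open (- H)" "z : - H" using \<open>z \<notin> H\<close> by auto
  then obtain e where "0 < e" "cball z e <= - H" using open_contains_cball by blast
  thus "EX d>0. H Int cball z d = {}" by blast
 qed
 then obtain d where d: "!!H. H : F ==> 0 < d H & H Int cball z (d H) = {}" by metis
 define \<delta> where "\<delta> = Min (insert 1 (d ` F))"
 show ?thesis
 proof
  show "0 < \<delta>" unfolding \<delta>_def using fin d by(subst Min_gr_iff) auto
  fix H assume H: "H : \<eta>" "z ~: H"
  have d1: "\<delta> <= 1" unfolding \<delta>_def using fin by(intro Min_le) auto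
  show "H Int cball z \<delta> = {}"
  proof(cases "H : F")
   case True
   hence "\<delta> <= d H" unfolding \<delta>_def using fin by(intro Min_le) auto
   thus ?thesis using d[OF True] by auto
  next
   case False
   hence "H Int cball z 1 = {}" using H by(auto simp:F_def)
   thus ?thesis using d1 by auto
  qed
 qed
qed

text \<open>For \<open>x0\<close> off all hyperplanes exactly one of the two parameters of each
  hyperplane satisfies the strict inequality, so no orientation has to be chosen.\<close>

definition side_set :: "'a::euclidean_space set set => 'a => 'a set" where
 "side_set \<eta> x0 = {x. ALL p:params. hyp p : \<eta> --> inner x0 (fst p) < snd p --> inner x (fst p) <= snd p}"

lemma convex_side_set: "convex (side_set \<eta> x0)"
proof -
 have "side_set \<eta> x0 = (\<Inter>p\<in>{p : params. hyp p : \<eta> & inner x0 (fst p) < snd p}. {x. inner (fst p) x <= snd p})"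
  by(auto simp:side_set_def inner_commute)
 thus ?thesis by(simp add:convex_INT convex_halfspace_le)
qed

lemma closed_side_set: "closed (side_set \<eta> x0)"
proof -
 have "side_set \<eta> x0 = (\<Inter>p\<in>{p : params. hyp p : \<eta> & inner x0 (fst p) < snd p}. {x. inner (fst p) x <= snd p})"
  by(auto simp:side_set_def inner_commute)
 thus ?thesis by(simp add:closed_INT closed_halfspace_le)
qed

text \<open>The strict inequalities define a convex set that avoids all hyperplanes, hence a subset
  of the component. A point satisfying the weak inequalities is the endpoint of a segment from
  \<open>x0\<close> whose relative interior satisfies the strict ones.\<close>

lemma closure_component:
 fixes \<eta> :: "'a::euclidean_space set set"
 assumes \<eta>: "\<eta> : configurations" and x0: "x0 ~: \<Union>\<eta>"
 shows "closure (connected_component_set (UNIV - \<Union>\<eta>) x0) = side_set \<eta> x0"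
proof(rule equalityI)
 let ?D = "connected_component_set (UNIV - \<Union>\<eta>) x0"
 have x0D: "x0 : ?D" using x0 by simp
 have "?D <= side_set \<eta> x0"
 proof
  fix x assume x: "x : ?D"
  show "x : side_set \<eta> x0"
   unfolding side_set_def
  proof(intro CollectI ballI impI)
   fix p assume p: "p : params" "hyp p : \<eta>" "inner x0 (fst p) < snd p"
   have "hyp p Int ?D = {}" using p(2) connected_component_subset[of "UNIV - \<Union>\<eta>" x0] by blast
   from same_side_le[OF connected_connected_component x0D x p(3) this] show "inner x (fst p) <= snd p" by simp
  qed
 qed
 thus "closure ?D <= side_set \<eta> x0" using closed_side_set by(rule closure_minimal)
 define S where "S = (\<Inter>p\<in>{p : params. hyp p : \<eta> & inner x0 (fst p) < snd p}. {x. inner (fst p) x < snd p})"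
 have memS: "x : S <-> (ALL p:params. hyp p : \<eta> --> inner x0 (fst p) < snd p --> inner x (fst p) < snd p)" for x
  by(auto simp:S_def inner_commute)
 have "S <= UNIV - \<Union>\<eta>"
 proof
  fix x assume x: "x : S"
  have False if H: "H : \<eta>" "x : H" for H
  proof -
   obtain p where p: "p : params" "H = hyp p" "inner x0 (fst p) <= snd p"
    by(rule configurations_rep[OF \<eta> H(1)])
   have "x0 ~: hyp p" using x0 H(1) p(2) by blast
   hence "inner x0 (fst p) < snd p" using p(3) by(auto simp:mem_hyp)
   hence "inner x (fst p) < snd p" using x p(1,2) H(1) memS by blast
   thus False using H(2) p(2) by(auto simp:mem_hyp)
  qed
  thus "x : UNIV - \<Union>\<eta>" by blast
 qed
 moreover have "convex S" unfolding S_def by(intro convex_INT convex_halfspace_lt)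
 moreover have x0S: "x0 : S" by(auto simp:memS)
 ultimately have SD: "S <= ?D" by(intro connected_component_maximal convex_connected)
 show "side_set \<eta> x0 <= closure ?D"
 proof
  fix x assume x: "x : side_set \<eta> x0"
  show "x : closure ?D"
  proof(cases "x = x0")
   case True thus ?thesis using x0D closure_subset[of ?D] True by auto
  next
   case False
   have "open_segment x0 x <= S"
   proof
    fix y assume "y : open_segment x0 x"
    then obtain t where t: "0 < t" "t < 1" "y = (1 - t) *R x0 + t *R x" by(auto simp:in_segment)
    show "y : S"
     unfolding memS
    proof(intro ballI impI)
     fix p assume p: "p : params" "hyp p : \<eta>" "inner x0 (fst p) < snd p"
     have "inner x (fst p) <= snd p" using x p by(auto simp:side_set_def)
     hence "(1 - t) * inner x0 (fst p) + t * inner x (fst p) < (1 - t) * snd p + t * snd p"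
      using t p(3) by(intro add_less_le_mono mult_strict_left_mono mult_left_mono) auto
     thus "inner y (fst p) < snd p" by(simp add:t inner_add_left algebra_simps)
    qed
   qed
   hence "closure (open_segment x0 x) <= closure ?D" using SD by(intro closure_mono) blast
   moreover have "x : closure (open_segment x0 x)" using False by simp
   ultimately show ?thesis by blast
  qed
 qed
qed

lemma cellsE:
 fixes \<eta> :: "'a::euclidean_space set set"
 assumes "\<eta> : configurations" "C : cells \<eta>"
 obtains x0 where "x0 ~: \<Union>\<eta>" "C = side_set \<eta> x0"
proof -
 obtain D where D: "D : components (UNIV - \<Union>\<eta>)" "C = closure D" using assms(2) by(auto simp:cells_def)
 then obtain x0 where x0: "x0 : UNIV - \<Union>\<eta>" "D = connected_component_set (UNIV - \<Union>\<eta>) x0"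
  by(auto elim: componentsE)
 thus ?thesis using closure_component[OF assms(1), of x0] D(2) that by auto
qed

lemma side_set_in_cells:
 assumes "\<eta> : configurations" "x0 ~: \<Union>\<eta>"
 shows "side_set \<eta> x0 : cells \<eta>"
proof -
 have "connected_component_set (UNIV - \<Union>\<eta>) x0 : components (UNIV - \<Union>\<eta>)"
  using assms(2) by(intro componentsI) simp
 thus ?thesis unfolding cells_def closure_component[OF assms, symmetric] by(rule imageI)
qed

text \<open>A hyperplane through a relative interior point \<open>z\<close> contains the whole face,
  as segments of the face can be prolonged beyond \<open>z\<close>. Conversely, for a small step
  from \<open>z\<close> along all these hyperplanes, the step and its opposite stay in the cell, and
  the face property puts both endpoints into the face. So the face is determined by \<open>z\<close>
  and the configuration.\<close>

lemma face_structure: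
 fixes \<eta> :: "'a::euclidean_space set set"
 assumes \<eta>: "\<eta> : configurations" and x0: "x0 ~: \<Union>\<eta>"
  and K: "K face_of side_set \<eta> x0" and z: "z : rel_interior K"
 defines "W \<equiv> {w. ALL p:params. hyp p : \<eta> --> z : hyp p --> inner w (fst p) = 0}"
 shows "affine hull K = (%w. z + w) ` W"
  and "K = {x. x - z : W & (ALL p:params. hyp p : \<eta> --> inner z (fst p) < snd p --> inner x (fst p) <= snd p)}"
proof -
 let ?C = "side_set \<eta> x0"
 have zK: "z : K" using z rel_interior_subset[of K] by blast
 have KC: "K <= ?C" using K by(rule face_of_imp_subset)
 have cK: "convex K" using K by(rule face_of_imp_convex)
 have zC: "z : ?C" using zK KC by blast
 have z_side: "inner z (fst p) <= snd p" if "p : params" "hyp p : \<eta>" "inner x0 (fst p) < snd p" for p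
  using zC that by(auto simp:side_set_def)
 have KW: "x - z : W" if x: "x : K" for x
  unfolding W_def
 proof(intro CollectI ballI impI)
  fix p assume p: "p : params" "hyp p : \<eta>" "z : hyp p"
  \<comment> \<open>Prolongs the segment from \<open>x\<close> beyond \<open>z\<close>; an affine
    function that is maximal on the cell at the intermediate point \<open>z\<close> cannot be
    smaller at \<open>x\<close>.\<close>
  obtain e where e: "1 < e" "(1 - e) *R x + e *R z : K"
   using convex_rel_interior_iff[OF cK] zK z x by blast
  have main: "inner x (fst q) = snd q" if q: "q : params" "hyp q : \<eta>" "z : hyp q" "inner x0 (fst q) < snd q" for q
  proof -
   have zq: "inner z (fst q) = snd q" using q(3) by(simp add:mem_hyp)
   have 1: "inner x (fst q) <= snd q" using x KC q by(auto simp:side_set_def)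
   have "inner ((1 - e) *R x + e *R z) (fst q) <= snd q" using e(2) KC q by(auto simp:side_set_def)
   hence "(1 - e) * (inner x (fst q) - snd q) <= 0" using zq by(simp add:inner_add_left algebra_simps)
   hence "0 <= inner x (fst q) - snd q" using e(1) by(simp add:mult_le_0_iff)
   thus ?thesis using 1 by simp
  qed
  have "x0 ~: hyp p" using x0 p(2) by blast
  then consider "inner x0 (fst p) < snd p" | "inner x0 (fst (- p)) < snd (- p)" by(force simp:mem_hyp)
  hence "inner x (fst p) = snd p"
  proof cases
   case 1 thus ?thesis using main[of p] p by blast
  next
   case 2 thus ?thesis using main[of "- p"] p by(simp add:mem_hyp)
  qed
  thus "inner (x - z) (fst p) = 0" using p(3) by(simp add:mem_hyp inner_diff_left)
 qed
 obtain \<delta> where \<delta>: "0 < \<delta>" "!!H. H : \<eta> ==> z ~: H ==> H Int cball z \<delta> = {}"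
  using configurations_local[OF \<eta>] by blast
 have near: "z + w : ?C" if w: "w : W" "norm w <= \<delta>" for w
  unfolding side_set_def
 proof(intro CollectI ballI impI)
  fix p assume p: "p : params" "hyp p : \<eta>" "inner x0 (fst p) < snd p"
  show "inner (z + w) (fst p) <= snd p"
  proof(cases "z : hyp p")
   case True
   hence "inner w (fst p) = 0" using w(1) p by(auto simp:W_def)
   thus ?thesis using True by(simp add:mem_hyp inner_add_left)
  next
   case False
   hence "inner z (fst p) < snd p" using z_side[OF p] by(auto simp:mem_hyp)
   moreover have "hyp p Int cball z \<delta> = {}" using \<delta>(2)[OF p(2) False] .
   moreover have "z : cball z \<delta>" "z + w : cball z \<delta>" using \<delta>(1) w(2) by(auto simp:dist_norm)
   ultimately have "inner (z + w) (fst p) < snd p"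
    using same_side_le[of "cball z \<delta>" z "z + w" p] by simp
   thus ?thesis by simp
  qed
 qed
 have sW: "subspace W"
  unfolding W_def by(auto simp:subspace_def inner_add_left)
 have near_K: "z + w : K" if w: "w : W" "norm w <= \<delta>" for w
 proof(cases "w = 0")
  case True thus ?thesis using zK by simp
 next
  case False
  have "z + w : ?C" "z + (- w) : ?C" using near[of w] near[of "- w"] w subspace_neg[OF sW] by auto
  moreover have "z : open_segment (z + w) (z + - w)"
  proof -
   have "z + w ~= z + - w"
   proof
    assume "z + w = z + - w"
    hence "2 *R w = 0" by(simp add:scaleR_2 eq_neg_iff_add_eq_0)
    thus False using False by simp
   qed
   hence mid: "midpoint (z + w) (z + - w) : open_segment (z + w) (z + - w)" by simp
   have "midpoint (z + w) (z + - w) = z" by(simp add:midpoint_def flip: scaleR_2)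
   thus ?thesis using mid by(simp only:)
  qed
  ultimately show ?thesis using face_ofD[OF K _ _ _ zK] by blast
 qed
 show ah: "affine hull K = (%w. z + w) ` W"
 proof(rule equalityI)
  have "affine ((%w. z + w) ` W)" using subspace_imp_affine[OF sW] by(metis affine_translation)
  moreover have "K <= (%w. z + w) ` W"
  proof
   fix x assume "x : K"
   hence "x - z : W" by(rule KW)
   hence "z + (x - z) : (%w. z + w) ` W" by(rule imageI)
   thus "x : (%w. z + w) ` W" by simp
  qed
  ultimately show "affine hull K <= (%w. z + w) ` W" by(simp add:hull_minimal)
 next
  show "(%w. z + w) ` W <= affine hull K"
  proof clarify
   fix w assume w: "w : W"
   show "z + w : affine hull K"
   proof(cases "w = 0")
    case True thus ?thesis using zK by(simp add:hull_inc)
   next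
    case False
    define q where "q = z + (\<delta> / norm w) *R w"
    have "q : K" unfolding q_def using w False \<delta>(1) by(intro near_K subspace_scale[OF sW]) auto
    hence "(1 - norm w / \<delta>) *R z + (norm w / \<delta>) *R q : affine hull K"
     using zK by(intro mem_affine[OF affine_affine_hull]) (auto simp:hull_inc)
    moreover have "(1 - norm w / \<delta>) *R z + (norm w / \<delta>) *R q = z + w"
     using \<delta>(1) False by(simp add:q_def algebra_simps)
    ultimately show ?thesis by simp
   qed
  qed
 qed
 show "K = {x. x - z : W & (ALL p:params. hyp p : \<eta> --> inner z (fst p) < snd p --> inner x (fst p) <= snd p)}"
  (is "K = ?R")
 proof(rule equalityI; rule subsetI)
  fix x assume x: "x : K"
  have "inner x (fst p) <= snd p" if p: "p : params" "hyp p : \<eta>" "inner z (fst p) < snd p" for p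
  proof -
   \<comment> \<open>If \<open>x0\<close> were on the other side, the whole cell and with it
     \<open>z\<close> would satisfy the reversed inequality.\<close>
   have "~ inner x0 (fst (- p)) < snd (- p)"
   proof
    assume "inner x0 (fst (- p)) < snd (- p)"
    hence "inner z (fst (- p)) <= snd (- p)" using z_side[of "- p"] p by simp
    thus False using p(3) by simp
   qed
   moreover have "x0 ~: hyp p" using x0 p(2) by blast
   ultimately have "inner x0 (fst p) < snd p" by(auto simp:mem_hyp)
   thus ?thesis using x KC p by(auto simp:side_set_def)
  qed
  thus "x : ?R" using KW[OF x] by blast
 next
  fix x assume x: "x : ?R"
  have "x = z + (x - z)" by simp
  hence "x : affine hull K" unfolding ah using x by blast
  moreover have "x : ?C"
   unfolding side_set_def
  proof(intro CollectI ballI impI)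
   fix p assume p: "p : params" "hyp p : \<eta>" "inner x0 (fst p) < snd p"
   show "inner x (fst p) <= snd p"
   proof(cases "z : hyp p")
    case True
    hence "inner (x - z) (fst p) = 0" using x p by(auto simp:W_def)
    thus ?thesis using True by(simp add:mem_hyp inner_diff_left)
   next
    case False
    hence "inner z (fst p) < snd p" using z_side[OF p] by(auto simp:mem_hyp)
    thus ?thesis using x p by blast
   qed
  qed
  ultimately show "x : K" using face_of_imp_eq_affine_Int[OF convex_side_set K] by blast
 qed
qed

section \<open>Tangent tuples of hyperplanes\<close>

text \<open>The last column of the matrix in \<open>Dk\<close>. The value 0 expresses that the
  hyperplanes from \<open>k + 2\<close> on pass through the centre.\<close>

definition rho :: "nat => (nat => 'a::euclidean_space) => nat => real" where
 "rho k u i = (if i <= k + 1 then norm (orth_proj (Lsub k u) (u i)) else 0)"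

definition normals :: "(nat => 'a::euclidean_space \<times> real) => nat => 'a" where
 "normals p = (\<lambda>i\<in>II('a). fst (p i))"

definition tangent :: "nat => (nat => 'a::euclidean_space \<times> real) => 'a => real => bool" where
 "tangent k p z r <-> normals p : tuples k & 0 < r &
   (ALL i:II('a). snd (p i) = inner z (fst (p i)) + r * rho k (normals p) i)"

definition no_hit :: "'a::euclidean_space set set => (nat => 'a \<times> real) => 'a set => bool" where
 "no_hit \<eta> p T <-> (ALL H:\<eta>. H ~: (%i. hyp (p i)) ` II('a) --> H Int T = {})"

text \<open>A suitable cell is found by a small step from \<open>z\<close> to the lower side of the
  last \<open>DIM('a) - k\<close> hyperplanes. These support that cell, and intersecting it with all
  of them gives the simplex.\<close>

lemma simplex_is_face:
 fixes \<eta> :: "'a::euclidean_space set set"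
 assumes k: "k : {1..DIM('a)}" and \<eta>: "\<eta> : configurations"
  and p: "p : tup II('a) \<eta>" and t: "tangent k p z r"
  and nh: "no_hit \<eta> p (Tk_at k (normals p) z r)"
 shows "Tk_at k (normals p) z r : tessellation_faces k \<eta>"
proof -
 interpret face_data k "normals p" using k t by(intro face_dataI) (auto simp:tangent_def)
 let ?T = "Tk_at k (normals p) z r" and ?u = "normals p"
 have r: "0 < r" using t by(simp add:tangent_def)
 have pi: "p i : params" "hyp (p i) : \<eta>" "fst (p i) = ?u i" if "i : II('a)" for i
  using p that by(auto simp:tup_def PiE_iff normals_def)
 have snd1: "snd (p i) = inner z (?u i) + r * norm (v i)" if "i : I1" for i
  using t that k pi(3)[of i] by(simp add:tangent_def rho_def)
 have snd2: "snd (p i) = inner z (?u i)" if "i : {k+2..DIM('a)+1}" for i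
  using t that k pi(3)[of i] by(simp add:tangent_def rho_def)
 have zT: "z : ?T" by(rule ball_subset_simp[OF r]) (use r in \<open>auto simp: subspace_0[OF subspace_Lsub]\<close>)
 obtain \<delta> where \<delta>: "0 < \<delta>" "!!H. H : \<eta> ==> z ~: H ==> H Int cball z \<delta> = {}"
  using configurations_local[OF \<eta>] by blast
 \<comment> \<open>The dual vectors provide a direction that has product -1 with each of these
   normals.\<close>
 define w where "w = (\<Sum>i\<in>{k+2..DIM('a)+1}. - dual_vec ?u {k+2..DIM('a)+1} i)"
 have ind2: "indep_fam ?u {k+2..DIM('a)+1}" using k by(intro general_position_indep_fam[OF gp]) auto
 have w: "inner w (?u i) = - 1" if i: "i : {k+2..DIM('a)+1}" for i
 proof -
  have "inner w (?u i) = (\<Sum>j\<in>{k+2..DIM('a)+1}. if j = i then - 1 else 0)"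
   unfolding w_def inner_sum_left using inner_dual_vec[OF _ ind2 _ i] by(intro sum.cong) auto
  thus ?thesis using i by(simp add:sum.delta)
 qed
 \<comment> \<open>The 1 in the denominator covers \<open>w = 0\<close>, which occurs for
   \<open>k = DIM('a)\<close>.\<close>
 define x0 where "x0 = z + (\<delta> / (norm w + 1)) *R w"
 have x0b: "x0 : cball z \<delta>"
 proof -
  have np: "0 < norm w + 1" by(simp add:add_nonneg_pos)
  have "norm w * \<delta> <= \<delta> * (norm w + 1)" using \<delta>(1) by(simp add:algebra_simps)
  thus ?thesis using \<delta>(1) np by(simp add:x0_def dist_norm pos_divide_le_eq abs_of_pos mult.commute)
 qed
 have zb: "z : cball z \<delta>" using \<delta>(1) by simp
 \<comment> \<open>The simplex contains \<open>z\<close>, so a hyperplane through \<open>z\<close>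
   belongs to the tuple; the first \<open>k + 1\<close> of the tuple have positive distance from
   \<open>z\<close>.\<close>
 have thru: "EX i:{k+2..DIM('a)+1}. H = hyp (p i)" if H: "H : \<eta>" "z : H" for H
 proof -
  have "H Int ?T ~= {}" using H zT by blast
  then obtain i where i: "i : II('a)" "H = hyp (p i)" using nh H(1) unfolding no_hit_def by blast
  have "i ~: I1"
  proof
   assume i1: "i : I1"
   hence "r * norm (v i) > 0" using r v_nonzero by simp
   moreover have "inner z (?u i) = snd (p i)" using H(2) i pi(3)[OF i(1)] by(simp add:mem_hyp)
   ultimately show False using snd1[OF i1] by simp
  qed
  thus ?thesis using i by auto
 qed
 have x0s: "inner x0 (?u i) < snd (p i)" if i: "i : II('a)" for i
 proof(cases "i : I1")
  case True
  hence lt: "inner z (fst (p i)) < snd (p i)" using snd1[OF True] r v_nonzero[OF True] pi(3)[OF i] by simp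
  hence "z ~: hyp (p i)" by(simp add:mem_hyp)
  hence "inner x0 (fst (p i)) < snd (p i)"
   using same_side_le[of "cball z \<delta>" z x0 "p i"] \<delta>(2)[OF pi(2)[OF i]] zb x0b lt by simp
  thus ?thesis using pi(3)[OF i] by simp
 next
  case False
  hence i2: "i : {k+2..DIM('a)+1}" using i by auto
  have "\<delta> / (norm w + 1) > 0" using \<delta>(1) by(simp add:add_nonneg_pos)
  thus ?thesis using snd2[OF i2] w[OF i2] by(simp add:x0_def inner_add_left)
 qed
 have x0: "x0 ~: \<Union>\<eta>"
 proof
  assume "x0 : \<Union>\<eta>"
  then obtain H where H: "H : \<eta>" "x0 : H" by blast
  show False
  proof(cases "z : H")
   case True
   then obtain i where i: "i : {k+2..DIM('a)+1}" "H = hyp (p i)" using thru H(1) by blast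
   hence "i : II('a)" by auto
   thus False using x0s[of i] H(2) i pi(3)[of i] by(simp add:mem_hyp)
  next
   case False thus False using \<delta>(2)[OF H(1)] H(2) x0b by blast
  qed
 qed
 let ?C = "side_set \<eta> x0"
 have TC: "?T <= ?C"
 proof
  fix x assume x: "x : ?T"
  show "x : ?C"
   unfolding side_set_def
  proof(intro CollectI ballI impI)
   fix q assume q: "q : params" "hyp q : \<eta>" "inner x0 (fst q) < snd q"
   show "inner x (fst q) <= snd q"
   proof(cases "hyp q : (%i. hyp (p i)) ` II('a)")
    case True
    then obtain i where i: "i : II('a)" "hyp (p i) = hyp q" by auto
    hence "q = p i | q = - p i" using hyp_eq_iff[OF pi(1)[OF i(1)] q(1)] by blast
    moreover have "q ~= - p i" using q(3) x0s[OF i(1)] pi(3)[OF i(1)] by auto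
    ultimately have qp: "q = p i" by blast
    show ?thesis
    proof(cases "i : I1")
     case True
     thus ?thesis using x snd1[OF True] pi(3)[OF i(1)] unfolding mem_simp_u[OF r] qp by auto
    next
     case False
     hence i2: "i : {k+2..DIM('a)+1}" using i by auto
     hence "inner (x - z) (?u i) = 0" using x unfolding mem_simp_u[OF r] mem_Lsub by blast
     thus ?thesis using snd2[OF i2] pi(3)[OF i(1)] qp by(simp add:inner_diff_left)
    qed
   next
    case False
    hence d: "hyp q Int ?T = {}" using nh q(2) by(auto simp:no_hit_def)
    hence "z ~: hyp q" using zT by blast
    hence "hyp q Int cball z \<delta> = {}" using \<delta>(2)[OF q(2)] by blast
    hence "inner z (fst q) < snd q" using same_side_le[of "cball z \<delta>" x0 z q] zb x0b q(3) by simp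
    moreover have "connected ?T" unfolding simp_eq_convex_hull by(intro convex_connected) (rule convex_convex_hull)
    ultimately have "inner x (fst q) < snd q" using same_side_le[of ?T z x q] zT x d by blast
    thus ?thesis by simp
   qed
  qed
 qed
 have CT: "x : ?T" if x: "x : ?C" "!!i. i : {k+2..DIM('a)+1} ==> inner x (?u i) = snd (p i)" for x
  unfolding mem_simp_u[OF r]
 proof
  show "x - z : L" unfolding mem_Lsub using x(2) snd2 by(auto simp:inner_diff_left)
  show "ALL i:I1. inner x (?u i) <= inner z (?u i) + r * norm (v i)"
  proof
   fix i assume i: "i : I1"
   hence i': "i : II('a)" using k by auto
   have "inner x (fst (p i)) <= snd (p i)"
    using x(1) pi[OF i'] x0s[OF i'] by(auto simp:side_set_def)
   thus "inner x (?u i) <= inner z (?u i) + r * norm (v i)" using snd1[OF i] pi(3)[OF i'] by simp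
  qed
 qed
 \<comment> \<open>The cell itself is put into the family because no supporting hyperplane is left
   when \<open>k = DIM('a)\<close>.\<close>
 have "?T = \<Inter>(insert ?C ((%i. ?C Int {x. inner (?u i) x = snd (p i)}) ` {k+2..DIM('a)+1}))" (is "_ = ?R")
 proof(rule equalityI; rule subsetI)
  fix x assume x: "x : ?T"
  have "inner (?u i) x = snd (p i)" if i: "i : {k+2..DIM('a)+1}" for i
  proof -
   have "inner (x - z) (?u i) = 0" using x i unfolding mem_simp_u[OF r] mem_Lsub by blast
   hence "inner x (?u i) = inner z (?u i)" by(simp add:inner_diff_left)
   thus ?thesis using snd2[OF i] inner_commute[of "?u i" x] by simp
  qed
  thus "x : ?R" using x TC by auto
 next
  fix x assume "x : ?R"
  thus "x : ?T" by(intro CT) (auto simp:inner_commute)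
 qed
 moreover have "?R face_of ?C"
 proof(rule face_of_Inter)
  fix Q assume "Q : insert ?C ((%i. ?C Int {x. inner (?u i) x = snd (p i)}) ` {k+2..DIM('a)+1})"
  then consider "Q = ?C" | i where "i : {k+2..DIM('a)+1}" "Q = ?C Int {x. inner (?u i) x = snd (p i)}" by blast
  thus "Q face_of ?C"
  proof cases
   case 1 thus ?thesis using face_of_refl[OF convex_side_set] by simp
  next
   case 2
   hence i': "i : II('a)" by auto
   have "inner (?u i) x <= snd (p i)" if "x : ?C" for x
    using that pi[OF i'] x0s[OF i'] unfolding side_set_def by(auto simp:inner_commute)
   thus ?thesis unfolding 2(2) by(rule face_of_Int_supporting_hyperplane_le[OF convex_side_set])
  qed
 qed simp
 ultimately have "?T face_of ?C" by simp
 moreover have "?C : cells \<eta>" by(rule side_set_in_cells[OF \<eta> x0])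
 ultimately show ?thesis unfolding tessellation_faces_def using aff_dim_simp[OF r] by blast
qed

section \<open>Inballs and their contact hyperplanes\<close>

lemma convex_same_side_le:
 assumes "connected T" "z : T" "x : T" "inner z (fst p) < snd p" "hyp p Int T = {}"
 shows "inner x (fst p) <= snd p"
 using same_side_le[OF assms] by simp

text \<open>The first-order optimality condition for the largest inscribed ball: its center cannot be
 moved away from all tangent hyperplanes at once. Uniqueness of the ball excludes even motions
 along some of them.\<close>

lemma unique_inball_contacts:
 fixes \<eta> :: "'a::euclidean_space set set" and f :: "'a set => 'a" and s :: "'a set => real"
 assumes \<eta>: "\<eta> : configurations" and L: "subspace L"
  and uniq: "!!y. inball K y r ==> y = z" and ib: "inball K z r"
  and aff: "affine hull K = (%w. z + w) ` L"
  and K: "K = {x. x - z : L & (ALL H:\<eta>'. inner x (f H) <= s H)}"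
  and \<eta>': "\<eta>' <= \<eta>"
  and rep: "!!H. H : \<eta>' ==> (f H, s H) : params & hyp (f H, s H) = H & inner z (f H) < s H"
  and v0: "!!H. H : \<eta>' ==> orth_proj L (f H) ~= 0"
 defines "A \<equiv> {H : \<eta>'. inner z (f H) + r * norm (orth_proj L (f H)) = s H}"
 shows "finite A"
  and "!!H. H : \<eta>' ==> inner z (f H) + r * norm (orth_proj L (f H)) <= s H"
  and "!!w. w : L ==> (!!H. H : A ==> inner w (orth_proj L (f H)) <= 0) ==> w = 0"
proof -
 define v where "v H = orth_proj L (f H)" for H
 have vL: "v H : L" for H unfolding v_def by(rule orth_proj_props(1)[OF L])
 have iv: "inner w (v H) = inner w (f H)" if "w : L" for w H unfolding v_def by(rule inner_orth_proj[OF L that])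
 have vpos: "0 < norm (v H)" if "H : \<eta>'" for H using v0[OF that] by(simp add:v_def)
 have vle: "norm (v H) <= 1" if "H : \<eta>'" for H
  using norm_orth_proj_le[OF L, of "f H"] rep[OF that] by(simp add:v_def params_def)
 have r: "0 < r" and zK: "z : K" and ball: "cball z r Int affine hull K <= K"
  and rmax: "!!y t. inscribed_ball K y t ==> t <= r"
  using ib by(auto simp:inball_def inscribed_ball_def)
 \<comment> \<open>The point where the ball reaches farthest towards \<open>H\<close>.\<close>
 define c where "c H = z + (r / norm (v H)) *R v H" for H
 have cH: "c H : cball z r" "inner (c H) (f H) = inner z (f H) + r * norm (v H)" if "H : \<eta>'" for H
 proof -
  show "c H : cball z r" using r vpos[OF that] by(simp add:c_def dist_norm)
  have "inner (v H) (f H) = norm (v H) * norm (v H)"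
   using iv[OF vL, of H H] by(simp add:dot_square_norm power2_eq_square)
  thus "inner (c H) (f H) = inner z (f H) + r * norm (v H)"
   using vpos[OF that] by(simp add:c_def inner_add_left)
 qed
 have le: "inner z (f H) + r * norm (v H) <= s H" if H: "H : \<eta>'" for H
 proof -
  have "c H : affine hull K" unfolding aff c_def by(intro imageI subspace_scale[OF L vL])
  hence "c H : K" using cH(1)[OF H] ball by blast
  hence "inner (c H) (f H) <= s H" using K H by blast
  thus ?thesis using cH(2)[OF H] by simp
 qed
 thus "!!H. H : \<eta>' ==> inner z (f H) + r * norm (orth_proj L (f H)) <= s H" by(simp add:v_def)
 have "A <= {H : \<eta>. H Int cball z r ~= {}}"
 proof
  fix H assume "H : A"
  hence H: "H : \<eta>'" "inner z (f H) + r * norm (v H) = s H" by(auto simp:A_def v_def)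
  hence "c H : hyp (f H, s H)" using cH(2) by(simp add:mem_hyp)
  hence "c H : H" using rep[OF H(1)] by simp
  thus "H : {H : \<eta>. H Int cball z r ~= {}}" using cH(1)[OF H(1)] H(1) \<eta>' by blast
 qed
 thus "finite A" using configurations_finite_hits[OF \<eta> compact_cball[of z r]] finite_subset by blast
 fix w assume w: "w : L" and wA: "!!H. H : A ==> inner w (orth_proj L (f H)) <= 0"
 \<comment> \<open>A shift of length at most 1 can conflict only with hyperplanes that meet the ball
   of radius \<open>r + 1\<close>. Those among them that are no contacts are finite in number and
   have positive slack.\<close>
 define B where "B = {H : \<eta>. H Int cball z (r + 1) ~= {}} Int (\<eta>' - A)"
 have fB: "finite B" unfolding B_def using configurations_finite_hits[OF \<eta> compact_cball[of z "r + 1"]] by blast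
 define slack where "slack H = s H - inner z (f H) - r * norm (v H)" for H
 have slack: "0 < slack H" if "H : B" for H
  using le[of H] that by(auto simp:slack_def B_def A_def v_def)
 \<comment> \<open>The step \<open>t *R w\<close> is no longer than 1 and than any slack in
   \<open>B\<close>. Contacts impose no bound, as \<open>w\<close> does not move towards
   them.\<close>
 define t where "t = Min (insert 1 (slack ` B)) / (norm w + 1)"
 have np: "0 < norm w + 1" by(simp add:add_nonneg_pos)
 have m0: "0 < Min (insert 1 (slack ` B))" using fB slack by(subst Min_gr_iff) auto
 have t0: "0 < t" unfolding t_def using m0 np by simp
 have tw: "t * norm w <= Min (insert 1 (slack ` B))"
 proof -
  have "t * norm w <= t * (norm w + 1)" using t0 by(intro mult_left_mono) auto
  also have "... = Min (insert 1 (slack ` B))" unfolding t_def using np by simp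
  finally show ?thesis .
 qed
 have tw1: "t * norm w <= 1"
  by(rule order_trans[OF tw]) (use fB in \<open>auto intro: Min_le\<close>)
 have tws: "t * norm w <= slack H" if "H : B" for H
  by(rule order_trans[OF tw]) (use fB that in \<open>auto intro: Min_le\<close>)
 have inK: "z + t *R w + b : K" if b: "b : L" "norm b <= r" for b
 proof -
  let ?y = "z + t *R w + b"
  have yz: "?y - z = t *R w + b" by simp
  have "?y - z : L" unfolding yz by(intro subspace_add subspace_scale L w b(1))
  moreover have "inner ?y (f H) <= s H" if H: "H : \<eta>'" for H
  proof -
   have "inner b (v H) <= norm b * norm (v H)" by(rule norm_cauchy_schwarz)
   also have "... <= r * norm (v H)" using b(2) by(intro mult_right_mono) auto
   finally have bv: "inner b (v H) <= r * norm (v H)" .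
   have ey: "inner ?y (f H) = inner z (f H) + t * inner w (v H) + inner b (v H)"
    using iv[OF w] iv[OF b(1)] by(simp add:inner_add_left)
   show ?thesis
   proof(cases "H : A")
    case True
    hence "t * inner w (v H) <= 0" using wA t0 by(simp add:v_def mult_nonneg_nonpos)
    thus ?thesis using ey bv le[OF H] by linarith
   next
    case nA: False
    show ?thesis
    proof(cases "H : B")
     case True
     have "inner w (v H) <= norm w * norm (v H)" by(rule norm_cauchy_schwarz)
     also have "... <= norm w" using vle[OF H] by(simp add:mult_left_le)
     finally have "t * inner w (v H) <= t * norm w" using t0 by simp
     hence "t * inner w (v H) <= slack H" using tws[OF True] by linarith
     thus ?thesis using ey bv by(simp add:slack_def)
    next
     case False
     hence "H Int cball z (r + 1) = {}" using H nA \<eta>' by(auto simp:B_def)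
     moreover have "?y : cball z (r + 1)"
     proof -
      have "norm (t *R w + b) <= norm (t *R w) + norm b" by(rule norm_triangle_ineq)
      also have "... <= 1 + r" using tw1 b(2) t0 by simp
      finally show ?thesis using norm_minus_commute[of z ?y] unfolding mem_cball dist_norm yz by linarith
     qed
     moreover have "z : cball z (r + 1)" using r by simp
     ultimately show ?thesis
      using convex_same_side_le[of "cball z (r + 1)" z ?y "(f H, s H)"] rep[OF H] by simp
    qed
   qed
  qed
  ultimately show ?thesis using K by blast
 qed
 have "inscribed_ball K (z + t *R w) r"
  unfolding inscribed_ball_def
 proof(intro conjI r subsetI)
  show "z + t *R w : K" using inK[of 0] r subspace_0[OF L] by simp
  fix y assume y: "y : cball (z + t *R w) r Int affine hull K"
  then obtain x where x: "x : L" "y = z + x" unfolding aff by blast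
  have "z + t *R w + (x - t *R w) : K"
  proof(rule inK)
   show "x - t *R w : L" by(intro subspace_diff subspace_scale L x(1) w)
   show "norm (x - t *R w) <= r" using y x(2) by(simp add:dist_norm norm_minus_commute)
  qed
  thus "y : K" using x(2) by simp
 qed
 \<comment> \<open>The shifted ball has the maximal radius too, so uniqueness identifies the
   centres.\<close>
 hence "inball K (z + t *R w) r" using rmax by(auto simp:inball_def)
 hence "z + t *R w = z" by(rule uniq)
 thus "w = 0" using t0 by simp
qed

text \<open>The contact normals of a unique inball have the origin in their convex hull; in general
 position Caratheodory's theorem then selects exactly \<open>dim L + 1\<close> of them.\<close>

lemma contacts_pos_dependency:
 fixes v :: "'h => 'a::euclidean_space"
 assumes A: "finite A" and L: "subspace L" "0 < dim L" and vL: "!!H. H : A ==> v H : L"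
  and opt: "!!w. w : L ==> (!!H. H : A ==> inner w (v H) <= 0) ==> w = 0"
 shows "EX A' c. A' <= A & A' ~= {} & card A' <= dim L + 1 & (ALL H:A'. 0 < c H) &
  (\<Sum>H\<in>A'. c H *R v H) = 0"
proof -
 have Ane: "A ~= {}"
 proof
  assume "A = {}"
  hence "L = {0}" using opt subspace_0[OF L(1)] by blast
  thus False using L(2) by simp
 qed
 have "0 : convex hull (v ` A)"
 proof(rule ccontr)
  assume "0 ~: convex hull (v ` A)"
  moreover have "closed (convex hull (v ` A))"
   using A by(intro compact_imp_closed compact_convex_hull finite_imp_compact) auto
  ultimately obtain a b where ab: "a ~= 0" "0 < b" "!!x. x : convex hull (v ` A) ==> b < inner a x"
   using separating_hyperplane_closed_0[OF convex_convex_hull] by metis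
  \<comment> \<open>A hyperplane separating 0 from the contact normals yields a direction leaving
    all contacts at once; only its component in \<open>L\<close> is a motion within the affine
    hull.\<close>
  define w where "w = - orth_proj L a"
  have wL: "w : L" unfolding w_def by(intro subspace_neg L orth_proj_props)
  have neg: "inner w (v H) < 0" if "H : A" for H
  proof -
   have "inner (v H) (orth_proj L a) = inner (v H) a" by(rule inner_orth_proj[OF L(1) vL[OF that]])
   moreover have "0 < inner a (v H)" using ab(2) ab(3)[of "v H"] that by(simp add:hull_inc)
   ultimately show ?thesis by(simp add:w_def inner_commute)
  qed
  have "w = 0" using neg by(intro opt wL) (auto simp:less_imp_le)
  thus False using neg Ane by auto
 qed
 then obtain S c where S: "finite S" "S <= v ` A" "int (card S) <= aff_dim (v ` A) + 1"
  "ALL x:S. 0 <= c x" "sum c S = 1" "(\<Sum>x\<in>S. c x *R x) = 0"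
  unfolding convex_hull_caratheodory_aff_dim by blast
 have "aff_dim (v ` A) <= aff_dim L" using vL by(intro aff_dim_subset) auto
 hence cS: "card S <= dim L + 1" using S(3) aff_dim_subspace[OF L(1)] by simp
 \<comment> \<open>Dropping zero coefficients makes the dependency strictly positive; then one
   hyperplane is selected for each remaining normal.\<close>
 define S' where "S' = {x : S. 0 < c x}"
 have "S' <= v ` A" using S(2) by(auto simp:S'_def)
 then obtain A' where A': "A' <= A" "inj_on v A'" "S' = v ` A'" using subset_image_inj by metis
 have fS': "finite S'" using S(1) by(simp add:S'_def)
 show ?thesis
 proof(intro exI[of _ A'] exI[of _ "%H. c (v H)"] conjI ballI)
  show "A' <= A" by fact
  show "A' ~= {}"
  proof
   assume "A' = {}"
   hence "S' = {}" using A'(3) by simp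
   hence "!!x. x : S ==> c x = 0" using S(4) by(force simp:S'_def)
   thus False using S(5) by simp
  qed
  have "card A' = card S'" using A' by(simp add:card_image)
  also have "... <= card S" using S(1) by(intro card_mono) (auto simp:S'_def)
  finally show "card A' <= dim L + 1" using cS by simp
  show "0 < c (v H)" if "H : A'" for H using that A'(3) by(auto simp:S'_def)
  have "(\<Sum>H\<in>A'. c (v H) *R v H) = (\<Sum>x\<in>S'. c x *R x)"
   unfolding A'(3) by(simp add:sum.reindex[OF A'(2)])
  also have "... = (\<Sum>x\<in>S. c x *R x)"
   using S(1,4) by(intro sum.mono_neutral_left) (auto simp:S'_def order_le_less)
  finally show "(\<Sum>H\<in>A'. c (v H) *R v H) = 0" using S(6) by simp
 qed
qed

text \<open>The first \<open>k\<close> projections form a basis of \<open>L\<close>. Adding a large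
  multiple of the positive dependency to an expansion in this basis makes all coefficients
  nonnegative.\<close>

lemma (in gp_data) tuples_if_pos_dependency:
 assumes "u : II('a) \<rightarrow>\<^sub>E sphere 0 1"
  and c: "!!i. i : I1 ==> 0 < c i" "(\<Sum>i\<in>I1. c i *R v i) = 0"
 shows "u : tuples k"
 unfolding tuples_def
proof(intro CollectI conjI ballI)
 fix x assume x: "x : L"
 let ?J = "{1..k}"
 have ind: "indep_fam v ?J" by(rule v_indep) auto
 have "span (v ` ?J) = L"
 proof(rule subspace_dim_equal)
  show "span (v ` ?J) <= L" using v_in_L by(intro span_minimal subspace_Lsub) auto
  show "dim L <= dim (span (v ` ?J))" using indep_fam_dim_span[OF ind] dim_L by simp
 qed (auto intro:subspace_Lsub)
 then obtain a where a: "x = (\<Sum>i\<in>?J. a i *R v i)" using indep_fam_span_sum[OF ind, of x] x by auto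
 \<comment> \<open>Large enough for \<open>l * c i\<close> to outweigh every negative
   \<open>a i\<close>.\<close>
 define l where "l = Max ((%i. \<bar>a i\<bar> / c i) ` ?J)"
 have l: "- a i <= l * c i" if "i : ?J" for i
 proof -
  have "\<bar>a i\<bar> / c i <= l" unfolding l_def using that by(intro Max_ge) auto
  hence "\<bar>a i\<bar> <= l * c i" using c(1)[of i] that by(simp add:pos_divide_le_eq)
  thus ?thesis by linarith
 qed
 have l0: "0 <= l"
 proof -
  have "1 : ?J" using k by auto
  hence "\<bar>a 1\<bar> / c 1 <= l" unfolding l_def by(intro Max_ge) auto
  moreover have "0 <= \<bar>a 1\<bar> / c 1" using c(1)[of 1] by simp
  ultimately show ?thesis by linarith
 qed
 let ?b = "%i. (if i : ?J then a i else 0) + l * c i"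
 show "EX c. (ALL j:I1. 0 <= c j) & x = (\<Sum>j\<in>I1. c j *R v j)"
 proof(intro exI[of _ ?b] conjI ballI)
  fix j assume j: "j : I1"
  show "0 <= ?b j" using l[of j] l0 c(1)[OF j] by auto
 next
  have "(\<Sum>j\<in>I1. ?b j *R v j) = (\<Sum>j\<in>I1. (if j : ?J then a j else 0) *R v j) + l *R (\<Sum>j\<in>I1. c j *R v j)"
   by(simp add:scaleR_add_left sum.distrib scaleR_sum_right)
  also have "(\<Sum>j\<in>I1. (if j : ?J then a j else 0) *R v j) = (\<Sum>j\<in>?J. a j *R v j)"
   by(intro sum.mono_neutral_cong_right) auto
  finally show "x = (\<Sum>j\<in>I1. ?b j *R v j)" using a c(2) by simp
 qed
qed (use assms gp in auto)

lemma unique_inballE: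
 assumes "K : unique_inball_polytopes k"
 obtains z r where "inball K z r" "!!y t. inball K y t ==> y = z & t = r" "incenter K = z"
proof -
 have "\<exists>!a. case a of (z, r) => inball K z r" using assms by(simp add:unique_inball_polytopes_def)
 then obtain a where a: "case a of (z, r) => inball K z r" "ALL b. (case b of (z, r) => inball K z r) --> b = a"
  by(rule ex1E) blast
 obtain z r where azr: "a = (z, r)" by(cases a)
 have 1: "inball K z r" using a(1) azr by simp
 have 2: "y = z & t = r" if "inball K y t" for y t
  using a(2)[rule_format, of "(y, t)"] that azr by simp
 have "incenter K = z" unfolding incenter_def using 1 2 by(intro the_equality) blast+
 thus ?thesis using 1 2 that by blast
qed

text \<open>By genericity exactly \<open>DIM('a) - k\<close> hyperplanes pass through the incenter.
  At most \<open>k + 1\<close> contacts carry a positive dependency, and \<open>k\<close> or fewer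
  would have independent projections, so there are exactly \<open>k + 1\<close>. Their half-spaces
  alone cut out the simplex; if nothing else hits it, the other hyperplanes impose no
  restriction.\<close>

theorem face_has_tangent_tuple:
 fixes \<eta> :: "'a::euclidean_space set set"
 assumes k: "k : {1..DIM('a)}" and \<eta>: "\<eta> : configurations" and gen: "generic \<eta>"
  and K: "K : tessellation_faces k \<eta>" "K : unique_inball_polytopes k"
 obtains p r where "p : tup II('a) \<eta>" "tangent k p (incenter K) r"
  "cball (incenter K) r Int (%w. incenter K + w) ` Lsub k (normals p) <= K"
  "no_hit \<eta> p (Tk_at k (normals p) (incenter K) r) ==> K = Tk_at k (normals p) (incenter K) r"
proof -
 obtain z r where zr: "inball K z r" "!!y t. inball K y t ==> y = z & t = r" and zI: "incenter K = z"
  by(rule unique_inballE[OF K(2)]) blast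
 have r: "0 < r" and zK: "z : K" and ball: "cball z r Int affine hull K <= K"
  using zr(1) by(auto simp:inball_def inscribed_ball_def)
 have zrel: "z : rel_interior K" using zK ball r by(auto simp:mem_rel_interior_cball)
 obtain C where C: "C : cells \<eta>" "K face_of C" "aff_dim K = int k" using K(1) by(auto simp:tessellation_faces_def)
 obtain x0 where x0: "x0 ~: \<Union>\<eta>" "C = side_set \<eta> x0" by(rule cellsE[OF \<eta> C(1)])
 have "ALL H:\<eta>. EX p. p : params & H = hyp p & inner z (fst p) <= snd p"
  using configurations_rep[OF \<eta>] by metis
 then obtain rep where rep: "!!H. H : \<eta> ==> rep H : params & H = hyp (rep H) & inner z (fst (rep H)) <= snd (rep H)"
  by metis
 define f where "f H = fst (rep H)" for H
 define s where "s H = snd (rep H)" for H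
 define N where "N = {H : \<eta>. z : H}"
 define \<eta>' where "\<eta>' = \<eta> - N"
 define W where "W = {w. ALL p:params. hyp p : \<eta> --> z : hyp p --> inner w (fst p) = 0}"
 note fs = face_structure[OF \<eta> x0(1) C(2)[unfolded x0(2)] zrel, folded W_def]
 have rep': "p = rep H | p = - rep H" if "H : \<eta>" "p : params" "hyp p = H" for p H
  using hyp_eq_iff[of "rep H" p] rep[OF that(1)] that by metis
 have fin_N: "finite N"
 proof -
  have "N <= {H : \<eta>. H Int {z} ~= {}}" by(auto simp:N_def)
  thus ?thesis using configurations_finite_hits[OF \<eta>, of "{z}"] finite_subset by auto
 qed
 have W: "W = orthogonal_comp (span (f ` N))"
 proof(rule equalityI; rule subsetI)
  fix w assume "w : W"
  thus "w : orthogonal_comp (span (f ` N))"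
   unfolding mem_orthogonal_comp_span W_def f_def N_def using rep by auto
 next
  fix w assume w: "w : orthogonal_comp (span (f ` N))"
  show "w : W"
   unfolding W_def
  proof(intro CollectI ballI impI)
   fix p assume p: "p : params" "hyp p : \<eta>" "z : hyp p"
   hence "inner w (f (hyp p)) = 0" using w by(auto simp:mem_orthogonal_comp_span N_def)
   thus "inner w (fst p) = 0" using rep'[OF p(2,1) refl] by(auto simp:f_def) (metis fst_uminus inner_minus_right neg_0_equal_iff_equal)
  qed
 qed
 have sW: "subspace W" unfolding W by(rule subspace_orthogonal_comp)
 have dW: "dim W = k"
  using C(3) aff_dim_affine_hull[of K] unfolding fs(1) aff_dim_translation_eq aff_dim_subspace[OF sW] by simp
 have indep: "indep_fam f J" if "finite J" "card J <= DIM('a)" "J <= \<eta>" for J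
  unfolding f_def
 proof(rule genericD[OF gen that(1,2)])
  show "rep i : params & hyp (rep i) : \<eta>" if "i : J" for i using rep[of i] that \<open>J \<subseteq> \<eta>\<close> by auto
  show "inj_on (%i. hyp (rep i)) J" using rep that(3) by(intro inj_onI) (metis subsetD)
 qed
 have N\<eta>: "N <= \<eta>" by(auto simp:N_def)
 have card_N: "card N = DIM('a) - k"
 proof -
  have dims: "dim W + dim (span (f ` N)) = DIM('a)" unfolding W by(rule dim_orthogonal_comp) simp
  \<comment> \<open>Genericity speaks of at most \<open>DIM('a)\<close> hyperplanes, so a larger
    \<open>N\<close> is first refuted by a subset of that size.\<close>
  have "card N <= DIM('a)"
  proof(rule ccontr)
   assume "~ card N <= DIM('a)"
   then obtain N' where N': "N' <= N" "card N' = DIM('a)" "finite N'"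
    using obtain_subset_with_card_n[of "DIM('a)" N] by auto
   hence "indep_fam f N'" using N\<eta> by(intro indep) auto
   hence "dim (span (f ` N')) = DIM('a)" using N' by(simp add:indep_fam_dim_span del:dim_span)
   moreover have "dim (span (f ` N')) <= dim (span (f ` N))" using N'(1) by(intro dim_subset span_mono) auto
   ultimately show False using dims dW k by simp
  qed
  hence "indep_fam f N" using fin_N N\<eta> by(intro indep)
  hence "dim (span (f ` N)) = card N" using fin_N by(rule indep_fam_dim_span)
  thus ?thesis using dims dW by simp
 qed
 have r': "(f H, s H) : params & hyp (f H, s H) = H & inner z (f H) < s H" if "H : \<eta>'" for H
 proof -
  have H: "H : \<eta>" "z ~: H" using that by(auto simp:\<eta>'_def N_def)
  have "inner z (f H) ~= s H" using H rep[OF H(1)] mem_hyp[of z "rep H"] by(auto simp:f_def s_def)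
  thus ?thesis using rep[OF H(1)] by(auto simp:f_def s_def)
 qed
 have K_eq: "K = {x. x - z : W & (ALL H:\<eta>'. inner x (f H) <= s H)}"
 proof -
  have "(ALL p:params. hyp p : \<eta> --> inner z (fst p) < snd p --> inner x (fst p) <= snd p) <->
   (ALL H:\<eta>'. inner x (f H) <= s H)" for x
  proof
   assume l: "ALL p:params. hyp p : \<eta> --> inner z (fst p) < snd p --> inner x (fst p) <= snd p"
   show "ALL H:\<eta>'. inner x (f H) <= s H"
   proof
    fix H assume H: "H : \<eta>'"
    hence "H : \<eta>" by(simp add:\<eta>'_def)
    thus "inner x (f H) <= s H" using l[rule_format, of "(f H, s H)"] r'[OF H] by simp
   qed
  next
   assume R: "ALL H:\<eta>'. inner x (f H) <= s H"
   show "ALL p:params. hyp p : \<eta> --> inner z (fst p) < snd p --> inner x (fst p) <= snd p"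
   proof(intro ballI impI)
    fix p assume p: "p : params" "hyp p : \<eta>" "inner z (fst p) < snd p"
    hence "z ~: hyp p" by(simp add:mem_hyp)
    hence H: "hyp p : \<eta>'" using p(2) by(simp add:\<eta>'_def N_def)
    have "p ~= - rep (hyp p)"
    proof
     assume e: "p = - rep (hyp p)"
     have "fst p = - fst (rep (hyp p))" "snd p = - snd (rep (hyp p))"
      using arg_cong[OF e, of fst] arg_cong[OF e, of snd] by simp_all
     hence "inner z (fst p) = - inner z (fst (rep (hyp p)))" by simp
     thus False using p(3) rep[OF p(2)] \<open>snd p = - snd (rep (hyp p))\<close> by linarith
    qed
    hence "p = rep (hyp p)" using rep'[OF p(2,1) refl] by blast
    hence "fst p = f (hyp p)" "snd p = s (hyp p)" by(simp_all add:f_def s_def)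
    thus "inner x (fst p) <= snd p" using R H by metis
   qed
  qed
  thus ?thesis using fs(2) by simp
 qed
 define v where "v H = orth_proj W (f H)" for H
 have disj: "\<eta>' Int N = {}" by(auto simp:\<eta>'_def)
 have v_indep: "indep_fam v J" if J: "J <= \<eta>'" "finite J" "card J <= k" for J
 proof -
  have "card (J Un N) <= DIM('a)" using card_Un_le[of J N] J(3) card_N k by auto
  moreover have "J Un N <= \<eta>" using J(1) N\<eta> by(auto simp:\<eta>'_def)
  ultimately have "indep_fam f (J Un N)" using J(2) fin_N by(intro indep) auto
  thus ?thesis unfolding v_def W using J disj fin_N by(intro indep_fam_orth_proj) auto
 qed
 have v0: "v H ~= 0" if "H : \<eta>'" for H
  using v_indep[of "{H}"] indep_fam_nonzero[of v "{H}" H] that k by auto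
 define A where "A = {H : \<eta>'. inner z (f H) + r * norm (v H) = s H}"
 have \<eta>'\<eta>: "\<eta>' <= \<eta>" by(auto simp:\<eta>'_def)
 have uniq: "y = z" if "inball K y r" for y using zr(2)[OF that] by blast
 note contacts = unique_inball_contacts[OF \<eta> sW uniq zr(1) fs(1) K_eq \<eta>'\<eta> r' v0[unfolded v_def], folded v_def, folded A_def]
 have AN: "A <= \<eta>'" by(auto simp:A_def)
 have vW: "v H : W" for H unfolding v_def by(rule orth_proj_props(1)[OF sW])
 have dW0: "0 < dim W" using dW k by simp
 have opt: "w = 0" if "w : W" "!!H. H : A ==> inner w (v H) <= 0" for w
  by(rule contacts(3)) (assumption | rule that)+
 have finA: "finite A" by(rule contacts(1))
 obtain A' c where A': "A' <= A" "A' ~= {}" "card A' <= dim W + 1" "!!H. H : A' ==> 0 < c H"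
  "(\<Sum>H\<in>A'. c H *R v H) = 0"
 proof -
  have "EX A' c. A' <= A & A' ~= {} & card A' <= dim W + 1 & (ALL H:A'. 0 < c H) &
   (\<Sum>H\<in>A'. c H *R v H) = 0"
   using vW opt by(intro contacts_pos_dependency finA sW dW0) auto
  thus ?thesis using that by blast
 qed
 have fA': "finite A'" using A'(1) finA by(rule finite_subset)
 have card_A': "card A' = k + 1"
 proof(rule ccontr)
  assume "card A' ~= k + 1"
  hence "card A' <= k" using A'(3) dW by simp
  hence ind: "indep_fam v A'" using A'(1) AN fA' by(intro v_indep) auto
  obtain H where H: "H : A'" using A'(2) by blast
  have "c H = 0" by(rule indep_famD[OF ind fA' A'(5) H])
  thus False using A'(4)[OF H] by simp
 qed
 have "card {1..k+1} = card A'" using card_A' by simp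
 then obtain g1 where g1: "bij_betw g1 {1..k+1} A'" using finite_same_card_bij[OF _ fA'] by blast
 have "card {k+2..DIM('a)+1} = card N" using card_N k by simp
 then obtain g2 where g2: "bij_betw g2 {k+2..DIM('a)+1} N" using finite_same_card_bij[OF _ fin_N] by blast
 \<comment> \<open>The order required by \<open>tangent\<close>: contacts first, then the
   hyperplanes through the centre.\<close>
 define g where "g i = (if i <= k + 1 then g1 i else g2 i)" for i
 have gA: "g ` {1..k+1} = A'" using g1 by(auto simp:bij_betw_def g_def)
 have gN: "g ` {k+2..DIM('a)+1} = N" using g2 by(auto simp:bij_betw_def g_def)
 have II: "II('a) = {1..k+1} Un {k+2..DIM('a)+1}" using k by auto
 have A'N: "A' Int N = {}" using A'(1) AN disj by blast
 have inj_g: "inj_on g II('a)"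
 proof -
  have "inj_on g {1..k+1}" using g1 by(auto simp:bij_betw_def g_def inj_on_def)
  moreover have "inj_on g {k+2..DIM('a)+1}" using g2 by(auto simp:bij_betw_def g_def inj_on_def)
  ultimately show ?thesis unfolding II using gA gN A'N by(subst inj_on_Un) auto
 qed
 have g\<eta>: "g i : \<eta>" if "i : II('a)" for i
  using that gA gN A'(1) AN \<eta>'\<eta> N\<eta> unfolding II by blast
 define p where "p = (\<lambda>i\<in>II('a). rep (g i))"
 have hp: "hyp (p i) = g i" "p i : params" "fst (p i) = f (g i)" "snd (p i) = s (g i)" if "i : II('a)" for i
  using rep[OF g\<eta>[OF that]] that by(auto simp:p_def f_def s_def)
 have ptup: "p : tup II('a) \<eta>"
  unfolding tup_def
 proof(intro CollectI conjI ballI)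
  show "p : II('a) \<rightarrow>\<^sub>E params" using hp(2) by(auto simp:p_def PiE_iff)
  show "hyp (p i) : \<eta>" if "i : II('a)" for i using hp(1)[OF that] g\<eta>[OF that] by simp
  show "inj_on (%i. hyp (p i)) II('a)" using inj_g hp(1) by(subst inj_on_cong[where g = g]) auto
 qed
 let ?u = "normals p"
 have ui: "?u i = f (g i)" if "i : II('a)" for i using hp(3)[OF that] that by(simp add:normals_def)
 have gp: "general_position ?u"
  unfolding general_position_def
 proof(intro allI impI)
  fix J assume J: "J <= II('a) & card J = DIM('a)"
  hence fJ: "finite J" using finite_subset by blast
  have "indep_fam (%i. fst (p i)) J"
   using J ptup by(intro genericD[OF gen fJ]) (auto simp:tup_def PiE_iff intro:inj_on_subset)
  hence "indep_fam ?u J" by(subst indep_fam_cong[where w' = "%i. fst (p i)"]) (use J in \<open>auto simp: normals_def\<close>)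
  thus "inj_on ?u J & independent (?u ` J)" by(simp add:indep_fam_def)
 qed
 have "?u ` {k+2..DIM('a)+1} = f ` N" unfolding gN[symmetric] using ui by(auto simp:image_iff)
 hence L: "Lsub k ?u = W" unfolding Lsub_def W by simp
 interpret gp_data k ?u using k gp by(simp add:gp_data_def)
 have vi: "orth_proj (Lsub k ?u) (?u i) = v (g i)" if "i : II('a)" for i
  unfolding L v_def using ui[OF that] by simp
 have ut: "?u : tuples k"
 proof(rule tuples_if_pos_dependency[where c = "%i. c (g i)"])
  show "?u : II('a) \<rightarrow>\<^sub>E sphere 0 1" using hp(2) by(auto simp:normals_def params_def mem_Times_iff)
  show "0 < c (g i)" if "i : {1..k+1}" for i using A'(4) gA that by blast
  have "(\<Sum>i\<in>{1..k+1}. c (g i) *R orth_proj (Lsub k ?u) (?u i)) = (\<Sum>i\<in>{1..k+1}. c (g i) *R v (g i))"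
   using k by(intro sum.cong refl) (subst vi, auto)
  also have "... = (\<Sum>H\<in>A'. c H *R v H)"
  proof -
   have "inj_on g {1..k+1}" by(rule inj_on_subset[OF inj_g]) (use k in auto)
   thus ?thesis unfolding gA[symmetric] by(simp add:sum.reindex)
  qed
  finally show "(\<Sum>i\<in>{1..k+1}. c (g i) *R orth_proj (Lsub k ?u) (?u i)) = 0" using A'(5) by simp
 qed
 have snd1: "s (g i) = inner z (f (g i)) + r * norm (v (g i))" if "i : {1..k+1}" for i
 proof -
  have "g i : A" using that gA A'(1) by blast
  thus ?thesis by(simp add:A_def)
 qed
 have snd2: "s (g i) = inner z (f (g i))" if "i : {k+2..DIM('a)+1}" for i
 proof -
  have "g i : N" using that gN by blast
  hence "z : hyp (rep (g i))" using rep[of "g i"] by(auto simp:N_def)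
  thus ?thesis by(simp add:mem_hyp f_def s_def)
 qed
 have tang: "tangent k p z r"
  unfolding tangent_def
 proof(intro conjI ut r ballI)
  fix i assume i: "i : II('a)"
  show "snd (p i) = inner z (fst (p i)) + r * rho k ?u i"
  proof(cases "i <= k + 1")
   case True
   thus ?thesis using i snd1[of i] hp(3,4)[OF i] vi[OF i] by(simp add:rho_def)
  next
   case False
   thus ?thesis using i snd2[of i] hp(3,4)[OF i] by(simp add:rho_def)
  qed
 qed
 interpret fd: face_data k ?u using k ut by(rule face_dataI)
 show ?thesis
 proof(rule that[OF ptup, of r]; unfold zI)
  show "tangent k p z r" by(rule tang)
  show "cball z r Int (%w. z + w) ` Lsub k ?u <= K" unfolding L fs(1)[symmetric] by(rule ball)
  assume nh: "no_hit \<eta> p (Tk_at k ?u z r)"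
  show "K = Tk_at k ?u z r"
  proof(rule equalityI; rule subsetI)
   fix x assume x: "x : K"
   show "x : Tk_at k ?u z r"
    unfolding fd.mem_simp_u[OF r]
   proof(intro conjI ballI)
    show "x - z : Lsub k ?u" using x K_eq L by blast
    fix i assume i: "i : {1..k+1}"
    hence i': "i : II('a)" using k by auto
    have "g i : \<eta>'" using i gA A'(1) AN by blast
    hence "inner x (f (g i)) <= s (g i)" using x K_eq by blast
    thus "inner x (?u i) <= inner z (?u i) + r * norm (orth_proj (Lsub k ?u) (?u i))"
     using snd1[OF i] vi[OF i'] ui[OF i'] by simp
   qed
  next
   fix x assume x: "x : Tk_at k ?u z r"
   have zT: "z : Tk_at k ?u z r"
    by(rule fd.ball_subset_simp[OF r]) (use r in \<open>auto simp: subspace_0[OF subspace_Lsub]\<close>)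
   have "inner x (f H) <= s H" if H: "H : \<eta>'" for H
   proof(cases "H : (%i. hyp (p i)) ` II('a)")
    case True
    then obtain i where i: "i : II('a)" "H = g i" using hp(1) by auto
    have "i : {1..k+1}"
    proof(rule ccontr)
     assume "i ~: {1..k+1}"
     hence "H : N" using i gN unfolding II by blast
     thus False using H disj by blast
    qed
    hence "inner x (?u i) <= inner z (?u i) + r * norm (orth_proj (Lsub k ?u) (?u i))"
     using x unfolding fd.mem_simp_u[OF r] by blast
    thus ?thesis using snd1[OF \<open>i \<in> {1..k + 1}\<close>] vi[OF i(1)] ui[OF i(1)] i(2) by simp
   next
    case False
    hence "H Int Tk_at k ?u z r = {}" using nh H \<eta>'\<eta> unfolding no_hit_def by blast
    moreover have "connected (Tk_at k ?u z r)" unfolding fd.simp_eq_convex_hull by(intro convex_connected) (rule convex_convex_hull)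
    ultimately show ?thesis
     using convex_same_side_le[of "Tk_at k ?u z r" z x "(f H, s H)"] zT x r'[OF H] by simp
   qed
   moreover have "x - z : W" using x unfolding fd.mem_simp_u[OF r] L by blast
   ultimately show "x : K" using K_eq by blast
  qed
 qed
qed

text \<open>A face with a unique inball is determined by its incenter, because its affine hull is cut
 out by the hyperplanes through that point.\<close>

lemma incenter_inj_on_faces:
 fixes \<eta> :: "'a::euclidean_space set set"
 assumes \<eta>: "\<eta> : configurations"
 shows "inj_on incenter (tessellation_faces k \<eta> Int unique_inball_polytopes k)"
proof(rule inj_onI)
 fix K K' assume K: "K : tessellation_faces k \<eta> Int unique_inball_polytopes k"
  and K': "K' : tessellation_faces k \<eta> Int unique_inball_polytopes k" and eq: "incenter K = incenter K'"
 have rel: "incenter P : rel_interior P" if P: "P : unique_inball_polytopes k" for P :: "'a set"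
 proof -
  obtain z r where zr: "inball P z r" "incenter P = z" using unique_inballE[OF P] by metis
  thus ?thesis using zr(1) by(auto simp:inball_def inscribed_ball_def mem_rel_interior_cball)
 qed
 have *: "P = {x. x - incenter P : {w. ALL p:params. hyp p : \<eta> --> incenter P : hyp p --> inner w (fst p) = 0} &
   (ALL p:params. hyp p : \<eta> --> inner (incenter P) (fst p) < snd p --> inner x (fst p) <= snd p)}"
  if P: "P : tessellation_faces k \<eta> Int unique_inball_polytopes k" for P
 proof -
  obtain C where C: "C : cells \<eta>" "P face_of C" using P by(auto simp:tessellation_faces_def)
  obtain x0 where x0: "x0 ~: \<Union>\<eta>" "C = side_set \<eta> x0" by(rule cellsE[OF \<eta> C(1)])
  show ?thesis by(rule face_structure(2)[OF \<eta> x0(1) C(2)[unfolded x0(2)]]) (use rel P in blast)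
 qed
 show "K = K'" using *[OF K] *[OF K'] unfolding eq by(rule trans_sym)
qed

section \<open>Counting the tuples of a simplex face\<close>

definition ext_normal :: "nat => (nat => 'a::euclidean_space) => nat => 'a \<times> real" where
 "ext_normal k u i = (u i, rho k u i)"

text \<open>The inverse of the linear system, read off from the dual basis of its rows. The formula
  makes sense for every tuple and gives centre and radius when the normals belong to
  \<open>tuples k\<close>.\<close>

definition solve :: "nat => (nat => 'a::euclidean_space \<times> real) => 'a \<times> real" where
 "solve k p = (\<Sum>i\<in>II('a). snd (p i) *R dual_vec (ext_normal k (normals p)) II('a) i)"

definition Tk_of :: "nat => (nat => 'a::euclidean_space \<times> real) => 'a set" where
 "Tk_of k p = Tk_at k (normals p) (fst (solve k p)) (snd (solve k p))"

text \<open>Projection to \<open>L\<close> turns a dependency of the rows into one of the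
  \<open>v i\<close>, which is a multiple of the positive one. The last coordinate then equals this
  multiple times a positive sum, so the multiple is 0, and only independent vectors from
  \<open>k + 2\<close> on remain.\<close>

lemma (in face_data) indep_ext_normal: "indep_fam (ext_normal k u) II('a)"
 unfolding indep_fam_iff_sum[OF finite_atLeastAtMost]
proof(intro allI impI)
 fix a assume s: "(\<Sum>i\<in>II('a). a i *R ext_normal k u i) = 0"
 have II: "II('a) = I1 Un {k+2..DIM('a)+1}" using k by auto
 have s1: "(\<Sum>i\<in>II('a). a i *R u i) = 0"
  using arg_cong[OF s, of fst] by(simp add:ext_normal_def fst_sum)
 have s2: "(\<Sum>i\<in>II('a). a i * rho k u i) = 0"
  using arg_cong[OF s, of snd] by(simp add:ext_normal_def snd_sum)
 have split:"(\<Sum>i\<in>II('a). f i) = (\<Sum>i\<in>I1. f i) + (\<Sum>i\<in>{k+2..DIM('a)+1}. f i)" for f :: "nat => 'c::comm_monoid_add"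
  unfolding II by(rule sum.union_disjoint) auto
 have "orth_proj L (\<Sum>i\<in>II('a). a i *R u i) = 0"
  unfolding s1 orth_proj_eq_0_iff[OF subspace_Lsub] by(rule subspace_0[OF subspace_orthogonal_comp])
 hence "(\<Sum>i\<in>II('a). a i *R v i) = 0"
  by(simp only:orth_proj_sum[OF subspace_Lsub])
 hence "(\<Sum>i\<in>I1. a i *R v i) + (\<Sum>i\<in>{k+2..DIM('a)+1}. a i *R v i) = 0"
  by(simp only:split)
 moreover have "v i = 0" if "i : {k+2..DIM('a)+1}" for i
 proof -
  have "u i : orthogonal_comp L"
   unfolding Lsub_def orthogonal_comp_self[OF subspace_span] using that by(intro span_base imageI)
  thus ?thesis using orth_proj_eq_0_iff[OF subspace_Lsub] by blast
 qed
 ultimately have v0: "(\<Sum>i\<in>I1. a i *R v i) = 0" by simp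
 obtain c where c: "!!j. j : I1 ==> 0 < c j" "(\<Sum>j\<in>I1. c j *R v j) = 0" by(rule pos_dependency) blast
 obtain l where l: "ALL j:I1. a j = l * c j" using dependency_unique[OF c v0] by blast
 have "(\<Sum>i\<in>{k+2..DIM('a)+1}. a i * rho k u i) = 0" by(intro sum.neutral) (auto simp:rho_def)
 hence "(\<Sum>i\<in>I1. a i * rho k u i) = 0" using s2 unfolding split by simp
 moreover have "(\<Sum>i\<in>I1. a i * rho k u i) = (\<Sum>i\<in>I1. l * (c i * norm (v i)))"
  using l by(intro sum.cong) (auto simp:rho_def)
 ultimately have "l * (\<Sum>i\<in>I1. c i * norm (v i)) = 0" by(simp add:sum_distrib_left)
 moreover have "0 < (\<Sum>i\<in>I1. c i * norm (v i))" using c(1) v_nonzero by(intro sum_pos) auto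
 ultimately have "l = 0" by simp
 hence a1: "a i = 0" if "i : I1" for i using l that by simp
 hence "(\<Sum>i\<in>{k+2..DIM('a)+1}. a i *R u i) = 0" using s1 unfolding split by simp
 moreover have "indep_fam u {k+2..DIM('a)+1}" using k by(intro general_position_indep_fam[OF gp]) auto
 ultimately have "a i = 0" if "i : {k+2..DIM('a)+1}" for i using that by(intro indep_famD) auto
 thus "ALL i:II('a). a i = 0" unfolding II using a1 by blast
qed

lemma solve_iff:
 fixes p :: "nat => 'a::euclidean_space \<times> real"
 assumes "k : {1..DIM('a)}" "normals p : tuples k"
 shows "(ALL i:II('a). snd (p i) = inner z (fst (p i)) + r * rho k (normals p) i) <-> solve k p = (z, r)"
proof -
 interpret face_data k "normals p" by(rule face_dataI[OF assms])
 let ?I = "II('a)" and ?e = "ext_normal k (normals p)"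
 have fst: "normals p i = fst (p i)" if "i : ?I" for i using that by(simp add:normals_def)
 have e1: "inner (solve k p) (?e i) = snd (p i)" if i: "i : ?I" for i
 proof -
  have "inner (solve k p) (?e i) = (\<Sum>j\<in>?I. if j = i then snd (p j) else 0)"
   unfolding solve_def inner_sum_left
   using inner_dual_vec[OF _ indep_ext_normal _ i] by(intro sum.cong) (auto simp:inner_sum_left)
  thus ?thesis using i by(simp add:sum.delta)
 qed
 have e2: "inner (z, r) (?e i) = inner z (fst (p i)) + r * rho k (normals p) i" if "i : ?I" for i
  using fst[OF that] by(simp add:ext_normal_def)
 have sp: "span (?e ` ?I) = UNIV" using indep_ext_normal by(intro indep_fam_span_UNIV) auto
 show ?thesis
 proof
  assume l: "ALL i:?I. snd (p i) = inner z (fst (p i)) + r * rho k (normals p) i"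
  show "solve k p = (z, r)" by(rule eq_of_inner_indep[OF sp]) (use l e1 e2 in simp)
 next
  assume "solve k p = (z, r)"
  thus "ALL i:?I. snd (p i) = inner z (fst (p i)) + r * rho k (normals p) i" using e1 e2 by metis
 qed
qed

lemma tangent_iff:
 fixes p :: "nat => 'a::euclidean_space \<times> real"
 assumes "k : {1..DIM('a)}"
 shows "tangent k p z r <-> normals p : tuples k & 0 < r & solve k p = (z, r)"
 unfolding tangent_def using solve_iff[OF assms] by blast

definition tangent_tuples :: "nat => (nat => 'a::euclidean_space \<times> real) set" where
 "tangent_tuples k = {p. normals p : tuples k & 0 < snd (solve k p)}"

definition simplex_tuples :: "nat => 'a::euclidean_space set set => (nat => 'a \<times> real) set" where
 "simplex_tuples k \<eta> = {p : tup II('a) \<eta>. p : tangent_tuples k & no_hit \<eta> p (Tk_of k p)}"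

lemma tangent_tuplesD:
 fixes p :: "nat => 'a::euclidean_space \<times> real"
 assumes "k : {1..DIM('a)}" "p : tangent_tuples k"
 shows "tangent k p (fst (solve k p)) (snd (solve k p))"
 using assms by(auto simp:tangent_tuples_def tangent_iff)

section \<open>Tuples that describe the same simplex\<close>

lemma indep_fam_scale:
 assumes "finite J" "!!i. i : J ==> s i ~= 0" "indep_fam w J"
 shows "indep_fam (%i. s i *R w i) J"
 unfolding indep_fam_iff_sum[OF assms(1)]
proof(intro allI impI ballI)
 fix a i assume "(\<Sum>i\<in>J. a i *R s i *R w i) = 0" and i: "i : J"
 hence "(\<Sum>i\<in>J. (a i * s i) *R w i) = 0" by simp
 from indep_famD[OF assms(3,1) this i] show "a i = 0" using assms(2)[OF i] by simp
qed

text \<open>The first block has no free signs, because the incenter lies strictly below its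
  hyperplanes. The \<open>itself\<close> argument supplies the dimension.\<close>

definition relabelings :: "nat => 'a::euclidean_space itself => ((nat => nat) \<times> (nat => real)) set" where
 "relabelings k _ = {\<sigma>. \<sigma> permutes II('a) & \<sigma> ` {1..k+1} = {1..k+1}} \<times>
   ({k+2..DIM('a)+1} \<rightarrow>\<^sub>E {1, -1})"

definition relabel :: "nat => (nat => 'a::euclidean_space \<times> real) => (nat => nat) \<times> (nat => real) => nat => 'a \<times> real" where
 "relabel k p = (%(\<sigma>, \<epsilon>). \<lambda>i\<in>II('a). (if i <= k + 1 then 1 else \<epsilon> i) *R p (\<sigma> i))"

lemma finite_relabelings: "finite (relabelings k TYPE('a::euclidean_space))"
proof -
 have "finite {\<sigma>. \<sigma> permutes II('a)}" by(rule finite_permutations) simp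
 hence "finite {\<sigma>. \<sigma> permutes II('a) & \<sigma> ` {1..k+1} = {1..k+1}}" by(rule rev_finite_subset) auto
 thus ?thesis unfolding relabelings_def by(intro finite_cartesian_product finite_PiE) auto
qed

lemma relabelings_nonempty: "relabelings k TYPE('a::euclidean_space) ~= {}"
proof -
 have "(id, \<lambda>i\<in>{k+2..DIM('a)+1}. 1) : relabelings k TYPE('a)"
  by(auto simp:relabelings_def permutes_id)
 thus ?thesis by blast
qed

text \<open>Permutations and signs change neither \<open>Lsub\<close> nor the constraints of the
  first block, and the same centre and radius solve the relabelled system.\<close>

lemma relabel_simplex_tuples:
 fixes p :: "nat => 'a::euclidean_space \<times> real"
 assumes k: "k : {1..DIM('a)}" and p: "p : simplex_tuples k \<eta>" and g: "g : relabelings k TYPE('a)"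
 shows "relabel k p g : simplex_tuples k \<eta>" "Tk_of k (relabel k p g) = Tk_of k p"
proof -
 obtain \<sigma> \<epsilon> where g_eq: "g = (\<sigma>, \<epsilon>)" by(cases g)
 let ?I = "II('a)" and ?I1 = "{1..k+1}" and ?I2 = "{k+2..DIM('a)+1}"
 have \<sigma>: "\<sigma> permutes ?I" "\<sigma> ` ?I1 = ?I1" and \<epsilon>: "!!i. i : ?I2 ==> \<epsilon> i = 1 | \<epsilon> i = -1"
  using g unfolding g_eq relabelings_def by auto
 define p' where "p' = relabel k p g"
 define s where "s i = (if i <= k + 1 then 1 else \<epsilon> i)" for i
 have s: "s i = 1 | s i = -1" if "i : ?I" for i using \<epsilon>[of i] that by(auto simp:s_def)
 have p': "p' i = s i *R p (\<sigma> i)" if "i : ?I" for i using that by(simp add:p'_def relabel_def g_eq s_def)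
 have \<sigma>I: "\<sigma> i : ?I" if "i : ?I" for i using \<sigma>(1) that by(meson permutes_in_image)
 have inj\<sigma>: "inj \<sigma>" using \<sigma>(1) by(rule permutes_inj)
 have \<sigma>1: "bij_betw \<sigma> ?I1 ?I1" using \<sigma>(2) inj\<sigma> by(auto simp:bij_betw_def intro:inj_on_subset)
 have bI: "bij_betw \<sigma> ?I ?I" using \<sigma>(1) by(rule permutes_imp_bij)
 have I2: "?I2 = ?I - ?I1" using k by auto
 have \<sigma>2: "\<sigma> ` ?I2 = ?I2"
  unfolding I2 using image_set_diff[OF inj\<sigma>, of ?I ?I1] bI \<sigma>(2) by(simp add:bij_betw_def)
 have tp: "p : tup ?I \<eta>" and tang: "p : tangent_tuples k" and nh: "no_hit \<eta> p (Tk_of k p)"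
  using p by(auto simp:simplex_tuples_def)
 have pp: "p i : params" "hyp (p i) : \<eta>" if "i : ?I" for i using tp that by(auto simp:tup_def PiE_iff)
 let ?u = "normals p" and ?u' = "normals p'"
 have u': "?u' i = s i *R ?u (\<sigma> i)" if "i : ?I" for i
  using p'[OF that] \<sigma>I[OF that] that by(simp add:normals_def)
 have hyp': "hyp (p' i) = hyp (p (\<sigma> i))" if "i : ?I" for i
  using s[OF that] p'[OF that] by auto
 obtain z r where zr: "solve k p = (z, r)" by(cases "solve k p")
 have r: "0 < r" and ut: "?u : tuples k" using tang zr by(auto simp:tangent_tuples_def)
 interpret fd: face_data k ?u by(rule face_dataI[OF k ut])
 have L: "Lsub k ?u' = Lsub k ?u"
 proof -
  have "(ALL i:?I2. inner x (?u' i) = 0) <-> (ALL i:\<sigma> ` ?I2. inner x (?u i) = 0)" for x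
  proof -
   have "inner x (?u' i) = 0 <-> inner x (?u (\<sigma> i)) = 0" if "i : ?I2" for i
    using u'[of i] s[of i] that by auto
   thus ?thesis by auto
  qed
  thus ?thesis unfolding \<sigma>2 by(auto simp:mem_Lsub)
 qed
 have gp': "general_position ?u'"
  unfolding general_position_def
 proof(intro allI impI)
  fix J assume J: "J <= ?I & card J = DIM('a)"
  hence fJ: "finite J" using finite_subset by blast
  have "card (\<sigma> ` J) <= DIM('a)" using J card_image_le[OF fJ, of \<sigma>] by simp
  moreover have "\<sigma> ` J <= ?I" using J \<sigma>I by blast
  ultimately have "indep_fam ?u (\<sigma> ` J)" by(intro general_position_indep_fam[OF fd.gp])
  moreover have "bij_betw \<sigma> J (\<sigma> ` J)" using inj\<sigma> by(auto simp:bij_betw_def intro:inj_on_subset)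
  ultimately have "indep_fam (%i. ?u (\<sigma> i)) J" using indep_fam_reindex by blast
  hence "indep_fam (%i. s i *R ?u (\<sigma> i)) J" using s J by(intro indep_fam_scale fJ) force+
  hence "indep_fam ?u' J" using J u' by(subst indep_fam_cong[where w' = "%i. s i *R ?u (\<sigma> i)"]) auto
  thus "inj_on ?u' J & independent (?u' ` J)" by(simp add:indep_fam_def)
 qed
 interpret gp': gp_data k ?u' using k gp' by(simp add:gp_data_def)
 have u1: "?u' i = ?u (\<sigma> i)" if "i : ?I1" for i using u'[of i] that k by(simp add:s_def)
 obtain c where c: "!!j. j : ?I1 ==> 0 < c j" "(\<Sum>j\<in>?I1. c j *R orth_proj (Lsub k ?u) (?u j)) = 0"
  by(rule fd.pos_dependency) blast
 have ut': "?u' : tuples k"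
 proof(rule gp'.tuples_if_pos_dependency[where c = "%i. c (\<sigma> i)"])
  show "?u' : ?I \<rightarrow>\<^sub>E sphere 0 1"
  proof(rule PiE_I)
   fix i assume i: "i : ?I"
   show "?u' i : sphere 0 1" using u'[OF i] s[OF i] fd.norm_u[OF \<sigma>I[OF i]] by auto
  next
   fix i assume "i ~: ?I"
   thus "?u' i = undefined" by(simp only:normals_def restrict_apply if_False)
  qed
  show "0 < c (\<sigma> i)" if "i : ?I1" for i using c(1) \<sigma>(2) that by blast
  have "(\<Sum>i\<in>?I1. c (\<sigma> i) *R orth_proj (Lsub k ?u') (?u' i)) = (\<Sum>i\<in>?I1. c (\<sigma> i) *R orth_proj (Lsub k ?u) (?u (\<sigma> i)))"
   unfolding L using u1 by(intro sum.cong) auto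
  also have "... = (\<Sum>j\<in>?I1. c j *R orth_proj (Lsub k ?u) (?u j))"
   by(rule sum.reindex_bij_betw[OF \<sigma>1])
  finally show "(\<Sum>i\<in>?I1. c (\<sigma> i) *R orth_proj (Lsub k ?u') (?u' i)) = 0" using c(2) by simp
 qed
 interpret fd': face_data k ?u' by(rule face_dataI[OF k ut'])
 have zr': "solve k p' = (z, r)"
  unfolding solve_iff[OF k ut', symmetric]
 proof
  fix i assume i: "i : ?I"
  have base: "snd (p (\<sigma> i)) = inner z (fst (p (\<sigma> i))) + r * rho k ?u (\<sigma> i)"
   using solve_iff[OF k ut, of z r] zr \<sigma>I[OF i] by blast
  show "snd (p' i) = inner z (fst (p' i)) + r * rho k ?u' i"
  proof(cases "i : ?I1")
   case True
   hence "\<sigma> i : ?I1" using \<sigma>(2) by blast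
   thus ?thesis using base True u1[OF True] p'[OF i] L by(simp add:rho_def s_def)
  next
   case False
   hence "\<sigma> i : ?I2" using \<sigma>2 i I2 by blast
   thus ?thesis using base False i p'[OF i] by(simp add:rho_def)
  qed
 qed
 have T: "Tk_at k ?u' z r = Tk_at k ?u z r"
 proof -
  have "(ALL i:?I1. inner x (?u' i) <= inner z (?u' i) + r * norm (orth_proj (Lsub k ?u') (?u' i))) <->
   (ALL i:\<sigma> ` ?I1. inner x (?u i) <= inner z (?u i) + r * norm (orth_proj (Lsub k ?u) (?u i)))" for x
   unfolding L using u1 by auto
  thus ?thesis unfolding \<sigma>(2) by(auto simp:fd.mem_simp_u[OF r] fd'.mem_simp_u[OF r] L)
 qed
 thus TT: "Tk_of k (relabel k p g) = Tk_of k p" unfolding p'_def[symmetric] Tk_of_def zr zr' by simp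
 have img: "(%i. hyp (p' i)) ` ?I = (%i. hyp (p i)) ` ?I"
 proof -
  have "(%i. hyp (p' i)) ` ?I = (%i. hyp (p i)) ` (\<sigma> ` ?I)" using hyp' by(auto simp:image_iff)
  thus ?thesis using bI by(simp add:bij_betw_def)
 qed
 have "p' : tup ?I \<eta>"
  unfolding tup_def
 proof(intro CollectI conjI ballI)
  show "p' : ?I \<rightarrow>\<^sub>E params"
  proof(rule PiE_I)
   fix i assume i: "i : ?I"
   show "p' i : params" using p'[OF i] s[OF i] pp(1)[OF \<sigma>I[OF i]] by auto
  next
   fix i assume "i ~: ?I"
   thus "p' i = undefined" by(simp only:p'_def relabel_def g_eq prod.case restrict_apply if_False)
  qed
  show "hyp (p' i) : \<eta>" if "i : ?I" for i using hyp'[OF that] pp(2)[OF \<sigma>I[OF that]] by simp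
  have "inj_on (%i. hyp (p (\<sigma> i))) ?I"
   using comp_inj_on[of \<sigma> ?I "%i. hyp (p i)"] bI tp by(auto simp:bij_betw_def tup_def comp_def)
  thus "inj_on (%i. hyp (p' i)) ?I" using hyp' by(subst inj_on_cong[where g = "%i. hyp (p (\<sigma> i))"]) auto
 qed
 moreover have "p' : tangent_tuples k" using ut' zr' r by(simp add:tangent_tuples_def)
 moreover have "no_hit \<eta> p' (Tk_of k p')"
  using nh unfolding no_hit_def img TT[folded p'_def] .
 ultimately show "relabel k p g : simplex_tuples k \<eta>" by(simp add:simplex_tuples_def p'_def)
qed

text \<open>Recovers both blocks from the simplex alone: the hyperplanes that contain it and those
  that merely meet it. Hence two tuples with the same simplex can differ only within the
  blocks.\<close>

lemma simplex_tuples_hyps: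
 fixes p :: "nat => 'a::euclidean_space \<times> real"
 assumes k: "k : {1..DIM('a)}" and p: "p : simplex_tuples k \<eta>"
 defines "z \<equiv> fst (solve k p)"
 shows "(%i. hyp (p i)) ` {k+2..DIM('a)+1} = {H : \<eta>. Tk_of k p <= H}"
  and "(%i. hyp (p i)) ` {1..k+1} = {H : \<eta>. H Int Tk_of k p ~= {} & ~ Tk_of k p <= H}"
  and "!!i. i : {1..k+1} ==> inner z (fst (p i)) < snd (p i)"
  and "incenter (Tk_of k p) = z"
proof -
 let ?I = "II('a)" and ?I1 = "{1..k+1}" and ?I2 = "{k+2..DIM('a)+1}"
 obtain r where zr: "solve k p = (z, r)" by(cases "solve k p") (simp add:z_def)
 have tp: "p : tup ?I \<eta>" and tang: "p : tangent_tuples k" and nh: "no_hit \<eta> p (Tk_of k p)"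
  using p by(auto simp:simplex_tuples_def)
 have r: "0 < r" and ut: "normals p : tuples k" using tang zr by(auto simp:tangent_tuples_def)
 interpret fd: face_data k "normals p" by(rule face_dataI[OF k ut])
 have T: "Tk_of k p = Tk_at k (normals p) z r" by(simp add:Tk_of_def zr)
 have eq: "snd (p i) = inner z (fst (p i)) + r * rho k (normals p) i" if "i : ?I" for i
  using solve_iff[OF k ut, of z r] zr that by blast
 have n: "normals p i = fst (p i)" if "i : ?I" for i using that by(simp add:normals_def)
 have pp: "p i : params" "hyp (p i) : \<eta>" if "i : ?I" for i using tp that by(auto simp:tup_def PiE_iff)
 have sub: "?I1 <= ?I" "?I2 <= ?I" "?I = ?I1 Un ?I2" using k by auto
 show "incenter (Tk_of k p) = z" unfolding T by(rule fd.incenter_simp[OF r])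
 have zT: "z : Tk_of k p"
  unfolding T by(rule fd.ball_subset_simp[OF r]) (use r in \<open>auto simp: subspace_0[OF subspace_Lsub]\<close>)
 have lt: "inner z (fst (p i)) < snd (p i)" if i: "i : ?I1" for i
 proof -
  have "r * norm (orth_proj (Lsub k (normals p)) (normals p i)) > 0" using r fd.v_nonzero[OF i] by simp
  thus ?thesis using eq[of i] i sub(1) by(simp add:rho_def)
 qed
 thus "!!i. i : ?I1 ==> inner z (fst (p i)) < snd (p i)" .
 have c2: "Tk_of k p <= hyp (p i)" if i: "i : ?I2" for i
 proof
  fix x assume "x : Tk_of k p"
  hence "x - z : Lsub k (normals p)" unfolding T fd.mem_simp[OF r] by blast
  hence "inner (x - z) (normals p i) = 0" using i unfolding mem_Lsub by blast
  hence "inner (x - z) (fst (p i)) = 0" using n[of i] i sub(2) by(simp only:subsetD)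
  thus "x : hyp (p i)" using eq[of i] i sub(2) by(simp add:mem_hyp rho_def inner_diff_left)
 qed
 have c1: "hyp (p i) Int Tk_of k p ~= {}" "~ Tk_of k p <= hyp (p i)" if i: "i : ?I1" for i
 proof -
  show "~ Tk_of k p <= hyp (p i)" using zT lt[OF i] by(auto simp:mem_hyp)
  let ?v = "orth_proj (Lsub k (normals p)) (normals p i)"
  let ?c = "z + (r / norm ?v) *R ?v"
  have nv: "0 < norm ?v" using fd.v_nonzero[OF i] by simp
  have "?c : Tk_of k p"
   unfolding T using r nv fd.v_in_L[of i] by(intro fd.ball_subset_simp[OF r]) (auto simp:dist_norm subspace_scale[OF subspace_Lsub])
  moreover have "?c : hyp (p i)"
  proof -
   have "inner ?v (normals p i) = norm ?v * norm ?v"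
    using fd.inner_v[OF fd.v_in_L[of i], of i] by(simp add:dot_square_norm power2_eq_square)
   hence "inner ?c (normals p i) = inner z (normals p i) + r * norm ?v" using nv by(simp add:inner_add_left)
   thus ?thesis using eq[of i] n[of i] i sub(1) by(simp add:mem_hyp rho_def)
  qed
  ultimately show "hyp (p i) Int Tk_of k p ~= {}" by blast
 qed
 have hits: "H : (%i. hyp (p i)) ` ?I" if "H : \<eta>" "H Int Tk_of k p ~= {}" for H
  using nh that unfolding no_hit_def by blast
 have imgs: "(%i. hyp (p i)) ` ?I = (%i. hyp (p i)) ` ?I1 Un (%i. hyp (p i)) ` ?I2"
  unfolding sub(3) by(rule image_Un)
 show "(%i. hyp (p i)) ` ?I2 = {H : \<eta>. Tk_of k p <= H}"
 proof(rule equalityI; rule subsetI)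
  fix H assume "H : (%i. hyp (p i)) ` ?I2"
  thus "H : {H : \<eta>. Tk_of k p <= H}" using c2 pp(2) sub(2) by blast
 next
  fix H assume H: "H : {H : \<eta>. Tk_of k p <= H}"
  hence "H : (%i. hyp (p i)) ` ?I" using zT by(intro hits) auto
  thus "H : (%i. hyp (p i)) ` ?I2" unfolding imgs using H c1(2) by blast
 qed
 show "(%i. hyp (p i)) ` ?I1 = {H : \<eta>. H Int Tk_of k p ~= {} & ~ Tk_of k p <= H}"
 proof(rule equalityI; rule subsetI)
  fix H assume "H : (%i. hyp (p i)) ` ?I1"
  thus "H : {H : \<eta>. H Int Tk_of k p ~= {} & ~ Tk_of k p <= H}" using c1 pp(2) sub(1) by blast
 next
  fix H assume H: "H : {H : \<eta>. H Int Tk_of k p ~= {} & ~ Tk_of k p <= H}"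
  hence "H : (%i. hyp (p i)) ` ?I" by(intro hits) auto
  thus "H : (%i. hyp (p i)) ` ?I1" unfolding imgs using H c2 by blast
 qed
qed

text \<open>The tuples that describe a given simplex face differ only by permutations within the two
 groups of hyperplanes and by the signs of the normals of the second group. So their number does
 not depend on the face, and its value is irrelevant for the limit of the quotient.\<close>

lemma simplex_tuples_fiber:
 fixes p :: "nat => 'a::euclidean_space \<times> real"
 assumes k: "k : {1..DIM('a)}" and p: "p : simplex_tuples k \<eta>"
 shows "bij_betw (relabel k p) (relabelings k TYPE('a)) {q : simplex_tuples k \<eta>. Tk_of k q = Tk_of k p}"
 unfolding bij_betw_def
proof
 let ?I = "II('a)" and ?I1 = "{1..k+1}" and ?I2 = "{k+2..DIM('a)+1}"
 have sub: "?I1 <= ?I" "?I2 <= ?I" "?I = ?I1 Un ?I2" using k by auto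
 have tup: "q : tup ?I \<eta>" if "q : simplex_tuples k \<eta>" for q using that by(simp add:simplex_tuples_def)
 have par: "q i : params" if "q : simplex_tuples k \<eta>" "i : ?I" for q i
  using tup[OF that(1)] that(2) by(auto simp:tup_def PiE_iff)
 have inj: "inj_on (%i. hyp (q i)) ?I" if "q : simplex_tuples k \<eta>" for q
  using tup[OF that] by(auto simp:tup_def)
 show "inj_on (relabel k p) (relabelings k TYPE('a))"
 proof(rule inj_onI)
  fix g g' assume g: "g : relabelings k TYPE('a)" and g': "g' : relabelings k TYPE('a)" and eq: "relabel k p g = relabel k p g'"
  obtain \<sigma> \<epsilon> \<sigma>' \<epsilon>' where gg: "g = (\<sigma>, \<epsilon>)" "g' = (\<sigma>', \<epsilon>')" by(cases g; cases g')
  have \<sigma>: "\<sigma> permutes ?I" "\<sigma>' permutes ?I" and \<epsilon>: "\<epsilon> : ?I2 \<rightarrow>\<^sub>E {1, -1}" "\<epsilon>' : ?I2 \<rightarrow>\<^sub>E {1, -1}"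
   using g g' unfolding gg relabelings_def by auto
  define s where "s \<epsilon> i = (if i <= k + 1 then 1 else \<epsilon> i)" for \<epsilon> :: "nat => real" and i
  have e: "s \<epsilon> i *R p (\<sigma> i) = s \<epsilon>' i *R p (\<sigma>' i)" if "i : ?I" for i
   using fun_cong[OF eq, of i] that by(simp add:relabel_def gg s_def)
  have sgn: "s e i = 1 | s e i = -1" if "i : ?I" "e : ?I2 \<rightarrow>\<^sub>E {1, -1}" for e i
   using that by(auto simp:s_def PiE_iff)
  have hs: "hyp (s e i *R x) = hyp x" if "i : ?I" "e : ?I2 \<rightarrow>\<^sub>E {1, -1}" for e i x
   using sgn[OF that] by auto
  have "\<sigma> i = \<sigma>' i" for i
  proof(cases "i : ?I")
   case True
   have "hyp (p (\<sigma> i)) = hyp (p (\<sigma>' i))" using arg_cong[OF e[OF True], of hyp] unfolding hs[OF True \<epsilon>(1)] hs[OF True \<epsilon>(2)] .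
   moreover have "\<sigma> i : ?I" "\<sigma>' i : ?I" using \<sigma> True by(meson permutes_in_image)+
   ultimately show ?thesis using inj_onD[OF inj[OF p]] by blast
  next
   case False
   thus ?thesis using \<sigma> by(simp add:permutes_not_in)
  qed
  hence ss: "\<sigma> = \<sigma>'" by auto
  have "\<epsilon> i = \<epsilon>' i" if "i : ?I2" for i
  proof -
   have i: "i : ?I" using that sub by blast
   have "p (\<sigma> i) : params" using par[OF p] \<sigma>(1) i by(meson permutes_in_image)
   hence "p (\<sigma> i) ~= - p (\<sigma> i)" by(rule params_neq_uminus)
   hence "p (\<sigma> i) ~= 0" by auto
   moreover have "\<epsilon> i *R p (\<sigma> i) = \<epsilon>' i *R p (\<sigma> i)" using e[OF i] that ss by(simp add:s_def)
   ultimately show ?thesis by simp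
  qed
  hence "\<epsilon> = \<epsilon>'" using \<epsilon> by(intro PiE_ext) auto
  thus "g = g'" using ss gg by simp
 qed
 show "relabel k p ` relabelings k TYPE('a) = {q : simplex_tuples k \<eta>. Tk_of k q = Tk_of k p}"
 proof(rule equalityI; rule subsetI)
  fix q assume "q : relabel k p ` relabelings k TYPE('a)"
  thus "q : {q : simplex_tuples k \<eta>. Tk_of k q = Tk_of k p}"
   using relabel_simplex_tuples[OF k p] by auto
 next
  fix q assume "q : {q : simplex_tuples k \<eta>. Tk_of k q = Tk_of k p}"
  hence q: "q : simplex_tuples k \<eta>" and T: "Tk_of k q = Tk_of k p" by auto
  note hp = simplex_tuples_hyps[OF k p] and hq = simplex_tuples_hyps[OF k q, unfolded T]
  have im1: "(%i. hyp (q i)) ` ?I1 = (%i. hyp (p i)) ` ?I1" using hp(2) hq(2) by simp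
  have im2: "(%i. hyp (q i)) ` ?I2 = (%i. hyp (p i)) ` ?I2" using hp(1) hq(1) by simp
  have im: "(%i. hyp (q i)) ` ?I = (%i. hyp (p i)) ` ?I"
   unfolding sub(3) image_Un im1 im2 ..
  \<comment> \<open>Finds the position in \<open>p\<close> of each hyperplane of
    \<open>q\<close>.\<close>
  define \<sigma> where "\<sigma> i = (if i : ?I then inv_into ?I (%i. hyp (p i)) (hyp (q i)) else i)" for i
  have \<sigma>: "\<sigma> i : ?I" "hyp (p (\<sigma> i)) = hyp (q i)" if i: "i : ?I" for i
  proof -
   have m: "hyp (q i) : (%i. hyp (p i)) ` ?I" using im i by blast
   show "\<sigma> i : ?I" using inv_into_into[OF m] i by(simp add:\<sigma>_def)
   show "hyp (p (\<sigma> i)) = hyp (q i)" using f_inv_into_f[OF m] i by(simp add:\<sigma>_def)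
  qed
  have \<sigma>_blk: "\<sigma> ` J <= J" if J: "J <= ?I" "(%i. hyp (q i)) ` J = (%i. hyp (p i)) ` J" for J
  proof(rule image_subsetI)
   fix i assume i: "i : J"
   then obtain j where j: "j : J" "hyp (q i) = hyp (p j)" using J(2) by blast
   have iI: "i : ?I" using i J(1) by blast
   have "\<sigma> i = j" using inj_onD[OF inj[OF p], of "\<sigma> i" j] \<sigma>[OF iI] j J(1) by auto
   thus "\<sigma> i : J" using j by simp
  qed
  have inj\<sigma>: "inj_on \<sigma> ?I"
  proof(rule inj_onI)
   fix i j assume ij: "i : ?I" "j : ?I" "\<sigma> i = \<sigma> j"
   hence "hyp (q i) = hyp (q j)" using \<sigma>(2) by metis
   thus "i = j" using inj_onD[OF inj[OF q]] ij by blast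
  qed
  have "\<sigma> permutes ?I"
  proof(rule bij_imp_permutes)
   have "\<sigma> ` ?I = ?I" by(rule endo_inj_surj[OF finite_atLeastAtMost _ inj\<sigma>]) (rule image_subsetI, rule \<sigma>(1))
   thus "bij_betw \<sigma> ?I ?I" using inj\<sigma> by(simp add:bij_betw_def)
  next
   fix i assume "i ~: ?I"
   thus "\<sigma> i = i" unfolding \<sigma>_def by(rule if_not_P)
  qed
  moreover have "\<sigma> ` ?I1 = ?I1"
   by(rule endo_inj_surj[OF _ \<sigma>_blk[OF sub(1) im1] inj_on_subset[OF inj\<sigma> sub(1)]]) simp
  moreover define \<epsilon> where "\<epsilon> = (\<lambda>i\<in>?I2. if q i = p (\<sigma> i) then 1 else - 1 :: real)"
  ultimately have g: "(\<sigma>, \<epsilon>) : relabelings k TYPE('a)" by(auto simp:relabelings_def)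
  have pm: "q i = p (\<sigma> i) | q i = - p (\<sigma> i)" if "i : ?I" for i
   using hyp_eq_iff[OF par[OF p \<sigma>(1)[OF that]] par[OF q that]] \<sigma>(2)[OF that] by auto
  have "q = relabel k p (\<sigma>, \<epsilon>)"
  proof
   fix i
   show "q i = relabel k p (\<sigma>, \<epsilon>) i"
   proof(cases "i : ?I")
    case i: True
    show ?thesis
    proof(cases "i : ?I1")
     case True
     hence \<sigma>i: "\<sigma> i : ?I1" using \<sigma>_blk[OF sub(1) im1] by blast
     \<comment> \<open>A reversed sign would put the common incenter on the upper side of this
       hyperplane.\<close>
     have "q i ~= - p (\<sigma> i)"
     proof
      assume neg: "q i = - p (\<sigma> i)"
      have "inner (fst (solve k q)) (fst (q i)) < snd (q i)" by(rule hq(3)[OF True])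
      moreover have "fst (solve k q) = fst (solve k p)" using hp(4) hq(4) by simp
      ultimately show False using hp(3)[OF \<sigma>i] neg by simp
     qed
     hence "q i = p (\<sigma> i)" using pm[OF i] by blast
     thus ?thesis using i True by(simp add:relabel_def)
    next
     case False
     thus ?thesis using i pm[OF i] sub(3) by(auto simp:relabel_def \<epsilon>_def)
    qed
   next
    case False
    thus ?thesis using tup[OF q] by(auto simp:relabel_def tup_def PiE_iff extensional_def)
   qed
  qed
  thus "q : relabel k p ` relabelings k TYPE('a)" using g by blast
 qed
qed

text \<open>Double counting: the graph of \<open>F\<close> is summed in both orders.\<close>

lemma nn_integral_count_fibers:
 fixes F :: "'p => 'b" and g :: "'b => ennreal"
 assumes "!!p. p : V ==> finite {q : V. F q = F p} & card {q : V. F q = F p} = c"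
 shows "(NN p. g (F p) * indicator V p \<partial>count_space UNIV) =
  of_nat c * (NN K. g K * indicator (F ` V) K \<partial>count_space UNIV)"
proof -
 let ?f = "%(p, K). g K * indicator {(p, K). p : V & K = F p} (p, K)"
 have "(NN p. g (F p) * indicator V p \<partial>count_space UNIV) =
  (NN p. (NN K. ?f (p, K) \<partial>count_space UNIV) \<partial>count_space UNIV)"
 proof(rule nn_integral_cong)
  fix p
  have "(NN K. ?f (p, K) \<partial>count_space UNIV) = (NN K. (g (F p) * indicator V p) * indicator {F p} K \<partial>count_space UNIV)"
   by(intro nn_integral_cong) (auto simp:indicator_def)
  also have "... = g (F p) * indicator V p" by(subst nn_integral_cmult_indicator) auto
  finally show "g (F p) * indicator V p = (NN K. ?f (p, K) \<partial>count_space UNIV)" by simp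
 qed
 also have "... = (NN x. ?f x \<partial>count_space UNIV)" by(rule nn_integral_fst_count_space)
 also have "... = (NN K. (NN p. ?f (p, K) \<partial>count_space UNIV) \<partial>count_space UNIV)"
  by(rule nn_integral_snd_count_space[symmetric])
 also have "... = (NN K. of_nat c * (g K * indicator (F ` V) K) \<partial>count_space UNIV)"
 proof(rule nn_integral_cong)
  fix K
  have "(NN p. ?f (p, K) \<partial>count_space UNIV) = (NN p. g K * indicator {q : V. F q = K} p \<partial>count_space UNIV)"
   by(intro nn_integral_cong) (auto simp:indicator_def)
  also have "... = g K * emeasure (count_space UNIV) {q : V. F q = K}"
   by(subst nn_integral_cmult_indicator) auto
  also have "... = of_nat c * (g K * indicator (F ` V) K)"
  proof(cases "K : F ` V")
   case True
   then obtain p where "p : V" "K = F p" by blast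
   thus ?thesis using assms[of p] True by(simp add:mult.commute)
  next
   case False
   hence e: "{q : V. F q = K} = {}" by blast
   show ?thesis unfolding e using False by simp
  qed
  finally show "(NN p. ?f (p, K) \<partial>count_space UNIV) = of_nat c * (g K * indicator (F ` V) K)" .
 qed
 also have "... = of_nat c * (NN K. g K * indicator (F ` V) K \<partial>count_space UNIV)"
  by(rule nn_integral_cmult) simp
 finally show ?thesis .
qed

section \<open>Measurability of the incenter\<close>

lemma closedin_sets_borel_of:
 assumes "closedin T C"
 shows "C : sets (borel_of T)"
proof -
 have "topspace T - C : sets (borel_of T)" using assms by(intro openin_sets_borel_of) auto
 hence "space (borel_of T) - (topspace T - C) : sets (borel_of T)" by(rule sets.compl_sets)
 thus ?thesis using closedin_subset[OF assms] by(simp add:space_borel_of double_diff)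
qed

lemma measurable_borel_ofI:
 assumes "!!x. x : space N ==> f x : topspace T"
  and "!!U. openin T U ==> f -` U Int space N : sets N"
 shows "f : measurable N (borel_of T)"
 unfolding borel_of_def
proof(rule measurable_measure_of)
 show "{U. openin T U} <= Pow (topspace T)" by(auto dest:openin_subset)
qed (use assms in auto)

lemma borel_measurable_continuous_map:
 assumes "continuous_map T euclidean f"
 shows "f : borel_measurable (borel_of T)"
proof(rule borel_measurableI)
 fix S :: "'b set" assume "open S"
 hence "openin T {x : topspace T. f x : S}"
  using assms by(auto simp:continuous_map_def)
 moreover have "f -` S Int space (borel_of T) = {x : topspace T. f x : S}" by(auto simp:space_borel_of)
 ultimately show "f -` S Int space (borel_of T) : sets (borel_of T)" by(simp add:openin_sets_borel_of)
qed

interpretation CB: Metric_space "convex_bodies :: 'a::euclidean_space set set" hausdorff_dist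
 by(rule Metric_space_hausdorff_dist)

abbreviation CBT :: "'a::euclidean_space set topology" where "CBT \<equiv> convex_body_topology"

lemma CBT: "CBT = CB.mtopology" by(rule convex_body_topology_def)

lemma topspace_CBT [simp]: "topspace CBT = convex_bodies" by(simp add:CBT)

lemma space_borel_CBT [simp]: "space (borel_of CBT) = convex_bodies" by(simp add:space_borel_of)

lemma hausdorff_dist_leI:
 assumes K: "K : convex_bodies" and L: "L : convex_bodies"
  and "!!x. x : K ==> EX y:L. dist x y <= e" "!!y. y : L ==> EX x:K. dist y x <= e"
 shows "hausdorff_dist K L <= e"
 unfolding hausdorff_dist_le_iff[OF K L]
proof(intro conjI ballI)
 fix x assume "x : K"
 then obtain y where "y : L" "dist x y <= e" using assms(3) by blast
 thus "infdist x L <= e" using infdist_le[of y L x] by linarith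
next
 fix y assume "y : L"
 then obtain x where "x : K" "dist y x <= e" using assms(4) by blast
 thus "infdist y K <= e" using infdist_le[of x K y] by linarith
qed

lemma hausdorff_dist_leD:
 assumes K: "K : convex_bodies" and L: "L : convex_bodies" and x: "x : K"
 obtains y where "y : L" "dist x y <= hausdorff_dist K L"
proof -
 have "closed L" "L ~= {}" using L by(auto simp:convex_bodies_def compact_imp_closed)
 then obtain y where y: "y : L" "infdist x L = dist x y" by(rule infdist_attains_inf)
 moreover have "infdist x L <= hausdorff_dist K L" using hausdorff_dist_le_iff[OF K L] x by blast
 ultimately show ?thesis using that by simp
qed

text \<open>The coefficients belong to indices instead of points, so repeated points are harmless
  and two families can be compared index by index.\<close>

lemma convex_hull_finite_image_sum:
 assumes "finite J" "x : convex hull (p ` J)"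
 obtains a where "!!i. i : J ==> 0 <= a i" "sum a J = (1::real)" "x = (\<Sum>i\<in>J. a i *R p i)"
proof -
 define S where "S = {(\<Sum>i\<in>J. a i *R p i) | a. (ALL i:J. 0 <= a i) & sum a J = (1::real)}"
 have "p ` J <= S"
 proof(rule image_subsetI)
  fix j assume j: "j : J"
  have "(\<Sum>i\<in>J. (if i = j then 1 else 0) *R p i) = (\<Sum>i\<in>J. if i = j then p i else 0)"
   by(intro sum.cong) auto
  hence "p j = (\<Sum>i\<in>J. (if i = j then 1 else 0) *R p i)" using assms(1) j by(simp add:sum.delta)
  moreover have "(\<Sum>i\<in>J. if i = j then 1 else (0::real)) = 1" using assms(1) j by(simp add:sum.delta)
  ultimately show "p j : S" unfolding S_def by(intro CollectI exI[of _ "%i. if i = j then 1 else 0"]) auto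
 qed
 moreover have "convex S"
  unfolding convex_alt
 proof(intro ballI allI impI)
  fix x y and t :: real assume "x : S" "y : S" and t: "0 <= t & t <= 1"
  then obtain a b where a: "ALL i:J. 0 <= a i" "sum a J = 1" "x = (\<Sum>i\<in>J. a i *R p i)"
   and b: "ALL i:J. 0 <= b i" "sum b J = 1" "y = (\<Sum>i\<in>J. b i *R p i)" unfolding S_def by blast
  let ?c = "%i. (1 - t) * a i + t * b i"
  have "(1 - t) *R x + t *R y = (\<Sum>i\<in>J. ?c i *R p i)"
   by(simp add:a(3) b(3) scaleR_sum_right sum.distrib[symmetric] scaleR_add_left)
  moreover have "sum ?c J = 1" using a(2) b(2) by(simp add:sum.distrib sum_distrib_left[symmetric])
  moreover have "ALL i:J. 0 <= ?c i" using a(1) b(1) t by auto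
  ultimately show "(1 - t) *R x + t *R y : S"
   unfolding S_def by(intro CollectI exI[of _ ?c] conjI)
 qed
 ultimately have "convex hull (p ` J) <= S" by(rule hull_minimal)
 thus ?thesis using assms(2) that unfolding S_def by blast
qed

lemma convex_hull_in_convex_bodies: "finite S ==> S ~= {} ==> convex hull S : convex_bodies"
 by(auto simp:convex_bodies_def intro:compact_convex_hull finite_imp_compact)

text \<open>The coefficients of a point in one hull, applied to the other family, give a point at
  distance at most \<open>e\<close>.\<close>

lemma hausdorff_dist_convex_hull_le:
 fixes J :: "'i set" and p q :: "'i => 'a::euclidean_space"
 assumes J: "finite J" "J ~= {}" and d: "!!i. i : J ==> dist (p i) (q i) <= e"
 shows "hausdorff_dist (convex hull (p ` J)) (convex hull (q ` J)) <= e"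
proof -
 have *: "EX y:convex hull (q ` J). dist x y <= e"
  if x: "x : convex hull (p ` J)" and d: "!!i. i : J ==> dist (p i) (q i) <= e" for p q :: "'i => 'a" and x
 proof -
  obtain a where a: "!!i. i : J ==> 0 <= a i" "sum a J = 1" "x = (\<Sum>i\<in>J. a i *R p i)"
   by(rule convex_hull_finite_image_sum[OF J(1) x]) blast
  show ?thesis
  proof
   show "(\<Sum>i\<in>J. a i *R q i) : convex hull (q ` J)"
    using a(1,2) J(1) by(intro convex_sum) (auto simp:convex_convex_hull hull_inc)
   have "dist x (\<Sum>i\<in>J. a i *R q i) = norm (\<Sum>i\<in>J. a i *R (p i - q i))"
    by(simp add:a(3) dist_norm sum_subtractf scaleR_diff_right)
   also have "... <= (\<Sum>i\<in>J. norm (a i *R (p i - q i)))" by(rule norm_sum)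
   also have "... <= (\<Sum>i\<in>J. a i * e)"
    using a(1) d by(intro sum_mono) (auto simp:dist_norm mult_left_mono)
   also have "... = e" using a(2) by(simp add:sum_distrib_right[symmetric])
   finally show "dist x (\<Sum>i\<in>J. a i *R q i) <= e" .
  qed
 qed
 show ?thesis
  by(rule hausdorff_dist_leI) (use J d * in \<open>auto intro!: convex_hull_in_convex_bodies simp: dist_commute\<close>)
qed

text \<open>The hull depends on the finitely many coordinates in \<open>J\<close> only, so a product
  neighbourhood suffices.\<close>

lemma open_convex_hull_preimage:
 fixes J :: "nat set"
 assumes J: "finite J" "J ~= {}" and U: "openin CBT U"
 shows "open {p :: nat => 'a::euclidean_space. convex hull (p ` J) : U}"
proof(subst open_subopen, intro ballI)
 fix p :: "nat => 'a" assume p: "p : {p. convex hull (p ` J) : U}"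
 then obtain e where e: "0 < e" "CB.mball (convex hull (p ` J)) e <= U"
  using U unfolding CBT CB.openin_mtopology by blast
 let ?T = "\<Inter>i\<in>J. (%q :: nat => 'a. q i) -` ball (p i) (e / 2)"
 have "open ?T"
  using J(1) by(intro open_INT ballI open_vimage continuous_on_product_coordinates) auto
 moreover have "p : ?T" using e(1) by auto
 moreover have "?T <= {p. convex hull (p ` J) : U}"
 proof
  fix q assume q: "q : ?T"
  have "hausdorff_dist (convex hull (p ` J)) (convex hull (q ` J)) <= e / 2"
   using q by(intro hausdorff_dist_convex_hull_le J) (auto simp:less_imp_le)
  hence "convex hull (q ` J) : CB.mball (convex hull (p ` J)) e"
   using e(1) J by(auto intro!:convex_hull_in_convex_bodies)
  thus "q : {p. convex hull (p ` J) : U}" using e(2) by blast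
 qed
 ultimately show "EX T. open T & p : T & T <= {p. convex hull (p ` J) : U}" by blast
qed

lemma continuous_map_convex_hull:
 fixes J :: "nat set"
 assumes "finite J" "J ~= {}"
 shows "continuous_map euclidean CBT (%p :: nat => 'a::euclidean_space. convex hull (p ` J))"
 using assms open_convex_hull_preimage[OF assms]
 by(auto simp:continuous_map_def intro!:convex_hull_in_convex_bodies)

lemma measurable_convex_hull:
 fixes J :: "nat set" and f :: "nat => 'n => 'a::euclidean_space"
 assumes J: "finite J" "J ~= {}" and f: "!!i. i : J ==> f i : borel_measurable N"
 shows "(%w. convex hull ((%i. f i w) ` J)) : measurable N (borel_of CBT)"
proof(rule measurable_borel_ofI)
 show "convex hull ((%i. f i w) ` J) : topspace CBT" for w
  using J by(auto intro!:convex_hull_in_convex_bodies)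
 fix U :: "'a set set" assume U: "openin CBT U"
 \<comment> \<open>Coordinates outside \<open>J\<close> are frozen at 0, so that measurability holds
   in every coordinate.\<close>
 let ?g = "%w i. if i : J then f i w else 0"
 have g: "?g : borel_measurable N"
 proof(rule measurable_coordinatewise_then_product)
  show "(%w. if i : J then f i w else 0) : borel_measurable N" for i
   using f[of i] by(cases "i : J") simp_all
 qed
 have eq: "(%i. f i w) ` J = ?g w ` J" for w by auto
 have "(%w. convex hull ((%i. f i w) ` J)) -` U Int space N = ?g -` {p. convex hull (p ` J) : U} Int space N"
  unfolding eq by blast
 also have "... : sets N"
  by(rule measurable_sets[OF g]) (intro borel_open open_convex_hull_preimage J U)
 finally show "(%w. convex hull ((%i. f i w) ` J)) -` U Int space N : sets N" .
qed

text \<open>The limit lies in the open set \<open>U\<close> iff one of countably many closed inner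
  approximations of \<open>U\<close> contains all late members of the sequence.\<close>

lemma borel_CBT_limit:
 fixes g :: "'n => 'a::euclidean_space set"
 assumes f: "!!n. f n : measurable N (borel_of CBT)"
  and g: "!!x. x : space N ==> g x : convex_bodies"
  and lim: "!!x. x : space N ==> (%n. hausdorff_dist (f n x) (g x)) \<longlonglongrightarrow> 0"
 shows "g : measurable N (borel_of CBT)"
proof(rule measurable_borel_ofI)
 show "x : space N ==> g x : topspace CBT" for x using g by simp
 fix U :: "'a set set" assume U: "openin CBT U"
 \<comment> \<open>The bodies at distance at least \<open>1 / real (Suc m)\<close> from the
   complement of \<open>U\<close>, a closed condition.\<close>
 define V where "V m = {K : convex_bodies. CB.mball K (1 / real (Suc m)) <= U}" for m
 have Vc: "closedin CBT (V m)" for m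
 proof -
  have "convex_bodies - V m = (\<Union>y\<in>convex_bodies - U. CB.mball y (1 / real (Suc m)))"
   by(auto simp:V_def CB.commute)
  moreover have "openin CBT (\<Union>y\<in>convex_bodies - U. CB.mball y (1 / real (Suc m)))"
   unfolding CBT by(intro openin_Union) auto
  ultimately show ?thesis by(auto simp:closedin_def V_def)
 qed
 have fx: "f n x : convex_bodies" if "x : space N" for n x
  using measurable_space[OF f that] by simp
 have "g -` U Int space N = (\<Union>m. \<Union>n0. \<Inter>n\<in>{n0..}. f n -` V m Int space N)"
 proof(rule equalityI; rule subsetI)
  fix x assume "x : g -` U Int space N"
  hence x: "x : space N" "g x : U" by auto
  then obtain e where e: "0 < e" "CB.mball (g x) e <= U" using U unfolding CBT CB.openin_mtopology by blast
  obtain m where m: "1 / real (Suc m) < e / 2" using nat_approx_posE[of "e / 2"] e(1) by auto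
  have "\<forall>\<^sub>F n in sequentially. hausdorff_dist (f n x) (g x) < e / 2"
   using order_tendstoD(2)[OF lim[OF x(1)], of "e / 2"] e(1) by simp
  then obtain n0 where n0: "!!n. n >= n0 ==> hausdorff_dist (f n x) (g x) < e / 2"
   by(auto simp:eventually_sequentially)
  have "f n x : V m" if "n >= n0" for n
  proof -
   have "CB.mball (f n x) (1 / real (Suc m)) <= CB.mball (g x) e"
   proof
    fix K assume "K : CB.mball (f n x) (1 / real (Suc m))"
    hence K: "K : convex_bodies" "hausdorff_dist (f n x) K < e / 2" using m by auto
    have "hausdorff_dist (g x) K <= hausdorff_dist (g x) (f n x) + hausdorff_dist (f n x) K"
     by(rule CB.triangle) (use g x fx K in auto)
    thus "K : CB.mball (g x) e" using K n0[OF that] g[OF x(1)] CB.commute[of "g x" "f n x"] by auto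
   qed
   thus ?thesis using e(2) fx[OF x(1)] by(auto simp:V_def)
  qed
  thus "x : (\<Union>m. \<Union>n0. \<Inter>n\<in>{n0..}. f n -` V m Int space N)" using x(1) by auto
 next
  fix x assume "x : (\<Union>m. \<Union>n0. \<Inter>n\<in>{n0..}. f n -` V m Int space N)"
  then obtain m n0 where x: "!!n. n >= n0 ==> f n x : V m" "x : space N" by auto
  have "\<forall>\<^sub>F n in sequentially. hausdorff_dist (f n x) (g x) < 1 / real (Suc m)"
   using order_tendstoD(2)[OF lim[OF x(2)], of "1 / real (Suc m)"] by simp
  then obtain n1 where n1: "!!n. n >= n1 ==> hausdorff_dist (f n x) (g x) < 1 / real (Suc m)"
   by(auto simp:eventually_sequentially)
  have "g x : CB.mball (f (max n0 n1) x) (1 / real (Suc m))"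
   using n1[of "max n0 n1"] fx[OF x(2)] g[OF x(2)] by auto
  moreover have "CB.mball (f (max n0 n1) x) (1 / real (Suc m)) <= U"
   using x(1)[of "max n0 n1"] by(simp add:V_def)
  ultimately show "x : g -` U Int space N" using x(2) by blast
 qed
 also have "... : sets N"
 proof -
  have 1: "f n -` V m Int space N : sets N" for n m
   by(rule measurable_sets[OF f closedin_sets_borel_of[OF Vc]])
  have 2: "(\<Inter>n\<in>{n0..}. f n -` V m Int space N) : sets N" for m and n0 :: nat
   by(rule sets.countable_INT') (use 1 in auto)
  have 3: "(\<Union>n0. \<Inter>n\<in>{n0..}. f n -` V m Int space N) : sets N" for m
   by(rule sets.countable_UN) (use 2 in blast)
  show ?thesis by(rule sets.countable_UN) (use 3 in blast)
 qed
 finally show "g -` U Int space N : sets N" .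
qed

section \<open>Random similarities\<close>

text \<open>Centering and the shape map are instances. Centre and factor form one argument, so that
  both can be random.\<close>

definition affmap :: "'a::euclidean_space \<times> real => 'a set => 'a set" where
 "affmap cs P = (%x. snd cs *R (x - fst cs)) ` P"

lemma affmap_in_convex_bodies:
 assumes "P : convex_bodies"
 shows "affmap cs P : convex_bodies"
proof -
 have eq: "affmap cs P = (%x. snd cs *R x) ` ((+) (- fst cs) ` P)" by(auto simp:affmap_def image_image)
 have "compact P" "convex P" "P ~= {}" using assms by(auto simp:convex_bodies_def)
 thus ?thesis
  unfolding eq convex_bodies_def mem_Collect_eq
  by(intro conjI compact_scaling compact_translation convex_scaling convex_translation) simp_all
qed

lemma hausdorff_dist_affmap_le:
 assumes P: "P : convex_bodies" and Q: "Q : convex_bodies"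
 shows "hausdorff_dist (affmap cs P) (affmap cs Q) <= \<bar>snd cs\<bar> * hausdorff_dist P Q"
proof -
 have *: "EX y:affmap cs B. dist x y <= \<bar>snd cs\<bar> * hausdorff_dist P Q"
  if A: "A : convex_bodies" "B : convex_bodies" "x : affmap cs A" "hausdorff_dist A B = hausdorff_dist P Q" for A B x
 proof -
  obtain a where a: "a : A" "x = snd cs *R (a - fst cs)" using A(3) by(auto simp:affmap_def)
  obtain b where b: "b : B" "dist a b <= hausdorff_dist A B" by(rule hausdorff_dist_leD[OF A(1,2) a(1)])
  show ?thesis
  proof
   show "snd cs *R (b - fst cs) : affmap cs B" using b(1) by(auto simp:affmap_def)
   have "dist x (snd cs *R (b - fst cs)) = norm (snd cs *R (a - b))"
    by(simp add:a(2) dist_norm scaleR_diff_right[symmetric])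
   also have "... <= \<bar>snd cs\<bar> * hausdorff_dist P Q"
    using b(2) A(4) by(simp add:dist_norm mult_left_mono)
   finally show "dist x (snd cs *R (b - fst cs)) <= \<bar>snd cs\<bar> * hausdorff_dist P Q" .
  qed
 qed
 show ?thesis
 proof(rule hausdorff_dist_leI[OF affmap_in_convex_bodies[OF P] affmap_in_convex_bodies[OF Q]])
  fix x assume "x : affmap cs P"
  thus "EX y:affmap cs Q. dist x y <= \<bar>snd cs\<bar> * hausdorff_dist P Q" by(rule *[OF P Q _ refl])
 next
  fix y assume "y : affmap cs Q"
  thus "EX x:affmap cs P. dist y x <= \<bar>snd cs\<bar> * hausdorff_dist P Q" by(rule *[OF Q P _ CB.commute])
 qed
qed

lemma continuous_map_affmap: "continuous_map CBT CBT (affmap cs)"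
proof -
 have "Lipschitz_continuous_map CB.Self CB.Self (affmap cs)"
  unfolding Lipschitz_continuous_map_def
  using hausdorff_dist_affmap_le[of _ _ cs] affmap_in_convex_bodies[of _ cs]
  by(auto intro!:exI[of _ "\<bar>snd cs\<bar>"])
 hence "continuous_map (mtopology_of CB.Self) (mtopology_of CB.Self) (affmap cs)"
  by(rule Lipschitz_continuous_imp_continuous_map)
 thus ?thesis by(simp add:CBT mtopology_of_def)
qed

lemma measurable_continuous_map:
 assumes "continuous_map T T' f"
 shows "f : measurable (borel_of T) (borel_of T')"
proof(rule measurable_borel_ofI)
 show "!!x. x : space (borel_of T) ==> f x : topspace T'"
  using assms by(auto simp:space_borel_of continuous_map_def)
 fix U assume "openin T' U"
 hence "openin T {x : topspace T. f x : U}" using assms by(auto simp:continuous_map_def)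
 moreover have "f -` U Int space (borel_of T) = {x : topspace T. f x : U}" by(auto simp:space_borel_of)
 ultimately show "f -` U Int space (borel_of T) : sets (borel_of T)" by(simp add:openin_sets_borel_of)
qed

text \<open>With fixed parameters the map is continuous, so simple random parameters give measurable
  results, and arbitrary ones are pointwise limits of simple ones. No product structure with the
  space of bodies is involved.\<close>

lemma measurable_affmap:
 fixes \<pi> :: "'n => 'a::euclidean_space \<times> real"
 assumes \<pi>: "\<pi> : borel_measurable N" and Z: "Z : measurable N (borel_of CBT)"
 shows "(%om. affmap (\<pi> om) (Z om)) : measurable N (borel_of CBT)"
proof -
 obtain F where F: "!!i. simple_function N (F i)" "!!x. x : space N ==> (%i. F i x) \<longlonglongrightarrow> \<pi> x"
  using borel_measurable_implies_sequence_metric[OF \<pi>, of 0] by blast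
 have Zx: "Z x : convex_bodies" if "x : space N" for x using measurable_space[OF Z that] by simp
 show ?thesis
 proof(rule borel_CBT_limit[where f = "%n om. affmap (F n om) (Z om)"])
  fix n
  show "(%om. affmap (F n om) (Z om)) : measurable N (borel_of CBT)"
  proof(rule measurable_borel_ofI)
   show "om : space N ==> affmap (F n om) (Z om) : topspace CBT" for om
    using Zx by(simp add:affmap_in_convex_bodies)
   fix U :: "'a set set" assume U: "openin CBT U"
   have "(%om. affmap (F n om) (Z om)) -` U Int space N =
    (\<Union>c\<in>F n ` space N. (F n -` {c} Int space N) Int ((%om. affmap c (Z om)) -` U Int space N))" by auto
   also have "... : sets N"
   proof(rule sets.finite_UN)
    show "finite (F n ` space N)" using simple_functionD(1)[OF F(1)] .
    show "(F n -` {c} Int space N) Int ((%om. affmap c (Z om)) -` U Int space N) : sets N" for c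
     using simple_functionD(2)[OF F(1), of n "{c}"]
      measurable_sets[OF measurable_compose[OF Z measurable_continuous_map[OF continuous_map_affmap]] openin_sets_borel_of[OF U]]
     by blast
   qed
   finally show "(%om. affmap (F n om) (Z om)) -` U Int space N : sets N" .
  qed
 next
  show "x : space N ==> affmap (\<pi> x) (Z x) : convex_bodies" for x using Zx by(rule affmap_in_convex_bodies)
 next
  fix x assume x: "x : space N"
  obtain R where R: "!!y. y : Z x ==> norm y <= R"
   using Zx[OF x] compact_imp_bounded by(force simp:convex_bodies_def bounded_iff)
  \<comment> \<open>The first term bounds the effect of the changed factor on a body of radius
    \<open>R\<close>, the second one that of the changed shift.\<close>
  let ?b = "%n. \<bar>snd (F n x) - snd (\<pi> x)\<bar> * R + norm (snd (F n x) *R fst (F n x) - snd (\<pi> x) *R fst (\<pi> x))"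
  have le: "hausdorff_dist (affmap (F n x) (Z x)) (affmap (\<pi> x) (Z x)) <= ?b n" for n
  proof -
   have pt: "dist (snd (F n x) *R (y - fst (F n x))) (snd (\<pi> x) *R (y - fst (\<pi> x))) <= ?b n" if "y : Z x" for y
   proof -
    have "snd (F n x) *R (y - fst (F n x)) - snd (\<pi> x) *R (y - fst (\<pi> x)) =
     (snd (F n x) - snd (\<pi> x)) *R y - (snd (F n x) *R fst (F n x) - snd (\<pi> x) *R fst (\<pi> x))"
     by(simp add:algebra_simps)
    hence "dist (snd (F n x) *R (y - fst (F n x))) (snd (\<pi> x) *R (y - fst (\<pi> x))) <=
     norm ((snd (F n x) - snd (\<pi> x)) *R y) + norm (snd (F n x) *R fst (F n x) - snd (\<pi> x) *R fst (\<pi> x))"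
     unfolding dist_norm by(metis norm_triangle_ineq4)
    also have "norm ((snd (F n x) - snd (\<pi> x)) *R y) <= \<bar>snd (F n x) - snd (\<pi> x)\<bar> * R"
     using R[OF that] by(simp add:mult_left_mono)
    finally show ?thesis by simp
   qed
   show ?thesis
   proof(rule hausdorff_dist_leI)
    fix w assume "w : affmap (F n x) (Z x)"
    then obtain y where "y : Z x" "w = snd (F n x) *R (y - fst (F n x))" by(auto simp:affmap_def)
    thus "EX y:affmap (\<pi> x) (Z x). dist w y <= ?b n" using pt by(auto simp:affmap_def)
   next
    fix w assume "w : affmap (\<pi> x) (Z x)"
    then obtain y where "y : Z x" "w = snd (\<pi> x) *R (y - fst (\<pi> x))" by(auto simp:affmap_def)
    thus "EX y:affmap (F n x) (Z x). dist w y <= ?b n" using pt by(auto simp:affmap_def dist_commute)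
   qed (rule affmap_in_convex_bodies[OF Zx[OF x]])+
  qed
  have "?b \<longlonglongrightarrow> \<bar>snd (\<pi> x) - snd (\<pi> x)\<bar> * R + norm (snd (\<pi> x) *R fst (\<pi> x) - snd (\<pi> x) *R fst (\<pi> x))"
   using F(2)[OF x] by(intro tendsto_intros tendsto_fst tendsto_snd)
  hence "?b \<longlonglongrightarrow> 0" by simp
  thus "(%n. hausdorff_dist (affmap (F n x) (Z x)) (affmap (\<pi> x) (Z x))) \<longlonglongrightarrow> 0"
   by(rule tendsto_sandwich[OF _ _ tendsto_const, rotated 2]) (auto simp:le CB.nonneg)
 qed
qed

section \<open>Inscribed balls described by orthonormal frames\<close>

text \<open>The value 0 outside the index range makes this a compact set in the product topology on
  all functions.\<close>

definition frames :: "nat => (nat => 'a::euclidean_space) set" where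
 "frames k = {f. (ALL i:{1..k}. ALL j:{1..k}. inner (f i) (f j) = (if i = j then 1 else 0)) & (ALL i. i ~: {1..k} --> f i = 0)}"

lemma compact_frames: "compact (frames k :: (nat => 'a::euclidean_space) set)"
proof -
 let ?B = "PiE UNIV (%_. cball 0 1) :: (nat => 'a) set"
 have "compactin (product_topology (%_. euclidean) UNIV) ?B"
  by(subst compactin_PiE) (auto simp:compactin_euclidean_iff)
 hence B: "compact ?B" by(simp add:euclidean_product_topology compactin_euclidean_iff)
 let ?C1 = "\<Inter>i\<in>{1..k}. \<Inter>j\<in>{1..k}. {f :: nat => 'a. inner (f i) (f j) = (if i = j then 1 else 0)}"
 let ?C2 = "\<Inter>i\<in>- {1..k}. {f :: nat => 'a. f i = 0}"
 have c: "continuous_on UNIV (%f :: nat => 'a. f i)" for i by(rule continuous_on_product_coordinates)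
 have "closed ?C1" using c by(intro closed_INT ballI closed_Collect_eq continuous_intros)
 moreover have "closed ?C2" using c by(intro closed_INT ballI closed_Collect_eq continuous_intros)
 ultimately have cl: "closed (?C1 Int ?C2)" by(rule closed_Int)
 have "frames k = ?B Int (?C1 Int ?C2)"
 proof(rule equalityI; rule subsetI)
  fix f :: "nat => 'a" assume f: "f : frames k"
  have "norm (f i) <= 1" for i
   using f by(cases "i : {1..k}") (auto simp:frames_def norm_eq_sqrt_inner)
  thus "f : ?B Int (?C1 Int ?C2)" using f by(auto simp:frames_def)
 qed (auto simp:frames_def)
 thus ?thesis using compact_Int_closed[OF B cl] by simp
qed

definition kball :: "nat => 'a::euclidean_space => (nat => 'a) => real => 'a set" where
 "kball k z f q = {z + (\<Sum>i=1..k. a i *R f i) | a. (\<Sum>i=1..k. (a i)\<^sup>2) <= q\<^sup>2}"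

lemma frame_norm:
 assumes "f : frames k"
 shows "(norm (\<Sum>i=1..k. a i *R f i))\<^sup>2 = (\<Sum>i=1..k. (a i)\<^sup>2)"
proof -
 have "(norm (\<Sum>i=1..k. a i *R f i))\<^sup>2 = (\<Sum>i=1..k. \<Sum>j=1..k. a i * (a j * inner (f j) (f i)))"
  by(simp add:power2_norm_eq_inner inner_sum_left inner_sum_right sum_distrib_left mult.left_commute)
 also have "... = (\<Sum>i=1..k. \<Sum>j=1..k. if i = j then a i * a j else 0)"
  using assms by(intro sum.cong) (auto simp:frames_def)
 also have "... = (\<Sum>i=1..k. (a i)\<^sup>2)" by(simp add:sum.delta power2_eq_square)
 finally show ?thesis .
qed

lemma frame_indep: "f : frames k ==> indep_fam f {1..k}"
 unfolding indep_fam_iff_sum[OF finite_atLeastAtMost]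
proof(intro allI impI)
 fix a assume f: "f : frames k" and "(\<Sum>i\<in>{1..k}. a i *R f i) = 0"
 hence "(\<Sum>i=1..k. (a i)\<^sup>2) = 0" using frame_norm[OF f, of a] by simp
 thus "ALL i:{1..k}. a i = 0" by(simp add:sum_nonneg_eq_0_iff)
qed

lemma subspace_frame:
 fixes L :: "'a::euclidean_space set"
 assumes "subspace L" "dim L = k"
 obtains f where "f : frames k" "span (f ` {1..k}) = L"
proof -
 obtain B where B: "B <= L" "pairwise orthogonal B" "!!x. x : B ==> norm x = 1" "independent B"
  "card B = dim L" "span B = L"
  using orthonormal_basis_subspace[OF assms(1)] by metis
 have "finite B" using B(4) by(rule finiteI_independent)
 then obtain g where g: "bij_betw g {1..k} B"
  using finite_same_card_bij[of "{1..k}" B] B(5) assms(2) by auto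
 define f where "f i = (if i : {1..k} then g i else 0)" for i
 have gB: "g i : B" if "i : {1..k}" for i using g that by(auto simp:bij_betw_def)
 have "inner (g i) (g j) = (if i = j then 1 else 0)" if "i : {1..k}" "j : {1..k}" for i j
 proof(cases "i = j")
  case True thus ?thesis using B(3)[OF gB[OF that(1)]] by(simp add:norm_eq_1)
 next
  case False
  hence "g i ~= g j" using inj_on_eq_iff[OF bij_betw_imp_inj_on[OF g] that] by blast
  hence "orthogonal (g i) (g j)" using B(2) gB[OF that(1)] gB[OF that(2)] unfolding pairwise_def by blast
  thus ?thesis using False by(simp add:orthogonal_def)
 qed
 hence "f : frames k" by(simp add:frames_def f_def)
 moreover have "f ` {1..k} = B" using g by(auto simp:f_def bij_betw_def)
 ultimately show ?thesis using that B(6) by simp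
qed

text \<open>Centres and frames range over compact sets. Along a convergent subsequence every point
  of the limit ball is a limit of points of the given bodies.\<close>

lemma kball_limit:
 fixes P :: "nat => 'a::euclidean_space set"
 assumes P: "!!n. P n : convex_bodies" "Q : convex_bodies" "(%n. hausdorff_dist (P n) Q) \<longlonglongrightarrow> 0"
  and q: "!!n. 0 < q n" "0 < q'" "q \<longlonglongrightarrow> q'"
  and F: "compact F" and ex: "!!n. EX z:F. EX f:frames k. kball k z f (q n) <= P n"
 shows "EX z:F. EX f:frames k. kball k z f q' <= Q"
proof -
 obtain z f where zf: "!!n. z n : F" "!!n. f n : frames k" "!!n. kball k (z n) (f n) (q n) <= P n"
  using ex by metis
 have "compact (F \<times> (frames k :: (nat => 'a) set))" by(intro compact_Times F compact_frames)
 hence "EX l:F \<times> frames k. EX r. strict_mono r & ((%n. (z n, f n)) \<circ> r) \<longlonglongrightarrow> l"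
  using zf(1,2) unfolding compact_def by auto
 then obtain l r where l: "l : F \<times> frames k" and r: "strict_mono r" and lim: "((%n. (z n, f n)) \<circ> r) \<longlonglongrightarrow> l"
  by blast
 have lz: "(%n. z (r n)) \<longlonglongrightarrow> fst l" using tendsto_fst[OF lim] by(simp add:comp_def)
 have lf: "(%n. f (r n) i) \<longlonglongrightarrow> snd l i" for i
 proof -
  have "(%n. f (r n)) \<longlonglongrightarrow> snd l" using tendsto_snd[OF lim] by(simp add:comp_def)
  thus ?thesis
   using continuous_on_tendsto_compose[OF continuous_on_product_coordinates[of i]] by auto
 qed
 have lq: "(%n. q (r n)) \<longlonglongrightarrow> q'" using LIMSEQ_subseq_LIMSEQ[OF q(3) r] by(simp add:comp_def)
 have lh: "(%n. hausdorff_dist (P (r n)) Q) \<longlonglongrightarrow> 0" using LIMSEQ_subseq_LIMSEQ[OF P(3) r] by(simp add:comp_def)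
 have clQ: "closed Q" "Q ~= {}" using P(2) by(auto simp:convex_bodies_def compact_imp_closed)
 have "kball k (fst l) (snd l) q' <= Q"
 proof
  fix x assume "x : kball k (fst l) (snd l) q'"
  then obtain a where a: "x = fst l + (\<Sum>i=1..k. a i *R snd l i)" "(\<Sum>i=1..k. (a i)\<^sup>2) <= q'\<^sup>2"
   by(auto simp:kball_def)
  \<comment> \<open>The coordinates of \<open>x\<close>, rescaled from radius \<open>q'\<close> to
    radius \<open>q (r n)\<close>.\<close>
  define y where "y n = z (r n) + (\<Sum>i=1..k. (q (r n) / q' * a i) *R f (r n) i)" for n
  have "y n : kball k (z (r n)) (f (r n)) (q (r n))" for n
  proof -
   have "(\<Sum>i=1..k. (q (r n) / q' * a i)\<^sup>2) = (q (r n) / q')\<^sup>2 * (\<Sum>i=1..k. (a i)\<^sup>2)"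
    by(simp only:power_mult_distrib sum_distrib_left)
   also have "... <= (q (r n) / q')\<^sup>2 * q'\<^sup>2" using a(2) by(intro mult_left_mono) auto
   also have "... = (q (r n))\<^sup>2" using q(2) by(simp add:power_divide)
   finally show ?thesis unfolding kball_def y_def
    by(intro CollectI exI[of _ "%i. q (r n) / q' * a i"]) auto
  qed
  hence yP: "y n : P (r n)" for n using zf(3) by blast
  have "y \<longlonglongrightarrow> fst l + (\<Sum>i=1..k. (q' / q' * a i) *R snd l i)"
   unfolding y_def using q(2) by(intro tendsto_intros lz lf lq) auto
  hence ly: "y \<longlonglongrightarrow> x" using q(2) a(1) by simp
  have "infdist x Q <= dist x (y n) + hausdorff_dist (P (r n)) Q" for n
  proof -
   have "infdist (y n) Q <= hausdorff_dist (P (r n)) Q" using hausdorff_dist_le_iff[OF P(1,2)] yP by blast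
   moreover have "infdist x Q <= infdist (y n) Q + dist x (y n)" by(rule infdist_triangle)
   ultimately show ?thesis by simp
  qed
  moreover have "(%n. dist x (y n) + hausdorff_dist (P (r n)) Q) \<longlonglongrightarrow> dist x x + 0"
   by(intro tendsto_intros ly lh)
  ultimately have "infdist x Q <= 0" by(intro LIMSEQ_le_const[of _ "0"]) auto
  hence "infdist x Q = 0" using infdist_nonneg[of x Q] by linarith
  thus "x : Q" using in_closed_iff_infdist_zero[OF clQ] by blast
 qed
 thus ?thesis using l by(auto simp:mem_Times_iff)
qed

lemma polytopes_dim_subset: "P : polytopes_dim k ==> P : convex_bodies"
proof -
 assume P: "P : polytopes_dim k"
 hence "P ~= {}" using aff_dim_empty[of P] by(auto simp:polytopes_dim_def)
 thus ?thesis using P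
  by(auto simp:polytopes_dim_def convex_bodies_def polytope_imp_compact polytope_imp_convex)
qed

lemma polytopes_dim_direction:
 fixes P :: "'a::euclidean_space set"
 assumes P: "P : polytopes_dim k" and z: "z : P"
 obtains L where "subspace L" "dim L = k" "affine hull P = (%x. z + x) ` L"
proof -
 define L where "L = (%x. x - z) ` (affine hull P)"
 have L: "subspace L"
  unfolding L_def by(rule affine_diffs_subspace_subtract[OF affine_affine_hull]) (simp add:hull_inc z)
 have aff: "affine hull P = (%x. z + x) ` L" by(auto simp:L_def image_image)
 have "aff_dim P = aff_dim (affine hull P)" by(rule aff_dim_affine_hull[symmetric])
 hence "int k = int (dim L)"
  using P unfolding aff aff_dim_translation_eq aff_dim_subspace[OF L] by(simp add:polytopes_dim_def)
 thus ?thesis using that L aff by simp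
qed

text \<open>The affine hull in the definition of an inscribed ball is awkward under Hausdorff
  limits, while a frame passes to the limit. A frame whose ball lies in \<open>P\<close> spans the
  direction space of \<open>P\<close>, as both dimensions are \<open>k\<close>.\<close>

lemma inscribed_ball_iff_kball:
 fixes P :: "'a::euclidean_space set"
 assumes P: "P : polytopes_dim k"
 shows "inscribed_ball P z q <-> 0 < q & (EX f:frames k. kball k z f q <= P)"
proof
 assume i: "inscribed_ball P z q"
 hence z: "z : P" and q: "0 < q" and sub: "cball z q Int affine hull P <= P" by(auto simp:inscribed_ball_def)
 obtain L where L: "subspace L" "dim L = k" "affine hull P = (%x. z + x) ` L"
  by(rule polytopes_dim_direction[OF P z])
 obtain f where f: "f : frames k" "span (f ` {1..k}) = L" by(rule subspace_frame[OF L(1,2)])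
 have "kball k z f q <= P"
 proof
  fix x assume "x : kball k z f q"
  then obtain a where a: "x = z + (\<Sum>i=1..k. a i *R f i)" "(\<Sum>i=1..k. (a i)\<^sup>2) <= q\<^sup>2"
   by(auto simp:kball_def)
  have "(\<Sum>i=1..k. a i *R f i) : span (f ` {1..k})" by(intro span_sum span_scale span_base imageI)
  hence "x : affine hull P" using a(1) f(2) L(3) by blast
  moreover have "norm (\<Sum>i=1..k. a i *R f i) <= q"
   using a(2) q unfolding frame_norm[OF f(1), symmetric] by(simp add:power_mono_iff)
  ultimately show "x : P" using sub a(1) by(auto simp:dist_norm)
 qed
 thus "0 < q & (EX f:frames k. kball k z f q <= P)" using q f(1) by blast
next
 assume "0 < q & (EX f:frames k. kball k z f q <= P)"
 then obtain f where q: "0 < q" and f: "f : frames k" and sub: "kball k z f q <= P" by blast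
 have "z : kball k z f q" unfolding kball_def using q by(intro CollectI exI[of _ "%_. 0"]) auto
 hence z: "z : P" using sub by blast
 obtain L where L: "subspace L" "dim L = k" "affine hull P = (%x. z + x) ` L"
  by(rule polytopes_dim_direction[OF P z])
 have fL: "f i : L" if i: "i : {1..k}" for i
 proof -
  have "(\<Sum>j=1..k. (if j = i then q else 0) *R f j) = (\<Sum>j=1..k. if j = i then q *R f j else 0)"
   by(intro sum.cong) auto
  also have "... = q *R f i" using i by(simp add:sum.delta)
  finally have e: "(\<Sum>j=1..k. (if j = i then q else 0) *R f j) = q *R f i" .
  have "(\<Sum>j=1..k. (if j = i then q else 0)\<^sup>2) = (\<Sum>j=1..k. if j = i then q\<^sup>2 else 0)" by(intro sum.cong) auto
  also have "... = q\<^sup>2" using i by(simp add:sum.delta)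
  finally have "z + q *R f i : kball k z f q"
   unfolding kball_def e[symmetric] by(intro CollectI exI[of _ "%j. if j = i then q else 0"]) auto
  hence "z + q *R f i : affine hull P" using sub by(simp add:hull_inc subsetD)
  hence "q *R f i : L" unfolding L(3) by auto
  hence "(1 / q) *R q *R f i : L" by(rule subspace_scale[OF L(1)])
  thus ?thesis using q by simp
 qed
 have "span (f ` {1..k}) = L"
 proof(rule subspace_dim_equal)
  show "span (f ` {1..k}) <= L" using fL by(intro span_minimal L(1)) auto
  show "dim L <= dim (span (f ` {1..k}))" using indep_fam_dim_span[OF frame_indep[OF f]] L(2) by simp
 qed (auto intro:L(1))
 have "x : P" if x: "x : cball z q Int affine hull P" for x
 proof -
  obtain w where w: "w : L" "x = z + w" using x unfolding L(3) by blast
  obtain a where a: "w = (\<Sum>i\<in>{1..k}. a i *R f i)"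
   using indep_fam_span_sum[OF frame_indep[OF f], of w] w(1) \<open>span (f ` {1..k}) = L\<close> by auto
  have "norm w <= q" using x w(2) by(auto simp:dist_norm)
  hence "(\<Sum>i=1..k. (a i)\<^sup>2) <= q\<^sup>2" unfolding frame_norm[OF f, symmetric] a[symmetric] by(intro power_mono) auto
  hence "x : kball k z f q" using a w(2) by(auto simp:kball_def)
  thus ?thesis using sub by blast
 qed
 thus "inscribed_ball P z q" using q z by(auto simp:inscribed_ball_def)
qed

lemma inscribed_ball_mono:
 assumes "inscribed_ball P z r" "0 < q" "q <= r"
 shows "inscribed_ball P z q"
proof -
 have "cball z q <= cball z r" using assms(3) by(rule subset_cball)
 thus ?thesis using assms(1,2) unfolding inscribed_ball_def by blast
qed

text \<open>For positive dimension the affine hull contains a point at distance exactly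
  \<open>q\<close> from the centre. The bound makes the supremum of the radii finite.\<close>

lemma inscribed_ball_le_diameter:
 fixes P :: "'a::euclidean_space set"
 assumes P: "P : polytopes_dim k" and k: "1 <= k" and i: "inscribed_ball P z q"
 shows "q <= diameter P"
proof -
 have z: "z : P" and q: "0 < q" and sub: "cball z q Int affine hull P <= P" using i by(auto simp:inscribed_ball_def)
 obtain L where L: "subspace L" "dim L = k" "affine hull P = (%x. z + x) ` L"
  by(rule polytopes_dim_direction[OF P z])
 have "~ L <= {0}"
 proof
  assume "L <= {0}"
  hence "L = {0}" using subspace_0[OF L(1)] by blast
  thus False using L(2) k by simp
 qed
 then obtain w where w: "w : L" "w ~= 0" by blast
 let ?y = "z + (q / norm w) *R w"
 have "?y : affine hull P" unfolding L(3) by(intro imageI subspace_scale L(1) w(1))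
 moreover have d: "dist z ?y = q" using q w(2) by(simp add:dist_norm)
 ultimately have "?y : P" using sub by auto
 moreover have "bounded P"
  using polytopes_dim_subset[OF P] by(auto simp:convex_bodies_def compact_imp_bounded)
 ultimately have "dist z ?y <= diameter P" using z by(intro diameter_bounded_bound)
 thus ?thesis using d by simp
qed

text \<open>Take rational radii that increase to the supremum; their centres can be chosen in
  \<open>F\<close>, and compactness produces a ball of the supremal radius centred in
  \<open>F\<close>.\<close>

lemma inball_in_compact:
 fixes P :: "'a::euclidean_space set"
 assumes P: "P : polytopes_dim k" and k: "1 <= k" and F: "compact F"
  and h: "!!q. q : \<rat> ==> 0 < q ==> (EX z. inscribed_ball P z q) ==> EX z:F. inscribed_ball P z q"
 shows "EX z:F. EX r. inball P z r"
proof -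
 define R where "R = {q. EX z. inscribed_ball P z q}"
 have Pb: "P : convex_bodies" by(rule polytopes_dim_subset[OF P])
 have bdd: "bdd_above R" unfolding R_def using inscribed_ball_le_diameter[OF P k] by(intro bdd_aboveI) auto
 have "rel_interior P ~= {}" using Pb by(auto simp:convex_bodies_def rel_interior_eq_empty)
 then obtain z0 e where e: "z0 : P" "0 < e" "cball z0 e Int affine hull P <= P"
  by(auto simp:mem_rel_interior_cball)
 hence eR: "e : R" by(auto simp:R_def inscribed_ball_def)
 define rm where "rm = Sup R"
 have rm: "0 < rm" using cSup_upper[OF eR bdd] e(2) by(simp add:rm_def)
 \<comment> \<open>The bound \<open>rm / 2\<close> keeps the radii positive.\<close>
 have "EX q:\<rat>. max (rm / 2) (rm - 1 / real (Suc n)) < q & q < rm" for n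
  using Rats_dense_in_real[of "max (rm / 2) (rm - 1 / real (Suc n))" rm] rm by auto
 then obtain q where q: "!!n. q n : \<rat>" "!!n. max (rm / 2) (rm - 1 / real (Suc n)) < q n" "!!n. q n < rm" by metis
 have q0: "0 < q n" for n using q(2)[of n] rm by auto
 have "q \<longlonglongrightarrow> rm"
 proof(rule tendsto_sandwich[OF _ _ _ tendsto_const])
  show "\<forall>\<^sub>F n in sequentially. rm - 1 / real (Suc n) <= q n" using q(2) by(intro always_eventually allI) (simp add:less_imp_le)
  show "\<forall>\<^sub>F n in sequentially. q n <= rm" using q(3) by(intro always_eventually allI) (simp add:less_imp_le)
  have "(%n. rm - 1 / real (Suc n)) \<longlonglongrightarrow> rm - 0" by(intro tendsto_intros LIMSEQ_Suc[OF lim_1_over_n])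
  thus "(%n. rm - 1 / real (Suc n)) \<longlonglongrightarrow> rm" by simp
 qed
 have "EX z:F. EX f:frames k. kball k z f (q n) <= P" for n
 proof -
  obtain r where "r : R" "q n < r" using q(3)[of n] less_cSup_iff[OF _ bdd] eR unfolding rm_def by blast
  hence "EX z. inscribed_ball P z (q n)" unfolding R_def using inscribed_ball_mono q0[of n] less_imp_le by blast
  hence "EX z:F. inscribed_ball P z (q n)" by(rule h[OF q(1) q0])
  thus ?thesis using inscribed_ball_iff_kball[OF P] by blast
 qed
 note ex = this
 have "EX z:F. EX f:frames k. kball k z f rm <= P"
 proof(rule kball_limit[of "%_. P" P q rm F k])
  show "(%n. hausdorff_dist P P) \<longlonglongrightarrow> 0" using CB.mdist_zero[OF Pb] by simp
 qed (fact Pb q0 rm \<open>q \<longlonglongrightarrow> rm\<close> F ex)+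
 then obtain z where z: "z : F" "inscribed_ball P z rm" using inscribed_ball_iff_kball[OF P] rm by blast
 have "s <= rm" if "inscribed_ball P y s" for y s
  unfolding rm_def using that by(intro cSup_upper bdd) (auto simp:R_def)
 thus ?thesis using z by(auto simp:inball_def)
qed

section \<open>Measurability of inballs and incenters\<close>

definition ball_bodies :: "nat => 'a::euclidean_space set => real => 'a set set" where
 "ball_bodies k F q = {P : convex_bodies. EX z:F. EX f:frames k. kball k z f q <= P}"

lemma closedin_ball_bodies:
 assumes "compact F" "0 < q"
 shows "closedin CBT (ball_bodies k F q)"
 unfolding CBT CB.metric_closedin_iff_sequentially_closed
proof(intro conjI allI impI)
 show "ball_bodies k F q <= convex_bodies" by(auto simp:ball_bodies_def)
 fix P Q assume h: "range P <= ball_bodies k F q & limitin CB.mtopology P Q sequentially"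
 hence "P n : ball_bodies k F q" for n by blast
 hence P: "P n : convex_bodies" "EX z:F. EX f:frames k. kball k z f q <= P n" for n
  unfolding ball_bodies_def by blast+
 have Q: "Q : convex_bodies" "(%n. hausdorff_dist (P n) Q) \<longlonglongrightarrow> 0"
  using h by(auto simp:CB.limitin_metric_dist_null)
 thus "Q : ball_bodies k F q"
  unfolding ball_bodies_def using kball_limit[OF P(1) Q, of "%_. q" q F k] assms P(2) by auto
qed

lemma ball_bodies_UNIV: "ball_bodies k UNIV q = (\<Union>n::nat. ball_bodies k (cball 0 (real n)) q)"
proof(rule equalityI; rule subsetI)
 fix P :: "'a set" assume "P : ball_bodies k UNIV q"
 then obtain z f where "P : convex_bodies" "f : frames k" "kball k z f q <= P" by(auto simp:ball_bodies_def)
 moreover obtain n where "norm z <= real n" using real_arch_simple by blast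
 ultimately have "P : ball_bodies k (cball 0 (real n)) q"
  unfolding ball_bodies_def by(intro CollectI conjI bexI[of _ z] bexI[of _ f]) auto
 thus "P : (\<Union>n::nat. ball_bodies k (cball 0 (real n)) q)" by blast
qed (auto simp:ball_bodies_def)

lemma space_polytope_space: "space (polytope_space k) = polytopes_dim k"
 using polytopes_dim_subset by(auto simp:polytope_space_def space_restrict_space)

lemma sets_polytope_spaceI: "A : sets (borel_of CBT) ==> polytopes_dim k Int A : sets (polytope_space k)"
 by(auto simp:polytope_space_def sets_restrict_space)

text \<open>An inball with centre in \<open>F\<close> exists iff, for each rational radius that
  occurs at all, an inscribed ball of this radius can be centred in \<open>F\<close>. These are
  countably many conditions with Borel sets of bodies.\<close>

lemma measurable_meets:
 fixes F :: "'a::euclidean_space set"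
 assumes k: "1 <= k" and F: "compact F"
 shows "{P : polytopes_dim k. EX z:F. EX r. inball P z r} : sets (polytope_space k)"
proof -
 let ?Q = "\<rat> Int {0<..} :: real set"
 have G: "ball_bodies k F' q : sets (borel_of CBT)" if "compact F'" "q : ?Q" for F' :: "'a set" and q
  using that by(intro closedin_sets_borel_of closedin_ball_bodies) auto
 have GU: "ball_bodies k (UNIV :: 'a set) q : sets (borel_of CBT)" if "q : ?Q" for q
  unfolding ball_bodies_UNIV by(rule sets.countable_UN) (use G[OF compact_cball that] in auto)
 have ib: "(EX z:F'. inscribed_ball P z q) <-> P : ball_bodies k F' q" if "P : polytopes_dim k" "0 < q" for P and F' :: "'a set" and q
  using inscribed_ball_iff_kball[OF that(1)] that(2) polytopes_dim_subset[OF that(1)]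
  unfolding ball_bodies_def by blast
 have eq: "{P : polytopes_dim k. EX z:F. EX r. inball P z r} =
  polytopes_dim k Int (convex_bodies - (\<Union>q\<in>?Q. ball_bodies k UNIV q - ball_bodies k F q))"
 proof(rule equalityI; rule subsetI)
  fix P assume "P : {P : polytopes_dim k. EX z:F. EX r. inball P z r}"
  then obtain z r where P: "P : polytopes_dim k" and z: "z : F" "inball P z r" by blast
  have "P : ball_bodies k F q" if q: "q : ?Q" "P : ball_bodies k UNIV q" for q
  proof -
   have q0: "0 < q" using q(1) by simp
   obtain y where "inscribed_ball P y q" using ib[OF P q0, of UNIV] q(2) by blast
   hence "q <= r" using z(2) by(auto simp:inball_def)
   hence "inscribed_ball P z q" using z(2) q0 inscribed_ball_mono[of P z r q] by(simp add:inball_def)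
   thus ?thesis using ib[OF P q0, of F] z(1) by blast
  qed
  thus "P : polytopes_dim k Int (convex_bodies - (\<Union>q\<in>?Q. ball_bodies k UNIV q - ball_bodies k F q))"
   using P polytopes_dim_subset[OF P] by blast
 next
  fix P assume "P : polytopes_dim k Int (convex_bodies - (\<Union>q\<in>?Q. ball_bodies k UNIV q - ball_bodies k F q))"
  hence P: "P : polytopes_dim k" and h: "!!q. q : ?Q ==> P : ball_bodies k UNIV q ==> P : ball_bodies k F q" by auto
  have "EX z:F. EX r. inball P z r"
  proof(rule inball_in_compact[OF P k F])
   fix q :: real assume "q : \<rat>" "0 < q" "EX z. inscribed_ball P z q"
   thus "EX z:F. inscribed_ball P z q" using h[of q] ib[OF P, of q UNIV] ib[OF P, of q F] by simp
  qed
  thus "P : {P : polytopes_dim k. EX z:F. EX r. inball P z r}" using P by blast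
 qed
 have "countable ?Q" using countable_rat by blast
 hence "(\<Union>q\<in>?Q. ball_bodies k UNIV q - ball_bodies k F q) : sets (borel_of CBT)"
  using G[OF F] GU by(intro sets.countable_UN' sets.Diff) auto
 hence "convex_bodies - (\<Union>q\<in>?Q. ball_bodies k UNIV q - ball_bodies k F q) : sets (borel_of CBT)"
  using sets.compl_sets[of _ "borel_of CBT"] by(simp only:space_borel_CBT)
 thus ?thesis unfolding eq by(rule sets_polytope_spaceI)
qed

lemma inball_radius_unique: "inball P y s ==> inball P z r ==> s = r"
 by(auto simp:inball_def intro:antisym)

text \<open>Compactness of \<open>P\<close> gives existence, and all inballs have the same radius,
  so only the centre can be ambiguous.\<close>

lemma unique_inball_polytopes_iff:
 fixes P :: "'a::euclidean_space set"
 assumes k: "1 <= k" and P: "P : polytopes_dim k"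
 shows "P : unique_inball_polytopes k <-> (ALL y z s r. inball P y s --> inball P z r --> y = z)"
proof
 assume "P : unique_inball_polytopes k"
 then obtain w where "!!y t. inball P y t ==> y = w" using unique_inballE by metis
 thus "ALL y z s r. inball P y s --> inball P z r --> y = z" by blast
next
 assume u: "ALL y z s r. inball P y s --> inball P z r --> y = z"
 have "compact P" using polytopes_dim_subset[OF P] by(simp add:convex_bodies_def)
 hence "EX z:P. EX r. inball P z r"
  by(intro inball_in_compact[OF P k]) (auto simp:inscribed_ball_def)
 then obtain z r where z: "inball P z r" by blast
 have "\<exists>!a. case a of (z, r) => inball P z r"
 proof(rule ex1I[of _ "(z, r)"])
  show "case (z, r) of (z, r) => inball P z r" using z by simp
  fix a assume "case a of (z, r) => inball P z r"
  thus "a = (z, r)" using u z inball_radius_unique by(cases a) blast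
 qed
 thus "P : unique_inball_polytopes k" using P by(simp add:unique_inball_polytopes_def)
qed

text \<open>Two different centres are separated by disjoint small balls around points of a countable
  dense set, so non-uniqueness is a countable union of events from
  \<open>measurable_meets\<close>.\<close>

lemma measurable_unique_inball:
 assumes k: "1 <= k"
 shows "(unique_inball_polytopes k :: 'a::euclidean_space set set) : sets (polytope_space k)"
proof -
 obtain D :: "'a set" where D: "countable D" "!!S. open S ==> S ~= {} ==> EX x:D. x : S"
  using countable_dense_setE by blast
 let ?m = "%F :: 'a set. {P : polytopes_dim k. EX z:F. EX r. inball P z r}"
 let ?I = "{(c, d, n). c : D & d : D & cball c (1 / real (Suc n)) Int cball d (1 / real (Suc n)) = {}}"
 let ?N = "\<Union>(c, d, n)\<in>?I. ?m (cball c (1 / real (Suc n))) Int ?m (cball d (1 / real (Suc n)))"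
 have "countable ?I"
  by(rule countable_subset[of _ "D \<times> D \<times> UNIV"]) (use D(1) in auto)
 hence "?N : sets (polytope_space k)"
  using measurable_meets[OF k compact_cball] by(intro sets.countable_UN') auto
 moreover have "unique_inball_polytopes k = polytopes_dim k - ?N"
 proof(rule equalityI; rule subsetI)
  fix P :: "'a set" assume P: "P : unique_inball_polytopes k"
  hence Pd: "P : polytopes_dim k" by(simp add:unique_inball_polytopes_def)
  have "P ~: ?N" using P unfolding unique_inball_polytopes_iff[OF k Pd] by fastforce
  thus "P : polytopes_dim k - ?N" using Pd by blast
 next
  fix P :: "'a set" assume P: "P : polytopes_dim k - ?N"
  hence Pd: "P : polytopes_dim k" by blast
  show "P : unique_inball_polytopes k"
   unfolding unique_inball_polytopes_iff[OF k Pd]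
  proof(intro allI impI, rule ccontr)
   fix y z s r assume yz: "inball P y s" "inball P z r" "y ~= z"
   obtain n where n: "1 / real (Suc n) < dist y z / 4" using nat_approx_posE[of "dist y z / 4"] yz(3) by auto
   have "EX x:D. x : ball w (1 / real (Suc n))" for w by(rule D(2)) auto
   then obtain c d where c: "c : D" "dist y c < 1 / real (Suc n)" and d: "d : D" "dist z d < 1 / real (Suc n)"
    by(metis mem_ball)
   have "cball c (1 / real (Suc n)) Int cball d (1 / real (Suc n)) = {}"
   proof(rule ccontr)
    assume "~ ?thesis"
    then obtain x where "dist c x <= 1 / real (Suc n)" "dist d x <= 1 / real (Suc n)" by auto
    moreover have "dist y z <= dist y c + dist c x + dist d x + dist z d"
     using dist_triangle[of y z c] dist_triangle[of c z x] dist_triangle[of x z d] by(simp add:dist_commute)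
    ultimately show False using c d n by linarith
   qed
   hence "(c, d, n) : ?I" using c d by auto
   moreover have "P : ?m (cball c (1 / real (Suc n))) Int ?m (cball d (1 / real (Suc n)))"
   proof -
    have "y : cball c (1 / real (Suc n))" "z : cball d (1 / real (Suc n))"
     using c(2) d(2) by(simp_all add:dist_commute less_imp_le)
    thus ?thesis using Pd yz(1,2) by blast
   qed
   ultimately have "P : ?N" by(intro UN_I[of "(c, d, n)"]) auto
   thus False using P by blast
  qed
 qed
 moreover have "polytopes_dim k - ?N = space (polytope_space k) - ?N" by(simp add:space_polytope_space)
 ultimately show ?thesis using sets.compl_sets[of ?N "polytope_space k"] by(simp only:)
qed

lemma incenter_inball:
 assumes "P : unique_inball_polytopes k"
 shows "EX r. inball P (incenter P) r" "inball P z s ==> incenter P = z"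
 using unique_inballE[OF assms] by metis+

definition unique_space :: "nat => 'a::euclidean_space set measure" where
 "unique_space k = restrict_space (polytope_space k) (unique_inball_polytopes k)"

lemma space_unique_space: "space (unique_space k) = unique_inball_polytopes k"
 by(auto simp:unique_space_def space_restrict_space space_polytope_space unique_inball_polytopes_def)

lemma sets_unique_space:
 fixes A :: "'a::euclidean_space set set"
 assumes "1 <= k" "A : sets (unique_space k)"
 shows "A : sets (polytope_space k)"
proof -
 have "unique_inball_polytopes k Int space (polytope_space k) = (unique_inball_polytopes k :: 'a set set)"
  by(auto simp:space_polytope_space unique_inball_polytopes_def)
 hence "unique_inball_polytopes k Int space (polytope_space k) : sets (polytope_space k :: 'a set measure)"
  using measurable_unique_inball[OF assms(1)] by(simp only:)
 from sets_restrict_space_iff[OF this, of A] show ?thesis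
  using assms(2) unfolding unique_space_def by blast
qed

text \<open>Preimages of compact sets are measurable, and closed sets are countable unions of
  compact ones.\<close>

lemma measurable_incenter:
 assumes k: "1 <= k"
 shows "incenter : measurable (unique_space k) (borel :: 'a::euclidean_space measure)"
proof(rule borel_measurableI)
 fix S :: "'a set" assume S: "open S"
 have cpt: "incenter -` F Int space (unique_space k) : sets (unique_space k)" if F: "compact F" for F :: "'a set"
 proof -
  have "incenter -` F Int space (unique_space k) = unique_inball_polytopes k Int {P : polytopes_dim k. EX z:F. EX r. inball P z r}"
   unfolding space_unique_space
   using incenter_inball by(fastforce simp:unique_inball_polytopes_def)
  thus ?thesis using measurable_meets[OF k F] by(auto simp:unique_space_def sets_restrict_space)
 qed
 have "incenter -` (- S) Int space (unique_space k) = (\<Union>n::nat. incenter -` (- S Int cball 0 (real n)) Int space (unique_space k))"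
  using real_arch_simple by fastforce
 also have "... : sets (unique_space k)"
  using S by(intro sets.countable_UN image_subsetI cpt closed_Int_compact) auto
 finally have "space (unique_space k) - (incenter -` (- S) Int space (unique_space k)) : sets (unique_space k)"
  by(rule sets.compl_sets)
 moreover have "space (unique_space k) - (incenter -` (- S) Int space (unique_space k)) = incenter -` S Int space (unique_space k)" by auto
 ultimately show "incenter -` S Int space (unique_space k) : sets (unique_space k)" by simp
qed

section \<open>Facets of simplices\<close>

lemma num_faces_facets:
 assumes "1 <= k" "P : polytopes_dim k"
 shows "num_faces (k - 1) P = card {F. F facet_of P}"
proof -
 have "F face_of P & aff_dim F = int (k - 1) <-> F facet_of P" for F
  using assms by(auto simp:facet_of_def polytopes_dim_def of_nat_diff)
 thus ?thesis by(simp add:num_faces_def)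
qed

text \<open>Dimension \<open>k\<close> forces the \<open>k + 1\<close> points to be distinct and
  affinely independent; each facet omits exactly one of them.\<close>

lemma num_faces_simplex:
 fixes p :: "nat => 'a::euclidean_space"
 assumes k: "1 <= k" and P: "P : polytopes_dim k" "P = convex hull (p ` {1..k+1})"
 shows "num_faces (k - 1) P = k + 1"
proof -
 let ?S = "p ` {1..k+1}"
 have ad: "aff_dim ?S = int k" using P by(simp add:polytopes_dim_def aff_dim_convex_hull)
 have "card ?S <= k + 1" using card_image_le[of "{1..k+1}" p] by simp
 moreover have "aff_dim ?S <= int (card ?S) - 1" by(intro aff_dim_le_card) simp
 ultimately have card: "card ?S = k + 1" using ad by linarith
 hence ind: "~ affine_dependent ?S" using ad by(simp add:affine_independent_iff_card)
 have "{F. F facet_of P} = (%u. convex hull (?S - {u})) ` ?S"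
  using facet_of_convex_hull_affine_independent_alt[OF ind] card k unfolding P(2) by auto
 moreover have "inj_on (%u. convex hull (?S - {u})) ?S"
 proof(rule inj_onI, rule ccontr)
  fix u v assume uv: "u : ?S" "v : ?S" "convex hull (?S - {u}) = convex hull (?S - {v})" "u ~= v"
  have "v : ?S - {u}" using uv(2,4) by blast
  hence "v : convex hull (?S - {v})" unfolding uv(3)[symmetric] by(rule hull_inc)
  hence "v : affine hull (?S - {v})" using convex_hull_subset_affine_hull by blast
  thus False using ind uv(2) unfolding affine_dependent_def by blast
 qed
 ultimately have "card {F. F facet_of P} = k + 1" using card by(simp only:card_image)
 thus ?thesis by(simp only:num_faces_facets[OF k P(1)])
qed

text \<open>With fewer than \<open>k\<close> facets at \<open>x\<close>, some nonzero direction of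
  the affine hull is orthogonal to all their normals. Small steps in this and the opposite direction
  stay in \<open>P\<close>, so \<open>x\<close> is not extreme.\<close>

lemma card_facets_at_vertex:
 fixes P :: "'a::euclidean_space set"
 assumes P: "P : polytopes_dim k" and x: "x extreme_point_of P"
 shows "k <= card {F. F facet_of P & x : F}"
proof(rule ccontr)
 assume neg: "~ k <= card {F. F facet_of P & x : F}"
 have poly: "polyhedron P" and cv: "convex P" and ad: "aff_dim P = int k"
  using P by(auto simp:polytopes_dim_def polytope_imp_polyhedron polytope_imp_convex)
 have xP: "x : P" using x by(simp add:extreme_point_of_def)
 obtain H where H: "finite H" "P = affine hull P Int \<Inter>H"
  "ALL h : H. EX a b. a ~= 0 & h = {x. inner a x <= b}"
  "ALL F'. F' \<subset> H --> P \<subset> affine hull P Int \<Inter>F'"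
  using poly unfolding polyhedron_Int_affine_minimal by blast
 obtain a b where ab: "!!h. h : H ==> a h ~= 0 & h = {x. inner (a h) x <= b h}"
  using H(3) by metis
 have facet: "C facet_of P <-> (EX h. h : H & C = P Int {x. inner (a h) x = b h})" for C
  by(rule facet_of_polyhedron_explicit[OF H(1,2) ab]) (use H(4) in auto)
 have mem: "y : h <-> inner (a h) y <= b h" if "h : H" for h y
 proof -
  from ab[OF that] have "h = {x. inner (a h) x <= b h}" ..
  from arg_cong[OF this, of "%S. y : S"] show ?thesis by(simp only:mem_Collect_eq)
 qed
 let ?G = "{F. F facet_of P & x : F}"
 have finG: "finite ?G" using finite_polyhedron_facets[OF poly] by(rule rev_finite_subset) blast
 \<comment> \<open>One half-space per facet, so that the chosen normals are at most as many as the
   facets at \<open>x\<close>.\<close>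
 define c where "c F = (SOME h. h : H & F = P Int {x. inner (a h) x = b h})" for F
 have c: "c F : H" "F = P Int {x. inner (a (c F)) x = b (c F)}" if "F facet_of P" for F
  using someI_ex[OF facet[THEN iffD1, OF that]] by(auto simp:c_def)
 define D where "D = {v. x + v : affine hull P}"
 have subD: "subspace D"
 proof -
  have "D = (%y. - x + y) ` (affine hull P)"
   by(auto simp:D_def image_iff algebra_simps intro!:exI bexI[of _ "x + _"])
  moreover have "x : affine hull P" using xP by(rule hull_inc)
  ultimately show ?thesis using affine_diffs_subspace[of "affine hull P" x] by simp
 qed
 have dimD: "dim D = k"
 proof -
  have "D = (+) (- x) ` (affine hull P)" by(auto simp:D_def image_iff algebra_simps intro!:bexI[of _ "x + _"])
  hence "aff_dim D = int k" using aff_dim_translation_eq[of "- x" "affine hull P"] ad by simp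
  thus ?thesis using aff_dim_subspace[OF subD] by simp
 qed
 let ?N = "span ((%F. a (c F)) ` ?G)"
 have "dim ?N < k"
  using dim_le_card'[of "(%F. a (c F)) ` ?G"] card_image_le[OF finG, of "%F. a (c F)"] finG neg
  by simp
 hence "D Int orthogonal_comp ?N ~= {0}"
 proof -
  have "dim (D Int orthogonal_comp ?N) + dim {x + y |x y. x : D & y : orthogonal_comp ?N} = dim D + dim (orthogonal_comp ?N)"
   using dim_sums_Int[OF subD subspace_orthogonal_comp[of ?N]] by simp
  moreover have "dim {x + y |x y. x : D & y : orthogonal_comp ?N} <= DIM('a)" by(rule dim_subset_UNIV)
  moreover have "dim (orthogonal_comp ?N) + dim ?N = DIM('a)" using dim_orthogonal_comp[of ?N] by simp
  ultimately have "0 < dim (D Int orthogonal_comp ?N)" using \<open>dim ?N < k\<close> dimD by linarith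
  hence nz: "dim (D Int orthogonal_comp ?N) ~= 0" by(rule gr_implies_not0)
  show ?thesis
  proof
   assume "D Int orthogonal_comp ?N = {0}"
   hence "D Int orthogonal_comp ?N <= {0}" by(rule equalityD1)
   with nz show False unfolding dim_eq_0 ..
  qed
 qed
 then obtain v where v: "v : D" "v : orthogonal_comp ?N" "v ~= 0"
  using subspace_0[OF subD] subspace_0[OF subspace_orthogonal_comp[of ?N]] by blast
 \<comment> \<open>A half-space active at \<open>x\<close> may differ from the one chosen for its
   facet. But its bounding hyperplane contains the affine hull of the facet, which is all that the
   chosen hyperplane cuts out of the affine hull of \<open>P\<close>.\<close>
 have active: "inner (a h) v = 0" if h: "h : H" and hx: "inner (a h) x = b h" for h
 proof -
  define F where "F = P Int {y. inner (a h) y = b h}"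
  have F: "F facet_of P" using h by(auto simp:facet F_def)
  have xF: "x : F" using xP hx by(simp add:F_def)
  note cF = c[OF F]
  have adF: "aff_dim (affine hull F) = int k - 1" using F ad by(simp add:facet_of_def)
  let ?A = "affine hull P Int {y. inner (a (c F)) y = b (c F)}"
  have sub: "affine hull F <= ?A"
  proof(rule hull_minimal)
   show "F <= ?A" using cF(2) hull_subset[of P affine] by blast
   show "affine ?A" by(intro affine_Int affine_affine_hull affine_hyperplane)
  qed
  have "aff_dim ?A <= int k - 1"
  proof -
   have "~ affine hull P <= {y. inner (a (c F)) y = b (c F)}"
   proof
    assume "affine hull P <= {y. inner (a (c F)) y = b (c F)}"
    hence "F = P" using cF(2) hull_subset[of P affine] by blast
    thus False using F by simp
   qed
   thus ?thesis
    using aff_dim_affine_Int_hyperplane[OF affine_affine_hull[of P], of "a (c F)" "b (c F)"] ad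
    by(simp split:if_splits)
  qed
  hence eq: "affine hull F = ?A"
   using sub adF aff_dim_psubset[of "affine hull F" ?A]
    hull_same[of affine ?A] affine_Int[OF affine_affine_hull affine_hyperplane, of P "a (c F)" "b (c F)"]
   by(auto simp:psubset_eq)
  have "inner (a (c F)) v = 0"
   using v(2) F xF unfolding mem_orthogonal_comp_span by(auto simp:inner_commute)
  hence "x + v : ?A" using v(1) xF cF(2) by(auto simp:D_def inner_add_right)
  moreover have "affine hull F <= {y. inner (a h) y = b h}"
   by(intro hull_minimal affine_hyperplane) (auto simp:F_def)
  ultimately show ?thesis using eq hx by(auto simp:inner_add_right)
 qed
 have le: "inner (a h) x <= b h" if h: "h : H" for h
 proof -
  have "x : affine hull P Int \<Inter>H" using xP by(simp only:H(2)[symmetric])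
  hence "x : \<Inter>H" by(rule IntD2)
  hence "x : h" using h by(rule InterD)
  thus ?thesis by(simp only:mem[OF h])
 qed
 \<comment> \<open>Active constraints do not change along \<open>v\<close>, and each of the finitely
   many inactive ones leaves room for a short step.\<close>
 have "EX e>0. ALL h:H. inner (a h) (x + e *R v) <= b h & inner (a h) (x - e *R v) <= b h"
 proof -
  have "\<forall>\<^sub>F e in at_right 0. inner (a h) (x + e *R v) <= b h & inner (a h) (x - e *R v) <= b h"
   if h: "h : H" for h
  proof(cases "inner (a h) x = b h")
   case True
   have "inner (a h) (x + e *R v) <= b h & inner (a h) (x - e *R v) <= b h" for e
    unfolding inner_add_right inner_diff_right inner_scaleR_right active[OF h True] True by simp
   thus ?thesis by(rule always_eventually[OF allI])
  next
   case False
   hence lt: "inner (a h) x < b h" using le[OF h] by linarith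
   have "((%e. inner (a h) (x + e *R v)) \<longlongrightarrow> inner (a h) (x + 0 *R v)) (at_right 0)"
    "((%e. inner (a h) (x - e *R v)) \<longlongrightarrow> inner (a h) (x - 0 *R v)) (at_right 0)"
    by(intro tendsto_intros)+
   hence "\<forall>\<^sub>F e in at_right 0. inner (a h) (x + e *R v) < b h"
    "\<forall>\<^sub>F e in at_right 0. inner (a h) (x - e *R v) < b h"
    using lt by(auto elim: order_tendstoD(2))
   thus ?thesis by eventually_elim simp
  qed
  hence "\<forall>\<^sub>F e in at_right (0::real). ALL h:H. inner (a h) (x + e *R v) <= b h & inner (a h) (x - e *R v) <= b h"
   using H(1) by(simp add:eventually_ball_finite_distrib)
  with eventually_at_right_less have "\<forall>\<^sub>F e in at_right (0::real). 0 < e & (ALL h:H. inner (a h) (x + e *R v) <= b h & inner (a h) (x - e *R v) <= b h)"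
   by(rule eventually_conj)
  from eventually_happens[OF this] show ?thesis by simp
 qed
 then obtain e where e: "e > 0" "!!h. h : H ==> inner (a h) (x + e *R v) <= b h & inner (a h) (x - e *R v) <= b h"
  by blast
 have "e *R v : D" "- (e *R v) : D" using v(1) subD by(auto intro:subspace_scale subspace_neg)
 hence "x + e *R v : P" "x - e *R v : P"
  using e(2) mem by(subst H(2); auto simp:D_def)+
 moreover have "x : open_segment (x - e *R v) (x + e *R v)"
  using e(1) v(3) midpoint_in_open_segment[of "x - e *R v" "x + e *R v"]
  by(simp add:midpoint_def algebra_simps scaleR_2[symmetric])
 ultimately show False using x by(auto simp:extreme_point_of_def)
qed

lemma finite_image_of_interval:
 assumes "finite E" "E ~= {}" "card E <= n"
 shows "EX p. E = p ` {1..n}"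
proof -
 obtain g where g: "g ` E <= {1..n}" "inj_on g E"
  using card_le_inj[of E "{1..n}"] assms by auto
 obtain x where x: "x : E" using assms(2) by blast
 define p where "p i = (if i : g ` E then inv_into E g i else x)" for i
 have "p (g y) = y" if "y : E" for y using g(2) that by(simp add:p_def)
 hence "E <= p ` {1..n}" using g(1) by(metis image_eqI image_subset_iff subsetI)
 moreover have "p i : E" for i using x by(auto simp:p_def inv_into_into)
 ultimately show ?thesis by blast
qed

text \<open>A vertex is the intersection of its facets, so the sets of facets at different vertices
  are incomparable. Each has at least \<open>k\<close> of the \<open>k + 1\<close> facets: either
  one vertex has all of them and is the only vertex, or the vertices inject into the
  \<open>k\<close>-element subsets.\<close>

lemma simplex_if_num_faces:
 fixes P :: "'a::euclidean_space set"
 assumes k: "1 <= k" and P: "P : polytopes_dim k" and n: "num_faces (k - 1) P = k + 1"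
 shows "EX p. P = convex hull (p ` {1..k+1})"
proof -
 let ?G = "{F. F facet_of P}"
 let ?S = "%x. {F. F facet_of P & x : F}"
 let ?E = "{x. x extreme_point_of P}"
 have poly: "polyhedron P" and ad: "aff_dim P = int k" and pt: "polytope P"
  using P by(auto simp:polytopes_dim_def polytope_imp_polyhedron)
 have card: "card ?G = k + 1" using n by(simp only:num_faces_facets[OF k P])
 have finG: "finite ?G" using finite_polyhedron_facets[OF poly] .
 have finE: "finite ?E" using finite_polyhedron_extreme_points[OF poly] .
 have hull: "P = convex hull ?E"
  using Krein_Milman_Minkowski[of P] pt by(simp add:polytope_imp_compact polytope_imp_convex)
 have vertex: "{x} = \<Inter>{F. F facet_of P & {x} <= F}" if "x : ?E" for x
 proof(rule face_of_polyhedron[OF poly])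
  show "{x} face_of P" using that by(simp add:face_of_singleton)
  show "{x} ~= P" using ad k by auto
 qed simp
 have anti: "x = y" if "x : ?E" "?S x <= ?S y" for x y
 proof -
  have "y : \<Inter>{F. F facet_of P & {x} <= F}" using that(2) by auto
  thus ?thesis unfolding vertex[OF that(1), symmetric] by simp
 qed
 have "card ?E <= k + 1"
 proof(cases "EX x:?E. card (?S x) = k + 1")
  case True
  then obtain x where x: "x : ?E" "card (?S x) = k + 1" by blast
  have "?S x = ?G" using x(2) card finG by(intro card_subset_eq) auto
  hence "?E <= {x}" using anti by blast
  hence "card ?E <= 1" using card_mono[of "{x}" ?E] by simp
  thus ?thesis by simp
 next
  case False
  have "?S ` ?E <= {T. T <= ?G & card T = k}"
  proof
   fix T assume "T : ?S ` ?E"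
   then obtain x where x: "x : ?E" "T = ?S x" by blast
   have "card (?S x) <= k + 1" using card_mono[OF finG, of "?S x"] card by auto
   hence "card (?S x) = k" using False x(1) card_facets_at_vertex[OF P, of x] by force
   thus "T : {T. T <= ?G & card T = k}" using x by blast
  qed
  moreover have "inj_on ?S ?E" using anti by(intro inj_onI) blast
  moreover have "finite {T. T <= ?G & card T = k}" using finG by simp
  ultimately have "card ?E <= card {T. T <= ?G & card T = k}" by(intro card_inj_on_le)
  also have "... = card ?G choose k" by(rule n_subsets[OF finG])
  also have "... = k + 1" unfolding card by simp
  finally show ?thesis .
 qed
 moreover have "?E ~= {}" using hull ad by force
 ultimately obtain p where "?E = p ` {1..k+1}"
  using finite_image_of_interval[OF finE] by blast
 thus ?thesis using hull by metis
qed

lemma num_faces_iff_simplex: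
 assumes "1 <= k" "P : polytopes_dim k"
 shows "num_faces (k - 1) P = k + 1 <-> (EX p. P = convex hull (p ` {1..k+1}))"
 using num_faces_simplex[OF assms] simplex_if_num_faces[OF assms] by blast

text \<open>Hulls of \<open>k + 1\<close> points from a fixed ball form the continuous image of a
  compact set, and countably many balls suffice.\<close>

lemma measurable_num_faces_simplex:
 assumes k: "1 <= k"
 shows "{P : polytopes_dim k. num_faces (k - 1) P = k + 1} : sets (polytope_space k :: 'a::euclidean_space set measure)"
proof -
 let ?J = "{1..k+1}"
 let ?h = "%p :: nat => 'a. convex hull (p ` ?J)"
 let ?B = "%n. PiE UNIV (%_. cball 0 (real n)) :: (nat => 'a) set"
 have closed: "?h ` ?B n : sets (borel_of CBT)" for n
 proof -
  have "compactin (product_topology (%_. euclidean) UNIV) (?B n)"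
   by(subst compactin_PiE) (auto simp:compactin_euclidean_iff)
  hence "compactin euclidean (?B n)" by(simp only:euclidean_product_topology)
  hence "compactin CBT (?h ` ?B n)"
   by(rule image_compactin) (rule continuous_map_convex_hull, auto)
  hence "closedin CBT (?h ` ?B n)"
   unfolding CBT by(rule compactin_imp_closedin[OF CB.Hausdorff_space_mtopology])
  thus ?thesis by(rule closedin_sets_borel_of)
 qed
 have "{P : polytopes_dim k. num_faces (k - 1) P = k + 1} = polytopes_dim k Int (\<Union>n. ?h ` ?B n)"
 proof(intro equalityI subsetI)
  fix P :: "'a set" assume "P : {P : polytopes_dim k. num_faces (k - 1) P = k + 1}"
  hence P: "P : polytopes_dim k" "num_faces (k - 1) P = k + 1" by simp_all
  then obtain p where p: "P = ?h p" using num_faces_iff_simplex[OF k P(1)] by blast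
  have "bounded (p ` ?J)" by(intro finite_imp_bounded) simp
  then obtain c where c: "ALL i:?J. norm (p i) <= c" unfolding bounded_iff by blast
  \<comment> \<open>Values at the remaining indices are set to 0 so that the function lies in the
    compact product.\<close>
  define q where "q i = (if i : ?J then p i else 0)" for i
  have "norm (q i) <= real (nat \<lceil>c\<rceil>)" for i
   using bspec[OF c, of i] by(cases "i : ?J") (auto simp:q_def intro:order_trans[OF _ real_nat_ceiling_ge])
  hence "q : ?B (nat \<lceil>c\<rceil>)" by auto
  moreover have "q ` ?J = p ` ?J" by(intro image_cong) (simp_all add:q_def)
  hence "P = ?h q" unfolding p by(simp only:)
  ultimately show "P : polytopes_dim k Int (\<Union>n. ?h ` ?B n)" using P(1) by blast
 next
  fix P :: "'a set" assume "P : polytopes_dim k Int (\<Union>n. ?h ` ?B n)"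
  thus "P : {P : polytopes_dim k. num_faces (k - 1) P = k + 1}"
   using num_faces_iff_simplex[OF k, of P] by blast
 qed
 also have "... : sets (polytope_space k)" using closed by(intro sets_polytope_spaceI) blast
 finally show ?thesis .
qed

section \<open>Shape and size\<close>

lemma support_function_ge:
 assumes "K : convex_bodies" "x : K"
 shows "inner x u <= support_function K u"
proof -
 have "bdd_above ((%x. inner x u) ` K)"
  using assms by(intro bounded_imp_bdd_above compact_imp_bounded compact_continuous_image continuous_intros)
   (auto simp:convex_bodies_def)
 thus ?thesis unfolding support_function_def by(rule cSUP_upper[OF assms(2)])
qed

lemma support_function_le:
 assumes "K : convex_bodies" "!!x. x : K ==> inner x u <= c"
 shows "support_function K u <= c"
 unfolding support_function_def using assms by(intro cSUP_least) (auto simp:convex_bodies_def)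

lemma support_function_affmap:
 assumes K: "K : convex_bodies" and s: "0 <= s"
 shows "support_function (affmap (z, s) K) u = s * (support_function K u - inner z u)"
proof(rule antisym)
 show "support_function (affmap (z, s) K) u <= s * (support_function K u - inner z u)"
  using support_function_ge[OF K, of _ u] s
  by(intro support_function_le affmap_in_convex_bodies K)
   (auto simp:affmap_def inner_diff_left intro!:mult_left_mono)
next
 have aK: "affmap (z, s) K : convex_bodies" by(rule affmap_in_convex_bodies[OF K])
 show "s * (support_function K u - inner z u) <= support_function (affmap (z, s) K) u"
 proof(cases "s = 0")
  case True
  obtain x where "x : affmap (z, s) K" using aK by(auto simp:convex_bodies_def)
  thus ?thesis using support_function_ge[OF aK, of x u] True by(auto simp:affmap_def)
 next
  case False
  hence s: "0 < s" using s by simp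
  have "support_function K u <= support_function (affmap (z, s) K) u / s + inner z u"
  proof(rule support_function_le[OF K])
   fix x assume "x : K"
   hence "s *R (x - z) : affmap (z, s) K" by(auto simp:affmap_def)
   from support_function_ge[OF aK this, of u] show "inner x u <= support_function (affmap (z, s) K) u / s + inner z u"
    using s by(simp add:field_simps inner_diff_left)
  qed
  thus ?thesis using s by(simp add:field_simps)
 qed
qed

lemma support_function_hausdorff_le:
 assumes K: "K : convex_bodies" and L: "L : convex_bodies" and u: "norm u = 1"
 shows "support_function K u <= support_function L u + hausdorff_dist K L"
proof(rule support_function_le[OF K])
 fix x assume "x : K"
 obtain y where y: "y : L" "dist x y <= hausdorff_dist K L" by(rule hausdorff_dist_leD[OF K L \<open>x \<in> K\<close>])
 have "inner x u = inner y u + inner (x - y) u" by(simp add:inner_diff_left)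
 also have "inner (x - y) u <= norm (x - y) * norm u" by(rule norm_cauchy_schwarz)
 also have "... <= hausdorff_dist K L" using y(2) u by(simp add:dist_norm)
 finally show "inner x u <= support_function L u + hausdorff_dist K L"
  using support_function_ge[OF L y(1), of u] by simp
qed

lemma convex_body_bounded:
 assumes "K : convex_bodies"
 shows "EX R>=0. ALL x:K. norm x <= R"
proof -
 have "bounded K" using assms by(auto simp:convex_bodies_def compact_imp_bounded)
 then obtain R where R: "ALL x:K. norm x <= R" unfolding bounded_iff by blast
 hence "ALL x:K. norm x <= max R 0" by(auto simp:le_max_iff_disj)
 thus ?thesis by(intro exI[of _ "max R 0"]) simp
qed

lemma support_function_abs_le:
 assumes K: "K : convex_bodies" and R: "!!x. x : K ==> norm x <= R" and u: "norm u = 1"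
 shows "\<bar>support_function K u\<bar> <= R"
proof -
 have le: "\<bar>inner x u\<bar> <= R" if "x : K" for x
  using Cauchy_Schwarz_ineq2[of x u] R[OF that] u by simp
 obtain x where x: "x : K" using K by(auto simp:convex_bodies_def)
 have "support_function K u <= R" using le by(intro support_function_le[OF K]) force
 moreover have "- R <= support_function K u"
  using le[OF x] support_function_ge[OF K x, of u] by simp
 ultimately show ?thesis by simp
qed

lemma continuous_support_function:
 assumes K: "K : convex_bodies"
 shows "continuous_on UNIV (support_function K)"
proof -
 obtain R where R: "0 <= R" "!!x. x : K ==> norm x <= R" using convex_body_bounded[OF K] by blast
 have le: "support_function K u <= support_function K v + R * norm (u - v)" for u v
 proof(rule support_function_le[OF K])
  fix x assume x: "x : K"
  have "inner x (u - v) <= norm x * norm (u - v)" by(rule norm_cauchy_schwarz)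
  also have "... <= R * norm (u - v)" by(intro mult_right_mono R x) simp
  finally show "inner x u <= support_function K v + R * norm (u - v)"
   using support_function_ge[OF K x, of v] by(simp add:inner_diff_right)
 qed
 have "\<bar>support_function K u - support_function K v\<bar> <= R * norm (u - v)" for u v
  using le[of u v] le[of v u] by(simp add:abs_le_iff norm_minus_commute)
 hence "R-lipschitz_on UNIV (support_function K)"
  using R(1) by(intro lipschitz_onI) (auto simp:dist_norm)
 thus ?thesis by(rule lipschitz_on_continuous_on)
qed

context directional
begin

lemma measurable_support_function:
 assumes "K : convex_bodies"
 shows "support_function K : borel_measurable \<phi>"
 using measurable_compose[OF measurable_phi_borel borel_measurable_continuous_onI[OF continuous_support_function[OF assms]]] by simp

lemma integrable_support_function:
 assumes K: "K : convex_bodies"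
 shows "integrable \<phi> (support_function K)"
proof -
 obtain R where R: "0 <= R" "!!x. x : K ==> norm x <= R" using convex_body_bounded[OF K] by blast
 show ?thesis
 proof(rule \<phi>.integrable_const_bound[where B = R])
  show "AE u in \<phi>. norm (support_function K u) <= R"
   using support_function_abs_le[OF K R(2)] by(intro AE_I2) (auto simp:space_phi)
 qed (rule measurable_support_function[OF K])
qed

lemma integrable_inner_phi: "integrable \<phi> (inner z)"
proof(rule \<phi>.integrable_const_bound[where B = "norm z"])
 show "AE u in \<phi>. norm (inner z u) <= norm z"
 proof(rule AE_I2)
  fix u assume "u : space \<phi>"
  thus "norm (inner z u) <= norm z" using Cauchy_Schwarz_ineq2[of z u] by(simp add:space_phi)
 qed
 show "inner z : borel_measurable \<phi>" by(rule measurable_compose[OF measurable_phi_borel]) simp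
qed

lemma integral_inner_phi: "(\<integral>u. inner z u \<partial>\<phi>) = 0"
proof -
 have "(\<integral>u. inner z u \<partial>\<phi>) = (\<integral>u. inner z u \<partial>distr \<phi> \<phi> uminus)" by(simp add:distr_uminus_phi)
 also have "... = (\<integral>u. inner z (- u) \<partial>\<phi>)"
  using integrable_inner_phi[of z] by(intro integral_distr measurable_uminus_phi) auto
 also have "... = - (\<integral>u. inner z u \<partial>\<phi>)" by simp
 finally show ?thesis by simp
qed

text \<open>The translation contributes the mean of \<open>inner z u\<close>, which vanishes as
  \<phi> is even.\<close>

lemma hitting_functional_affmap:
 assumes K: "K : convex_bodies" and s: "0 <= s"
 shows "hitting_functional \<phi> (affmap (z, s) K) = s * hitting_functional \<phi> K"
proof -
 have "hitting_functional \<phi> (affmap (z, s) K) = (\<integral>u. s * (support_function K u - inner z u) \<partial>\<phi>)"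
  unfolding hitting_functional_def support_function_affmap[OF K s, abs_def] by(rule refl)
 also have "... = s * ((\<integral>u. support_function K u \<partial>\<phi>) - (\<integral>u. inner z u \<partial>\<phi>))"
  by(subst Bochner_Integration.integral_diff[symmetric])
   (simp_all add:integrable_support_function[OF K] integrable_inner_phi)
 finally show ?thesis by(simp add:integral_inner_phi hitting_functional_def)
qed

lemma hitting_functional_le:
 assumes K: "K : convex_bodies" and L: "L : convex_bodies"
 shows "hitting_functional \<phi> K <= hitting_functional \<phi> L + hausdorff_dist K L"
proof -
 have "(\<integral>u. support_function K u \<partial>\<phi>) <= (\<integral>u. support_function L u + hausdorff_dist K L \<partial>\<phi>)"
  using support_function_hausdorff_le[OF K L]
  by(intro integral_mono integrable_support_function K Bochner_Integration.integrable_add L)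
   (auto simp:space_phi)
 also have "... = hitting_functional \<phi> L + hausdorff_dist K L"
  by(subst Bochner_Integration.integral_add)
   (simp_all add:integrable_support_function[OF L] hitting_functional_def \<phi>.prob_space)
 finally show ?thesis by(simp add:hitting_functional_def)
qed

lemma continuous_map_hitting_functional: "continuous_map CBT euclideanreal (hitting_functional \<phi>)"
proof -
 have "Lipschitz_continuous_map CB.Self euclidean_metric (hitting_functional \<phi>)"
  unfolding Lipschitz_continuous_map_def
 proof(intro conjI exI[of _ 1] ballI)
  fix K L :: "'a set" assume "K : mspace CB.Self" "L : mspace CB.Self"
  hence KL: "K : convex_bodies" "L : convex_bodies" by simp_all
  show "mdist euclidean_metric (hitting_functional \<phi> K) (hitting_functional \<phi> L) <= 1 * mdist CB.Self K L"
   using hitting_functional_le[OF KL] hitting_functional_le[OF KL(2,1)] CB.commute[of K L]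
   by(simp add:dist_real_def)
 qed simp
 hence "continuous_map (mtopology_of CB.Self) (mtopology_of euclidean_metric) (hitting_functional \<phi>)"
  by(rule Lipschitz_continuous_imp_continuous_map)
 thus ?thesis by(simp add:CBT mtopology_of_def)
qed

end

locale subspace_free_directional = directional +
 assumes subspace_free_phi: "subspace_free \<phi>"
begin

lemma AE_not_orthogonal:
 assumes "w ~= 0"
 shows "AE u in \<phi>. inner w u ~= 0"
proof -
 let ?L = "{u. inner w u = 0}"
 have L: "subspace ?L" "dim ?L = DIM('a) - 1" using assms by(auto simp:subspace_hyperplane dim_hyperplane)
 hence "emeasure \<phi> (sphere 0 1 Int ?L) = 0" using subspace_free_phi by(simp add:subspace_free_def)
 moreover have "sphere 0 1 Int ?L : sets \<phi>"
 proof -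
  have "?L : sets borel" by(intro borel_closed closed_hyperplane)
  thus ?thesis unfolding sets_phi by(auto simp:sets_restrict_space)
 qed
 ultimately show ?thesis by(intro AE_I[of _ _ "sphere 0 1 Int ?L"]) (auto simp:space_phi)
qed

text \<open>The maximum of \<open>inner x u\<close> and \<open>inner y u\<close> is their mean plus
  half the modulus of their difference. The mean integrates to 0, and the modulus is positive for
  almost every \<open>u\<close> since great subspheres are null sets.\<close>

lemma hitting_functional_pos:
 assumes K: "K : convex_bodies" and xy: "x : K" "y : K" "x ~= y"
 shows "0 < hitting_functional \<phi> K"
proof -
 have int: "integrable \<phi> (%u. \<bar>inner (x - y) u\<bar>)" "integrable \<phi> (%u. inner (x + y) u)"
  by(intro integrable_abs integrable_inner_phi)+
 have le: "inner (x + y) u / 2 + \<bar>inner (x - y) u\<bar> / 2 <= support_function K u" for u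
  using support_function_ge[OF K xy(1), of u] support_function_ge[OF K xy(2), of u]
  by(cases "inner x u <= inner y u") (simp_all add:inner_add_left inner_diff_left add_divide_distrib diff_divide_distrib)
 have "(\<integral>u. \<bar>inner (x - y) u\<bar> \<partial>\<phi>) > 0"
 proof -
  have nn: "0 <= (\<integral>u. \<bar>inner (x - y) u\<bar> \<partial>\<phi>)" by simp
  have "(\<integral>u. \<bar>inner (x - y) u\<bar> \<partial>\<phi>) ~= 0"
  proof
   assume "(\<integral>u. \<bar>inner (x - y) u\<bar> \<partial>\<phi>) = 0"
   hence "AE u in \<phi>. \<bar>inner (x - y) u\<bar> = 0"
    by(subst (asm) integral_nonneg_eq_0_iff_AE[OF int(1)]) auto
   moreover have "AE u in \<phi>. inner (x - y) u ~= 0" by(rule AE_not_orthogonal) (use xy(3) in simp)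
   ultimately have "AE u in \<phi>. False" by eventually_elim simp
   thus False by simp
  qed
  with nn show ?thesis by linarith
 qed
 also have "(\<integral>u. \<bar>inner (x - y) u\<bar> \<partial>\<phi>) = 2 * (\<integral>u. inner (x + y) u / 2 + \<bar>inner (x - y) u\<bar> / 2 \<partial>\<phi>)"
  using int by(subst Bochner_Integration.integral_add) (simp_all add:integral_inner_phi)
 also have "(\<integral>u. inner (x + y) u / 2 + \<bar>inner (x - y) u\<bar> / 2 \<partial>\<phi>) <= hitting_functional \<phi> K"
  unfolding hitting_functional_def using le int
  by(intro integral_mono integrable_support_function[OF K] Bochner_Integration.integrable_add) auto
 finally show ?thesis by simp
qed

lemma hitting_functional_polytope_pos:
 assumes P: "P : polytopes_dim k" and k: "1 <= k"
 shows "0 < hitting_functional \<phi> P"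
proof -
 have "~ (EX a. P <= {a})"
 proof
  assume "EX a. P <= {a}"
  then obtain a where "P <= {a}" by blast
  from aff_dim_subset[OF this] show False using P k by(simp add:polytopes_dim_def)
 qed
 moreover have "P : convex_bodies" by(rule polytopes_dim_subset[OF P])
 hence "P ~= {}" by(simp add:convex_bodies_def)
 ultimately obtain x y where "x : P" "y : P" "x ~= y" by blast
 thus ?thesis by(intro hitting_functional_pos polytopes_dim_subset[OF P])
qed

end

section \<open>Similarities, inballs and shapes\<close>

lemma affmap_affmap: "affmap (y, t) (affmap (z, s) P) = (%x. (t * s) *R (x - z) - t *R y) ` P"
 by(simp add:affmap_def image_image scaleR_diff_right)

lemma affmap_inverse: "s ~= 0 ==> affmap (- (s *R z), 1 / s) (affmap (z, s) P) = P"
 by(simp add:affmap_affmap)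

lemma affmap_convex_hull: "affmap (z, s) (convex hull S) = convex hull (affmap (z, s) S)"
proof -
 have eq: "affmap (z, s) A = (%x. s *R x) ` ((+) (- z) ` A)" for A :: "'a set" by(auto simp:affmap_def image_image)
 show ?thesis unfolding eq by(simp only:convex_hull_translation convex_hull_scaling)
qed

lemma affmap_affine_hull: "affmap (z, s) (affine hull S) = affine hull (affmap (z, s) S)"
proof -
 have eq: "affmap (z, s) A = (%x. s *R x) ` ((+) (- z) ` A)" for A :: "'a set" by(auto simp:affmap_def image_image)
 show ?thesis
  unfolding eq affine_hull_linear_image[OF bounded_linear_scaleR_right, symmetric] affine_hull_translation ..
qed

lemma affmap_polytopes_dim:
 assumes P: "P : polytopes_dim k" and s: "s ~= 0"
 shows "affmap (z, s) P : polytopes_dim k"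
proof -
 have eq: "affmap (z, s) P = (%x. s *R x) ` ((+) (- z) ` P)" by(auto simp:affmap_def image_image)
 have "inj (%x :: 'a. s *R x)" using s by(auto intro:injI)
 from aff_dim_injective_linear_image[OF linear_scaleR this, of "(+) (- z) ` P"]
 have "aff_dim ((%x. s *R x) ` ((+) (- z) ` P)) = aff_dim P" by(simp only:aff_dim_translation_eq)
 moreover have "polytope ((%x. s *R x) ` ((+) (- z) ` P))"
  by(rule polytope_linear_image[OF linear_scaleR])
   (use P in \<open>simp only: polytope_translation_eq polytopes_dim_def mem_Collect_eq\<close>)
 ultimately show ?thesis using P unfolding eq polytopes_dim_def by simp
qed

lemma inscribed_ball_affmap_imp:
 assumes s: "0 < s" and i: "inscribed_ball P y r"
 shows "inscribed_ball (affmap (z, s) P) (s *R (y - z)) (s * r)"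
 unfolding inscribed_ball_def
proof(intro conjI)
 show "s *R (y - z) : affmap (z, s) P" using i by(auto simp:affmap_def inscribed_ball_def)
 show "0 < s * r" using i s by(simp add:inscribed_ball_def)
 show "cball (s *R (y - z)) (s * r) Int affine hull affmap (z, s) P <= affmap (z, s) P"
 proof
  fix x assume x: "x : cball (s *R (y - z)) (s * r) Int affine hull affmap (z, s) P"
  then obtain w where w: "w : affine hull P" "x = s *R (w - z)"
   unfolding affmap_affine_hull[symmetric] by(auto simp:affmap_def)
  have "dist (s *R (y - z)) x = s * dist y w"
   using s by(simp add:w(2) dist_norm scaleR_diff_right[symmetric])
  hence "w : cball y r" using x s by simp
  hence "w : P" using w(1) i by(auto simp:inscribed_ball_def)
  thus "x : affmap (z, s) P" using w(2) by(auto simp:affmap_def)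
 qed
qed

lemma inscribed_ball_affmap:
 assumes s: "0 < s"
 shows "inscribed_ball (affmap (z, s) P) (s *R (y - z)) (s * r) <-> inscribed_ball P y r"
proof
 assume "inscribed_ball (affmap (z, s) P) (s *R (y - z)) (s * r)"
 from inscribed_ball_affmap_imp[of "1 / s", OF _ this, of "- (s *R z)"] s
 show "inscribed_ball P y r" by(simp add:affmap_inverse scaleR_diff_right)
qed (rule inscribed_ball_affmap_imp[OF s])

lemma inball_affmap_imp:
 assumes s: "0 < s" and i: "inball P y r"
 shows "inball (affmap (z, s) P) (s *R (y - z)) (s * r)"
 unfolding inball_def
proof(intro conjI allI impI)
 show "inscribed_ball (affmap (z, s) P) (s *R (y - z)) (s * r)"
  using i unfolding inball_def by(blast intro:inscribed_ball_affmap_imp[OF s])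
 fix w t assume "inscribed_ball (affmap (z, s) P) w t"
 moreover have "w = s *R ((z + (1 / s) *R w) - z)" "t = s * (t / s)" using s by simp_all
 ultimately have "inscribed_ball P (z + (1 / s) *R w) (t / s)"
  using inscribed_ball_affmap[OF s, of z P "z + (1 / s) *R w" "t / s"] by simp
 hence "t / s <= r" using i by(auto simp:inball_def)
 thus "t <= s * r" using s by(simp add:field_simps)
qed

lemma inball_affmap:
 assumes s: "0 < s"
 shows "inball (affmap (z, s) P) (s *R (y - z)) (s * r) <-> inball P y r"
proof
 assume "inball (affmap (z, s) P) (s *R (y - z)) (s * r)"
 from inball_affmap_imp[of "1 / s", OF _ this, of "- (s *R z)"] s
 show "inball P y r" by(simp add:affmap_inverse scaleR_diff_right)
qed (rule inball_affmap_imp[OF s])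

lemma unique_inball_affmap:
 assumes P: "P : unique_inball_polytopes k" and s: "0 < s" and k: "1 <= k"
 shows "affmap (z, s) P : unique_inball_polytopes k"
  and "incenter (affmap (z, s) P) = s *R (incenter P - z)"
proof -
 have Pd: "P : polytopes_dim k" using P by(simp add:unique_inball_polytopes_def)
 have aP: "affmap (z, s) P : polytopes_dim k" using affmap_polytopes_dim[OF Pd] s by simp
 have inv: "z + (1 / s) *R w = incenter P" if "inball (affmap (z, s) P) w t" for w t
 proof -
  have "w = s *R ((z + (1 / s) *R w) - z)" "t = s * (t / s)" using s by simp_all
  hence "inball P (z + (1 / s) *R w) (t / s)"
   using that inball_affmap[OF s, of z P "z + (1 / s) *R w" "t / s"] by simp
  from incenter_inball(2)[OF P this] show ?thesis by simp
 qed
 show u: "affmap (z, s) P : unique_inball_polytopes k"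
  unfolding unique_inball_polytopes_iff[OF k aP]
 proof(intro allI impI)
  fix y w t r assume "inball (affmap (z, s) P) y t" "inball (affmap (z, s) P) w r"
  hence "(1 / s) *R y = (1 / s) *R w" using inv by(metis add_left_cancel)
  thus "y = w" using s by simp
 qed
 obtain r where "inball P (incenter P) r" using incenter_inball(1)[OF P] by blast
 hence "inball (affmap (z, s) P) (s *R (incenter P - z)) (s * r)" by(rule inball_affmap_imp[OF s])
 thus "incenter (affmap (z, s) P) = s *R (incenter P - z)" by(rule incenter_inball(2)[OF u])
qed

lemma unique_inball_subset: "P : unique_inball_polytopes k ==> P : polytopes_dim k"
 by(simp add:unique_inball_polytopes_def)

lemma shape_affmap: "shape \<phi> P = affmap (incenter P, 1 / hitting_functional \<phi> P) P"
 by(simp add:shape_def centered_def affmap_def image_image)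

lemma centered_affmap: "centered P = affmap (incenter P, 1) P"
 by(simp add:centered_def affmap_def)

context subspace_free_directional
begin

lemma shape_unique_inball:
 assumes P: "P : unique_inball_polytopes k" and k: "1 <= k"
 shows "shape \<phi> P : unique_inball_polytopes k" "incenter (shape \<phi> P) = 0" "hitting_functional \<phi> (shape \<phi> P) = 1"
proof -
 have h: "0 < hitting_functional \<phi> P" using hitting_functional_polytope_pos[OF unique_inball_subset[OF P] k] .
 thus "shape \<phi> P : unique_inball_polytopes k" "incenter (shape \<phi> P) = 0"
  unfolding shape_affmap using unique_inball_affmap[OF P _ k] by simp_all
 show "hitting_functional \<phi> (shape \<phi> P) = 1"
  unfolding shape_affmap using h hitting_functional_affmap[OF polytopes_dim_subset[OF unique_inball_subset[OF P]]] by simp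
qed

lemma shape_of_affmap:
 assumes P: "P : unique_inball_polytopes k" and k: "1 <= k" and s: "0 < s"
 shows "shape \<phi> (affmap (z, s) P) = shape \<phi> P"
proof -
 have "hitting_functional \<phi> (affmap (z, s) P) = s * hitting_functional \<phi> P"
  using hitting_functional_affmap[OF polytopes_dim_subset[OF unique_inball_subset[OF P]]] s by simp
 thus ?thesis
  unfolding shape_affmap unique_inball_affmap(2)[OF P s k] affmap_affmap using s
  by(simp add:affmap_def scaleR_diff_right)
qed

text \<open>Without a unique inball, \<open>incenter P\<close> may be an arbitrary default value,
  but the shape is still a similar copy of \<open>P\<close>, and the inverse similarity transfers
  uniqueness back.\<close>

lemma shape_in_imp_unique:
 assumes P: "P : polytopes_dim k" and k: "1 <= k" and sh: "shape \<phi> P : unique_inball_polytopes k"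
 shows "P : unique_inball_polytopes k"
proof -
 have h: "0 < hitting_functional \<phi> P" using hitting_functional_polytope_pos[OF P k] .
 let ?s = "1 / hitting_functional \<phi> P"
 have "affmap (- (?s *R incenter P), 1 / ?s) (shape \<phi> P) : unique_inball_polytopes k"
  using h by(intro unique_inball_affmap(1)[OF sh _ k]) simp
 also have "affmap (- (?s *R incenter P), 1 / ?s) (shape \<phi> P) = P"
  unfolding shape_affmap using h by(intro affmap_inverse) simp
 finally show ?thesis .
qed

lemma shape_set_subset:
 assumes k: "1 <= k"
 shows "shape_set \<phi> k <= unique_inball_polytopes k"
 using shape_unique_inball(1)[OF _ k] by(auto simp:shape_set_def)

lemma shape_set_convex_bodies: "1 <= k ==> shape_set \<phi> k <= convex_bodies"
 using shape_set_subset unique_inball_subset polytopes_dim_subset by blast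

lemma space_shape_space: "1 <= k ==> space (shape_space \<phi> k) = shape_set \<phi> k"
 using shape_set_convex_bodies by(auto simp:shape_space_def space_restrict_space)

lemma measurable_shape:
 assumes k: "1 <= k"
 shows "shape \<phi> : measurable (unique_space k) (shape_space \<phi> k)"
proof -
 have id: "(%P. P) : measurable (unique_space k) (borel_of CBT)"
  unfolding unique_space_def polytope_space_def by(intro measurable_restrict_space1) simp
 have h: "hitting_functional \<phi> : borel_measurable (unique_space k)"
  using measurable_compose[OF id borel_measurable_continuous_map[OF continuous_map_hitting_functional]] by simp
 have "(%P. affmap (incenter P, 1 / hitting_functional \<phi> P) P) : measurable (unique_space k) (borel_of CBT)"
  using measurable_incenter[OF k] h
  by(intro measurable_affmap[OF _ id] borel_measurable_Pair borel_measurable_divide borel_measurable_const)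
 hence "shape \<phi> : measurable (unique_space k) (borel_of CBT)" by(simp only:shape_affmap[symmetric])
 thus ?thesis
  unfolding shape_space_def by(intro measurable_restrict_space2) (auto simp:shape_set_def space_unique_space)
qed

text \<open>The event lies within the polytopes with a unique inball, where the shape map is
  measurable; default values of the incenter elsewhere cannot contribute.\<close>

lemma sets_shape_in:
 assumes k: "1 <= k" and S: "S : sets (shape_space \<phi> k)"
 shows "{P : polytopes_dim k. shape \<phi> P : S} : sets (polytope_space k)"
proof -
 have "S <= shape_set \<phi> k" using sets.sets_into_space[OF S] by(simp add:space_shape_space[OF k])
 hence sub: "S <= unique_inball_polytopes k" using shape_set_subset[OF k] by blast
 have "{P : polytopes_dim k. shape \<phi> P : S} = shape \<phi> -` S Int space (unique_space k)"
  unfolding space_unique_space using shape_in_imp_unique[OF _ k] unique_inball_subset sub by blast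
 also have "... : sets (unique_space k)" by(rule measurable_sets[OF measurable_shape[OF k] S])
 finally show ?thesis by(rule sets_unique_space[OF k])
qed

end

text \<open>An inscribed ball of radius \<open>r\<close> contains a translate of \<open>r\<close>
  times the simplex spanned by 0 and an orthonormal frame. The size of this simplex is positive and
  continuous in the frame, so compactness of \<open>frames k\<close> gives the constant.\<close>

lemma size_functional_ge_inradius:
 fixes \<Sigma> :: "'a::euclidean_space set => real"
 assumes S: "size_functional k \<Sigma>" "translation_invariant \<Sigma>"
 shows "EX c>0. ALL P:polytopes_dim k. ALL z r. inscribed_ball P z r --> c * r <= \<Sigma> P"
proof -
 \<comment> \<open>Index 0 is reserved for the vertex at the origin.\<close>
 define g :: "(nat => 'a) => nat => 'a" where "g f i = (if i = 0 then 0 else f i)" for f i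
 let ?B = "%f :: nat => 'a. convex hull (g f ` {0..k})"
 have mono: "K : convex_bodies ==> L : convex_bodies ==> K <= L ==> \<Sigma> K <= \<Sigma> L" for K L
  using S(1) by(simp add:size_functional_def)
 have Bc: "?B f : convex_bodies" for f by(intro convex_hull_in_convex_bodies) auto
 have pos: "0 < \<Sigma> (?B f)" if f: "f : frames k" for f
 proof -
  have img: "g f ` {0..k} = insert 0 (f ` {1..k})" by(auto simp:g_def image_iff Bex_def)
  have "aff_dim (?B f) = int (dim (f ` {1..k}))"
   unfolding aff_dim_convex_hull img aff_dim_zero[OF hull_inc[OF insertI1]]
   by(simp only:dim_span[of "insert 0 _", symmetric] span_insert_0 dim_span)
  also have "dim (f ` {1..k}) = k"
   using indep_fam_dim_span[OF frame_indep[OF f]] by simp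
  finally show ?thesis using S(1) Bc by(simp add:size_functional_def)
 qed
 have "continuous_map euclidean euclideanreal (%f. \<Sigma> (convex hull (g f ` {0..k})))"
 proof -
  have "continuous_map euclidean CBT (%p :: nat => 'a. convex hull (p ` {0..k}))"
   by(rule continuous_map_convex_hull) auto
  moreover have "continuous_map euclidean euclidean g"
  proof -
   have "continuous_on UNIV (%f. g f i)" for i
    by(cases "i = 0") (simp_all add:g_def continuous_on_product_coordinates)
   hence "continuous_on UNIV (%f i. g f i)" by(intro continuous_on_coordinatewise_then_product)
   thus ?thesis by simp
  qed
  moreover have "continuous_map CBT euclideanreal \<Sigma>" using S(1) by(simp add:size_functional_def)
  ultimately have "continuous_map euclidean euclideanreal (\<Sigma> \<circ> ((%p. convex hull (p ` {0..k})) \<circ> g))"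
   by(intro continuous_map_compose)
  thus ?thesis by(simp only:o_def)
 qed
 hence cont: "continuous_on (frames k) (%f. \<Sigma> (?B f))"
  unfolding continuous_map_iff_continuous2 by(rule continuous_on_subset) (rule subset_UNIV)
 have "EX c>0. ALL f:frames k. c <= \<Sigma> (?B f)"
 proof(cases "frames k = ({} :: (nat => 'a) set)")
  case True
  thus ?thesis by(intro exI[of _ 1]) simp
 next
  case False
  then obtain f0 where "f0 : frames k" "ALL f:frames k. \<Sigma> (?B f0) <= \<Sigma> (?B f)"
   using continuous_attains_inf[OF compact_frames False cont] by blast
  thus ?thesis using pos by blast
 qed
 then obtain c where c: "c > 0" "!!f. f : frames k ==> c <= \<Sigma> (?B f)" by blast
 have "c * r <= \<Sigma> P" if P: "P : polytopes_dim k" and i: "inscribed_ball P z r" for P z r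
 proof -
  have r: "0 < r" using i by(simp add:inscribed_ball_def)
  obtain f where f: "f : frames k" "kball k z f r <= P" using i unfolding inscribed_ball_iff_kball[OF P] by blast
  have Pc: "P : convex_bodies" by(rule polytopes_dim_subset[OF P])
  let ?T = "(+) z ` (%x. r *R x) ` ?B f"
  have rB: "(%x. r *R x) ` ?B f = convex hull ((%x. r *R x) ` g f ` {0..k})" by(simp only:convex_hull_scaling)
  have TT: "?T = convex hull ((+) z ` (%x. r *R x) ` g f ` {0..k})" unfolding rB by(simp only:convex_hull_translation)
  have rBc: "(%x. r *R x) ` ?B f : convex_bodies" unfolding rB by(intro convex_hull_in_convex_bodies) auto
  have Tc: "?T : convex_bodies" unfolding TT by(intro convex_hull_in_convex_bodies) auto
  have "?T <= P"
   unfolding TT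
  proof(rule hull_minimal)
   show "convex P" using Pc by(simp add:convex_bodies_def)
   show "(+) z ` (%x. r *R x) ` g f ` {0..k} <= P"
   proof
    fix x assume "x : (+) z ` (%x. r *R x) ` g f ` {0..k}"
    then obtain j where j: "j : {0..k}" "x = z + r *R g f j" by blast
    define a where "a i = (if i = j then r else 0)" for i
    have "(\<Sum>i=1..k. a i *R f i) = (\<Sum>i=1..k. if i = j then r *R f j else 0)"
     by(intro sum.cong) (auto simp:a_def)
    hence 1: "(\<Sum>i=1..k. a i *R f i) = r *R g f j" using j(1) by(auto simp:g_def sum.delta)
    have "(\<Sum>i=1..k. (a i)\<^sup>2) = (\<Sum>i=1..k. if i = j then r\<^sup>2 else 0)"
     by(intro sum.cong) (auto simp:a_def)
    hence "(\<Sum>i=1..k. (a i)\<^sup>2) <= r\<^sup>2" by(simp add:sum.delta)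
    hence "x : kball k z f r" unfolding kball_def mem_Collect_eq using 1 j(2) by metis
    thus "x : P" using f(2) by blast
   qed
  qed
  hence "\<Sigma> ?T <= \<Sigma> P" by(rule mono[OF Tc Pc])
  moreover have "\<Sigma> ?T = \<Sigma> ((%x. r *R x) ` ?B f)"
   using S(2) rBc by(simp add:translation_invariant_def)
  moreover have "\<Sigma> ((%x. r *R x) ` ?B f) = r * \<Sigma> (?B f)"
   using S(1) Bc r by(simp add:size_functional_def)
  moreover have "c * r <= r * \<Sigma> (?B f)" using c(2)[OF f(1)] r by(simp add:mult.commute)
  ultimately show ?thesis by simp
 qed
 with c(1) show ?thesis by blast
qed

lemma size_functional_affmap:
 assumes S: "size_functional k \<Sigma>" "translation_invariant \<Sigma>" and P: "P : convex_bodies" and s: "0 <= s"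
 shows "\<Sigma> (affmap (z, s) P) = s * \<Sigma> P"
proof -
 have eq: "affmap (z, s) P = (%x. s *R x) ` ((+) (- z) ` P)" by(auto simp:affmap_def image_image)
 have "(+) (- z) ` P : convex_bodies" using affmap_in_convex_bodies[OF P, of "(z, 1)"] by(simp add:affmap_def)
 hence "\<Sigma> ((%x. s *R x) ` ((+) (- z) ` P)) = s * \<Sigma> ((+) (- z) ` P)"
  using S(1) s unfolding size_functional_def by blast
 also have "\<Sigma> ((+) (- z) ` P) = \<Sigma> P" using S(2) P unfolding translation_invariant_def by blast
 finally show ?thesis unfolding eq .
qed

section \<open>Random tuples of normals\<close>

lemma orth_proj_Lsub_eq_resid:
 fixes u :: "nat => 'a::euclidean_space"
 shows "orth_proj (Lsub k u) x = resid (map (%i. u i) [k + 2..<DIM('a) + 2]) x"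
proof -
 have "u ` {k+2..DIM('a)+1} = set (map (%i. u i) [k + 2..<DIM('a) + 2])" by(auto simp:image_iff Bex_def)
 thus ?thesis by(simp only:Lsub_def orth_proj_span_comp)
qed

lemma Dmat_sum:
 fixes u :: "nat => 'a::euclidean_space"
 shows "Dmat u \<rho> = \<bar>\<Sum>p | p permutes {0..<DIM('a)+1}. signof p *
  (\<Prod>i = 0..<DIM('a) + 1. if p i < DIM('a) then inner (u (i + 1)) (basis_enum (p i)) else \<rho> (i + 1))\<bar>"
proof -
 have "(\<Prod>i = 0..<DIM('a) + 1. Matrix.mat (DIM('a) + 1) (DIM('a) + 1) (%(i, j).
   if j < DIM('a) then inner (u (i + 1)) (basis_enum j) else \<rho> (i + 1)) $$ (i, p i)) =
  (\<Prod>i = 0..<DIM('a) + 1. if p i < DIM('a) then inner (u (i + 1)) (basis_enum (p i)) else \<rho> (i + 1))"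
  if "p permutes {0..<DIM('a)+1}" for p
 proof(rule prod.cong[OF refl])
  fix i assume i: "i : {0..<DIM('a)+1}"
  have "p i : {0..<DIM('a)+1}" using permutes_in_image[OF that] i by blast
  thus "Matrix.mat (DIM('a) + 1) (DIM('a) + 1) (%(i, j).
   if j < DIM('a) then inner (u (i + 1)) (basis_enum j) else \<rho> (i + 1)) $$ (i, p i) =
   (if p i < DIM('a) then inner (u (i + 1)) (basis_enum (p i)) else \<rho> (i + 1))"
   using i by simp
 qed
 thus ?thesis unfolding Dmat_def Determinant.det_def by(auto intro!:arg_cong[where f = abs] sum.cong)
qed

lemma Dk_eq_Dmat: "Dk k u = Dmat u (rho k u)"
 unfolding Dk_def Dmat_def rho_def by(rule refl)

text \<open>The Leibniz sum has \<open>fact (DIM('a) + 1)\<close> terms, each a product of factors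
  of modulus at most 1.\<close>

lemma Dmat_le:
 fixes u :: "nat => 'a::euclidean_space"
 assumes u: "!!i. i : II('a) ==> norm (u i) = 1" "!!i. i : II('a) ==> \<bar>\<rho> i\<bar> <= 1"
 shows "Dmat u \<rho> <= fact (DIM('a) + 1)"
proof -
 let ?P = "{p. p permutes {0..<DIM('a)+1}}"
 let ?t = "%p. signof p * (\<Prod>i = 0..<DIM('a) + 1. if p i < DIM('a) then inner (u (i + 1)) (basis_enum (p i)) else \<rho> (i + 1))"
 have "\<bar>?t p\<bar> <= 1" for p
 proof -
  have "\<bar>?t p\<bar> = (\<Prod>i = 0..<DIM('a) + 1. \<bar>if p i < DIM('a) then inner (u (i + 1)) (basis_enum (p i)) else \<rho> (i + 1)\<bar>)"
   by(simp add:abs_mult abs_prod sign_def)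
  also have "... <= 1"
  proof(intro prod_le_1 conjI)
   fix i assume i: "i : {0..<DIM('a)+1}"
   hence i1: "i + 1 : II('a)" by simp
   show "\<bar>if p i < DIM('a) then inner (u (i + 1)) (basis_enum (p i)) else \<rho> (i + 1)\<bar> <= 1"
   proof(cases "p i < DIM('a)")
    case True
    hence "(basis_enum (p i) :: 'a) : Basis" using basis_enum_bij[where 'a = 'a] by(auto simp:bij_betw_def)
    thus ?thesis
     using True Cauchy_Schwarz_ineq2[of "u (i + 1)" "basis_enum (p i)"] u(1)[OF i1] by simp
   qed (use u(2)[OF i1] in simp)
  qed simp
  finally show ?thesis .
 qed
 hence "(\<Sum>p\<in>?P. \<bar>?t p\<bar>) <= (\<Sum>p\<in>?P. 1)" by(intro sum_mono) auto
 also have "... = fact (DIM('a) + 1)"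
  unfolding sum_constant card_permutations[OF card_atLeastLessThan finite_atLeastLessThan] by(simp only:of_nat_fact mult_1_right diff_zero)
 finally show ?thesis unfolding Dmat_sum using sum_abs[of ?t ?P] by linarith
qed

lemma (in face_data) Dk_pos: "0 < Dk k u"
 unfolding Dk_eq_Dmat
 by(rule nn_integral_linear_change(1)[where g = "%_. 0"]) (use indep_ext_normal in \<open>simp_all add: ext_normal_def[abs_def]\<close>)

lemma (in face_data) Dk_le: "Dk k u <= fact (DIM('a) + 1)"
 unfolding Dk_eq_Dmat
proof(rule Dmat_le)
 fix i assume i: "i : II('a)"
 show "norm (u i) = 1" using norm_u[OF i] .
 thus "\<bar>rho k u i\<bar> <= 1"
  using norm_orth_proj_le[OF subspace_Lsub, of k u "u i"] by(simp add:rho_def)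
qed

lemma general_position_iff:
 fixes u :: "nat => 'a::euclidean_space"
 shows "general_position u <-> (ALL J:{J. J <= II('a) & card J = DIM('a)}. indep_fam u J)"
 by(auto simp:general_position_def indep_fam_def)

text \<open>Positive spanning means that \<open>v 1\<close> has only negative coefficients in the
  basis of the other \<open>v j\<close>. The coefficients are products with dual vectors, so the
  quantifier over all vectors of the subspace is replaced by finitely many measurable
  inequalities.\<close>

lemma tuples_iff:
 fixes u :: "nat => 'a::euclidean_space"
 assumes k: "k : {1..DIM('a)}"
 shows "u : tuples k <-> u : II('a) \<rightarrow>\<^sub>E sphere 0 1 & general_position u &
  (ALL j:{2..k + 1}. inner (dual_vec (%i. orth_proj (Lsub k u) (u i)) {2..k + 1} j) (orth_proj (Lsub k u) (u 1)) < 0)"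
proof(cases "u : II('a) \<rightarrow>\<^sub>E sphere 0 1 & general_position u")
 case False
 thus ?thesis by(auto simp:tuples_def)
next
 case True
 interpret gp_data k u by unfold_locales (use k True in auto)
 let ?v = "%i. v i" let ?J = "{2..k + 1}"
 have I1: "I1 = insert 1 ?J" using k by auto
 have J: "?J <= I1" "card ?J <= k" by auto
 have ind: "indep_fam ?v ?J" by(rule v_indep[OF J])
 have dual: "inner (dual_vec ?v ?J j) (v i) = (if j = i then 1 else 0)" if "j : ?J" "i : ?J" for i j
  by(rule inner_dual_vec[OF _ ind that]) simp
 have coef: "inner (dual_vec ?v ?J j) (\<Sum>i\<in>?J. a i *R v i) = a j" if j: "j : ?J" for a j
 proof -
  have "inner (dual_vec ?v ?J j) (\<Sum>i\<in>?J. a i *R v i) = (\<Sum>i\<in>?J. if j = i then a i else 0)"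
   unfolding inner_sum_right inner_scaleR_right using dual[OF j] by(intro sum.cong) auto
  thus ?thesis using j by simp
 qed
 show ?thesis
 proof
  assume u: "u : tuples k"
  interpret face_data k u by(rule face_dataI[OF k u])
  have "EX c. (ALL j:I1. 0 < c j) & (\<Sum>j\<in>I1. c j *R v j) = 0" by(rule pos_dependency) blast
  then obtain c where c: "ALL j:I1. 0 < c j" "(\<Sum>j\<in>I1. c j *R v j) = 0" by blast
  have c1: "0 < c 1" using c(1) I1 by blast
  have "c 1 *R v 1 + (\<Sum>j\<in>?J. c j *R v j) = 0" using c(2) unfolding I1 by simp
  hence "c 1 *R v 1 = (\<Sum>i\<in>?J. (- c i) *R v i)" by(simp add:sum_negf add_eq_0_iff2)
  hence neg: "c 1 * inner (dual_vec ?v ?J j) (v 1) = - c j" if "j : ?J" for j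
   using coef[OF that, of "%i. - c i"] by(metis inner_scaleR_right)
  have "inner (dual_vec ?v ?J j) (v 1) < 0" if j: "j : ?J" for j
  proof -
   have "0 < c j" using c(1) j I1 by blast
   hence "c 1 * inner (dual_vec ?v ?J j) (v 1) < 0" using neg[OF j] by simp
   thus ?thesis using c1 by(simp add:mult_less_0_iff)
  qed
  thus "u : II('a) \<rightarrow>\<^sub>E sphere 0 1 & general_position u &
   (ALL j:?J. inner (dual_vec ?v ?J j) (v 1) < 0)" using True by blast
 next
  assume a: "u : II('a) \<rightarrow>\<^sub>E sphere 0 1 & general_position u &
   (ALL j:?J. inner (dual_vec ?v ?J j) (v 1) < 0)"
  have "v 1 : span (?v ` ?J)"
  proof -
   have "card ?J = k" by simp
   hence "dim (span (?v ` ?J)) = dim L" using indep_fam_dim_span[OF ind] dim_L by simp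
   moreover have "span (?v ` ?J) <= L" by(rule span_minimal) (use v_in_L subspace_Lsub in auto)
   ultimately have "span (?v ` ?J) = L" by(intro subspace_dim_equal subspace_span subspace_Lsub) simp_all
   thus ?thesis using v_in_L by blast
  qed
  then obtain b where b: "v 1 = (\<Sum>i\<in>?J. b i *R v i)" using indep_fam_span_sum[OF ind] by blast
  have bneg: "b j < 0" if j: "j : ?J" for j
  proof -
   have "inner (dual_vec ?v ?J j) (v 1) = b j" using coef[OF j, of b] unfolding b[symmetric] .
   moreover have "inner (dual_vec ?v ?J j) (v 1) < 0" using a j by blast
   ultimately show ?thesis by(simp only:)
  qed
  define c where "c i = (if i = 1 then 1 else - b i)" for i
  show "u : tuples k"
  proof(rule tuples_if_pos_dependency)
   show "0 < c i" if "i : I1" for i using that bneg[of i] unfolding I1 by(auto simp:c_def)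
   have "(\<Sum>i\<in>?J. c i *R v i) = - (\<Sum>i\<in>?J. b i *R v i)"
    unfolding sum_negf[symmetric] by(intro sum.cong) (auto simp:c_def)
   hence "(\<Sum>i\<in>?J. c i *R v i) = - v 1" unfolding b[symmetric] .
   thus "(\<Sum>i\<in>I1. c i *R v i) = 0" unfolding I1 by(subst sum.insert) (auto simp:c_def)
  qed (use True in blast)
 qed
qed

context directional
begin

abbreviation "PhiN \<equiv> PiM II('a) (%_. \<phi>)"

sublocale Phi: product_prob_space "%_ :: nat. \<phi>" "II('a)" ..

lemma space_PhiN: "space PhiN = II('a) \<rightarrow>\<^sub>E sphere 0 1" by(simp add:space_PiM space_phi)

lemma measurable_component_phi:
 fixes I :: "nat set"
 assumes "i : I"
 shows "(%u. u i) : borel_measurable (PiM I (%_. \<phi>))"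
 by(rule measurable_compose[OF measurable_component_singleton[OF assms] measurable_phi_borel])

lemma measurable_orth_proj_Lsub:
 assumes "i : II('a)"
 shows "(%u. orth_proj (Lsub k u) (u i)) : borel_measurable PhiN"
 unfolding orth_proj_Lsub_eq_resid
 by(intro measurable_resid measurable_component_phi assms) auto

lemma measurable_rho:
 assumes "i : II('a)"
 shows "(%u. rho k u i) : borel_measurable PhiN"
 using measurable_orth_proj_Lsub[OF assms, of k] by(cases "i <= k + 1") (simp_all add:rho_def)

lemma sets_tuples:
 assumes k: "k : {1..DIM('a)}"
 shows "tuples k : sets PhiN"
proof -
 have gp: "{u : space PhiN. general_position u} : sets PhiN"
  unfolding general_position_iff
 proof(rule sets.sets_Collect_finite_All)
  show "finite {J. J <= II('a) & card J = DIM('a)}" by simp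
  show "{u : space PhiN. indep_fam u J} : sets PhiN" if "J : {J. J <= II('a) & card J = DIM('a)}" for J
  proof(rule measurable_indep_fam[where f = "%i u. u i"])
   show "finite J" using that by(auto intro:finite_subset)
   show "(%u. u i) : borel_measurable PhiN" if "i : J" for i
    using that \<open>J \<in> _\<close> by(intro measurable_component_phi) blast
  qed
 qed
 have "{u : space PhiN. ALL j:{2..k + 1}. inner (dual_vec (%i. orth_proj (Lsub k u) (u i)) {2..k + 1} j) (orth_proj (Lsub k u) (u 1)) < 0} : sets PhiN"
 proof(rule sets.sets_Collect_finite_All)
  fix j assume j: "j : {2..k + 1}"
  have "(%u. dual_vec (%i. orth_proj (Lsub k u) (u i)) {2..k + 1} j) : borel_measurable PhiN"
   using k by(intro measurable_dual_vec[OF _ j] measurable_orth_proj_Lsub) auto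
  moreover have "(%u. orth_proj (Lsub k u) (u 1)) : borel_measurable PhiN"
   by(intro measurable_orth_proj_Lsub) simp
  ultimately show "{u : space PhiN. inner (dual_vec (%i. orth_proj (Lsub k u) (u i)) {2..k + 1} j) (orth_proj (Lsub k u) (u 1)) < 0} : sets PhiN"
   by(intro borel_measurable_less borel_measurable_inner) simp_all
 qed simp
 note B = this
 have eq: "tuples k = {u : space PhiN. general_position u} Int {u : space PhiN.
  ALL j:{2..k + 1}. inner (dual_vec (%i. orth_proj (Lsub k u) (u i)) {2..k + 1} j) (orth_proj (Lsub k u) (u 1)) < 0}"
 proof(rule Set.set_eqI)
  fix u :: "nat => 'a"
  show "u : tuples k <-> u : {u : space PhiN. general_position u} Int {u : space PhiN.
   ALL j:{2..k + 1}. inner (dual_vec (%i. orth_proj (Lsub k u) (u i)) {2..k + 1} j) (orth_proj (Lsub k u) (u 1)) < 0}"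
   unfolding tuples_iff[OF k] space_PhiN by blast
 qed
 show ?thesis unfolding eq by(rule sets.Int[OF gp B])
qed

lemma measurable_Tk_vertex:
 assumes k: "k : {1..DIM('a)}" and j: "j : {1..k+1}"
 shows "(%u. Tk_vertex k u j) : borel_measurable PhiN"
 unfolding Tk_vertex_def
proof(intro borel_measurable_sum borel_measurable_scaleR)
 fix i assume "i : {1..k+1} - {j}"
 hence i: "i : II('a)" "i : II('a) - {j}" using k by auto
 show "(%u. norm (orth_proj (Lsub k u) (u i))) : borel_measurable PhiN"
  using measurable_orth_proj_Lsub[OF i(1), of k] by simp
 show "(%u. dual_vec u (II('a) - {j}) i) : borel_measurable PhiN"
  by(rule measurable_dual_vec[where f = "%i u. u i", OF _ i(2)]) (auto intro:measurable_component_phi)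
qed

lemma measurable_Tk_hull:
 assumes k: "k : {1..DIM('a)}"
 shows "(%u. convex hull (Tk_vertex k u ` {1..k+1})) : measurable PhiN (borel_of CBT)"
 by(rule measurable_convex_hull[where f = "%j u. Tk_vertex k u j"]) (use measurable_Tk_vertex[OF k] in auto)

lemma measurable_Dk: "Dk k : borel_measurable PhiN"
proof -
 have "(%u. Dmat u (rho k u)) : borel_measurable PhiN"
  unfolding Dmat_sum
 proof(intro borel_measurable_abs borel_measurable_sum borel_measurable_times borel_measurable_prod borel_measurable_const)
  fix p i assume "i : {0..<DIM('a)+1}"
  hence i: "i + 1 : II('a)" by simp
  show "(%u. if p i < DIM('a) then inner (u (i + 1)) (basis_enum (p i)) else rho k u (i + 1)) : borel_measurable PhiN"
   using measurable_component_phi[OF i] measurable_rho[OF i] by(cases "p i < DIM('a)") simp_all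
 qed
 thus ?thesis by(simp only:Dk_eq_Dmat[abs_def])
qed

end

context subspace_free_directional
begin

lemma AE_not_in_span:
 assumes "dim S < DIM('a)"
 shows "AE u in \<phi>. u ~: span S"
proof -
 have "span S ~= UNIV" using assms by(metis dim_UNIV dim_span less_irrefl)
 then obtain w where w: "w ~= 0" "!!x. x : span S ==> orthogonal w x"
  using orthogonal_to_subspace_exists[of S] assms by metis
 from AE_not_orthogonal[OF w(1)] show ?thesis
  by eventually_elim (use w(2) in \<open>auto simp: orthogonal_def\<close>)
qed

text \<open>By induction with Fubini: a further random normal almost surely avoids the span of fewer
  than \<open>DIM('a)\<close> fixed vectors.\<close>

lemma AE_indep_fam_PiM:
 assumes "finite J" "card J <= DIM('a)"
 shows "AE u in PiM J (%_. \<phi>). indep_fam u (J :: nat set)"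
 using assms
proof(induction J rule: finite_induct)
 case empty
 have "indep_fam u ({} :: nat set)" for u :: "nat => 'a" by(simp add:indep_fam_def independent_empty)
 thus ?case by(intro AE_I2)
next
 case (insert i J)
 let ?B = "{u : space (PiM (insert i J) (%_. \<phi>)). ~ indep_fam u (insert i J)}"
 have "{u : space (PiM (insert i J) (%_. \<phi>)). indep_fam u (insert i J)} : sets (PiM (insert i J) (%_. \<phi>))"
  using measurable_indep_fam[of "insert i J" "%i u. u i" "PiM (insert i J) (%_. \<phi>)"] measurable_component_phi insert.hyps(1)
  by auto
 hence B: "?B : sets (PiM (insert i J) (%_. \<phi>))" by(rule sets.sets_Collect_neg)
 have J: "AE u in PiM J (%_. \<phi>). indep_fam u J" using insert by simp
 have "emeasure (PiM (insert i J) (%_. \<phi>)) ?B = (NN u. indicator ?B u \<partial>PiM (insert i J) (%_. \<phi>))"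
  using B by simp
 also have "... = (NN x. (NN y. indicator ?B (x(i := y)) \<partial>\<phi>) \<partial>PiM J (%_. \<phi>))"
  by(rule Phi.product_nn_integral_insert[OF insert.hyps]) (use B in simp)
 also have "... = (NN x. 0 \<partial>PiM J (%_. \<phi>))"
 proof(rule nn_integral_cong_AE)
  from J show "AE x in PiM J (%_. \<phi>). (NN y. indicator ?B (x(i := y)) \<partial>\<phi>) = 0"
  proof eventually_elim
   case (elim x)
   have "dim (x ` J) <= card J"
    using dim_le_card'[of "x ` J"] card_image_le[OF insert.hyps(1), of x] insert.hyps(1) by simp
   hence "dim (x ` J) < DIM('a)" using insert.hyps insert.prems by simp
   from AE_not_in_span[OF this] have "AE y in \<phi>. indicator ?B (x(i := y)) = (0 :: ennreal)"
   proof eventually_elim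
    case (elim y)
    have img: "(x(i := y)) ` J = x ` J" using insert.hyps(2) by auto
    have "indep_fam (x(i := y)) J"
     using \<open>indep_fam x J\<close> by(subst indep_fam_cong[of J _ x]) (use insert.hyps(2) in auto)
    hence ind: "inj_on (x(i := y)) J" "independent (x ` J)" unfolding indep_fam_def img by auto
    have yn: "y ~: span (x ` J)" by(rule elim)
    hence y: "y ~: x ` J" by(meson span_base)
    have img2: "(x(i := y)) ` insert i J = insert y (x ` J)" by(simp only:image_insert img fun_upd_same)
    have "(x(i := y)) i ~: (x(i := y)) ` (J - {i})"
    proof -
     have Ji: "J - {i} = J" using insert.hyps(2) by simp
     show ?thesis unfolding Ji img fun_upd_same by(rule y)
    qed
    hence "inj_on (x(i := y)) (insert i J)" using ind(1) unfolding inj_on_insert by blast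
    moreover have "independent (insert y (x ` J))" using yn ind(2) by(rule independent_insertI)
    ultimately have "indep_fam (x(i := y)) (insert i J)" unfolding indep_fam_def img2 by blast
    thus ?case by simp
   qed
   thus ?case by(subst nn_integral_cong_AE[where v = "%_. 0"]) simp_all
  qed
 qed
 also have "... = 0" by simp
 finally have "?B : null_sets (PiM (insert i J) (%_. \<phi>))" using B by(intro null_setsI)
 from AE_not_in[OF this] show ?case by(rule AE_mp) (intro AE_I2 impI, simp)
qed

end

section \<open>Typical faces\<close>

locale face_process = hyperplane_process M X \<gamma> \<phi> + subspace_free_directional \<phi>
 for M :: "'w measure" and X :: "'w => 'a::euclidean_space set set" and \<gamma> :: real and \<phi> :: "'a measure" +
 fixes k :: nat
 assumes k: "k : {1..DIM('a)}" and dim_ge_2: "2 <= DIM('a)"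
begin

lemma space_EI: "space (EI I) = I \<rightarrow>\<^sub>E params" by(simp add:space_PiM space_E)

lemma tup_subset_space: "tup I \<eta> <= space (EI I)" unfolding space_EI tup_def by blast

lemma measurable_fst_E: "fst : measurable E \<phi>" unfolding E_def by(rule measurable_fst)
lemma measurable_snd_E: "snd : borel_measurable E"
 unfolding E_def using measurable_snd[of \<phi> "lborel :: real measure"] by simp

lemma measurable_fst_component:
 assumes "i : I"
 shows "(%p. fst (p i)) : measurable (EI I) \<phi>"
 by(rule measurable_compose[OF measurable_component_singleton[OF assms, of "%_. E"] measurable_fst_E])

lemma measurable_snd_component:
 assumes "i : I"
 shows "(%p. snd (p i)) : borel_measurable (EI I)"
 by(rule measurable_compose[OF measurable_component_singleton[OF assms, of "%_. E"] measurable_snd_E])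

text \<open>For each of the finitely many lengths, the mean number of tuples with dependent normals
  is the integral over a null set of normals.\<close>

lemma AE_generic: "AE w in M. generic (X w)"
proof -
 have n: "AE w in M. ALL p:tup {1..n} (X w). indep_fam (%i. fst (p i)) {1..n}" if n: "n <= DIM('a)" for n
 proof -
  let ?J = "{1..n}"
  let ?B = "{p : space (EI ?J). ~ indep_fam (%i. fst (p i)) ?J}"
  have "{p : space (EI ?J). indep_fam (%i. fst (p i)) ?J} : sets (EI ?J)"
   by(rule measurable_indep_fam[where f = "%i p. fst (p i)"])
    (simp, rule measurable_compose[OF measurable_fst_component measurable_phi_borel])
  hence B: "?B : sets (EI ?J)" by(rule sets.sets_Collect_neg)
  hence fB: "indicator ?B : borel_measurable (EI ?J)" by simp
  note fm = factorial_moment[OF finite_atLeastAtMost fB]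
  have "(NN p. indicator ?B p * indicator (distinct_hyps ?J) p \<partial>EI ?J) <= (NN p. indicator ?B p \<partial>EI ?J)"
   by(intro nn_integral_mono) (simp add:indicator_def)
  also have "... = (NN u. (NN \<tau>. indicator ?B (\<lambda>i\<in>?J. (u i, \<tau> i)) \<partial>PiM ?J (%_. lborel)) \<partial>PiM ?J (%_. \<phi>))"
   by(rule nn_integral_EI[OF finite_atLeastAtMost fB])
  also have "... = (NN u. 0 \<partial>PiM ?J (%_. \<phi>))"
  proof(rule nn_integral_cong_AE)
   have "AE u in PiM ?J (%_. \<phi>). indep_fam u ?J" by(rule AE_indep_fam_PiM) (use n in simp_all)
   thus "AE u in PiM ?J (%_. \<phi>). (NN \<tau>. indicator ?B (\<lambda>i\<in>?J. (u i, \<tau> i)) \<partial>PiM ?J (%_. lborel)) = 0"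
   proof eventually_elim
    case (elim u)
    have "indicator ?B (\<lambda>i\<in>?J. (u i, \<tau> i)) = (0 :: ennreal)" for \<tau>
    proof -
     have "indep_fam (%i. fst ((\<lambda>i\<in>?J. (u i, \<tau> i)) i)) ?J = indep_fam u ?J" by(rule indep_fam_cong) simp
     thus ?thesis using elim by simp
    qed
    thus ?case by simp
   qed
  qed
  also have "... = 0" by simp
  finally have "(NN w. tuple_sum ?J w (indicator ?B) \<partial>M) = 0" using fm by simp
  hence "AE w in M. tuple_sum ?J w (indicator ?B) = 0"
   using fm by(subst (asm) nn_integral_0_iff_AE) auto
  thus ?thesis
  proof eventually_elim
   case (elim w)
   show ?case
   proof
    fix p assume p: "p : tup ?J (X w)"
    have "indicator ?B p * indicator (tup ?J (X w)) p = (0 :: ennreal)"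
     using elim unfolding tuple_sum_def by(subst (asm) nn_integral_0_iff_AE) (auto simp:AE_count_space)
    hence "p ~: ?B" using p by(auto simp:indicator_def split:if_splits)
    thus "indep_fam (%i. fst (p i)) ?J" using p tup_subset_space by blast
   qed
  qed
 qed
 have "AE w in M. ALL n:{..DIM('a)}. ALL p:tup {1..n} (X w). indep_fam (%i. fst (p i)) {1..n}"
  by(rule AE_finite_allI) (simp, rule n, simp)
 thus ?thesis by(rule AE_mp) (intro AE_I2 impI, simp add:generic_def)
qed

lemma measurable_normals: "normals : measurable (EI II('a)) PhiN"
 unfolding normals_def[abs_def] by(intro measurable_restrict measurable_fst_component)

lemma measurable_ext_normal: "i : II('a) ==> (%p. ext_normal k (normals p) i) : borel_measurable (EI II('a))"
 unfolding ext_normal_def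
 by(intro borel_measurable_Pair measurable_compose[OF measurable_normals measurable_component_phi]
   measurable_compose[OF measurable_normals measurable_rho])

lemma measurable_solve: "solve k : borel_measurable (EI II('a))"
 unfolding solve_def[abs_def]
proof(intro borel_measurable_sum borel_measurable_scaleR)
 fix i assume i: "i : II('a)"
 show "(%p. snd (p i)) : borel_measurable (EI II('a))" by(rule measurable_snd_component[OF i])
 show "(%p. dual_vec (ext_normal k (normals p)) II('a) i) : borel_measurable (EI II('a))"
  by(rule measurable_dual_vec[where f = "%i p. ext_normal k (normals p) i", OF _ i])
   (simp, rule measurable_ext_normal)
qed

lemma normals_pair:
 assumes "u : space PhiN"
 shows "normals (\<lambda>i\<in>II('a). (u i, \<tau> i)) = u"
proof -
 have "u : extensional II('a)" using assms unfolding space_PhiN PiE_def by blast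
 thus ?thesis by(auto simp:normals_def extensional_def fun_eq_iff)
qed

text \<open>Pulls a weight of normals, centre and radius back to parameters. It vanishes unless the
  normals belong to \<open>tuples k\<close>, where \<open>solve\<close> has its meaning.\<close>

definition tuple_fun :: "((nat => 'a) \<times> 'a \<times> real => ennreal) => (nat => 'a \<times> real) => ennreal" where
 "tuple_fun G p = indicator (tuples k) (normals p) * G (normals p, solve k p)"

lemma measurable_tuple_fun:
 assumes "G : borel_measurable (PhiN \<Otimes>\<^sub>M borel)"
 shows "tuple_fun G : borel_measurable (EI II('a))"
proof -
 have "(%p. (normals p, solve k p)) : measurable (EI II('a)) (PhiN \<Otimes>\<^sub>M borel)"
  by(rule measurable_Pair[OF measurable_normals measurable_solve])
 from measurable_compose[OF this assms] have "(%p. G (normals p, solve k p)) : borel_measurable (EI II('a))" .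
 moreover have "(%p. indicator (tuples k) (normals p)) : borel_measurable (EI II('a))"
  by(rule measurable_compose[OF measurable_normals]) (use sets_tuples[OF k] in simp)
 ultimately show ?thesis unfolding tuple_fun_def[abs_def] by(intro borel_measurable_times_ennreal)
qed

text \<open>Fubini separates the normals from the distances; for fixed normals the linear
  substitution replaces the distances by (z, r).\<close>

lemma nn_integral_tuple_fun:
 assumes G: "G : borel_measurable (PhiN \<Otimes>\<^sub>M borel)"
 shows "(NN p. tuple_fun G p \<partial>EI II('a)) =
  (NN u. indicator (tuples k) u * (ennreal (Dk k u) * (NN z. (NN r. G (u, z, r) \<partial>lborel) \<partial>lborel)) \<partial>PhiN)"
proof -
 have "(NN p. tuple_fun G p \<partial>EI II('a)) =
  (NN u. (NN \<tau>. tuple_fun G (\<lambda>i\<in>II('a). (u i, \<tau> i)) \<partial>PiM II('a) (%_. lborel)) \<partial>PhiN)"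
  by(rule nn_integral_EI[OF finite_atLeastAtMost measurable_tuple_fun[OF G]])
 also have "... = (NN u. indicator (tuples k) u * (ennreal (Dk k u) * (NN z. (NN r. G (u, z, r) \<partial>lborel) \<partial>lborel)) \<partial>PhiN)"
 proof(rule nn_integral_cong)
  fix u assume u: "u : space PhiN"
  let ?p = "%\<tau>. \<lambda>i\<in>II('a). (u i, \<tau> i)"
  show "(NN \<tau>. tuple_fun G (?p \<tau>) \<partial>PiM II('a) (%_. lborel)) =
   indicator (tuples k) u * (ennreal (Dk k u) * (NN z. (NN r. G (u, z, r) \<partial>lborel) \<partial>lborel))"
  proof(cases "u : tuples k")
   case False
   show ?thesis unfolding tuple_fun_def normals_pair[OF u] indicator_simps(2)[OF False] by simp
  next
   case True
   interpret F: face_data k u by(rule face_dataI[OF k True])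
   let ?g = "%\<tau>. G (u, solve k (?p \<tau>))"
   have Gu: "(%x. G (u, x)) : borel_measurable borel"
    by(rule measurable_compose[OF measurable_Pair1'[OF u] G])
   have "(%\<tau>. solve k (?p \<tau>)) = (%\<tau>. \<Sum>i\<in>II('a). \<tau> i *R dual_vec (ext_normal k u) II('a) i)"
    unfolding solve_def normals_pair[OF u] by(intro ext sum.cong) simp_all
   moreover have "(%\<tau>. \<Sum>i\<in>II('a). \<tau> i *R dual_vec (ext_normal k u) II('a) i) : borel_measurable (PiM II('a) (%_. lborel :: real measure))"
   proof(intro borel_measurable_sum borel_measurable_scaleR borel_measurable_const)
    fix i assume "i : II('a)"
    from measurable_component_singleton[OF this, of "%_. lborel :: real measure"]
    show "(%\<tau>. \<tau> i) : borel_measurable (PiM II('a) (%_. lborel :: real measure))" by simp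
   qed
   ultimately have g: "?g : borel_measurable (PiM II('a) (%_. lborel))"
    by(intro measurable_compose[OF _ Gu]) (simp only:)
   have ind: "indep_fam (%i. (u i, rho k u i)) II('a)"
    using F.indep_ext_normal by(simp add:ext_normal_def[abs_def])
   have solve: "solve k (?p (\<lambda>i\<in>II('a). inner z (u i) + r * rho k u i)) = (z, r)" for z r
   proof(rule solve_iff[OF k, THEN iffD1])
    show "normals (?p (\<lambda>i\<in>II('a). inner z (u i) + r * rho k u i)) : tuples k" using True by(simp only:normals_pair[OF u])
    show "ALL i:II('a). snd (?p (\<lambda>i\<in>II('a). inner z (u i) + r * rho k u i) i) = inner z (fst (?p (\<lambda>i\<in>II('a). inner z (u i) + r * rho k u i) i)) +
     r * rho k (normals (?p (\<lambda>i\<in>II('a). inner z (u i) + r * rho k u i))) i"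
     unfolding normals_pair[OF u] by simp
   qed
   have "(NN \<tau>. tuple_fun G (?p \<tau>) \<partial>PiM II('a) (%_. lborel)) = (NN \<tau>. ?g \<tau> \<partial>PiM II('a) (%_. lborel))"
    using True by(simp only:tuple_fun_def normals_pair[OF u] indicator_simps mult_1)
   also have "... = ennreal (Dmat u (rho k u)) * (NN z. (NN r. ?g (\<lambda>i\<in>II('a). inner z (u i) + r * rho k u i) \<partial>lborel) \<partial>lborel)"
    by(rule nn_integral_linear_change(2)[OF ind g])
   also have "... = ennreal (Dk k u) * (NN z. (NN r. G (u, z, r) \<partial>lborel) \<partial>lborel)"
    by(simp only:solve Dk_eq_Dmat)
   finally show ?thesis using True by(simp only:indicator_simps mult_1)
  qed
 qed
 finally show ?thesis .
qed

text \<open>A repeated hyperplane would produce two parallel normals, which general position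
  excludes in dimension at least 2.\<close>

lemma tuples_distinct:
 assumes p: "p : space (EI II('a))" and n: "normals p : tuples k"
 shows "p : distinct_hyps II('a)"
proof -
 have pp: "!!i. i : II('a) ==> p i : params" using p by(auto simp:space_EI)
 have "hyp (p i) ~= hyp (p j)" if ij: "i : II('a)" "j : II('a)" "i ~= j" for i j
 proof
  assume "hyp (p i) = hyp (p j)"
  hence "p j = p i | p j = - p i" using hyp_eq_iff pp ij by blast
  then obtain s :: real where s: "p j = s *R p i" using scaleR_one scaleR_minus1_left by metis
  have "indep_fam (normals p) {i, j}"
   by(rule general_position_indep_fam) (use n ij dim_ge_2 in \<open>auto simp: tuples_def\<close>)
  hence "normals p j ~: span (normals p ` ({i, j} - {j}))" unfolding indep_fam_iff_span by blast
  moreover have "normals p ` ({i, j} - {j}) = {normals p i}" using ij(3) by auto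
  moreover have "normals p j = s *R normals p i" using s ij by(simp add:normals_def)
  ultimately show False by(auto simp:span_base span_scale)
 qed
 hence "inj_on (%i. hyp (p i)) II('a)" unfolding inj_on_def by blast
 thus ?thesis using p unfolding distinct_hyps_def space_EI by blast
qed

lemma mean_tuple_sum:
 assumes G: "G : borel_measurable (PhiN \<Otimes>\<^sub>M borel)"
 shows "(%w. tuple_sum II('a) w (tuple_fun G)) : borel_measurable M"
  and "(NN w. tuple_sum II('a) w (tuple_fun G) \<partial>M) = ennreal (2 * \<gamma>) ^ (DIM('a) + 1) *
   (NN u. indicator (tuples k) u * (ennreal (Dk k u) * (NN z. (NN r. G (u, z, r) \<partial>lborel) \<partial>lborel)) \<partial>PhiN)"
proof -
 note fm = factorial_moment[OF finite_atLeastAtMost measurable_tuple_fun[OF G]]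
 thus "(%w. tuple_sum II('a) w (tuple_fun G)) : borel_measurable M" by blast
 have "(NN p. tuple_fun G p * indicator (distinct_hyps II('a)) p \<partial>EI II('a)) = (NN p. tuple_fun G p \<partial>EI II('a))"
  by(rule nn_integral_cong) (use tuples_distinct in \<open>auto simp: tuple_fun_def indicator_def\<close>)
 thus "(NN w. tuple_sum II('a) w (tuple_fun G) \<partial>M) = ennreal (2 * \<gamma>) ^ (DIM('a) + 1) *
   (NN u. indicator (tuples k) u * (ennreal (Dk k u) * (NN z. (NN r. G (u, z, r) \<partial>lborel) \<partial>lborel)) \<partial>PhiN)"
  using fm unfolding nn_integral_tuple_fun[OF G, symmetric] by simp
qed

text \<open>Index 0 carries the additional hyperplane. Whatever the centre and its normal, the
  admissible distances form an interval of length \<open>2 * s\<close>.\<close>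

lemma mean_extra_hyperplane:
 fixes F :: "(nat => 'a \<times> real) => ennreal" and z :: "(nat => 'a \<times> real) => 'a"
 assumes F: "F : borel_measurable (EI II('a))" and z: "z : borel_measurable (EI II('a))" and s: "0 <= s"
 defines "f \<equiv> %q. F (restrict q II('a)) * indicator {x. \<bar>snd x - inner (z (restrict q II('a))) (fst x)\<bar> <= s} (q 0)"
 shows "(%om. tuple_sum (insert 0 II('a)) om f) : borel_measurable M"
  and "(NN om. tuple_sum (insert 0 II('a)) om f \<partial>M) <= ennreal (2 * \<gamma>) ^ (DIM('a) + 2) * (ennreal (2 * s) * (NN p. F p \<partial>EI II('a)))"
proof -
 let ?I0 = "insert 0 II('a)"
 have fin: "finite ?I0" by simp
 have r: "(%q. restrict q II('a)) : measurable (EI ?I0) (EI II('a))" by(rule measurable_restrict_subset) blast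
 have q0: "(%q. q 0) : borel_measurable (EI ?I0)"
  by(rule measurable_compose[OF measurable_component_singleton[of 0 ?I0 "%_. E"] measurable_E_borel]) simp
 have zr: "(%q. z (restrict q II('a))) : borel_measurable (EI ?I0)" by(rule measurable_compose[OF r z])
 have q0': "(%q. fst (q 0)) : borel_measurable (EI ?I0)" "(%q. snd (q 0)) : borel_measurable (EI ?I0)"
  by(rule measurable_compose[OF q0], simp add:borel_prod[symmetric])+
 have "{q : space (EI ?I0). \<bar>snd (q 0) - inner (z (restrict q II('a))) (fst (q 0))\<bar> <= s} : sets (EI ?I0)"
  by(intro borel_measurable_le borel_measurable_abs borel_measurable_diff borel_measurable_inner zr q0' borel_measurable_const)
 hence "indicator {q : space (EI ?I0). \<bar>snd (q 0) - inner (z (restrict q II('a))) (fst (q 0))\<bar> <= s} : borel_measurable (EI ?I0)"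
  by simp
 hence ind: "(%q. indicator {x. \<bar>snd x - inner (z (restrict q II('a))) (fst x)\<bar> <= s} (q 0) :: ennreal) : borel_measurable (EI ?I0)"
  by(rule measurable_cong[THEN iffD1, rotated]) (simp add:indicator_def)
 have f: "f : borel_measurable (EI ?I0)"
  unfolding f_def by(intro borel_measurable_times_ennreal ind measurable_compose[OF r F])
 note fm = factorial_moment[OF fin f]
 thus "(%om. tuple_sum (insert 0 II('a)) om f) : borel_measurable M" by blast
 have "(NN q. f q * indicator (distinct_hyps ?I0) q \<partial>EI ?I0) <= (NN q. f q \<partial>EI ?I0)"
  by(intro nn_integral_mono) (simp add:indicator_def)
 also have "... = (NN p. (NN y. f (p(0 := y)) \<partial>E) \<partial>EI II('a))"
  by(rule EI.product_nn_integral_insert[OF _ _ f]) simp_all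
 also have "... = (NN p. F p * ennreal (2 * s) \<partial>EI II('a))"
 proof(rule nn_integral_cong)
  fix p assume p: "p : space (EI II('a))"
  have rp: "restrict (p(0 := y)) II('a) = p" for y
  proof
   fix i show "restrict (p(0 := y)) II('a) i = p i"
    using p by(cases "i : II('a)") (auto simp:space_EI PiE_def extensional_def)
  qed
  have A: "{x. \<bar>snd x - inner w (fst x)\<bar> <= s} : sets borel" for w :: 'a
   by(intro borel_closed closed_Collect_le continuous_intros)
  have mA: "(%y. indicator {x. \<bar>snd x - inner w (fst x)\<bar> <= s} y :: ennreal) : borel_measurable E" for w :: 'a
   by(rule measurable_compose[OF measurable_E_borel borel_measurable_indicator[OF A]])
  have "(NN y. f (p(0 := y)) \<partial>E) = (NN y. F p * indicator {x. \<bar>snd x - inner (z p) (fst x)\<bar> <= s} y \<partial>E)"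
   unfolding f_def rp fun_upd_same by(rule refl)
  also have "... = F p * (NN y. indicator {x. \<bar>snd x - inner (z p) (fst x)\<bar> <= s} y \<partial>E)"
   by(rule nn_integral_cmult[OF mA])
  also have "(NN y. indicator {x. \<bar>snd x - inner (z p) (fst x)\<bar> <= s} y \<partial>E) =
   (NN u. (NN \<tau>. indicator {x. \<bar>snd x - inner (z p) (fst x)\<bar> <= s} (u, \<tau>) \<partial>lborel) \<partial>\<phi>)"
   using mA unfolding E_def by(intro lborel.nn_integral_fst[symmetric])
  also have "... = (NN u. ennreal (2 * s) \<partial>\<phi>)"
  proof(rule nn_integral_cong)
   fix u
   have "indicator {x. \<bar>snd x - inner (z p) (fst x)\<bar> <= s} (u, \<tau>) = (indicator {inner (z p) u - s .. inner (z p) u + s} \<tau> :: ennreal)" for \<tau>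
    by(auto simp:indicator_def abs_le_iff)
   hence "(NN \<tau>. indicator {x. \<bar>snd x - inner (z p) (fst x)\<bar> <= s} (u, \<tau>) \<partial>lborel) =
    emeasure lborel {inner (z p) u - s .. inner (z p) u + s}" by simp
   thus "(NN \<tau>. indicator {x. \<bar>snd x - inner (z p) (fst x)\<bar> <= s} (u, \<tau>) \<partial>lborel) = ennreal (2 * s)"
    using s by simp
  qed
  also have "... = ennreal (2 * s)" by(simp add:\<phi>.emeasure_space_1)
  finally show "(NN y. f (p(0 := y)) \<partial>E) = F p * ennreal (2 * s)" .
 qed
 also have "... = ennreal (2 * s) * (NN p. F p \<partial>EI II('a))" unfolding nn_integral_multc[OF F] by(rule mult.commute)
 finally have "(NN q. f q * indicator (distinct_hyps ?I0) q \<partial>EI ?I0) <= ennreal (2 * s) * (NN p. F p \<partial>EI II('a))" .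
 moreover have "card ?I0 = DIM('a) + 2" by simp
 ultimately show "(NN om. tuple_sum (insert 0 II('a)) om f \<partial>M) <= ennreal (2 * \<gamma>) ^ (DIM('a) + 2) * (ennreal (2 * s) * (NN p. F p \<partial>EI II('a)))"
  using fm by(simp only:mult_left_mono zero_le)
qed

end

section \<open>The limit measure and the weights\<close>

locale sized_process = face_process M X \<gamma> \<phi> k
 for M :: "'w measure" and X :: "'w => 'a::euclidean_space set set" and \<gamma> :: real and \<phi> :: "'a measure" and k :: nat +
 fixes \<Sigma> :: "'a set => real"
 assumes size: "size_functional k \<Sigma>" and size_translation: "translation_invariant \<Sigma>"
begin

text \<open>Replaces \<open>Tk\<close> by a map that is measurable on the whole product space and
  agrees with it on \<open>tuples k\<close>.\<close>

definition hull_Tk :: "(nat => 'a) => 'a set" where "hull_Tk u = convex hull (Tk_vertex k u ` {1..k+1})"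

lemma k1: "1 <= k" using k by simp

lemma measurable_hull_Tk: "hull_Tk : measurable PhiN (borel_of CBT)"
 unfolding hull_Tk_def[abs_def] by(rule measurable_Tk_hull[OF k])

lemma measurable_size: "\<Sigma> : borel_measurable (borel_of CBT)"
 by(rule borel_measurable_continuous_map) (use size in \<open>simp add: size_functional_def\<close>)

lemma hull_Tk_eq: "u : tuples k ==> hull_Tk u = Tk k u"
 using face_data.Tk_eq_convex_hull[OF face_dataI[OF k]] by(simp add:hull_Tk_def)

lemma Tk_unique_inball: fixes u :: "nat => 'a" shows "u : tuples k ==> Tk k u : unique_inball_polytopes k"
 using face_data.simp_unique_inball[OF face_dataI[OF k], of u 1 0] face_data.Tk_eq_simp[OF face_dataI[OF k]] by simp

text \<open>The integral in \<open>xi\<close> before passing to shapes, so that it can be evaluated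
  on any class of bodies.\<close>

definition limit_mass :: "'a set set => ennreal" where
 "limit_mass A = (NN u. indicator (tuples k) u * (indicator A (hull_Tk u) * ennreal (Dk k u / \<Sigma> (hull_Tk u))) \<partial>PhiN)"

lemma measurable_limit_mass:
 assumes "A : sets (borel_of CBT)"
 shows "(%u. indicator (tuples k) u * (indicator A (hull_Tk u) * ennreal (Dk k u / \<Sigma> (hull_Tk u)))) : borel_measurable PhiN"
proof(intro borel_measurable_times_ennreal)
 show "indicator (tuples k) : borel_measurable PhiN" using sets_tuples[OF k] by simp
 show "(%u. indicator A (hull_Tk u)) : borel_measurable PhiN"
  by(rule measurable_compose[OF measurable_hull_Tk borel_measurable_indicator[OF assms]])
 show "(%u. ennreal (Dk k u / \<Sigma> (hull_Tk u))) : borel_measurable PhiN"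
  by(intro measurable_compose[OF _ measurable_ennreal] borel_measurable_divide measurable_Dk
    measurable_compose[OF measurable_hull_Tk measurable_size])
qed

end

text \<open>\<open>A\<close> is a class of bodies that ignores position and scale, \<open>B\<close>
  a window of unit volume for incenters, and \<open>c0\<close> the constant that compares size with
  inradius.\<close>

locale face_limit = sized_process M X \<gamma> \<phi> k \<Sigma>
 for M :: "'w measure" and X :: "'w => 'a::euclidean_space set set" and \<gamma> :: real and \<phi> :: "'a measure" and k :: nat
  and \<Sigma> :: "'a set => real" +
 fixes A :: "'a set set" and B :: "'a set" and c0 :: real
 assumes A: "A : sets (borel_of CBT)"
  and A_similar: "!!P z s. P : unique_inball_polytopes k ==> 0 < s ==> affmap (z, s) P : A <-> P : A"
  and B: "B : sets borel" "emeasure lborel B = 1"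
  and c0: "0 < c0" "!!P z r. P : polytopes_dim k ==> inscribed_ball P z r ==> c0 * r <= \<Sigma> P"
begin

text \<open>Bounds the norm on \<open>Tk k u\<close>, hence the circumradius about the incenter; the
  sum of the vertex norms is plainly measurable.\<close>

definition circ :: "(nat => 'a) => real" where "circ u = (\<Sum>j\<in>{1..k+1}. norm (Tk_vertex k u j))"

definition face_weight :: "real => 'a set => ennreal" where
 "face_weight a K = indicator A K * indicator {K. \<Sigma> K < a} K * indicator B (incenter K)"

definition simplex_weight :: "real => (nat => 'a) \<times> 'a \<times> real => ennreal" where
 "simplex_weight a = (%(u, z, r). indicator A (hull_Tk u) * indicator {..<a} (r * \<Sigma> (hull_Tk u)) *
   indicator B z * indicator {0<..} r)"

text \<open>A majorant of the face weights for \<open>b = a / c0\<close>, which keeps only the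
  centre and the bound on the radius.\<close>

definition ball_weight :: "real => (nat => 'a) \<times> 'a \<times> real => ennreal" where
 "ball_weight b = (%(u, z, r). indicator B z * indicator {0<..<b} r)"

definition spread_weight :: "real => real => (nat => 'a) \<times> 'a \<times> real => ennreal" where
 "spread_weight R b = (%(u, z, r). indicator {R<..} (circ u) * (indicator B z * indicator {0<..<b} r))"

lemma measurable_coords:
 "fst : measurable (PhiN \<Otimes>\<^sub>M (borel :: ('a \<times> real) measure)) PhiN"
 "(%x. fst (snd x)) : borel_measurable (PhiN \<Otimes>\<^sub>M (borel :: ('a \<times> real) measure))"
 "(%x. snd (snd x)) : borel_measurable (PhiN \<Otimes>\<^sub>M (borel :: ('a \<times> real) measure))"
proof -
 show "fst : measurable (PhiN \<Otimes>\<^sub>M (borel :: ('a \<times> real) measure)) PhiN" by(rule measurable_fst)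
 have s: "snd : measurable (PhiN \<Otimes>\<^sub>M (borel :: ('a \<times> real) measure)) borel" by(rule measurable_snd)
 show "(%x. fst (snd x)) : borel_measurable (PhiN \<Otimes>\<^sub>M (borel :: ('a \<times> real) measure))"
  by(rule measurable_compose[OF s]) (simp add:borel_prod[symmetric])
 show "(%x. snd (snd x)) : borel_measurable (PhiN \<Otimes>\<^sub>M (borel :: ('a \<times> real) measure))"
  by(rule measurable_compose[OF s]) (simp add:borel_prod[symmetric])
qed

lemma measurable_circ: "circ : borel_measurable PhiN"
 unfolding circ_def[abs_def] by(intro borel_measurable_sum measurable_compose[OF measurable_Tk_vertex[OF k] borel_measurable_norm]) simp_all

lemma measurable_ball_weight: "ball_weight b : borel_measurable (PhiN \<Otimes>\<^sub>M borel)"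
 unfolding ball_weight_def case_prod_unfold
 by(intro borel_measurable_times_ennreal measurable_compose[OF measurable_coords(2) borel_measurable_indicator]
   measurable_compose[OF measurable_coords(3) borel_measurable_indicator] B) simp

lemma measurable_spread_weight: "spread_weight R b : borel_measurable (PhiN \<Otimes>\<^sub>M borel)"
 unfolding spread_weight_def case_prod_unfold
 by(intro borel_measurable_times_ennreal measurable_compose[OF measurable_coords(2) borel_measurable_indicator]
   measurable_compose[OF measurable_coords(3) borel_measurable_indicator] B
   measurable_compose[OF measurable_compose[OF measurable_coords(1) measurable_circ] borel_measurable_indicator]) simp_all

lemma measurable_simplex_weight: "simplex_weight a : borel_measurable (PhiN \<Otimes>\<^sub>M borel)"
proof -
 have h: "(%x. hull_Tk (fst x)) : measurable (PhiN \<Otimes>\<^sub>M (borel :: ('a \<times> real) measure)) (borel_of CBT)"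
  by(rule measurable_compose[OF measurable_coords(1) measurable_hull_Tk])
 have "(%x. snd (snd x) * \<Sigma> (hull_Tk (fst x))) : borel_measurable (PhiN \<Otimes>\<^sub>M (borel :: ('a \<times> real) measure))"
  by(intro borel_measurable_times measurable_coords(3) measurable_compose[OF h measurable_size])
 hence 1: "(%x. indicator {..<a} (snd (snd x) * \<Sigma> (hull_Tk (fst x))) :: ennreal) : borel_measurable (PhiN \<Otimes>\<^sub>M (borel :: ('a \<times> real) measure))"
  by(rule measurable_compose[OF _ borel_measurable_indicator]) simp
 have 2: "(%x. indicator A (hull_Tk (fst x)) :: ennreal) : borel_measurable (PhiN \<Otimes>\<^sub>M (borel :: ('a \<times> real) measure))"
  by(rule measurable_compose[OF h borel_measurable_indicator[OF A]])
 show ?thesis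
  unfolding simplex_weight_def case_prod_unfold
  by(intro borel_measurable_times_ennreal 1 2 measurable_compose[OF measurable_coords(2) borel_measurable_indicator]
   measurable_compose[OF measurable_coords(3) borel_measurable_indicator] B) simp
qed

lemma size_Tk:
 assumes u: "u : tuples k"
 shows "c0 <= \<Sigma> (Tk k u)"
proof -
 interpret face_data k u by(rule face_dataI[OF k u])
 have "inball (Tk k u) 0 1" unfolding Tk_eq_simp by(simp add:inball_simp)
 hence "inscribed_ball (Tk k u) 0 1" by(simp add:inball_def)
 from c0(2)[OF unique_inball_subset[OF Tk_unique_inball[OF u]] this] show ?thesis by simp
qed

lemma Tk_at_affmap: fixes u :: "nat => 'a" shows "0 < r ==> Tk_at k u z r = affmap (- ((1 / r) *R z), r) (Tk k u)"
 by(auto simp:Tk_at_def affmap_def scaleR_add_right image_iff add.commute)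

lemma tuple_fun_simplex_weight:
 assumes p: "p : tangent_tuples k"
 shows "tuple_fun (simplex_weight a) p = face_weight a (Tk_of k p)"
proof -
 obtain z r where zr: "solve k p = (z, r)" by fastforce
 have u: "normals p : tuples k" and r: "0 < r" using p zr by(auto simp:tangent_tuples_def)
 interpret face_data k "normals p" by(rule face_dataI[OF k u])
 let ?T = "Tk k (normals p)"
 have T: "?T : unique_inball_polytopes k" by(rule Tk_unique_inball[OF u])
 have Tc: "?T : convex_bodies" by(rule polytopes_dim_subset[OF unique_inball_subset[OF T]])
 have Tof: "Tk_of k p = affmap (- ((1 / r) *R z), r) ?T" using r by(simp add:Tk_of_def zr Tk_at_affmap)
 have "Tk_of k p : A <-> ?T : A" unfolding Tof by(rule A_similar[OF T r])
 moreover have "\<Sigma> (Tk_of k p) = r * \<Sigma> ?T"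
  unfolding Tof using r by(intro size_functional_affmap[OF size size_translation Tc]) simp
 moreover have "incenter (Tk_of k p) = z" using incenter_simp[OF r, of z] by(simp add:Tk_of_def zr)
 ultimately show ?thesis
  using u r by(simp add:tuple_fun_def face_weight_def simplex_weight_def zr hull_Tk_eq indicator_def)
qed

lemma tuple_fun_simplex_weight_0:
 assumes "p ~: tangent_tuples k"
 shows "tuple_fun (simplex_weight a) p = 0"
 using assms by(cases "solve k p") (auto simp:tuple_fun_def simplex_weight_def tangent_tuples_def indicator_def)

lemma Tk_of_unique_inball:
 fixes p :: "nat => 'a \<times> real"
 assumes p: "p : tangent_tuples k"
 shows "Tk_of k p : unique_inball_polytopes k" "inscribed_ball (Tk_of k p) (fst (solve k p)) (snd (solve k p))"
  "incenter (Tk_of k p) = fst (solve k p)"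
proof -
 have u: "normals p : tuples k" and r: "0 < snd (solve k p)" using p by(auto simp:tangent_tuples_def)
 interpret face_data k "normals p" by(rule face_dataI[OF k u])
 show "Tk_of k p : unique_inball_polytopes k" "incenter (Tk_of k p) = fst (solve k p)"
  using r by(simp_all add:Tk_of_def simp_unique_inball incenter_simp)
 have "inball (Tk_of k p) (fst (solve k p)) (snd (solve k p))" using r by(simp add:Tk_of_def inball_simp)
 thus "inscribed_ball (Tk_of k p) (fst (solve k p)) (snd (solve k p))" by(simp add:inball_def)
qed

text \<open>Size below \<open>a\<close> forces the inradius below \<open>a / c0\<close>.\<close>

lemma face_weight_le_ball_weight:
 assumes p: "p : tangent_tuples k"
 shows "face_weight a (Tk_of k p) <= tuple_fun (ball_weight (a / c0)) p"
proof(cases "face_weight a (Tk_of k p) = 0")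
 case False
 obtain z r where zr: "solve k p = (z, r)" by fastforce
 have u: "normals p : tuples k" and r: "0 < r" using p zr by(auto simp:tangent_tuples_def)
 have lt: "\<Sigma> (Tk_of k p) < a" and "z : B"
  using False Tk_of_unique_inball(3)[OF p] by(auto simp:face_weight_def zr indicator_def split:if_splits)
 have "c0 * r <= \<Sigma> (Tk_of k p)"
  using c0(2)[OF unique_inball_subset[OF Tk_of_unique_inball(1)[OF p]] Tk_of_unique_inball(2)[OF p]] by(simp add:zr)
 hence "r < a / c0" using lt c0(1) by(simp add:field_simps)
 hence "tuple_fun (ball_weight (a / c0)) p = 1"
  using u r \<open>z \<in> B\<close> by(simp add:tuple_fun_def ball_weight_def zr)
 thus ?thesis by(simp add:face_weight_def indicator_def)
qed simp

section \<open>Comparison of faces with tuples\<close>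

definition hit_tuples :: "'a set set => (nat => 'a \<times> real) set" where
 "hit_tuples \<eta> = {p : tup II('a) \<eta>. p : tangent_tuples k & ~ no_hit \<eta> p (Tk_of k p)}"

definition hit_sum :: "'w => real => ennreal" where
 "hit_sum w b = (NN p. tuple_fun (ball_weight b) p * indicator (hit_tuples (X w)) p \<partial>count_space UNIV)"

definition face_sum :: "'w => real => ennreal" where
 "face_sum w a = (NN K. face_weight a K \<partial>count_space (tessellation_faces k (X w) Int unique_inball_polytopes k))"

definition num_relabelings :: nat where "num_relabelings = card (relabelings k TYPE('a))"

lemma num_relabelings_pos: "0 < num_relabelings"
 using finite_relabelings relabelings_nonempty by(auto simp:num_relabelings_def card_gt_0_iff)

lemma simplex_sum_eq:
 "(NN p. face_weight a (Tk_of k p) * indicator (simplex_tuples k \<eta>) p \<partial>count_space UNIV) =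
  of_nat num_relabelings * (NN K. face_weight a K * indicator (Tk_of k ` simplex_tuples k \<eta>) K \<partial>count_space UNIV)"
proof(rule nn_integral_count_fibers)
 fix p :: "nat => 'a \<times> real" assume p: "p : simplex_tuples k \<eta>"
 note b = simplex_tuples_fiber[OF k p]
 show "finite {q : simplex_tuples k \<eta>. Tk_of k q = Tk_of k p} &
  card {q : simplex_tuples k \<eta>. Tk_of k q = Tk_of k p} = num_relabelings"
  using bij_betw_finite[OF b] bij_betw_same_card[OF b] finite_relabelings[of k, where 'a = 'a] by(simp add:num_relabelings_def)
qed

lemma simplex_tuples_faces:
 fixes \<eta> :: "'a set set"
 assumes \<eta>: "\<eta> : configurations"
 shows "Tk_of k ` simplex_tuples k \<eta> <= tessellation_faces k \<eta> Int unique_inball_polytopes k"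
proof
 fix K assume "K : Tk_of k ` simplex_tuples k \<eta>"
 then obtain p where p: "p : simplex_tuples k \<eta>" "K = Tk_of k p" by blast
 hence t: "p : tangent_tuples k" by(simp add:simplex_tuples_def)
 have "K : tessellation_faces k \<eta>"
  unfolding p(2) Tk_of_def
  by(rule simplex_is_face[OF k \<eta> _ tangent_tuplesD[OF k t]]) (use p(1) in \<open>auto simp: simplex_tuples_def Tk_of_def\<close>)
 thus "K : tessellation_faces k \<eta> Int unique_inball_polytopes k" using Tk_of_unique_inball(1)[OF t] p(2) by blast
qed

lemma face_sum_indicator:
 "face_sum w a = (NN K. face_weight a K * indicator (tessellation_faces k (X w) Int unique_inball_polytopes k) K \<partial>count_space UNIV)"
 unfolding face_sum_def by(rule nn_integral_count_space_indicator) simp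

text \<open>A tangent tuple either describes a simplex face or is hit by a further hyperplane. The
  former occur \<open>num_relabelings\<close> times per face, the latter are absorbed by
  \<open>hit_sum\<close>.\<close>

lemma tuple_sum_le:
 assumes w: "w : space M"
 shows "tuple_sum II('a) w (tuple_fun (simplex_weight a)) <= of_nat num_relabelings * face_sum w a + hit_sum w (a / c0)"
proof -
 let ?\<eta> = "X w"
 have "tuple_sum II('a) w (tuple_fun (simplex_weight a)) <=
  (NN p. face_weight a (Tk_of k p) * indicator (simplex_tuples k ?\<eta>) p +
   tuple_fun (ball_weight (a / c0)) p * indicator (hit_tuples ?\<eta>) p \<partial>count_space UNIV)"
  unfolding tuple_sum_def
 proof(rule nn_integral_mono)
  fix p :: "nat => 'a \<times> real"
  show "tuple_fun (simplex_weight a) p * indicator (tup II('a) ?\<eta>) p <=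
   face_weight a (Tk_of k p) * indicator (simplex_tuples k ?\<eta>) p + tuple_fun (ball_weight (a / c0)) p * indicator (hit_tuples ?\<eta>) p"
  proof(cases "p : tup II('a) ?\<eta> & p : tangent_tuples k")
   case False
   thus ?thesis using tuple_fun_simplex_weight_0[of p a] by(auto simp:indicator_def)
  next
   case True
   hence "p : simplex_tuples k ?\<eta> | p : hit_tuples ?\<eta>" unfolding simplex_tuples_def hit_tuples_def by blast
   thus ?thesis
   proof
    assume "p : simplex_tuples k ?\<eta>"
    thus ?thesis using True tuple_fun_simplex_weight[of p a] by simp
   next
    assume "p : hit_tuples ?\<eta>"
    hence "tuple_fun (simplex_weight a) p * indicator (tup II('a) ?\<eta>) p <= tuple_fun (ball_weight (a / c0)) p * indicator (hit_tuples ?\<eta>) p"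
     using True tuple_fun_simplex_weight[of p a] face_weight_le_ball_weight[of p a] by simp
    thus ?thesis by(rule order_trans) simp
   qed
  qed
 qed
 also have "... = (NN p. face_weight a (Tk_of k p) * indicator (simplex_tuples k ?\<eta>) p \<partial>count_space UNIV) + hit_sum w (a / c0)"
  unfolding hit_sum_def by(rule nn_integral_add) simp_all
 also have "(NN p. face_weight a (Tk_of k p) * indicator (simplex_tuples k ?\<eta>) p \<partial>count_space UNIV) <= of_nat num_relabelings * face_sum w a"
  unfolding simplex_sum_eq face_sum_indicator
 proof(intro mult_left_mono nn_integral_mono)
  fix K
  show "indicator (Tk_of k ` simplex_tuples k ?\<eta>) K <= (indicator (tessellation_faces k ?\<eta> Int unique_inball_polytopes k) K :: ennreal)"
   using simplex_tuples_faces[OF configuration[OF w]] by(auto simp:indicator_def)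
 qed simp_all
 finally show ?thesis by(simp add:add_right_mono)
qed

text \<open>The inscribed ball lies in the face itself. It is what bounds the radius of the tuple by
  the size of the face when the face is not the simplex.\<close>

lemma face_tuple:
 assumes om: "om : space M" and gen: "generic (X om)"
  and K: "K : tessellation_faces k (X om) Int unique_inball_polytopes k"
 shows "EX p:tup II('a) (X om). p : tangent_tuples k & fst (solve k p) = incenter K &
  inscribed_ball K (incenter K) (snd (solve k p)) & (no_hit (X om) p (Tk_of k p) --> K = Tk_of k p)"
proof -
 obtain p r where p: "p : tup II('a) (X om)" "tangent k p (incenter K) r"
  "cball (incenter K) r Int (%w. incenter K + w) ` Lsub k (normals p) <= K"
  "no_hit (X om) p (Tk_at k (normals p) (incenter K) r) ==> K = Tk_at k (normals p) (incenter K) r"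
  by(rule face_has_tangent_tuple[OF k configuration[OF om] gen]) (use K in auto)
 have s: "normals p : tuples k" "0 < r" "solve k p = (incenter K, r)" using p(2) tangent_iff[OF k] by blast+
 interpret face_data k "normals p" by(rule face_dataI[OF k s(1)])
 obtain f where f: "f : frames k" "span (f ` {1..k}) = Lsub k (normals p)"
  by(rule subspace_frame[OF subspace_Lsub dim_L])
 have "kball k (incenter K) f r <= K"
 proof
  fix x assume "x : kball k (incenter K) f r"
  then obtain b where b: "x = incenter K + (\<Sum>i=1..k. b i *R f i)" "(\<Sum>i=1..k. (b i)\<^sup>2) <= r\<^sup>2"
   by(auto simp:kball_def)
  have "(\<Sum>i=1..k. b i *R f i) : span (f ` {1..k})"
  proof(rule span_sum)
   fix i assume i: "i : {1..k}"
   show "b i *R f i : span (f ` {1..k})" by(rule span_scale[OF span_base[OF imageI[OF i]]])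
  qed
  moreover have "norm (\<Sum>i=1..k. b i *R f i) <= r"
  proof(rule power2_le_imp_le)
   show "(norm (\<Sum>i=1..k. b i *R f i))\<^sup>2 <= r\<^sup>2" unfolding frame_norm[OF f(1)] by(rule b(2))
   show "0 <= r" using s(2) by(rule less_imp_le)
  qed
  ultimately have "x : cball (incenter K) r Int (%w. incenter K + w) ` Lsub k (normals p)"
   unfolding f(2) b(1) by(auto simp:dist_norm)
  thus "x : K" using p(3) by blast
 qed
 hence "inscribed_ball K (incenter K) r"
  using inscribed_ball_iff_kball[of K k "incenter K" r] unique_inball_subset K s(2) f(1) by blast
 moreover have "p : tangent_tuples k" using s by(simp add:tangent_tuples_def)
 ultimately show ?thesis using p(1,4) s(3) by(intro bexI[of _ p]) (auto simp:Tk_of_def)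
qed

text \<open>A face that is not the simplex of its tangent tuple has a hit tuple. Different faces
  have different incenters, hence different tuples, so the exceptional faces are no more numerous
  than the hit tuples.\<close>

lemma face_sum_le:
 assumes om: "om : space M" and gen: "generic (X om)"
 shows "face_sum om a <= ennreal (1 / num_relabelings) * tuple_sum II('a) om (tuple_fun (simplex_weight a)) + hit_sum om (a / c0)"
proof -
 let ?\<eta> = "X om" and ?c = "ennreal (1 / num_relabelings)"
 let ?FU = "tessellation_faces k ?\<eta> Int unique_inball_polytopes k"
 let ?S = "Tk_of k ` simplex_tuples k ?\<eta>"
 let ?e = "%p. tuple_fun (ball_weight (a / c0)) p * indicator (hit_tuples ?\<eta>) p"
 note \<eta> = configuration[OF om]
 \<comment> \<open>The exceptional faces that count; being a product of indicators, their weight is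
   1.\<close>
 define D where "D = {K : ?FU - ?S. face_weight a K ~= 0}"
 obtain w where w: "!!K. K : ?FU ==> w K : tup II('a) ?\<eta> & w K : tangent_tuples k &
  fst (solve k (w K)) = incenter K & inscribed_ball K (incenter K) (snd (solve k (w K))) &
  (no_hit ?\<eta> (w K) (Tk_of k (w K)) --> K = Tk_of k (w K))"
  using face_tuple[OF om gen] by metis
 have e1: "?e (w K) = 1" if K: "K : D" for K
 proof -
  have KF: "K : ?FU" "K ~: ?S" using K by(auto simp:D_def)
  note wK = w[OF KF(1)]
  have "w K : hit_tuples ?\<eta>" using wK KF(2) unfolding hit_tuples_def simplex_tuples_def by blast
  moreover have "\<Sigma> K < a" "incenter K : B" using K by(auto simp:D_def face_weight_def indicator_def split:if_splits)
  moreover have "c0 * snd (solve k (w K)) <= \<Sigma> K" using wK KF(1) unique_inball_subset by(intro c0(2)) auto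
  moreover have "normals (w K) : tuples k" "0 < snd (solve k (w K))" using wK by(auto simp:tangent_tuples_def)
  moreover have "snd (solve k (w K)) < a / c0" using calculation c0(1) by(simp add:field_simps)
  ultimately show ?thesis using wK by(cases "solve k (w K)") (simp add:tuple_fun_def ball_weight_def)
 qed
 have inj: "inj_on w D"
 proof(rule inj_onI)
  fix K K' assume K: "K : D" "K' : D" "w K = w K'"
  have KF: "K : ?FU" "K' : ?FU" using K by(auto simp:D_def)
  hence "incenter K = incenter K'" using w K(3) by metis
  thus "K = K'" using incenter_inj_on_faces[OF \<eta>] KF by(meson inj_onD)
 qed
 have "face_sum om a <= (NN K. face_weight a K * indicator ?S K + indicator D K \<partial>count_space UNIV)"
  unfolding face_sum_indicator
 proof(rule nn_integral_mono)
  fix K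
  show "face_weight a K * indicator ?FU K <= face_weight a K * indicator ?S K + indicator D K"
   by(cases "K : ?S"; cases "K : ?FU"; cases "face_weight a K = 0")
    (auto simp:D_def face_weight_def indicator_def split:if_splits)
 qed
 also have "... = (NN K. face_weight a K * indicator ?S K \<partial>count_space UNIV) + (NN K. indicator D K \<partial>count_space UNIV)"
  by(rule nn_integral_add) simp_all
 also have "(NN K. indicator D K \<partial>count_space UNIV) <= hit_sum om (a / c0)"
 proof -
  have "(NN K. indicator D K \<partial>count_space UNIV) = (NN K. ?e (w K) * indicator D K \<partial>count_space UNIV)"
   using e1 by(intro nn_integral_cong) (auto simp:indicator_def)
  also have "... = (NN K. ?e (w K) \<partial>count_space D)" by(rule nn_integral_count_space_indicator[symmetric]) simp
  also have "... = (NN p. ?e p \<partial>count_space (w ` D))"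
   by(rule nn_integral_bij_count_space) (rule inj_on_imp_bij_betw[OF inj])
  also have "... = (NN p. ?e p * indicator (w ` D) p \<partial>count_space UNIV)" by(rule nn_integral_count_space_indicator) simp
  also have "... <= hit_sum om (a / c0)"
   unfolding hit_sum_def by(intro nn_integral_mono) (simp add:indicator_def)
  finally show ?thesis .
 qed
 also have "(NN K. face_weight a K * indicator ?S K \<partial>count_space UNIV) <= ?c * tuple_sum II('a) om (tuple_fun (simplex_weight a))"
 proof -
  have c: "?c * of_nat num_relabelings = 1"
   using num_relabelings_pos by(simp add:ennreal_of_nat_eq_real_of_nat ennreal_mult[symmetric])
  have "(NN K. face_weight a K * indicator ?S K \<partial>count_space UNIV) = ?c * (of_nat num_relabelings * (NN K. face_weight a K * indicator ?S K \<partial>count_space UNIV))"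
   unfolding mult.assoc[symmetric] c by simp
  also have "... = ?c * (NN p. face_weight a (Tk_of k p) * indicator (simplex_tuples k ?\<eta>) p \<partial>count_space UNIV)"
   unfolding simplex_sum_eq ..
  also have "... <= ?c * tuple_sum II('a) om (tuple_fun (simplex_weight a))"
   unfolding tuple_sum_def
  proof(intro mult_left_mono nn_integral_mono)
   fix p :: "nat => 'a \<times> real"
   show "face_weight a (Tk_of k p) * indicator (simplex_tuples k ?\<eta>) p <= tuple_fun (simplex_weight a) p * indicator (tup II('a) ?\<eta>) p"
    using tuple_fun_simplex_weight[of p a] by(simp add:indicator_def simplex_tuples_def)
  qed simp
  finally show ?thesis .
 qed
 finally show ?thesis by(simp add:add_left_mono add_right_mono)
qed

end

context face_limit
begin

text \<open>Entry 0 is the hitting hyperplane. With circumradius at most \<open>R\<close> and radius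
  below \<open>b\<close>, its distance from the centre is at most \<open>b * R\<close>.\<close>

definition outlier_weight :: "real => real => (nat => 'a \<times> real) => ennreal" where
 "outlier_weight R b q = tuple_fun (ball_weight b) (restrict q II('a)) *
   indicator {x. \<bar>snd x - inner (fst (solve k (restrict q II('a)))) (fst x)\<bar> <= b * R} (q 0)"

lemma norm_Tk_le_circ:
 assumes u: "u : tuples k" and x: "x : Tk k u"
 shows "norm x <= circ u"
proof -
 interpret face_data k u by(rule face_dataI[OF k u])
 have "Tk_vertex k u ` {1..k+1} <= cball 0 (circ u)"
 proof
  fix y assume "y : Tk_vertex k u ` {1..k+1}"
  then obtain j where j: "j : {1..k+1}" "y = Tk_vertex k u j" by blast
  have "norm (Tk_vertex k u j) <= (\<Sum>j\<in>{1..k+1}. norm (Tk_vertex k u j))"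
   by(rule member_le_sum[OF j(1)]) simp_all
  thus "y : cball 0 (circ u)" using j(2) by(simp add:circ_def)
 qed
 hence "convex hull (Tk_vertex k u ` {1..k+1}) <= cball 0 (circ u)" by(rule hull_minimal) (rule convex_cball)
 thus ?thesis using x unfolding Tk_eq_convex_hull by auto
qed

lemma hit_extra_hyperplane:
 assumes w: "w : space M" and p: "p : hit_tuples (X w)" and R: "circ (normals p) <= R"
  and b: "tuple_fun (ball_weight b) p ~= 0"
 shows "EX x. p(0 := x) : tup (insert 0 II('a)) (X w) & restrict (p(0 := x)) II('a) = p &
  \<bar>snd x - inner (fst (solve k p)) (fst x)\<bar> <= b * R"
proof -
 let ?I = "II('a)"
 obtain z r where zr: "solve k p = (z, r)" by fastforce
 have pt: "p : tup ?I (X w)" "p : tangent_tuples k" "~ no_hit (X w) p (Tk_of k p)"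
  using p by(auto simp:hit_tuples_def)
 have u: "normals p : tuples k" and r: "0 < r" using pt(2) zr by(auto simp:tangent_tuples_def)
 have rb: "r < b" using b by(auto simp:tuple_fun_def ball_weight_def zr indicator_def split:if_splits)
 obtain H y where H: "H : X w" "H ~: (%i. hyp (p i)) ` ?I" "y : H" "y : Tk_of k p"
  using pt(3) unfolding no_hit_def by blast
 obtain x where x: "x : params" "H = hyp x"
  using configurations_rep[OF configuration[OF w] H(1)] by metis
 obtain t where t: "t : Tk k (normals p)" "y = z + r *R t" using H(4) by(auto simp:Tk_of_def zr Tk_at_def)
 have nx: "norm (fst x) = 1" using x(1) by(auto simp:params_def)
 have "snd x - inner z (fst x) = inner (y - z) (fst x)" using H(3) x(2) by(simp add:mem_hyp inner_diff_left)
 also have "... = r * inner t (fst x)" by(simp add:t(2))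
 finally have "\<bar>snd x - inner z (fst x)\<bar> = r * \<bar>inner t (fst x)\<bar>" using r by(simp add:abs_mult)
 also have "... <= r * (norm t * norm (fst x))" using r by(intro mult_left_mono Cauchy_Schwarz_ineq2) simp
 also have "... <= b * R" using rb r norm_Tk_le_circ[OF u t(1)] R nx by(simp add:mult_mono)
 finally have le: "\<bar>snd x - inner (fst (solve k p)) (fst x)\<bar> <= b * R" by(simp add:zr)
 have pe: "p : extensional ?I" using pt(1) by(auto simp:tup_def PiE_def)
 have rest: "restrict (p(0 := x)) ?I = p"
 proof
  fix i show "restrict (p(0 := x)) ?I i = p i"
   using pe by(cases "i : ?I") (auto simp:extensional_def)
 qed
 have pI: "!!i. i : ?I ==> p i : params" "!!i. i : ?I ==> hyp (p i) : X w" "inj_on (%i. hyp (p i)) ?I"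
  using pt(1) by(auto simp:tup_def)
 have z0: "0 ~: ?I" by simp
 have eqI: "(p(0 := x)) i = p i" if "i : ?I" for i using that by(intro fun_upd_other) auto
 have "p(0 := x) : tup (insert 0 ?I) (X w)"
  unfolding tup_def mem_Collect_eq
 proof(intro conjI)
  show "p(0 := x) : insert 0 ?I \<rightarrow>\<^sub>E params"
   using pI(1) x(1) pe by(intro PiE_I) (auto simp:extensional_def)
  show "ALL i:insert 0 ?I. hyp ((p(0 := x)) i) : X w" using pI(2) H(1) x(2) by simp
  have "inj_on (%i. hyp ((p(0 := x)) i)) ?I" using pI(3) by(rule inj_on_cong[THEN iffD2, rotated]) (simp add:eqI)
  moreover have "(%i. hyp ((p(0 := x)) i)) ` ?I = (%i. hyp (p i)) ` ?I" by(rule image_cong) (simp_all add:eqI)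
  ultimately show "inj_on (%i. hyp ((p(0 := x)) i)) (insert 0 ?I)"
   using H(2) x(2) z0 unfolding inj_on_insert by simp
 qed
 thus ?thesis using rest le by blast
qed

text \<open>Tuples with circumradius above \<open>R\<close> go into the first sum. To the others a
  hitting hyperplane is added as entry 0; restriction recovers the tuple, so the extension is
  injective.\<close>

lemma hit_sum_le:
 assumes om: "om : space M"
 shows "hit_sum om b <= tuple_sum II('a) om (tuple_fun (spread_weight R b)) +
  tuple_sum (insert 0 II('a)) om (outlier_weight R b)"
proof -
 let ?I = "II('a)" and ?\<eta> = "X om"
 define D where "D = {p : hit_tuples ?\<eta>. circ (normals p) <= R & tuple_fun (ball_weight b) p ~= 0}"
 have "ALL p:D. EX x. p(0 := x) : tup (insert 0 ?I) ?\<eta> & restrict (p(0 := x)) ?I = p &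
  \<bar>snd x - inner (fst (solve k p)) (fst x)\<bar> <= b * R"
  using hit_extra_hyperplane[OF om] by(auto simp:D_def)
 then obtain w where w: "!!p. p : D ==> p(0 := w p) : tup (insert 0 ?I) ?\<eta> & restrict (p(0 := w p)) ?I = p &
  \<bar>snd (w p) - inner (fst (solve k p)) (fst (w p))\<bar> <= b * R" by metis
 let ?q = "%p. p(0 := w p)"
 have inj: "inj_on ?q D" using w by(metis (mono_tags, lifting) inj_onI)
 have "hit_sum om b <= (NN p. tuple_fun (spread_weight R b) p * indicator (tup ?I ?\<eta>) p +
  tuple_fun (ball_weight b) p * indicator D p \<partial>count_space UNIV)"
  unfolding hit_sum_def
 proof(rule nn_integral_mono)
  fix p :: "nat => 'a \<times> real"
  show "tuple_fun (ball_weight b) p * indicator (hit_tuples ?\<eta>) p <=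
   tuple_fun (spread_weight R b) p * indicator (tup ?I ?\<eta>) p + tuple_fun (ball_weight b) p * indicator D p"
  proof(cases "p : hit_tuples ?\<eta> & tuple_fun (ball_weight b) p ~= 0")
   case False
   hence 0: "tuple_fun (ball_weight b) p * indicator (hit_tuples ?\<eta>) p = 0" by auto
   show ?thesis unfolding 0 by(rule zero_le)
  next
   case True
   show ?thesis
   proof(cases "circ (normals p) <= R")
    case c: True
    hence "p : D" using True by(simp add:D_def)
    thus ?thesis using True by simp
   next
    case False
    have "tuple_fun (spread_weight R b) p = tuple_fun (ball_weight b) p"
     using False by(cases "solve k p") (simp add:tuple_fun_def spread_weight_def ball_weight_def)
    thus ?thesis using True by(simp add:hit_tuples_def)
   qed
  qed
 qed
 also have "... = tuple_sum ?I om (tuple_fun (spread_weight R b)) + (NN p. tuple_fun (ball_weight b) p * indicator D p \<partial>count_space UNIV)"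
  unfolding tuple_sum_def by(rule nn_integral_add) simp_all
 also have "(NN p. tuple_fun (ball_weight b) p * indicator D p \<partial>count_space UNIV) <= tuple_sum (insert 0 ?I) om (outlier_weight R b)"
 proof -
  have qw: "outlier_weight R b (?q p) = tuple_fun (ball_weight b) p" if p: "p : D" for p
   using w[OF p] by(simp add:outlier_weight_def)
  have "(NN p. tuple_fun (ball_weight b) p * indicator D p \<partial>count_space UNIV) =
   (NN p. tuple_fun (ball_weight b) p \<partial>count_space D)" by(rule nn_integral_count_space_indicator[symmetric]) simp
  also have "... = (NN p. outlier_weight R b (?q p) \<partial>count_space D)"
   by(rule nn_integral_cong) (simp add:qw)
  also have "... = (NN q. outlier_weight R b q \<partial>count_space (?q ` D))"
   by(rule nn_integral_bij_count_space) (rule inj_on_imp_bij_betw[OF inj])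
  also have "... = (NN q. outlier_weight R b q * indicator (?q ` D) q \<partial>count_space UNIV)"
   by(rule nn_integral_count_space_indicator) simp
  also have "... <= tuple_sum (insert 0 ?I) om (outlier_weight R b)"
   unfolding tuple_sum_def
  proof(intro nn_integral_mono mult_left_mono)
   fix q show "indicator (?q ` D) q <= (indicator (tup (insert 0 ?I) ?\<eta>) q :: ennreal)"
    using w by(auto simp:indicator_def)
  qed simp
  finally show ?thesis .
 qed
 finally show ?thesis by(simp add:add_left_mono)
qed

section \<open>Means of the weights and the asymptotic formula\<close>

definition total_D :: ennreal where
 "total_D = (NN u. indicator (tuples k) u * ennreal (Dk k u) \<partial>PhiN)"

definition spread_D :: "real => ennreal" where
 "spread_D R = (NN u. indicator (tuples k) u * (ennreal (Dk k u) * indicator {R<..} (circ u)) \<partial>PhiN)"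

lemma measurable_indicator_tuples: "indicator (tuples k) : borel_measurable PhiN"
 using sets_tuples[OF k] by simp

lemma measurable_ennreal_Dk: "(%u. ennreal (Dk k u)) : borel_measurable PhiN"
 by(rule measurable_compose[OF measurable_Dk measurable_ennreal])

lemma nn_integral_B: "(NN z. c * indicator B z \<partial>lborel) = (c :: ennreal)"
 using B by(simp add:nn_integral_cmult)

text \<open>For fixed normals, homogeneity turns the bound on the size into
  \<open>0 < r < a / \<Sigma> (hull_Tk u)\<close>, and the centre contributes the unit volume of
  \<open>B\<close>.\<close>

lemma mean_simplex_weight:
 assumes a: "0 < a"
 shows "(NN w. tuple_sum II('a) w (tuple_fun (simplex_weight a)) \<partial>M) =
  ennreal (2 * \<gamma>) ^ (DIM('a) + 1) * (ennreal a * limit_mass A)"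
proof -
 have "(NN u. indicator (tuples k) u * (ennreal (Dk k u) * (NN z. (NN r. simplex_weight a (u, z, r) \<partial>lborel) \<partial>lborel)) \<partial>PhiN) =
  (NN u. ennreal a * (indicator (tuples k) u * (indicator A (hull_Tk u) * ennreal (Dk k u / \<Sigma> (hull_Tk u)))) \<partial>PhiN)"
 proof(rule nn_integral_cong)
  fix u :: "nat => 'a"
  show "indicator (tuples k) u * (ennreal (Dk k u) * (NN z. (NN r. simplex_weight a (u, z, r) \<partial>lborel) \<partial>lborel)) =
   ennreal a * (indicator (tuples k) u * (indicator A (hull_Tk u) * ennreal (Dk k u / \<Sigma> (hull_Tk u))))"
  proof(cases "u : tuples k")
   case True
   interpret face_data k u by(rule face_dataI[OF k True])
   let ?s = "\<Sigma> (hull_Tk u)"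
   have s: "0 < ?s" using size_Tk[OF True] c0(1) by(simp add:hull_Tk_eq[OF True])
   have "(NN r. simplex_weight a (u, z, r) \<partial>lborel) = indicator A (hull_Tk u) * ennreal (a / ?s) * indicator B z" for z
   proof -
    have "(NN r. simplex_weight a (u, z, r) \<partial>lborel) = (NN r. (indicator A (hull_Tk u) * indicator B z) * indicator {0<..<a / ?s} r \<partial>lborel)"
    proof(rule nn_integral_cong)
     fix r :: real
     have "(indicator {..<a} (r * ?s) * indicator {0<..} r :: ennreal) = indicator {0<..<a / ?s} r"
      using s by(auto simp:indicator_def field_simps)
     thus "simplex_weight a (u, z, r) = (indicator A (hull_Tk u) * indicator B z) * indicator {0<..<a / ?s} r"
      unfolding simplex_weight_def by(simp add:mult.assoc mult.left_commute)
    qed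
    also have "... = (indicator A (hull_Tk u) * indicator B z) * ennreal (a / ?s)"
     using a s by(subst nn_integral_cmult) simp_all
    finally show ?thesis by(simp only:mult.assoc mult.commute[of "indicator B z"])
   qed
   hence "(NN z. (NN r. simplex_weight a (u, z, r) \<partial>lborel) \<partial>lborel) = indicator A (hull_Tk u) * ennreal (a / ?s)"
    by(simp only:nn_integral_B)
   moreover have "ennreal (Dk k u) * ennreal (a / ?s) = ennreal a * ennreal (Dk k u / ?s)"
    using s a Dk_pos by(simp add:ennreal_mult[symmetric] mult.commute)
   ultimately show ?thesis using True by(cases "hull_Tk u : A") simp_all
  qed simp
 qed
 also have "... = ennreal a * limit_mass A"
  unfolding limit_mass_def
 by(rule nn_integral_cmult[OF measurable_limit_mass[OF A]])
 finally show ?thesis unfolding mean_tuple_sum(2)[OF measurable_simplex_weight] by(simp only:)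
qed

lemma nn_integral_ball:
 assumes b: "0 < b"
 shows "(NN z. (NN r. c * (indicator B z * indicator {0<..<b} r) \<partial>lborel) \<partial>lborel) = c * ennreal b"
proof -
 have "(NN r. c * (indicator B z * indicator {0<..<b} r) \<partial>lborel) = c * ennreal b * indicator B z" for z
 proof -
  have "(NN r. c * (indicator B z * indicator {0<..<b} r) \<partial>lborel) = (NN r. (c * indicator B z) * indicator {0<..<b} r \<partial>lborel)"
   by(simp only:mult.assoc)
  also have "... = (c * indicator B z) * ennreal b" using b by(subst nn_integral_cmult) simp_all
  finally show ?thesis by(simp only:mult.assoc mult.commute[of "indicator B z"])
 qed
 thus ?thesis by(simp only:nn_integral_B)
qed

lemma mean_ball_weight:
 assumes b: "0 < b"
 shows "(NN p. tuple_fun (ball_weight b) p \<partial>EI II('a)) = ennreal b * total_D"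
proof -
 have "(NN z. (NN r. ball_weight b (u, z, r) \<partial>lborel) \<partial>lborel) = ennreal b" for u :: "nat => 'a"
  using nn_integral_ball[OF b, of 1] by(simp add:ball_weight_def)
 hence "(NN p. tuple_fun (ball_weight b) p \<partial>EI II('a)) =
  (NN u. ennreal b * (indicator (tuples k) u * ennreal (Dk k u)) \<partial>PhiN)"
  unfolding nn_integral_tuple_fun[OF measurable_ball_weight] by(simp add:mult.commute mult.left_commute)
 also have "... = ennreal b * total_D"
  unfolding total_D_def
  by(intro nn_integral_cmult borel_measurable_times_ennreal measurable_indicator_tuples measurable_ennreal_Dk)
 finally show ?thesis .
qed

lemma mean_spread_weight:
 assumes b: "0 < b"
 shows "(NN w. tuple_sum II('a) w (tuple_fun (spread_weight R b)) \<partial>M) =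
  ennreal (2 * \<gamma>) ^ (DIM('a) + 1) * (ennreal b * spread_D R)"
proof -
 have "(NN z. (NN r. spread_weight R b (u, z, r) \<partial>lborel) \<partial>lborel) = indicator {R<..} (circ u) * ennreal b" for u :: "nat => 'a"
  using nn_integral_ball[OF b, of "indicator {R<..} (circ u)"] by(simp add:spread_weight_def)
 hence "(NN u. indicator (tuples k) u * (ennreal (Dk k u) * (NN z. (NN r. spread_weight R b (u, z, r) \<partial>lborel) \<partial>lborel)) \<partial>PhiN) =
  (NN u. ennreal b * (indicator (tuples k) u * (ennreal (Dk k u) * indicator {R<..} (circ u))) \<partial>PhiN)"
  by(simp add:mult.commute mult.left_commute)
 also have "... = ennreal b * spread_D R"
  unfolding spread_D_def
  by(intro nn_integral_cmult borel_measurable_times_ennreal measurable_indicator_tuples measurable_ennreal_Dk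
    measurable_compose[OF measurable_circ borel_measurable_indicator]) simp
 finally show ?thesis unfolding mean_tuple_sum(2)[OF measurable_spread_weight] by(simp only:)
qed

lemma mean_outlier_weight:
 assumes b: "0 < b" and R: "0 <= R"
 shows "(%w. tuple_sum (insert 0 II('a)) w (outlier_weight R b)) : borel_measurable M"
  and "(NN w. tuple_sum (insert 0 II('a)) w (outlier_weight R b) \<partial>M) <=
   ennreal (2 * \<gamma>) ^ (DIM('a) + 2) * (ennreal (2 * (b * R)) * (ennreal b * total_D))"
proof -
 have z: "(%p. fst (solve k p)) : borel_measurable (EI II('a))"
  by(rule measurable_compose[OF measurable_solve]) (simp add:borel_prod[symmetric])
 have s: "0 <= b * R" using b R by simp
 note * = mean_extra_hyperplane[OF measurable_tuple_fun[OF measurable_ball_weight[of b]] z s, folded outlier_weight_def]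
 show "(%w. tuple_sum (insert 0 II('a)) w (outlier_weight R b)) : borel_measurable M" using *(1) .
 show "(NN w. tuple_sum (insert 0 II('a)) w (outlier_weight R b) \<partial>M) <=
   ennreal (2 * \<gamma>) ^ (DIM('a) + 2) * (ennreal (2 * (b * R)) * (ennreal b * total_D))"
  using *(2) unfolding mean_ball_weight[OF b] .
qed

lemma total_D_finite: "total_D < \<infinity>"
proof -
 have "total_D <= (NN u. ennreal (fact (DIM('a) + 1)) \<partial>PhiN)"
  unfolding total_D_def
 proof(rule nn_integral_mono)
  fix u :: "nat => 'a"
  show "indicator (tuples k) u * ennreal (Dk k u) <= ennreal (fact (DIM('a) + 1))"
  proof(cases "u : tuples k")
   case True
   thus ?thesis using face_data.Dk_le[OF face_dataI[OF k True]] by(simp only:indicator_simps mult_1 ennreal_leI)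
  qed simp
 qed
 also have "... < \<infinity>" using Phi.P.emeasure_space_1 by(simp add:ennreal_mult_less_top)
 finally show ?thesis .
qed

text \<open>\<open>Dk\<close> has a finite integral, and the size of \<open>Tk k u\<close> is at
  least \<open>c0\<close> because its inradius is 1.\<close>

lemma limit_mass_finite: "limit_mass A < \<infinity>"
proof -
 have "limit_mass A <= (NN u. ennreal (1 / c0) * (indicator (tuples k) u * ennreal (Dk k u)) \<partial>PhiN)"
  unfolding limit_mass_def
 proof(rule nn_integral_mono)
  fix u :: "nat => 'a"
  show "indicator (tuples k) u * (indicator A (hull_Tk u) * ennreal (Dk k u / \<Sigma> (hull_Tk u))) <= ennreal (1 / c0) * (indicator (tuples k) u * ennreal (Dk k u))"
  proof(cases "u : tuples k")
   case True
   have D: "0 < Dk k u" by(rule face_data.Dk_pos[OF face_dataI[OF k True]])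
   have "Dk k u / \<Sigma> (hull_Tk u) <= 1 / c0 * Dk k u"
    using size_Tk[OF True] c0(1) D unfolding hull_Tk_eq[OF True] by(simp add:frac_le)
   hence "ennreal (Dk k u / \<Sigma> (hull_Tk u)) <= ennreal (1 / c0) * ennreal (Dk k u)"
    using c0(1) D by(simp add:ennreal_mult[symmetric] ennreal_leI)
   thus ?thesis using True by(simp add:indicator_def)
  qed simp
 qed
 also have "... = ennreal (1 / c0) * total_D"
  unfolding total_D_def
  by(intro nn_integral_cmult borel_measurable_times_ennreal measurable_indicator_tuples measurable_ennreal_Dk)
 also have "... < \<infinity>" using total_D_finite by(simp add:ennreal_mult_less_top)
 finally show ?thesis .
qed

text \<open>Dominated convergence: for each \<open>u\<close> the indicator vanishes once
  \<open>n\<close> exceeds \<open>circ u\<close>.\<close>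

lemma spread_D_tendsto: "(%n. spread_D (real n)) \<longlonglongrightarrow> 0"
proof -
 have "(%n. spread_D (real n)) \<longlonglongrightarrow> (NN u. 0 \<partial>PhiN)"
  unfolding spread_D_def
 proof(rule nn_integral_dominated_convergence[where w = "%u. indicator (tuples k) u * ennreal (Dk k u)"])
  show "(%u. indicator (tuples k) u * (ennreal (Dk k u) * indicator {real n<..} (circ u))) : borel_measurable PhiN" for n
   by(intro borel_measurable_times_ennreal measurable_indicator_tuples measurable_ennreal_Dk
    measurable_compose[OF measurable_circ borel_measurable_indicator]) simp
  show "(%u. indicator (tuples k) u * ennreal (Dk k u)) : borel_measurable PhiN"
   by(intro borel_measurable_times_ennreal measurable_indicator_tuples measurable_ennreal_Dk)
  show "(NN u. indicator (tuples k) u * ennreal (Dk k u) \<partial>PhiN) < \<infinity>" using total_D_finite by(simp add:total_D_def)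
  show "AE u in PhiN. indicator (tuples k) u * (ennreal (Dk k u) * indicator {real n<..} (circ u)) <= indicator (tuples k) u * ennreal (Dk k u)" for n
   by(intro AE_I2 mult_left_mono) (simp_all add:indicator_def)
  show "AE u in PhiN. (%n. indicator (tuples k) u * (ennreal (Dk k u) * indicator {real n<..} (circ u))) \<longlonglongrightarrow> 0"
  proof(intro AE_I2)
   fix u :: "nat => 'a"
   have "\<forall>\<^sub>F n in sequentially. circ u <= real n"
    using eventually_ge_at_top[of "nat \<lceil>circ u\<rceil>"] by eventually_elim linarith
   hence "\<forall>\<^sub>F n in sequentially. indicator (tuples k) u * (ennreal (Dk k u) * indicator {real n<..} (circ u)) = 0"
    by eventually_elim (simp add:indicator_def)
   thus "(%n. indicator (tuples k) u * (ennreal (Dk k u) * indicator {real n<..} (circ u))) \<longlonglongrightarrow> 0"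
    by(rule tendsto_eventually)
  qed
 qed simp
 thus ?thesis by simp
qed

text \<open>The first term is linear in \<open>b\<close> with a coefficient that tends to 0 for
  large \<open>R\<close>; the second is quadratic in \<open>b\<close> for fixed
  \<open>R\<close>.\<close>

definition error_bound :: "real => real => ennreal" where
 "error_bound R b = ennreal (2 * \<gamma>) ^ (DIM('a) + 1) * (ennreal b * spread_D R) +
   ennreal (2 * \<gamma>) ^ (DIM('a) + 2) * (ennreal (2 * (b * R)) * (ennreal b * total_D))"

lemma spread_D_le: "spread_D R <= total_D"
 unfolding spread_D_def total_D_def by(intro nn_integral_mono mult_left_mono) (simp_all add:indicator_def)

lemma error_bound_finite: "error_bound R b < \<infinity>"
 using total_D_finite spread_D_le[of R]
 by(auto simp:error_bound_def ennreal_mult_less_top power_less_top_ennreal intro:le_less_trans)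

lemma mean_face_sum:
 assumes a: "0 < a" and R: "0 <= R"
 shows "(NN w. face_sum w a \<partial>M) <=
   ennreal (1 / num_relabelings) * (ennreal (2 * \<gamma>) ^ (DIM('a) + 1) * (ennreal a * limit_mass A)) + error_bound R (a / c0)"
  and "ennreal (1 / num_relabelings) * (ennreal (2 * \<gamma>) ^ (DIM('a) + 1) * (ennreal a * limit_mass A)) <=
   (NN w. face_sum w a \<partial>M) + error_bound R (a / c0)"
proof -
 let ?b = "a / c0" and ?c = "ennreal (1 / num_relabelings)"
 have b: "0 < ?b" using a c0(1) by simp
 let ?T = "%w. tuple_sum II('a) w (tuple_fun (simplex_weight a))"
 let ?E = "%w. tuple_sum II('a) w (tuple_fun (spread_weight R ?b)) +
  tuple_sum (insert 0 II('a)) w (outlier_weight R ?b)"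
 have T: "?T : borel_measurable M" by(rule mean_tuple_sum(1)[OF measurable_simplex_weight])
 have m: "(%w. tuple_sum II('a) w (tuple_fun (spread_weight R ?b))) : borel_measurable M"
  "(%w. tuple_sum (insert 0 II('a)) w (outlier_weight R ?b)) : borel_measurable M"
  by(rule mean_tuple_sum(1)[OF measurable_spread_weight], rule mean_outlier_weight(1)[OF b R])
 hence E: "?E : borel_measurable M" by(intro borel_measurable_add)
 have "(NN w. ?E w \<partial>M) = (NN w. tuple_sum II('a) w (tuple_fun (spread_weight R ?b)) \<partial>M) +
  (NN w. tuple_sum (insert 0 II('a)) w (outlier_weight R ?b) \<partial>M)" by(rule nn_integral_add[OF m])
 also have "... <= error_bound R ?b"
  unfolding error_bound_def mean_spread_weight[OF b] by(rule add_left_mono[OF mean_outlier_weight(2)[OF b R]])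
 finally have Eb: "(NN w. ?E w \<partial>M) <= error_bound R ?b" .
 hence "(NN w. ?E w \<partial>M) ~= \<infinity>" using error_bound_finite[of R ?b] by auto
 \<comment> \<open>Needed to cancel \<open>?E\<close> in the extended reals below.\<close>
 hence Efin: "AE w in M. ?E w ~= \<infinity>" by(rule nn_integral_PInf_AE[OF E])
 have "(NN w. face_sum w a \<partial>M) <= (NN w. ?c * ?T w + ?E w \<partial>M)"
 proof(rule nn_integral_mono_AE)
  from AE_generic AE_space[of M] show "AE w in M. face_sum w a <= ?c * ?T w + ?E w"
   by eventually_elim (rule order_trans[OF face_sum_le add_left_mono[OF hit_sum_le]])
 qed
 also have "... = (NN w. ?c * ?T w \<partial>M) + (NN w. ?E w \<partial>M)"
  using T E by(intro nn_integral_add) simp_all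
 also have "(NN w. ?c * ?T w \<partial>M) = ?c * (NN w. ?T w \<partial>M)" by(rule nn_integral_cmult[OF T])
 finally have "(NN w. face_sum w a \<partial>M) <= ?c * (NN w. ?T w \<partial>M) + (NN w. ?E w \<partial>M)" .
 from order_trans[OF this add_left_mono[OF Eb]]
 show "(NN w. face_sum w a \<partial>M) <=
   ?c * (ennreal (2 * \<gamma>) ^ (DIM('a) + 1) * (ennreal a * limit_mass A)) + error_bound R ?b"
  unfolding mean_simplex_weight[OF a] .
 have c: "?c * of_nat num_relabelings = 1"
  using num_relabelings_pos by(simp add:ennreal_of_nat_eq_real_of_nat ennreal_mult[symmetric])
 have c1: "?c <= 1" using num_relabelings_pos by(simp add:divide_le_eq)
 \<comment> \<open>Additivity of the integral is applied to measurable functions only. So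
   \<open>?E\<close> is first split off from \<open>?T\<close>, and the difference is compared with
   \<open>face_sum\<close> pointwise.\<close>
 have "(NN w. ?c * ?T w \<partial>M) <= (NN w. (?c * ?T w - ?E w) + ?E w \<partial>M)"
  by(rule nn_integral_mono) (metis add.commute ennreal_minus_le_iff order_refl)
 also have "... = (NN w. ?c * ?T w - ?E w \<partial>M) + (NN w. ?E w \<partial>M)"
  using T E by(intro nn_integral_add) simp_all
 also have "(NN w. ?c * ?T w - ?E w \<partial>M) <= (NN w. face_sum w a \<partial>M)"
 proof(rule nn_integral_mono_AE)
  from Efin AE_space[of M] show "AE w in M. ?c * ?T w - ?E w <= face_sum w a"
  proof eventually_elim
   case (elim w)
   have "?T w <= of_nat num_relabelings * face_sum w a + ?E w"
    by(rule order_trans[OF tuple_sum_le add_left_mono[OF hit_sum_le]]) (rule elim)+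
   hence "?c * ?T w <= ?c * (of_nat num_relabelings * face_sum w a + ?E w)" by(rule mult_left_mono) simp
   also have "... = face_sum w a + ?c * ?E w" by(simp only:distrib_left mult.assoc[symmetric] c mult_1)
   also have "... <= face_sum w a + 1 * ?E w" by(intro add_left_mono mult_right_mono c1) simp
   finally have "?c * ?T w <= ?E w + face_sum w a" by(simp add:add.commute)
   thus ?case using elim(1) by(simp add:ennreal_minus_le_iff)
  qed
 qed
 finally have "(NN w. ?c * ?T w \<partial>M) <= (NN w. face_sum w a \<partial>M) + (NN w. ?E w \<partial>M)"
  by(simp only:add_right_mono)
 from order_trans[OF this add_left_mono[OF Eb]]
 show "?c * (ennreal (2 * \<gamma>) ^ (DIM('a) + 1) * (ennreal a * limit_mass A)) <= (NN w. face_sum w a \<partial>M) + error_bound R ?b"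
  unfolding nn_integral_cmult[OF T] mean_simplex_weight[OF a] .
qed

text \<open>First choose \<open>R\<close> so that the part of the error linear in \<open>a\<close>
  has a small coefficient; then let \<open>a\<close> tend to 0 to remove the quadratic part.\<close>

theorem face_sum_asymptotics:
 assumes F: "!!a. 0 < a ==> ennreal (F a) = (NN w. face_sum w a \<partial>M)" "!!a. 0 <= F a"
 shows "((%a. F a / a) \<longlongrightarrow> (2 * \<gamma>) ^ (DIM('a) + 1) / num_relabelings * enn2real (limit_mass A)) (at_right 0)"
proof -
 define g where "g = 2 * \<gamma>"
 define K where "K = g ^ (DIM('a) + 1)"
 define j where "j = enn2real (limit_mass A)"
 define t where "t = enn2real total_D"
 define e where "e R = enn2real (spread_D R)" for R
 have g: "0 < g" using gamma_pos by(simp add:g_def)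
 have K: "0 < K" using g by(simp add:K_def)
 have jt: "limit_mass A = ennreal j" "total_D = ennreal t" "0 <= j" "0 <= t"
  using limit_mass_finite total_D_finite by(simp_all add:j_def t_def)
 have eR: "spread_D R = ennreal (e R)" "0 <= e R" for R
  using spread_D_le[of R] total_D_finite by(auto simp:e_def)
 define c where "c = real num_relabelings"
 have c: "0 < c" using num_relabelings_pos by(simp add:c_def)
 have eb: "error_bound R b = ennreal (K * (b * e R) + K * g * (2 * (b * R) * (b * t)))" if "0 < b" "0 <= R" for R b
  unfolding error_bound_def jt eR
  using that g K jt(3,4) eR(2)[of R] by(simp add:ennreal_mult[symmetric] ennreal_power g_def[symmetric] K_def ennreal_plus[symmetric] del:ennreal_plus)
 have main: "\<bar>F a / a - K / c * j\<bar> <= K / c0 * e R + K * g * 2 * R * t / (c0 * c0) * a" if a: "0 < a" and R: "0 <= R" for a R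
 proof -
  let ?er = "K * (a / c0 * e R) + K * g * (2 * (a / c0 * R) * (a / c0 * t))"
  have b: "0 < a / c0" using a c0(1) by simp
  have er: "0 <= ?er" using a c0(1) K g R jt(4) eR(2)[of R] by simp
  have mm: "ennreal (1 / num_relabelings) * (ennreal (2 * \<gamma>) ^ (DIM('a) + 1) * (ennreal a * limit_mass A)) = ennreal (1 / c * (K * (a * j)))"
   unfolding jt using a c g jt(3) by(simp add:ennreal_mult[symmetric] ennreal_power g_def[symmetric] K_def c_def)
  have nn: "0 <= 1 / c * (K * (a * j))" using a c K jt(3) by simp
  have "ennreal (F a) <= ennreal (1 / c * (K * (a * j)) + ?er)"
   using mean_face_sum(1)[OF a R] unfolding F(1)[OF a, symmetric] eb[OF b R] mm ennreal_plus[OF nn er] .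
  with add_nonneg_nonneg[OF nn er] have 1: "F a <= 1 / c * (K * (a * j)) + ?er" by(rule ennreal_le_iff[THEN iffD1])
  have "ennreal (1 / c * (K * (a * j))) <= ennreal (F a + ?er)"
   using mean_face_sum(2)[OF a R] unfolding F(1)[OF a, symmetric] eb[OF b R] mm ennreal_plus[OF F(2) er] .
  with add_nonneg_nonneg[OF F(2) er] have 2: "1 / c * (K * (a * j)) <= F a + ?er" by(rule ennreal_le_iff[THEN iffD1])
  have "\<bar>F a - a * (K / c * j)\<bar> <= ?er" using 1 2 by(simp add:abs_le_iff field_simps)
  hence "\<bar>F a - a * (K / c * j)\<bar> / a <= ?er / a" using a by(intro divide_right_mono) simp_all
  also have "?er / a = K / c0 * e R + K * g * 2 * R * t / (c0 * c0) * a" using a c0(1) by(simp add:field_simps)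
  also have "\<bar>F a - a * (K / c * j)\<bar> / a = \<bar>F a / a - K / c * j\<bar>"
  proof -
   have "F a / a - K / c * j = (F a - a * (K / c * j)) / a" using a by(simp add:field_simps)
   thus ?thesis using a by simp
  qed
  finally show ?thesis .
 qed
 have e0: "(%n. e (real n)) \<longlonglongrightarrow> 0"
  using tendsto_enn2real[OF spread_D_tendsto[unfolded ennreal_0[symmetric]]] by(simp add:e_def)
 have "((%a. F a / a) \<longlongrightarrow> K / c * j) (at_right 0)"
 proof(rule tendstoI)
  fix \<epsilon> :: real assume \<epsilon>: "0 < \<epsilon>"
  have "(%n. K / c0 * e (real n)) \<longlonglongrightarrow> K / c0 * 0" by(intro tendsto_intros e0)
  hence "(%n. K / c0 * e (real n)) \<longlonglongrightarrow> 0" by(simp only:mult_zero_right)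
  hence "\<forall>\<^sub>F n in sequentially. K / c0 * e (real n) < \<epsilon> / 2"
   by(rule order_tendstoD(2)) (use \<epsilon> in simp)
  then obtain n where n: "K / c0 * e (real n) < \<epsilon> / 2" by(metis eventually_happens trivial_limit_sequentially)
  let ?q = "K * g * 2 * real n * t / (c0 * c0)"
  have "((%a. ?q * a) \<longlongrightarrow> ?q * 0) (at_right 0)" by(intro tendsto_intros)
  hence "((%a. ?q * a) \<longlongrightarrow> 0) (at_right 0)" by(simp only:mult_zero_right)
  hence "\<forall>\<^sub>F a in at_right 0. ?q * a < \<epsilon> / 2"
   by(rule order_tendstoD(2)) (use \<epsilon> in simp)
  with eventually_at_right_less show "\<forall>\<^sub>F a in at_right 0. dist (F a / a) (K / c * j) < \<epsilon>"
  proof eventually_elim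
   case (elim a)
   have "\<bar>F a / a - K / c * j\<bar> <= K / c0 * e (real n) + ?q * a" by(rule main[OF elim(1) of_nat_0_le_iff])
   also have "... < \<epsilon> / 2 + \<epsilon> / 2" by(rule add_strict_mono[OF n elim(2)])
   finally show ?case unfolding dist_real_def by(simp only:field_sum_of_halves)
  qed
 qed
 thus ?thesis by(simp only:K_def g_def c_def j_def)
qed

end

section \<open>The typical face\<close>

lemma polytope_space_extend:
 assumes "S : sets (polytope_space k)"
 obtains A where "A : sets (borel_of CBT)" "S = polytopes_dim k Int A"
 using assms by(auto simp:polytope_space_def sets_restrict_space)

locale typical_face_process = sized_process M X \<gamma> \<phi> k \<Sigma>
 for M :: "'w measure" and X :: "'w => 'a::euclidean_space set set" and \<gamma> :: real and \<phi> :: "'a measure" and k :: nat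
  and \<Sigma> :: "'a set => real" +
 fixes N :: "'v measure" and Z :: "'v => 'a set" and \<gamma>\<^sub>k :: real
 assumes prob_N: "prob_space N" and Z: "Z : measurable N (polytope_space k)"
  and typical: "typical_face_distribution k M X \<gamma>\<^sub>k (distr N (polytope_space k) Z)"
begin

text \<open>Invariance is demanded on polytopes with a unique inball, because the sum over faces
  runs over these.\<close>

definition similar_class :: "'a set set => bool" where
 "similar_class A <-> A : sets (borel_of CBT) &
   (ALL P z s. P : unique_inball_polytopes k --> 0 < s --> (affmap (z, s) P : A <-> P : A))"

text \<open>The factor common to all classes, which cancels in conditional probabilities.\<close>

definition rate :: real where
 "rate = (2 * \<gamma>) ^ (DIM('a) + 1) / card (relabelings k TYPE('a)) / \<gamma>\<^sub>k"

lemma face_limit_exists: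
 assumes "similar_class A"
 shows "EX c. face_limit M X \<gamma> \<phi> k \<Sigma> A (cbox 0 One) c"
proof -
 obtain c where c: "c > 0" "ALL P:polytopes_dim k. ALL z r. inscribed_ball P z r --> c * r <= \<Sigma> P"
  using size_functional_ge_inradius[OF size size_translation] by blast
 have "face_limit M X \<gamma> \<phi> k \<Sigma> A (cbox 0 One) c"
 proof
  show "A : sets (borel_of CBT)" using assms by(simp add:similar_class_def)
  show "!!P z s. P : unique_inball_polytopes k ==> 0 < s ==> (affmap (z, s) P : A) = (P : A)"
   using assms by(simp add:similar_class_def)
  show "cbox 0 One : sets (borel :: 'a measure)" by simp
  show "emeasure lborel (cbox 0 One :: 'a set) = 1" by(simp add:emeasure_lborel_cbox_eq)
 qed (use c in auto)
 thus ?thesis by blast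
qed

lemma rate_pos: "0 < rate"
proof -
 have "0 < card (relabelings k TYPE('a))"
  using finite_relabelings relabelings_nonempty by(auto simp:card_gt_0_iff)
 moreover have "0 < \<gamma>\<^sub>k" using typical by(simp add:typical_face_distribution_def)
 ultimately show ?thesis using gamma_pos by(simp add:rate_def)
qed

lemma gamma_k_pos: "0 < \<gamma>\<^sub>k" using typical by(simp add:typical_face_distribution_def)

sublocale N: prob_space N by(rule prob_N)

lemma Z_polytope: "w : space N ==> Z w : polytopes_dim k"
 using measurable_space[OF Z] by(simp add:space_polytope_space)

lemma sets_small:
 assumes A: "A : sets (borel_of CBT)"
 shows "polytopes_dim k Int (A Int {P : convex_bodies. \<Sigma> P < a}) : sets (polytope_space k)"
  and "{w : space N. Z w : A & \<Sigma> (Z w) < a} = Z -` (polytopes_dim k Int (A Int {P : convex_bodies. \<Sigma> P < a})) Int space N"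
proof -
 have "{P : space (borel_of CBT). \<Sigma> P < a} : sets (borel_of CBT)"
  using measurable_size by(intro borel_measurable_less) simp_all
 thus "polytopes_dim k Int (A Int {P : convex_bodies. \<Sigma> P < a}) : sets (polytope_space k)"
  using A by(intro sets_polytope_spaceI sets.Int) simp_all
 show "{w : space N. Z w : A & \<Sigma> (Z w) < a} = Z -` (polytopes_dim k Int (A Int {P : convex_bodies. \<Sigma> P < a})) Int space N"
  using Z_polytope polytopes_dim_subset by auto
qed

text \<open>The distribution of the typical face counts centered faces. Neither \<open>A\<close> nor
  \<Sigma> notices the centering, so the count is \<open>face_sum\<close> with the unit cube as
  window.\<close>

lemma mean_face_sum_eq:
 assumes "face_limit M X \<gamma> \<phi> k \<Sigma> A (cbox 0 One) c"
 shows "ennreal (\<gamma>\<^sub>k * measure N {w : space N. Z w : A & \<Sigma> (Z w) < a}) =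
  (NN w. face_limit.face_sum X k \<Sigma> A (cbox 0 One) w a \<partial>M)"
proof -
 interpret L: face_limit M X \<gamma> \<phi> k \<Sigma> A "cbox 0 One" c by(rule assms)
 let ?A = "polytopes_dim k Int (A Int {P : convex_bodies. \<Sigma> P < a})"
 note mA = sets_small(1)[OF L.A, of a]
 have "emeasure (distr N (polytope_space k) Z) ?A = emeasure N {w : space N. Z w : A & \<Sigma> (Z w) < a}"
  unfolding sets_small(2)[OF L.A] by(rule emeasure_distr[OF Z mA])
 hence "ennreal (\<gamma>\<^sub>k * measure N {w : space N. Z w : A & \<Sigma> (Z w) < a}) = ennreal \<gamma>\<^sub>k * emeasure (distr N (polytope_space k) Z) ?A"
  using gamma_k_pos by(simp add:ennreal_mult N.emeasure_eq_measure)
 also have "... = (NN w. (NN K. indicator ?A (centered K) * indicator (cbox 0 One) (incenter K)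
   \<partial>count_space (tessellation_faces k (X w) Int unique_inball_polytopes k)) \<partial>M)"
  using typical mA L.B unfolding typical_face_distribution_def by blast
 also have "... = (NN w. L.face_sum w a \<partial>M)"
  unfolding L.face_sum_def
 proof(intro nn_integral_cong)
  fix w K assume "K : space (count_space (tessellation_faces k (X w) Int unique_inball_polytopes k))"
  hence K: "K : unique_inball_polytopes k" by simp
  have Kc: "K : convex_bodies" by(rule polytopes_dim_subset[OF unique_inball_subset[OF K]])
  have "centered K : polytopes_dim k"
   unfolding centered_affmap by(rule affmap_polytopes_dim[OF unique_inball_subset[OF K]]) simp
  moreover have "centered K : A <-> K : A" unfolding centered_affmap by(rule L.A_similar[OF K]) simp
  moreover have "\<Sigma> (centered K) = \<Sigma> K"
   unfolding centered_affmap using size_functional_affmap[OF size size_translation Kc, of 1] by simp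
  moreover have "centered K : convex_bodies" unfolding centered_affmap by(rule affmap_in_convex_bodies[OF Kc])
  ultimately show "indicator ?A (centered K) * indicator (cbox 0 One) (incenter K) = L.face_weight a K"
   by(simp add:L.face_weight_def indicator_def)
 qed
 finally show ?thesis .
qed

lemma similar_class_asymptotics:
 assumes "similar_class A"
 shows "((%a. measure N {w : space N. Z w : A & \<Sigma> (Z w) < a} / a) \<longlongrightarrow> rate * enn2real (limit_mass A)) (at_right 0)"
proof -
 obtain c where c: "face_limit M X \<gamma> \<phi> k \<Sigma> A (cbox 0 One) c" using face_limit_exists[OF assms] by blast
 interpret L: face_limit M X \<gamma> \<phi> k \<Sigma> A "cbox 0 One" c by(rule c)
 let ?m = "%a. measure N {w : space N. Z w : A & \<Sigma> (Z w) < a}"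
 have "((%a. \<gamma>\<^sub>k * ?m a / a) \<longlongrightarrow> (2 * \<gamma>) ^ (DIM('a) + 1) / L.num_relabelings * enn2real (limit_mass A)) (at_right 0)"
  using gamma_k_pos by(intro L.face_sum_asymptotics mean_face_sum_eq[OF c]) simp
 from tendsto_divide[OF this tendsto_const[of \<gamma>\<^sub>k]] gamma_k_pos
 show ?thesis by(simp add:rate_def L.num_relabelings_def)
qed

lemma similar_class_UNIV: "similar_class (convex_bodies :: 'a set set)"
proof -
 have "(convex_bodies :: 'a set set) = space (borel_of CBT)" by simp
 moreover have "space (borel_of CBT) : sets (borel_of CBT)" by(rule sets.top)
 ultimately show ?thesis
  unfolding similar_class_def using unique_inball_subset polytopes_dim_subset affmap_in_convex_bodies by metis
qed

text \<open>If almost no tuple of normals belonged to a simplex, then the first moment bounds would give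
 \<open>\<Sigma> (Z w) \<ge> a\<close> almost surely for every \<open>a\<close>.\<close>

lemma limit_mass_pos: "0 < enn2real (limit_mass convex_bodies)"
proof -
 obtain c where c: "face_limit M X \<gamma> \<phi> k \<Sigma> convex_bodies (cbox 0 One) c"
  using face_limit_exists[OF similar_class_UNIV] by blast
 interpret L: face_limit M X \<gamma> \<phi> k \<Sigma> convex_bodies "cbox 0 One" c by(rule c)
 have "limit_mass convex_bodies ~= 0"
 proof
  assume m0: "limit_mass convex_bodies = 0"
  have "AE u in PhiN. indicator (tuples k) u * (indicator convex_bodies (hull_Tk u) * ennreal (Dk k u / \<Sigma> (hull_Tk u))) = 0"
   using m0 unfolding limit_mass_def nn_integral_0_iff_AE[OF measurable_limit_mass[OF L.A]] .
  hence null: "AE u in PhiN. u ~: tuples k"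
  proof eventually_elim
   case (elim u)
   show ?case
   proof
    assume u: "u : tuples k"
    have "Tk k u : convex_bodies" by(rule polytopes_dim_subset[OF unique_inball_subset[OF Tk_unique_inball[OF u]]])
    moreover have "0 < Dk k u / \<Sigma> (Tk k u)"
     using face_data.Dk_pos[OF face_dataI[OF k u]] L.size_Tk[OF u] L.c0(1) by simp
    hence "ennreal (Dk k u / \<Sigma> (Tk k u)) ~= 0" by(simp only:ennreal_eq_0_iff not_le)
    ultimately show False
     using elim unfolding hull_Tk_eq[OF u] indicator_simps(1)[OF u] by(simp only:indicator_simps mult_1)
   qed
  qed
  have "L.total_D = (NN u. 0 \<partial>PhiN)"
   unfolding L.total_D_def using null by(intro nn_integral_cong_AE) (auto elim: eventually_mono)
  hence D0: "L.total_D = 0" by(simp only:nn_integral_const mult_zero_left)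
  hence "L.error_bound 0 b = 0" for b
   using L.spread_D_le[of 0] unfolding L.error_bound_def by simp
  hence "(NN w. L.face_sum w a \<partial>M) = 0" if "0 < a" for a
   using L.mean_face_sum(1)[OF that order_refl] unfolding m0 by simp
  hence "ennreal (\<gamma>\<^sub>k * measure N {w : space N. Z w : convex_bodies & \<Sigma> (Z w) < a}) = 0" if "0 < a" for a
   unfolding mean_face_sum_eq[OF c] using that by blast
  hence "measure N {w : space N. Z w : convex_bodies & \<Sigma> (Z w) < a} = 0" if "0 < a" for a
   using that gamma_k_pos measure_nonneg[of N] by(simp add:ennreal_eq_0_iff mult_le_0_iff order_antisym)
  hence "{w : space N. Z w : convex_bodies & \<Sigma> (Z w) < real n + 1} : null_sets N" for n
   unfolding sets_small(2)[OF L.A] using measurable_sets[OF Z sets_small(1)[OF L.A]]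
   by(intro null_setsI) (simp_all add:N.emeasure_eq_measure)
  hence "(\<Union>n. {w : space N. Z w : convex_bodies & \<Sigma> (Z w) < real n + 1}) : null_sets N"
   by(rule null_sets_UN)
  \<comment> \<open>Every size is a real number, so these null events exhaust the space.\<close>
  moreover have "(\<Union>n. {w : space N. Z w : convex_bodies & \<Sigma> (Z w) < real n + 1}) = space N"
  proof -
   have "w : (\<Union>n. {w : space N. Z w : convex_bodies & \<Sigma> (Z w) < real n + 1})" if w: "w : space N" for w
   proof -
    obtain n where "\<Sigma> (Z w) < real n" using reals_Archimedean2 by blast
    hence "\<Sigma> (Z w) < real n + 1" by linarith
    thus ?thesis using w polytopes_dim_subset[OF Z_polytope[OF w]] by(intro UN_I[of n]) simp_all
   qed
   thus ?thesis by(intro equalityI subsetI) simp_all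
  qed
  ultimately have "emeasure N (space N) = 0" by(simp add:null_sets_def)
  thus False using N.emeasure_space_1 by simp
 qed
 thus ?thesis using L.limit_mass_finite by(simp add:enn2real_positive_iff zero_less_iff_neq_zero)
qed

text \<open>Both probabilities in the quotient are asymptotically linear in \<open>a\<close>.
  Dividing each by \<open>a\<close> and cancelling \<open>rate\<close> leaves the ratio of the limit
  masses, whose denominator is positive.\<close>

lemma cond_prob_limit:
 assumes A: "similar_class A" and Q: "!!w. w : space N ==> Q w <-> Z w : A"
 shows "((%a. \<P>(w in N. Q w \<bar> \<Sigma> (Z w) < a)) \<longlongrightarrow> enn2real (limit_mass A) / enn2real (limit_mass convex_bodies)) (at_right 0)"
proof -
 let ?p = "%A a. measure N {w : space N. Z w : A & \<Sigma> (Z w) < a}"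
 have "rate * enn2real (limit_mass convex_bodies) ~= 0" using rate_pos limit_mass_pos by simp
 from tendsto_divide[OF similar_class_asymptotics[OF A] similar_class_asymptotics[OF similar_class_UNIV] this]
 have "((%a. (?p A a / a) / (?p convex_bodies a / a)) \<longlongrightarrow> enn2real (limit_mass A) / enn2real (limit_mass convex_bodies)) (at_right 0)"
  using rate_pos by simp
 moreover have "\<forall>\<^sub>F a in at_right 0. (?p A a / a) / (?p convex_bodies a / a) = \<P>(w in N. Q w \<bar> \<Sigma> (Z w) < a)"
  using eventually_at_right_less
 proof eventually_elim
  case (elim a)
  have Zc: "Z w : convex_bodies" if "w : space N" for w by(rule polytopes_dim_subset[OF Z_polytope[OF that]])
  have 1: "{w : space N. Z w : A & \<Sigma> (Z w) < a} = {w : space N. Q w & \<Sigma> (Z w) < a}" using Q by blast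
  have 2: "{w : space N. Z w : convex_bodies & \<Sigma> (Z w) < a} = {w : space N. \<Sigma> (Z w) < a}" using Zc by blast
  show ?case unfolding cond_prob_def 1 2 using elim by simp
 qed
 ultimately show ?thesis by(rule Lim_transform_eventually)
qed

text \<open>Translation and scaling do not change the shape, so a shape event, extended to a Borel
  class of bodies, is admissible in the asymptotic formula.\<close>

lemma shape_class:
 assumes S: "S : sets (shape_space \<phi> k)"
 shows "EX A. similar_class A & (ALL P:polytopes_dim k. shape \<phi> P : S <-> P : A)"
proof -
 have k1: "1 <= k" using k by simp
 obtain A where A: "A : sets (borel_of CBT)" "{P : polytopes_dim k. shape \<phi> P : S} = polytopes_dim k Int A"
  by(rule polytope_space_extend[OF sets_shape_in[OF k1 S]])
 have iff: "shape \<phi> P : S <-> P : A" if "P : polytopes_dim k" for P using A(2) that by blast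
 have "affmap (z, s) P : A <-> P : A" if P: "P : unique_inball_polytopes k" and s: "0 < s" for P z s
 proof -
  have "affmap (z, s) P : A <-> shape \<phi> (affmap (z, s) P) : S"
   using iff[OF affmap_polytopes_dim[OF unique_inball_subset[OF P]]] s by simp
  also have "... <-> P : A" unfolding shape_of_affmap[OF P k1 s] by(rule iff[OF unique_inball_subset[OF P]])
  finally show ?thesis .
 qed
 hence "similar_class A" using A(1) by(simp add:similar_class_def)
 with iff show ?thesis by blast
qed

lemma Tk_polytope: fixes u :: "nat => 'a" shows "u : tuples k ==> Tk k u : polytopes_dim k"
 by(rule unique_inball_subset[OF Tk_unique_inball])

lemma limit_mass_shape_class:
 assumes "!!P. P : polytopes_dim k ==> shape \<phi> P : S <-> P : A"
 shows "(\<integral>\<^sup>+u\<in>tuples k. indicator S (shape \<phi> (Tk k u)) * ennreal (Dk k u / \<Sigma> (Tk k u)) \<partial>PhiN) = limit_mass A"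
 unfolding limit_mass_def
proof(rule nn_integral_cong)
 fix u :: "nat => 'a"
 show "indicator S (shape \<phi> (Tk k u)) * ennreal (Dk k u / \<Sigma> (Tk k u)) * indicator (tuples k) u =
  indicator (tuples k) u * (indicator A (hull_Tk u) * ennreal (Dk k u / \<Sigma> (hull_Tk u)))"
  using assms[OF Tk_polytope, of u] by(cases "u : tuples k") (simp_all add:indicator_def hull_Tk_eq)
qed

lemma limit_mass_countably_additive:
 assumes "!!i :: nat. similar_class (A i)"
  and "!!u. u : tuples k ==> (\<Sum>i. indicator (A i) (Tk k u)) = (indicator A' (Tk k u) :: ennreal)"
 shows "(\<Sum>i. limit_mass (A i)) = limit_mass A'"
proof -
 let ?f = "%A u. indicator (tuples k) u * (indicator A (hull_Tk u) * ennreal (Dk k u / \<Sigma> (hull_Tk u)))"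
 have f: "?f (A i) : borel_measurable PhiN" for i
  using assms(1)[of i] unfolding similar_class_def by(intro measurable_limit_mass) blast
 have "(\<Sum>i. limit_mass (A i)) = (NN u. (\<Sum>i. ?f (A i) u) \<partial>PhiN)"
  unfolding limit_mass_def by(rule nn_integral_suminf[symmetric, OF f])
 also have "... = (NN u. ?f A' u \<partial>PhiN)"
 proof(rule nn_integral_cong)
  fix u :: "nat => 'a"
  show "(\<Sum>i. ?f (A i) u) = ?f A' u"
  proof(cases "u : tuples k")
   case True
   show ?thesis unfolding hull_Tk_eq[OF True] assms(2)[OF True, symmetric] by(simp only:ennreal_suminf_cmult ennreal_suminf_multc)
  qed simp
 qed
 finally show ?thesis unfolding limit_mass_def .
qed

text \<open>\<open>measure_of\<close> returns the given set function only if it is countably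
  additive. Replacing each shape event by its class of bodies turns the integrand into that of
  \<open>limit_mass\<close>, which is measurable, so sum and integral can be exchanged.\<close>

lemma emeasure_xi:
 assumes S: "S : sets (shape_space \<phi> k)"
 shows "emeasure (xi k \<phi> \<Sigma>) S = (\<integral>\<^sup>+u\<in>tuples k. indicator S (shape \<phi> (Tk k u)) * ennreal (Dk k u / \<Sigma> (Tk k u)) \<partial>PhiN)"
  (is "_ = ?\<mu> S")
proof -
 have k1: "1 <= k" using k by simp
 have sa: "sigma_algebra (shape_set \<phi> k) (sets (shape_space \<phi> k))"
  unfolding space_shape_space[OF k1, symmetric] by(rule sets.sigma_algebra_axioms)
 have empty: "indicator {} P = (0 :: ennreal)" for P :: "'a set" by simp
 have "?\<mu> {} = (NN u. 0 \<partial>PhiN)" by(rule nn_integral_cong) (simp only:empty mult_zero_left)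
 hence pos: "positive (sets (shape_space \<phi> k)) ?\<mu>" unfolding positive_def by(simp only:nn_integral_const mult_zero_left)
 have ca: "countably_additive (sets (shape_space \<phi> k)) ?\<mu>"
 proof(rule countably_additiveI)
  fix T :: "nat => 'a set set"
  assume T: "range T <= sets (shape_space \<phi> k)" "disjoint_family T" "\<Union>(range T) : sets (shape_space \<phi> k)"
  have "EX A. similar_class A & (ALL P:polytopes_dim k. shape \<phi> P : T i <-> P : A)" for i
   by(rule shape_class) (use T(1) in blast)
  hence "ALL i. EX A. similar_class A & (ALL P:polytopes_dim k. shape \<phi> P : T i <-> P : A)" by(rule allI)
  hence "EX A. ALL i. similar_class (A i) & (ALL P:polytopes_dim k. shape \<phi> P : T i <-> P : A i)" by(rule choice)
  then obtain A where A0: "ALL i. similar_class (A i) & (ALL P:polytopes_dim k. shape \<phi> P : T i <-> P : A i)" by(rule exE)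
  have A: "similar_class (A i)" "P : polytopes_dim k ==> shape \<phi> P : T i <-> P : A i" for i P
   using spec[OF A0, of i] by blast+
  obtain A' where A0': "similar_class A' & (ALL P:polytopes_dim k. shape \<phi> P : \<Union>(range T) <-> P : A')"
   using shape_class[OF T(3)] by(rule exE)
  have A': "similar_class A'" "P : polytopes_dim k ==> shape \<phi> P : \<Union>(range T) <-> P : A'" for P
   using A0' by blast+
  have "(\<Sum>i. limit_mass (A i)) = limit_mass A'"
  proof(rule limit_mass_countably_additive[OF A(1)])
   fix u :: "nat => 'a" assume u: "u : tuples k"
   have "(\<Sum>i. indicator (A i) (Tk k u)) = (\<Sum>i. indicator (T i) (shape \<phi> (Tk k u)) :: ennreal)"
    using A(2)[OF Tk_polytope[OF u]] by(simp add:indicator_def)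
   also have "... = indicator (\<Union>(range T)) (shape \<phi> (Tk k u))" by(rule suminf_indicator[OF T(2)])
   also have "... = indicator A' (Tk k u)" using A'(2)[OF Tk_polytope[OF u]] by(simp only:indicator_def)
   finally show "(\<Sum>i. indicator (A i) (Tk k u)) = (indicator A' (Tk k u) :: ennreal)" .
  qed
  moreover have "?\<mu> (T i) = limit_mass (A i)" for i by(rule limit_mass_shape_class) (rule A(2))
  moreover have "?\<mu> (\<Union>(range T)) = limit_mass A'" by(rule limit_mass_shape_class) (rule A'(2))
  ultimately show "(\<Sum>i. ?\<mu> (T i)) = ?\<mu> (\<Union>(range T))" by(simp only:)
 qed
 show ?thesis unfolding xi_def by(rule emeasure_measure_of_sigma[OF sa pos ca S])
qed

theorem shape_limit:
 assumes S: "S : sets (shape_space \<phi> k)"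
 shows "((%a. \<P>(w in N. shape \<phi> (Z w) : S \<bar> \<Sigma> (Z w) < a)) \<longlongrightarrow>
  measure (xi k \<phi> \<Sigma>) S / measure (xi k \<phi> \<Sigma>) (shape_set \<phi> k)) (at_right 0)"
proof -
 have k1: "1 <= k" using k by simp
 obtain A where A0: "similar_class A & (ALL P:polytopes_dim k. shape \<phi> P : S <-> P : A)"
  using shape_class[OF S] by(rule exE)
 have A: "similar_class A" "P : polytopes_dim k ==> shape \<phi> P : S <-> P : A" for P
  using A0 by blast+
 have all: "shape_set \<phi> k : sets (shape_space \<phi> k)"
  unfolding space_shape_space[OF k1, symmetric] by(rule sets.top)
 have "emeasure (xi k \<phi> \<Sigma>) (shape_set \<phi> k) = limit_mass convex_bodies"
  unfolding emeasure_xi[OF all] limit_mass_def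
 proof(rule nn_integral_cong)
  fix u :: "nat => 'a"
  show "indicator (shape_set \<phi> k) (shape \<phi> (Tk k u)) * ennreal (Dk k u / \<Sigma> (Tk k u)) * indicator (tuples k) u =
   indicator (tuples k) u * (indicator convex_bodies (hull_Tk u) * ennreal (Dk k u / \<Sigma> (hull_Tk u)))"
   using Tk_unique_inball[of u] polytopes_dim_subset[OF Tk_polytope, of u]
   by(cases "u : tuples k") (simp_all add:indicator_def shape_set_def hull_Tk_eq)
 qed
 moreover have "emeasure (xi k \<phi> \<Sigma>) S = limit_mass A"
  unfolding emeasure_xi[OF S] by(rule limit_mass_shape_class[OF A(2)])
 moreover have "((%a. \<P>(w in N. shape \<phi> (Z w) : S \<bar> \<Sigma> (Z w) < a)) \<longlongrightarrow> enn2real (limit_mass A) / enn2real (limit_mass convex_bodies)) (at_right 0)"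
  by(rule cond_prob_limit[OF A(1)]) (rule A(2)[OF Z_polytope])
 ultimately show ?thesis by(simp only:measure_def)
qed

text \<open>Every \<open>Tk k u\<close> is a simplex, so the class of simplices carries the full
  limit mass and the ratio is 1.\<close>

theorem num_faces_limit:
 "((%a. \<P>(w in N. num_faces (k - 1) (Z w) = k + 1 \<bar> \<Sigma> (Z w) < a)) \<longlongrightarrow> 1) (at_right 0)"
proof -
 have k1: "1 <= k" using k by simp
 obtain A where A: "A : sets (borel_of CBT)" "{P : polytopes_dim k. num_faces (k - 1) P = k + 1} = polytopes_dim k Int (A :: 'a set set)"
  by(rule polytope_space_extend[OF measurable_num_faces_simplex[OF k1]])
 have iff: "num_faces (k - 1) P = k + 1 <-> P : A" if "P : polytopes_dim k" for P using A(2) that by blast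
 have simplex: "P : A <-> (EX p. P = convex hull (p ` {1..k+1}))" if "P : polytopes_dim k" for P
  unfolding iff[OF that, symmetric] by(rule num_faces_iff_simplex[OF k1 that])
 have imp: "affmap (z, s) P : A" if P: "P : polytopes_dim k" "P : A" and s: "s ~= 0" for P z s
 proof -
  obtain p where "P = convex hull (p ` {1..k+1})" using simplex P by blast
  hence "affmap (z, s) P = convex hull ((%i. s *R (p i - z)) ` {1..k+1})"
   by(simp only:affmap_convex_hull) (simp add:affmap_def image_image)
  thus ?thesis
   unfolding simplex[OF affmap_polytopes_dim[OF P(1) s]] by(intro exI[of _ "%i. s *R (p i - z)"])
 qed
 have sim: "affmap (z, s) P : A <-> P : A" if P: "P : unique_inball_polytopes k" and s: "0 < s" for P z s
 proof
  assume a: "affmap (z, s) P : A"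
  have "affmap (- (s *R z), 1 / s) (affmap (z, s) P) : A"
   using s by(intro imp a affmap_polytopes_dim unique_inball_subset[OF P]) simp_all
  thus "P : A" using s by(simp add:affmap_inverse)
 next
  assume "P : A"
  thus "affmap (z, s) P : A" using s by(intro imp unique_inball_subset[OF P]) simp_all
 qed
 have cls: "similar_class A" unfolding similar_class_def using A(1) sim by blast
 have "limit_mass A = limit_mass convex_bodies"
  unfolding limit_mass_def
 proof(rule nn_integral_cong)
  fix u :: "nat => 'a"
  show "indicator (tuples k) u * (indicator A (hull_Tk u) * ennreal (Dk k u / \<Sigma> (hull_Tk u))) =
   indicator (tuples k) u * (indicator convex_bodies (hull_Tk u) * ennreal (Dk k u / \<Sigma> (hull_Tk u)))"
  proof(cases "u : tuples k")
   case True
   have "Tk k u : A"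
    unfolding simplex[OF Tk_polytope[OF True]] using face_data.Tk_eq_convex_hull[OF face_dataI[OF k True]] by blast
   moreover have "Tk k u : convex_bodies" by(rule polytopes_dim_subset[OF Tk_polytope[OF True]])
   ultimately show ?thesis by(simp add:hull_Tk_eq[OF True])
  qed simp
 qed
 moreover have "((%a. \<P>(w in N. num_faces (k - 1) (Z w) = k + 1 \<bar> \<Sigma> (Z w) < a)) \<longlongrightarrow> enn2real (limit_mass A) / enn2real (limit_mass convex_bodies)) (at_right 0)"
  by(rule cond_prob_limit[OF cls]) (rule iff[OF Z_polytope])
 ultimately show ?thesis using limit_mass_pos by simp
qed

end

theorem theorem2:
  fixes M :: "'w measure" and X :: "'w \<Rightarrow> 'a::euclidean_space set set"
    and \<gamma> :: real and \<phi> :: "'a measure" and k :: nat and \<Sigma> :: "'a set \<Rightarrow> real"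
    and N :: "'v measure" and Z :: "'v \<Rightarrow> 'a set"
  assumes "2 \<le> DIM('a)"
    and "poisson_hyperplane_process M X" and "stationary M X"
    and "has_intensity_and_direction M X \<gamma> \<phi>"
    and "nondegenerate \<phi>" and "subspace_free \<phi>"
    and "k \<in> {1..DIM('a)}"
    and "size_functional k \<Sigma>" and "translation_invariant \<Sigma>"
    and "typical_face k M X N Z"
  shows "(\<forall>S \<in> sets (shape_space \<phi> k).
           ((\<lambda>a. \<P>(\<omega> in N. shape \<phi> (Z \<omega>) \<in> S \<bar> \<Sigma> (Z \<omega>) < a)) \<longlongrightarrow>
             measure (xi k \<phi> \<Sigma>) S / measure (xi k \<phi> \<Sigma>) (shape_set \<phi> k)) (at_right 0)) \<and>
         ((\<lambda>a. \<P>(\<omega> in N. num_faces (k - 1) (Z \<omega>) = k + 1 \<bar> \<Sigma> (Z \<omega>) < a)) \<longlongrightarrow> 1) (at_right 0)"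
proof -
 interpret hyperplane_process M X \<gamma> \<phi> by unfold_locales (rule assms(2), rule assms(4))
 obtain \<gamma>\<^sub>k where tf: "prob_space N" "Z : measurable N (polytope_space k)"
  "typical_face_distribution k M X \<gamma>\<^sub>k (distr N (polytope_space k) Z)"
  using assms(10) unfolding typical_face_def by blast
 interpret N: prob_space N by(rule tf(1))
 interpret typical_face_process M X \<gamma> \<phi> k \<Sigma> N Z \<gamma>\<^sub>k
  by unfold_locales (rule assms(6), rule assms(7), rule assms(1), rule assms(8), rule assms(9), rule tf(2), rule tf(3))
 show ?thesis using shape_limit num_faces_limit by blast
qed

end
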